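(* Let $X$ be a simply connected, locally simply connected metric space, let $x\in X$, and let $D$ be a countable dense subset of $X$. Then the metric quotient map $\sigma:E(X,D)\to Q(D)$ induces an injective homomorphism $\sigma_*:\pi_1(E(X,D),x)\to\pi_1(Q(D),* )$. Consequently $\pi_1(E(X,D),x)$ is isomorphic to a subgroup of the free $\sigma$-product $G^{\sigma}(D)$ of copies $\mathbb{Z}_d$ $(d\in D)$ of $\mathbb{Z}$, i.e. isomorphic to a subgroup of the Hawaiian earring group $\pi_1(\mathbb{H},o)$.
   Context: Simply connected means path-connected with trivial fundamental group. Locally simply connected means: for every $y\in X$ and every neighborhood $U$ of $y$ there is a neighborhood $V\subseteq U$ of $y$ such that every loop in $V$ is null-homotopic in $U$ (neighborhoods are not required to be path-connected). Earring space: let $(X,\rho_X)$ be a metric space and $D$ a countable subset, with a fixed enumeration without repetition $d_1,d_2,\dots$ of $D$. Let $\mathbb{S}^1$ be the circle with a metric $\rho_C$ of diameter less than $1$ and a chosen point $o\in\mathbb{S}^1$. For $x=d_n\in D$ put $\rho_x(u,v)=\rho_C(u,v)/n$ on $\mathbb{S}^1$; for $x\notin D$ put $\rho_x(o,o)=0$. $E(X,D)$ is the set $X\times\{o\}\cup D\times\mathbb{S}^1$ with the metric $\rho((x,u),(y,v))=\rho_x(u,v)$ if $x=y\in D$, and $\rho((x,u),(y,v))=\rho_X(x,y)+\rho_x(u,o)+\rho_y(v,o)$ otherwise. We identify $x\in X$ with $(x,o)$. Metric quotient: $Q(D)$ is obtained from $E(X,D)$ by regarding $X\times\{o\}$ as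 a single point $*$, with the metric in which the distance between $*$ and $(d_n,u)$ is $\rho_C(u,o)/n$, the distance between $(d_n,u)$ and $(d_n,v)$ is $\rho_C(u,v)/n$, and the distance between $(d_m,u)$ and $(d_n,v)$ for $m\ne n$ is the sum of their distances to $*$. The map $\sigma$ is the quotient map. When $D$ is infinite, $Q(D)$ is homeomorphic to the Hawaiian earring $\mathbb{H}=\bigcup_{n\ge1}\{(x,y)\in\mathbb{R}^2:(x+1/n)^2+y^2=1/n^2\}$, with $*$ corresponding to the origin $o=(0,0)$ of $\mathbb{R}^2$. Free $\sigma$-product: letters are $a$ and $a^-$ for $a\in D$ (formal inverses, $(a^-)^-=a$, $D\cap D^-=\emptyset$ where $D^-=\{a^-:a\in D\}$). A word in $\mathcal{W}(D)$ is a map $W:\overline{W}\to D\cup D^-$ from a linearly ordered set $\overline{W}$ such that each letter has finite preimage. For finite $F\subseteq D$, $W_F$ is the restriction of $W$ to $\{\alpha\in\overline{W}:W(\alpha)=a\text{ or }a^-\text{ for some }a\in F\}$, a finite word. Two words $V,W$ are equivalent if $V_F=W_F$ in the free group on $F$ for every finite $F\subseteq D$. $G^{\sigma}(D)$ is the group of equivalence classes of words under concatenation. *)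

theory Defs
  imports "HOL-Analysis.Analysis" "HOL-Algebra.Group" "HOL-Library.Nat_Bijection"
begin

section \<open>The fundamental group of an abstract topological space\<close>

definition loops :: "'a topology \<Rightarrow> 'a \<Rightarrow> (real \<Rightarrow> 'a) set" where
  "loops T x = {f. pathin T f \<and> f 0 = x \<and> f 1 = x}"

definition loop_homotopic :: "'a topology \<Rightarrow> 'a \<Rightarrow> (real \<Rightarrow> 'a) \<Rightarrow> (real \<Rightarrow> 'a) \<Rightarrow> bool" where
  "loop_homotopic T x =
     homotopic_with (\<lambda>h. h 0 = x \<and> h 1 = x) (top_of_set {0..1::real}) T"

definition loop_class :: "'a topology \<Rightarrow> 'a \<Rightarrow> (real \<Rightarrow> 'a) \<Rightarrow> (real \<Rightarrow> 'a) set" where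
  "loop_class T x f = {g. loop_homotopic T x f g}"

text \<open>The same formula as the library's \<^const>\<open>joinpaths\<close>, which is restricted to types of class
  \<^class>\<open>topological_space\<close>.\<close>

definition loop_concat :: "(real \<Rightarrow> 'a) \<Rightarrow> (real \<Rightarrow> 'a) \<Rightarrow> real \<Rightarrow> 'a" where
  "loop_concat f g = (\<lambda>t. if t \<le> 1 / 2 then f (2 * t) else g (2 * t - 1))"

definition fundamental_group :: "'a topology \<Rightarrow> 'a \<Rightarrow> (real \<Rightarrow> 'a) set monoid" where
  "fundamental_group T x =
     \<lparr>carrier = loop_class T x ` loops T x,
      mult = (\<lambda>A B. \<Union>f\<in>A. \<Union>g\<in>B. loop_class T x (loop_concat f g)),
      one = loop_class T x (\<lambda>_. x)\<rparr>"

text \<open>The map of fundamental groups induced by a map \<open>\<phi>\<close> into \<open>T\<close> that sends the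
  base point to \<open>y\<close>: the class of \<open>f\<close> goes to the class of \<open>\<phi> \<circ> f\<close>.\<close>

definition induced_map ::
  "('a \<Rightarrow> 'b) \<Rightarrow> 'b topology \<Rightarrow> 'b \<Rightarrow> (real \<Rightarrow> 'a) set \<Rightarrow> (real \<Rightarrow> 'b) set" where
  "induced_map \<phi> T y A = (\<Union>f\<in>A. loop_class T y (\<phi> \<circ> f))"

definition simply_conn_space :: "'a topology \<Rightarrow> bool" where
  "simply_conn_space T \<longleftrightarrow>
     path_connected_space T \<and>
     (\<forall>x\<in>topspace T. carrier (fundamental_group T x) = {\<one>\<^bsub>fundamental_group T x\<^esub>})"

text \<open>Neighborhoods need be neither open nor path-connected.\<close>

definition nbhd_of :: "'a topology \<Rightarrow> 'a \<Rightarrow> 'a set \<Rightarrow> bool" where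
  "nbhd_of T y U \<longleftrightarrow> U \<subseteq> topspace T \<and> (\<exists>W. openin T W \<and> y \<in> W \<and> W \<subseteq> U)"

definition locally_simply_conn_space :: "'a topology \<Rightarrow> bool" where
  "locally_simply_conn_space T \<longleftrightarrow>
     (\<forall>y\<in>topspace T. \<forall>U. nbhd_of T y U \<longrightarrow>
        (\<exists>V. nbhd_of T y V \<and> V \<subseteq> U \<and>
           (\<forall>z. \<forall>f\<in>loops (subtopology T V) z.
              loop_homotopic (subtopology T U) z f (\<lambda>_. z))))"


section \<open>The space \<open>E(X, D)\<close> and its metric quotient \<open>Q(D)\<close>\<close>

definition circle_metric :: "complex metric \<Rightarrow> bool" where
  "circle_metric C \<longleftrightarrow>
     mspace C = sphere 0 1 \<and>
     mtopology_of C = top_of_set (sphere 0 1) \<and>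
     (\<exists>r<1. \<forall>u\<in>mspace C. \<forall>v\<in>mspace C. mdist C u v \<le> r)"

text \<open>An enumeration without repetition \<open>d\<^sub>1, d\<^sub>2, \<dots>\<close> of \<open>D\<close> is given by
  its index function: \<open>\<nu> x = n\<close> means \<open>x = d\<^sub>n\<close>.\<close>

definition index_of_enumeration :: "'a set \<Rightarrow> ('a \<Rightarrow> nat) \<Rightarrow> bool" where
  "index_of_enumeration D \<nu> \<longleftrightarrow> bij_betw \<nu> D (if finite D then {1..card D} else {1..})"

definition fibre_dist ::
  "'a set \<Rightarrow> ('a \<Rightarrow> nat) \<Rightarrow> complex metric \<Rightarrow> 'a \<Rightarrow> complex \<Rightarrow> complex \<Rightarrow> real" where
  "fibre_dist D \<nu> C x u v = (if x \<in> D then mdist C u v / real (\<nu> x) else 0)"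

fun earring_dist ::
  "'a metric \<Rightarrow> 'a set \<Rightarrow> ('a \<Rightarrow> nat) \<Rightarrow> complex metric \<Rightarrow> complex \<Rightarrow>
     'a \<times> complex \<Rightarrow> 'a \<times> complex \<Rightarrow> real" where
  "earring_dist X D \<nu> C p (x, u) (y, v) =
     (if x = y \<and> x \<in> D then fibre_dist D \<nu> C x u v
      else mdist X x y + fibre_dist D \<nu> C x u p + fibre_dist D \<nu> C y v p)"

definition earring_metric ::
  "'a metric \<Rightarrow> 'a set \<Rightarrow> ('a \<Rightarrow> nat) \<Rightarrow> complex metric \<Rightarrow> complex \<Rightarrow>
     ('a \<times> complex) metric" where
  "earring_metric X D \<nu> C p =
     metric (mspace X \<times> {p} \<union> D \<times> mspace C, earring_dist X D \<nu> C p)"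

text \<open>In \<open>Q(D)\<close> the collapsed set \<open>X \<times> {p}\<close> is the point \<^const>\<open>None\<close>, and \<open>Some (x, u)\<close> with
  \<open>u \<noteq> p\<close> is the class of \<open>(x, u)\<close>.\<close>

fun quotient_dist ::
  "('a \<Rightarrow> nat) \<Rightarrow> complex metric \<Rightarrow> complex \<Rightarrow>
     ('a \<times> complex) option \<Rightarrow> ('a \<times> complex) option \<Rightarrow> real" where
  "quotient_dist \<nu> C p None None = 0"
| "quotient_dist \<nu> C p None (Some (y, v)) = mdist C v p / real (\<nu> y)"
| "quotient_dist \<nu> C p (Some (x, u)) None = mdist C u p / real (\<nu> x)"
| "quotient_dist \<nu> C p (Some (x, u)) (Some (y, v)) =
     (if x = y then mdist C u v / real (\<nu> x)
      else mdist C u p / real (\<nu> x) + mdist C v p / real (\<nu> y))"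

definition quotient_metric ::
  "'a set \<Rightarrow> ('a \<Rightarrow> nat) \<Rightarrow> complex metric \<Rightarrow> complex \<Rightarrow> ('a \<times> complex) option metric" where
  "quotient_metric D \<nu> C p =
     metric (insert None (Some ` (D \<times> (mspace C - {p}))), quotient_dist \<nu> C p)"

definition quotient_map_sigma :: "complex \<Rightarrow> 'a \<times> complex \<Rightarrow> ('a \<times> complex) option" where
  "quotient_map_sigma p = (\<lambda>(x, u). if u = p then None else Some (x, u))"

text \<open>The type \<^typ>\<open>'a metric\<close> consists of genuine metrics, so the definitions above have their
  intended meaning because of the following facts.\<close>

lemma index_pos:
  assumes "index_of_enumeration D \<nu>" "x \<in> D"
  shows "0 < \<nu> x"
proof -
  have "\<nu> x \<in> (if finite D then {1..card D} else {1..})"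
    using assms unfolding index_of_enumeration_def by (rule bij_betw_apply)
  then show ?thesis by (auto split: if_splits)
qed

lemma mdist_pos:
  assumes "x \<in> mspace X" "y \<in> mspace X" "x \<noteq> y"
  shows "0 < mdist X x y"
  using assms mdist_zero[of x X y] mdist_nonneg[of X x y] by linarith

lemma Metric_space_earring:
  assumes D: "D \<subseteq> mspace X" and e: "index_of_enumeration D \<nu>" and p: "p \<in> mspace C"
  shows "Metric_space (mspace X \<times> {p} \<union> D \<times> mspace C) (earring_dist X D \<nu> C p)"
    (is "Metric_space ?M ?d")
proof
  have nn: "0 \<le> fibre_dist D \<nu> C x u v" for x u v
    by (simp add: fibre_dist_def)
  have sym: "fibre_dist D \<nu> C x u v = fibre_dist D \<nu> C x v u" for x u v
    by (simp add: fibre_dist_def mdist_commute)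
  have tri: "fibre_dist D \<nu> C x u w \<le> fibre_dist D \<nu> C x u v + fibre_dist D \<nu> C x v w"
    if "u \<in> mspace C" "v \<in> mspace C" "w \<in> mspace C" for x u v w
    using mdist_triangle[OF that]
    by (auto simp: fibre_dist_def simp flip: add_divide_distrib intro!: divide_right_mono)
  have zero: "fibre_dist D \<nu> C x u v = 0 \<longleftrightarrow> u = v"
    if "x \<in> D" "u \<in> mspace C" "v \<in> mspace C" for x u v
    using that index_pos[OF e that(1)] by (simp add: fibre_dist_def)
  show "0 \<le> ?d a b" for a b
    using nn by (cases a; cases b) (auto intro!: add_nonneg_nonneg)
  show "?d a b = ?d b a" for a b
    using sym by (cases a; cases b) (auto simp: mdist_commute)
  have inM: "x \<in> mspace X \<and> u \<in> mspace C \<and> (x \<notin> D \<longrightarrow> u = p)" if "(x, u) \<in> ?M" for x u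
    using that D p by auto
  show "?d a b = 0 \<longleftrightarrow> a = b" if ab: "a \<in> ?M" "b \<in> ?M" for a b
  proof -
    obtain x u y v where [simp]: "a = (x, u)" "b = (y, v)" by (cases a; cases b)
    have x: "x \<in> mspace X \<and> u \<in> mspace C \<and> (x \<notin> D \<longrightarrow> u = p)"
      and y: "y \<in> mspace X \<and> v \<in> mspace C \<and> (y \<notin> D \<longrightarrow> v = p)"
      using inM ab by auto
    show ?thesis
    proof (cases "x = y")
      case True
      then show ?thesis using x y zero by (auto simp: fibre_dist_def)
    next
      case False
      then have "0 < mdist X x y"
        using x y by (simp add: mdist_pos)
      then have "0 < ?d a b"
        using False nn[of x u p] nn[of y v p] by simp
      then show ?thesis using False by simp
    qed
  qed
  show "?d a c \<le> ?d a b + ?d b c" if abc: "a \<in> ?M" "b \<in> ?M" "c \<in> ?M" for a b c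
  proof -
    obtain x u y v z w where [simp]: "a = (x, u)" "b = (y, v)" "c = (z, w)"
      by (cases a; cases b; cases c)
    have x: "x \<in> mspace X \<and> u \<in> mspace C \<and> (x \<notin> D \<longrightarrow> u = p)"
      and y: "y \<in> mspace X \<and> v \<in> mspace C \<and> (y \<notin> D \<longrightarrow> v = p)"
      and z: "z \<in> mspace X \<and> w \<in> mspace C \<and> (z \<notin> D \<longrightarrow> w = p)"
      using inM abc by auto
    have X: "mdist X x z \<le> mdist X x y + mdist X y z"
      using x y z by (simp add: mdist_triangle)
    define F where "F = fibre_dist D \<nu> C"
    have F: "F x u p = 0" if "x \<notin> D" for x u
      using that by (simp add: F_def fibre_dist_def)
    note T = tri[folded F_def]
    have XY: "0 \<le> mdist X x y" "0 \<le> mdist X y z" "mdist X x x = 0" "mdist X y y = 0"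
      using x y by auto
    show ?thesis
      using X XY x y z p T[of u v w x] T[of u p w x] T[of u v p x] T[of w v p y]
        nn[of x u p, folded F_def] nn[of y v p, folded F_def] nn[of z w p, folded F_def]
        sym[of x w p, folded F_def] sym[of y v w, folded F_def]
      unfolding \<open>a = _\<close> \<open>b = _\<close> \<open>c = _\<close> earring_dist.simps F_def[symmetric]
      by (smt (verit))
  qed
qed

lemma Metric_space_quotient:
  assumes e: "index_of_enumeration D \<nu>" and p: "p \<in> mspace C"
  shows "Metric_space (insert None (Some ` (D \<times> (mspace C - {p})))) (quotient_dist \<nu> C p)"
    (is "Metric_space ?M ?d")
proof
  have nn: "0 \<le> mdist C u v / real n" for u v n
    by simp
  have tri: "mdist C u w / real n \<le> mdist C u v / real n + mdist C v w / real n"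
    if "u \<in> mspace C" "v \<in> mspace C" "w \<in> mspace C" for n u v w
    using mdist_triangle[OF that]
    by (auto simp flip: add_divide_distrib intro!: divide_right_mono)
  have pos: "0 < mdist C u p / real (\<nu> x)" if "x \<in> D" "u \<in> mspace C - {p}" for x u
    using that index_pos[OF e that(1)] p by (simp add: mdist_pos)
  show "0 \<le> ?d a b" for a b
    by (cases "(\<nu>, C, p, a, b)" rule: quotient_dist.cases) auto
  show "?d a b = ?d b a" for a b
    by (cases "(\<nu>, C, p, a, b)" rule: quotient_dist.cases) (auto simp: mdist_commute)
  show "?d a b = 0 \<longleftrightarrow> a = b" if "a \<in> ?M" "b \<in> ?M" for a b
  proof (cases "(\<nu>, C, p, a, b)" rule: quotient_dist.cases)
    case (4 \<nu>' C' p' x u y v)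
    then show ?thesis
      using that pos[of x u] pos[of y v] index_pos[OF e, of x]
      by (auto simp: add_nonneg_eq_0_iff)
  qed (use that p index_pos[OF e] in auto)
  show "?d a c \<le> ?d a b + ?d b c" if "a \<in> ?M" "b \<in> ?M" "c \<in> ?M" for a b c
  proof -
    define F where "F = (\<lambda>x u v. mdist C u v / real (\<nu> x))"
    have nn: "0 \<le> F x u v" for x u v by (simp add: F_def)
    have sym: "F x u v = F x v u" for x u v by (simp add: F_def mdist_commute)
    have tri: "F x u w \<le> F x u v + F x v w"
      if "u \<in> mspace C" "v \<in> mspace C" "w \<in> mspace C" for x u v w
      using tri[OF that] by (simp add: F_def)
    have d: "?d None None = 0" "?d None (Some (y, v)) = F y v p" "?d (Some (x, u)) None = F x u p"
      "?d (Some (x, u)) (Some (y, v)) = (if x = y then F x u v else F x u p + F y v p)"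
      for x u y v by (simp_all add: F_def)
    have in_C: "u \<in> mspace C" if "Some (x, u) \<in> ?M" for x u
      using that by auto
    show ?thesis
      using that p
      by (cases a; cases b; cases c)
         (clarify; simp only: d; smt (verit, ccfv_threshold) nn sym tri in_C d)+
  qed
qed

lemma mspace_earring_metric:
  assumes "D \<subseteq> mspace X" "index_of_enumeration D \<nu>" "p \<in> mspace C"
  shows "mspace (earring_metric X D \<nu> C p) = mspace X \<times> {p} \<union> D \<times> mspace C"
    and "mdist (earring_metric X D \<nu> C p) = earring_dist X D \<nu> C p"
  using Metric_space_earring[OF assms]
  by (simp_all add: earring_metric_def Metric_space.mspace_metric Metric_space.mdist_metric)

lemma mspace_quotient_metric:
  assumes "index_of_enumeration D \<nu>" "p \<in> mspace C"
  shows "mspace (quotient_metric D \<nu> C p) = insert None (Some ` (D \<times> (mspace C - {p})))"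
    and "mdist (quotient_metric D \<nu> C p) = quotient_dist \<nu> C p"
  using Metric_space_quotient[OF assms]
  by (simp_all add: quotient_metric_def Metric_space.mspace_metric Metric_space.mdist_metric)


definition earring_space ::
  "'a metric \<Rightarrow> 'a set \<Rightarrow> ('a \<Rightarrow> nat) \<Rightarrow> complex metric \<Rightarrow> complex \<Rightarrow>
     ('a \<times> complex) topology" where
  "earring_space X D \<nu> C p = mtopology_of (earring_metric X D \<nu> C p)"

definition quotient_space ::
  "'a set \<Rightarrow> ('a \<Rightarrow> nat) \<Rightarrow> complex metric \<Rightarrow> complex \<Rightarrow> ('a \<times> complex) option topology" where
  "quotient_space D \<nu> C p = mtopology_of (quotient_metric D \<nu> C p)"


section \<open>The Hawaiian earring\<close>

definition hawaiian_earring :: "(real \<times> real) set" where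
  "hawaiian_earring =
     (\<Union>n\<in>{1::nat..}. {(x, y). (x + 1 / real n)\<^sup>2 + y\<^sup>2 = (1 / real n)\<^sup>2})"


section \<open>The free \<open>\<sigma>\<close>-product\<close>

text \<open>The letters are \<open>(a, True)\<close> for \<open>a\<close> and \<open>(a, False)\<close> for the formal inverse of \<open>a\<close>. A word
  over a countable set of letters has a countable index set, so up to isomorphism that set is a
  set of natural numbers, linearly ordered by an arbitrary (reflexive) relation \<open>r\<close>; the index set
  is then the field of \<open>r\<close>. This makes the words a set.\<close>

type_synonym 'a letter = "'a \<times> bool"
type_synonym 'a sigma_word = "nat rel \<times> (nat \<Rightarrow> 'a letter)"

definition inv_letter :: "'a letter \<Rightarrow> 'a letter" where
  "inv_letter c = (fst c, \<not> snd c)"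

definition sigma_words :: "'a set \<Rightarrow> 'a sigma_word set" where
  "sigma_words D =
     {(r, w). Linear_order r \<and> w ` Field r \<subseteq> D \<times> UNIV \<and>
              (\<forall>c. finite {\<alpha> \<in> Field r. w \<alpha> = c})}"

text \<open>The subword for the letters in \<open>F\<close> and their inverses, as the list of its letters.\<close>

definition list_in_order :: "'i rel \<Rightarrow> 'i set \<Rightarrow> 'i list" where
  "list_in_order r A = (THE xs. set xs = A \<and> distinct xs \<and> sorted_wrt (\<lambda>\<alpha> \<beta>. (\<alpha>, \<beta>) \<in> r) xs)"

lemma list_in_order:
  assumes r: "Linear_order r" and A: "finite A" "A \<subseteq> Field r"
  shows "set (list_in_order r A) = A \<and> distinct (list_in_order r A) \<and>
    sorted_wrt (\<lambda>\<alpha> \<beta>. (\<alpha>, \<beta>) \<in> r) (list_in_order r A)"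
proof -
  let ?P = "\<lambda>A xs. set xs = A \<and> distinct xs \<and> sorted_wrt (\<lambda>\<alpha> \<beta>. (\<alpha>, \<beta>) \<in> r) xs"
  have tr: "trans r" and an: "antisym r"
    using r by (auto simp: order_on_defs)
  have tot: "(a, b) \<in> r \<or> (b, a) \<in> r" if "a \<in> Field r" "b \<in> Field r" for a b
    using r that by (cases "a = b") (auto simp: order_on_defs total_on_def refl_on_def)
  have ex: "\<exists>xs. ?P A xs"
    using A
  proof (induction A rule: finite_induct)
    case (insert x A)
    then obtain xs where xs: "?P A xs" by auto
    let ?ys = "filter (\<lambda>a. (a, x) \<in> r) xs @ [x] @ filter (\<lambda>a. (a, x) \<notin> r) xs"
    have "?P (insert x A) ?ys"
      using xs insert.hyps insert.prems tot[of x]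
      by (auto simp: sorted_wrt_append sorted_wrt_filter intro: transD[OF tr])
    then show ?case by blast
  qed auto
  have uniq: "xs = ys" if "?P A xs" "?P A ys" for A xs ys
    using that
  proof (induction xs arbitrary: A ys)
    case (Cons a xs)
    then obtain b zs where ys: "ys = b # zs" by (cases ys) auto
    have "a = b"
    proof (rule ccontr)
      assume "a \<noteq> b"
      then have "a \<in> set zs" "b \<in> set xs"
        using Cons.prems ys by auto
      then show False
        using Cons.prems ys antisymD[OF an, of a b] \<open>a \<noteq> b\<close> by auto
    qed
    moreover have "?P (A - {a}) xs" "?P (A - {a}) zs"
      using Cons.prems ys \<open>a = b\<close> by auto
    ultimately show ?case using Cons.IH ys by blast
  qed auto
  have "\<exists>!xs. ?P A xs" using ex uniq by blast
  then show ?thesis unfolding list_in_order_def by (rule theI')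
qed

definition restrict_word :: "'a set \<Rightarrow> 'a sigma_word \<Rightarrow> 'a letter list" where
  "restrict_word F W =
     (case W of (r, w) \<Rightarrow> map w (list_in_order r {\<alpha> \<in> Field r. fst (w \<alpha>) \<in> F}))"

text \<open>Two finite words over \<open>F\<close> represent the same element of the free group on \<open>F\<close> iff one can be
  transformed into the other by inserting and deleting pairs of adjacent inverse letters.\<close>

definition cancels_to :: "'a set \<Rightarrow> 'a letter list \<Rightarrow> 'a letter list \<Rightarrow> bool" where
  "cancels_to F u v \<longleftrightarrow>
     set u \<subseteq> F \<times> UNIV \<and> (\<exists>xs c ys. u = xs @ [c, inv_letter c] @ ys \<and> v = xs @ ys)"

definition free_group_eq :: "'a set \<Rightarrow> 'a letter list \<Rightarrow> 'a letter list \<Rightarrow> bool" where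
  "free_group_eq F = equivclp (cancels_to F)"

definition sigma_equiv :: "'a set \<Rightarrow> 'a sigma_word \<Rightarrow> 'a sigma_word \<Rightarrow> bool" where
  "sigma_equiv D V W \<longleftrightarrow>
     (\<forall>F. finite F \<and> F \<subseteq> D \<longrightarrow> free_group_eq F (restrict_word F V) (restrict_word F W))"

definition sigma_class :: "'a set \<Rightarrow> 'a sigma_word \<Rightarrow> 'a sigma_word set" where
  "sigma_class D W = {V \<in> sigma_words D. sigma_equiv D W V}"

text \<open>The index set of a concatenation is the ordered disjoint sum of the two index sets, recoded
  as a set of natural numbers.\<close>

definition order_sum :: "nat rel \<Rightarrow> nat rel \<Rightarrow> nat rel" where
  "order_sum r s =
     {(sum_encode (Inl \<alpha>), sum_encode (Inl \<beta>)) | \<alpha> \<beta>. (\<alpha>, \<beta>) \<in> r} \<union>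
     {(sum_encode (Inr \<alpha>), sum_encode (Inr \<beta>)) | \<alpha> \<beta>. (\<alpha>, \<beta>) \<in> s} \<union>
     {(sum_encode (Inl \<alpha>), sum_encode (Inr \<beta>)) | \<alpha> \<beta>. \<alpha> \<in> Field r \<and> \<beta> \<in> Field s}"

definition concat_word :: "'a sigma_word \<Rightarrow> 'a sigma_word \<Rightarrow> 'a sigma_word" where
  "concat_word V W =
     (case (V, W) of ((r, v), (s, w)) \<Rightarrow>
        (order_sum r s, \<lambda>n. case sum_decode n of Inl \<alpha> \<Rightarrow> v \<alpha> | Inr \<beta> \<Rightarrow> w \<beta>))"

definition free_sigma_product :: "'a set \<Rightarrow> 'a sigma_word set monoid" where
  "free_sigma_product D =
     \<lparr>carrier = sigma_class D ` sigma_words D,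
      mult = (\<lambda>A B. \<Union>V\<in>A. \<Union>W\<in>B. sigma_class D (concat_word V W)),
      one = sigma_class D ({}, undefined)\<rparr>"

end

theory Submission
  imports Defs
begin

text \<open>For each \<open>n\<close> a path in \<open>Q(D)\<close> has a winding, a path in the free group on the first \<open>n\<close> letters,
  which records the crossings of the points opposite to the base point on the first \<open>n\<close> circles.
  Increments of windings are locally determined by the end points, which gives homotopy invariance
  and additivity, and the final windings of a loop are the restrictions of a single word to finitely
  many letters, so that this word is trivial in \<open>G\<^sup>\<sigma>(D)\<close> only if they all vanish. Moreover \<open>Q(D)\<close> is a
  retract of the Hawaiian earring. So everything reduces to contracting a loop \<open>f\<close> in \<open>E(X, D)\<close> whose
  final windings all vanish.

  Call \<open>s\<close> and \<open>t\<close> equivalent if \<open>f s = f t\<close> and the windings at \<open>s\<close> and \<open>t\<close> agree, and call a closed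
  set \<open>K\<close> of times containing \<open>0\<close> and \<open>1\<close> good if the ends of each of its gaps are equivalent. Stopping
  \<open>f\<close> during the gaps of \<open>K\<close> gives a loop. Along a maximal chain of good sets, from \<open>[0, 1]\<close> down to
  \<open>{0, 1}\<close>, this loop changes continuously, except for jumps between consecutive members of the chain.
  Projecting \<open>f\<close> to an edge of the Cayley tree shows that a loop that jumps differs from its
  predecessor only on one gap, where it runs in \<open>X\<close>: an excursion into a circle would have to return
  through equivalent times, which yields a good set strictly in between. As \<open>X\<close> is simply
  connected, jumps can be contracted, and local simple connectivity makes these contractions small
  where the jumps are small, so that together they form a null-homotopy of \<open>f\<close>.\<close>

section \<open>The fundamental group\<close>

text \<open>A loop may visit infinitely many circles, with cancelling excursions nested in a dense
  order: there need be no innermost pair to cancel first and no sequence of homotopies to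
  concatenate; chains of closed sets replace such a sequence. Equivalence of times is a closed
  relation, so a maximal chain of good sets contains its limits. The integral of the distance to the
  set orders the chain by a real number, the time of the homotopy; that time is bounded, so only
  finitely many jumps exceed a given size. Winding and position together are the lift of the path to
  the universal cover of a finite bouquet of circles, a tree. A path in a tree that enters an edge
  and later comes back to where it started passes each point in between twice, and two such passages
  are equivalent times. This holds for one finite level at a time; a pair of times that serves all
  levels comes from compactness, which works because its position in the circle can be taken from a
  two-element set that does not depend on the level.\<close>

lemma continuous_map_compose_on:
  assumes "continuous_map (top_of_set A) T f" "continuous_on B g" "\<And>x. x \<in> B \<Longrightarrow> g x \<in> A"
  shows "continuous_map (top_of_set B) T (\<lambda>x. f (g x))"
proof -
  have "continuous_map (top_of_set B) (top_of_set A) g"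
    using assms(2,3) by (simp add: continuous_map_in_subtopology image_subset_iff)
  from continuous_map_compose[OF this assms(1)] show ?thesis by (simp add: o_def)
qed

lemma continuous_map_glue_le:
  fixes q :: "'a::topological_space \<Rightarrow> real"
  assumes q: "continuous_on S q"
    and f: "continuous_map (top_of_set {x \<in> S. q x \<le> c}) T f"
    and g: "continuous_map (top_of_set {x \<in> S. c \<le> q x}) T g"
    and fg: "\<And>x. x \<in> S \<Longrightarrow> q x = c \<Longrightarrow> f x = g x"
  shows "continuous_map (top_of_set S) T (\<lambda>x. if q x \<le> c then f x else g x)"
proof (rule continuous_map_cases_le)
  show "continuous_map (top_of_set S) euclideanreal q"
    using q by simp
  have "S \<inter> {x \<in> S. q x \<le> c} = {x \<in> S. q x \<le> c}" "S \<inter> {x \<in> S. c \<le> q x} = {x \<in> S. c \<le> q x}"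
    by auto
  then show "continuous_map (subtopology (top_of_set S) {x \<in> topspace (top_of_set S). q x \<le> c}) T f"
    "continuous_map (subtopology (top_of_set S) {x \<in> topspace (top_of_set S). c \<le> q x}) T g"
    using f g by (simp_all add: subtopology_subtopology)
qed (use fg in auto)

section \<open>Homotopies of loops as maps on the unit square\<close>

abbreviation unit_square :: "(real \<times> real) set" where
  "unit_square \<equiv> {0..1} \<times> {0..1}"

lemma prod_topology_unit_square:
  "prod_topology (top_of_set {0..1::real}) (top_of_set {0..1::real}) = top_of_set unit_square"
  using subtopology_Times[of euclidean euclidean "{0..1::real}" "{0..1::real}"]
  unfolding prod_topology_euclidean by (rule sym)

lemma loop_homotopicI:
  assumes "continuous_map (top_of_set unit_square) T h"
    and "\<And>t. t \<in> {0..1} \<Longrightarrow> h (0, t) = f t" "\<And>t. t \<in> {0..1} \<Longrightarrow> h (1, t) = g t"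
    and "\<And>s. s \<in> {0..1} \<Longrightarrow> h (s, 0) = x" "\<And>s. s \<in> {0..1} \<Longrightarrow> h (s, 1) = x"
  shows "loop_homotopic T x f g"
  unfolding loop_homotopic_def
  by (subst homotopic_with) (use assms in \<open>auto simp: prod_topology_unit_square intro!: exI[of _ h]\<close>)

lemma loop_homotopicE:
  assumes "loop_homotopic T x f g"
  obtains h where "continuous_map (top_of_set unit_square) T h"
    "\<And>t. h (0, t) = f t" "\<And>t. h (1, t) = g t"
    "\<And>s. s \<in> {0..1} \<Longrightarrow> h (s, 0) = x" "\<And>s. s \<in> {0..1} \<Longrightarrow> h (s, 1) = x"
  using assms that unfolding loop_homotopic_def homotopic_with_def prod_topology_unit_square
  by blast

lemma loop_homotopic_loops:
  assumes "loop_homotopic T x f g"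
  shows "f \<in> loops T x" "g \<in> loops T x"
  using homotopic_with_imp_continuous_maps[OF assms[unfolded loop_homotopic_def]]
    homotopic_with_imp_property[OF assms[unfolded loop_homotopic_def]]
  by (auto simp: loops_def pathin_def)

lemma loop_homotopic_refl: "f \<in> loops T x \<Longrightarrow> loop_homotopic T x f f"
  by (simp add: loop_homotopic_def loops_def pathin_def)

lemma loop_homotopic_sym: "loop_homotopic T x f g \<Longrightarrow> loop_homotopic T x g f"
  unfolding loop_homotopic_def by (rule homotopic_with_symD)

lemma loop_homotopic_trans:
  "loop_homotopic T x f g \<Longrightarrow> loop_homotopic T x g h \<Longrightarrow> loop_homotopic T x f h"
  unfolding loop_homotopic_def by (rule homotopic_with_trans)

lemma loop_class_eq_iff:
  assumes "f \<in> loops T x"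
  shows "loop_class T x f = loop_class T x g \<longleftrightarrow> loop_homotopic T x f g"
proof
  assume "loop_class T x f = loop_class T x g"
  moreover have "f \<in> loop_class T x f"
    using loop_homotopic_refl[OF assms] by (simp add: loop_class_def)
  ultimately have "loop_homotopic T x g f"
    by (simp add: loop_class_def)
  then show "loop_homotopic T x f g" by (rule loop_homotopic_sym)
next
  assume "loop_homotopic T x f g"
  then show "loop_class T x f = loop_class T x g"
    unfolding loop_class_def
    by (intro Collect_cong iffI)
       (rule loop_homotopic_trans[OF loop_homotopic_sym], assumption+, rule loop_homotopic_trans, assumption+)
qed

text \<open>Paths are total functions on the reals; this lets their values outside the unit interval
  be ignored.\<close>

lemma loop_homotopic_eq:
  assumes "f \<in> loops T x" "\<And>t. t \<in> {0..1} \<Longrightarrow> f t = g t"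
  shows "loop_homotopic T x f g"
  unfolding loop_homotopic_def
  by (rule homotopic_with_equal) (use assms in \<open>auto simp: loops_def pathin_def\<close>)

lemma const_loop: "x \<in> topspace T \<Longrightarrow> (\<lambda>_. x) \<in> loops T x"
  by (simp add: loops_def)

text \<open>The straight-line homotopy from \<open>u\<close> to \<open>v\<close> stays in the unit
  interval, whatever the space is in which \<open>f\<close> runs. With \<open>v\<close> the identity
  it gives associativity and units, with \<open>v\<close> constant it gives inverses.\<close>

lemma loop_homotopic_reparam:
  assumes f: "pathin T f"
    and u: "continuous_on {0..1} u" "u ` {0..1} \<subseteq> {0..1::real}"
    and v: "continuous_on {0..1} v" "v ` {0..1} \<subseteq> {0..1::real}"
    and uv: "u 0 = v 0" "u 1 = v 1" "f (u 0) = x" "f (u 1) = x"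
  shows "loop_homotopic T x (\<lambda>t. f (u t)) (\<lambda>t. f (v t))"
proof (rule loop_homotopicI)
  let ?k = "\<lambda>z::real \<times> real. (1 - fst z) * u (snd z) + fst z * v (snd z)"
  have "continuous_on unit_square (\<lambda>z. u (snd z))" "continuous_on unit_square (\<lambda>z. v (snd z))"
    by (rule continuous_on_compose2[OF u(1) continuous_on_snd[OF continuous_on_id]]
          continuous_on_compose2[OF v(1) continuous_on_snd[OF continuous_on_id]]; force)+
  then have "continuous_on unit_square ?k"
    by (intro continuous_intros)
  moreover have "?k z \<in> {0..1}" if "z \<in> unit_square" for z
  proof -
    have uv01: "u (snd z) \<in> {0..1}" "v (snd z) \<in> {0..1}"
      using that u(2) v(2) by (auto simp: mem_Times_iff image_subset_iff)
    then show ?thesis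
      using that convex_bound_le[of "u (snd z)" 1 "v (snd z)" "1 - fst z" "fst z"]
      by (auto simp: mem_Times_iff)
  qed
  ultimately show "continuous_map (top_of_set unit_square) T (\<lambda>z. f (?k z))"
    using f unfolding pathin_def by (rule_tac continuous_map_compose_on)
qed (use uv in \<open>auto simp: algebra_simps\<close>)

section \<open>Concatenation and reversal of loops\<close>

lemma loop_concat_loops:
  assumes "f \<in> loops T x" "g \<in> loops T x"
  shows "loop_concat f g \<in> loops T x"
proof -
  have "continuous_map (top_of_set {0..1}) T
      (\<lambda>t. if t \<le> 1 / 2 then f (2 * t) else g (2 * t - 1))"
  proof (rule continuous_map_glue_le)
    have f: "continuous_map (top_of_set {0..1}) T f" and g: "continuous_map (top_of_set {0..1}) T g"
      using assms by (auto simp: loops_def pathin_def)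
    show "continuous_map (top_of_set {t \<in> {0..1}. t \<le> 1 / 2}) T (\<lambda>t. f (2 * t))"
      by (rule continuous_map_compose_on[OF f]) (auto intro!: continuous_intros)
    show "continuous_map (top_of_set {t \<in> {0..1}. 1 / 2 \<le> t}) T (\<lambda>t. g (2 * t - 1))"
      by (rule continuous_map_compose_on[OF g]) (auto intro!: continuous_intros)
    show "f (2 * t) = g (2 * t - 1)" if "t = 1 / 2" for t
      unfolding that using assms by (simp add: loops_def)
  qed (auto intro: continuous_intros)
  then show ?thesis
    using assms by (auto simp: loops_def pathin_def loop_concat_def)
qed

lemma loop_homotopic_concat:
  assumes "loop_homotopic T x f f'" "loop_homotopic T x g g'"
  shows "loop_homotopic T x (loop_concat f g) (loop_concat f' g')"
proof -
  obtain h where h: "continuous_map (top_of_set unit_square) T h"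
    "\<And>t. h (0, t) = f t" "\<And>t. h (1, t) = f' t"
    "\<And>s. s \<in> {0..1} \<Longrightarrow> h (s, 0) = x" "\<And>s. s \<in> {0..1} \<Longrightarrow> h (s, 1) = x"
    using loop_homotopicE[OF assms(1)] by metis
  obtain k where k: "continuous_map (top_of_set unit_square) T k"
    "\<And>t. k (0, t) = g t" "\<And>t. k (1, t) = g' t"
    "\<And>s. s \<in> {0..1} \<Longrightarrow> k (s, 0) = x" "\<And>s. s \<in> {0..1} \<Longrightarrow> k (s, 1) = x"
    using loop_homotopicE[OF assms(2)] by metis
  show ?thesis
  proof (rule loop_homotopicI)
    show "continuous_map (top_of_set unit_square) T
        (\<lambda>z. if snd z \<le> 1 / 2 then h (fst z, 2 * snd z) else k (fst z, 2 * snd z - 1))"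
    proof (rule continuous_map_glue_le)
      show "continuous_map (top_of_set {z \<in> unit_square. snd z \<le> 1 / 2}) T (\<lambda>z. h (fst z, 2 * snd z))"
        by (rule continuous_map_compose_on[OF h(1)]) (auto intro!: continuous_intros)
      show "continuous_map (top_of_set {z \<in> unit_square. 1 / 2 \<le> snd z}) T
          (\<lambda>z. k (fst z, 2 * snd z - 1))"
        by (rule continuous_map_compose_on[OF k(1)]) (auto intro!: continuous_intros)
      show "h (fst z, 2 * snd z) = k (fst z, 2 * snd z - 1)"
        if "z \<in> unit_square" "snd z = 1 / 2" for z
        unfolding that(2) using that(1) h(5)[of "fst z"] k(4)[of "fst z"] by (auto simp: mem_Times_iff)
    qed (auto intro!: continuous_intros)
  qed (auto simp: h k loop_concat_def)
qed

lemma loop_reverse_loops: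
  assumes "f \<in> loops T x"
  shows "(\<lambda>t. f (1 - t)) \<in> loops T x"
proof -
  have "continuous_map (top_of_set {0..1}) T (\<lambda>t. f (1 - t))"
    by (rule continuous_map_compose_on[where A = "{0..1}"])
       (use assms in \<open>auto simp: loops_def pathin_def intro: continuous_on_op_minus\<close>)
  then show ?thesis using assms by (simp add: loops_def pathin_def)
qed

lemma continuous_on_real_glue_le:
  fixes f g :: "real \<Rightarrow> real"
  assumes "continuous_on {a..c} f" "continuous_on {a..c} g" "f b = g b"
  shows "continuous_on {a..c} (\<lambda>t. if t \<le> b then f t else g t)"
  by (rule continuous_on_cases_le)
     (use assms in \<open>auto intro: continuous_on_subset\<close>)

lemma loop_homotopic_reparam_id:
  assumes "f \<in> loops T x" "continuous_on {0..1} u" "\<And>t. t \<in> {0..1} \<Longrightarrow> u t \<in> {0..1}" "u 0 = 0" "u 1 = 1"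
  shows "loop_homotopic T x (\<lambda>t. f (u t)) f"
  using loop_homotopic_reparam[of T f u "\<lambda>t. t" x] assms
  by (auto simp: loops_def image_subset_iff)

lemma loop_concat_assoc:
  assumes "f \<in> loops T x" "g \<in> loops T x" "h \<in> loops T x"
  shows "loop_homotopic T x (loop_concat (loop_concat f g) h) (loop_concat f (loop_concat g h))"
proof -
  let ?k = "loop_concat f (loop_concat g h)"
  \<comment> \<open>The piecewise linear map that carries the break points 1/4 and 1/2 of
    \<open>(f g) h\<close> to the break points 1/2 and 3/4 of \<open>f (g h)\<close>.\<close>
  define u where "u = (\<lambda>t::real. if t \<le> 1/2 then (if t \<le> 1/4 then 2 * t else t + 1/4) else t / 2 + 1/2)"
  have k: "?k \<in> loops T x"
    by (intro loop_concat_loops assms)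
  have c: "continuous_on {0..1} u"
    unfolding u_def
    by (rule continuous_on_real_glue_le, rule continuous_on_real_glue_le)
       (auto intro!: continuous_intros)
  have "loop_homotopic T x (\<lambda>t. ?k (u t)) ?k"
    by (rule loop_homotopic_reparam_id[OF k c]) (auto simp: u_def)
  moreover have "loop_homotopic T x (loop_concat (loop_concat f g) h) (\<lambda>t. ?k (u t))"
  proof (rule loop_homotopic_eq)
    show "loop_concat (loop_concat f g) h t = ?k (u t)" if "t \<in> {0..1}" for t
    proof -
      consider "t \<le> 1/4" | "1/4 < t" "t \<le> 1/2" | "1/2 < t" by linarith
      then show ?thesis
        by cases (simp_all add: loop_concat_def u_def algebra_simps)
    qed
  qed (intro loop_concat_loops assms)
  ultimately show ?thesis by (metis loop_homotopic_trans)
qed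

lemma loop_concat_const_left:
  assumes "f \<in> loops T x"
  shows "loop_homotopic T x (loop_concat (\<lambda>_. x) f) f"
proof -
  define u where "u = (\<lambda>t::real. if t \<le> 1/2 then 0 else 2 * t - 1)"
  have c: "continuous_on {0..1} u"
    unfolding u_def by (rule continuous_on_real_glue_le) (auto intro!: continuous_intros)
  have "loop_homotopic T x (\<lambda>t. f (u t)) f"
    by (rule loop_homotopic_reparam_id[OF assms c]) (auto simp: u_def)
  moreover have "loop_concat (\<lambda>_. x) f = (\<lambda>t. f (u t))"
    using assms by (auto simp: loop_concat_def loops_def u_def)
  ultimately show ?thesis by simp
qed

lemma loop_concat_reverse:
  assumes "f \<in> loops T x"
  shows "loop_homotopic T x (loop_concat f (\<lambda>t. f (1 - t))) (\<lambda>_. x)"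
    and "loop_homotopic T x (loop_concat (\<lambda>t. f (1 - t)) f) (\<lambda>_. x)"
proof -
  have *: "loop_homotopic T x (loop_concat f (\<lambda>t. f (1 - t))) (\<lambda>_. x)" if f: "f \<in> loops T x" for f
  proof -
    \<comment> \<open>A loop followed by its reverse is \<open>f\<close> after a tent function, and
      the tent can be lowered to the constant 0.\<close>
    define u where "u = (\<lambda>t::real. if t \<le> 1/2 then 2 * t else 2 - 2 * t)"
    have c: "continuous_on {0..1} u"
      unfolding u_def by (rule continuous_on_real_glue_le) (auto intro!: continuous_intros)
    have u: "u ` {0..1} \<subseteq> {0..1}" "u 0 = 0" "u 1 = 0"
      by (auto simp: u_def)
    have "loop_homotopic T x (\<lambda>t. f (u t)) (\<lambda>t. f 0)"
      by (rule loop_homotopic_reparam[OF _ c u(1)]) (use f in \<open>auto simp: loops_def u(2,3)\<close>)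
    moreover have "loop_concat f (\<lambda>t. f (1 - t)) = (\<lambda>t. f (u t))"
      by (auto simp: loop_concat_def fun_eq_iff u_def)
    ultimately show ?thesis using f by (simp add: loops_def)
  qed
  show "loop_homotopic T x (loop_concat f (\<lambda>t. f (1 - t))) (\<lambda>_. x)"
    using *[OF assms] .
  show "loop_homotopic T x (loop_concat (\<lambda>t. f (1 - t)) f) (\<lambda>_. x)"
    using *[OF loop_reverse_loops[OF assms]] by simp
qed

section \<open>The group of loop classes\<close>

lemma loop_class_self: "f \<in> loops T x \<Longrightarrow> f \<in> loop_class T x f"
  by (simp add: loop_class_def loop_homotopic_refl)

text \<open>The product is defined as a union over all representatives. Concatenation respects
  homotopy, so the members of this union coincide and it is a single class.\<close>

lemma fundamental_group_mult:
  assumes f: "f \<in> loops T x" and g: "g \<in> loops T x"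
  shows "loop_class T x f \<otimes>\<^bsub>fundamental_group T x\<^esub> loop_class T x g =
    loop_class T x (loop_concat f g)"
proof -
  have "loop_class T x (loop_concat f' g') = loop_class T x (loop_concat f g)"
    if "f' \<in> loop_class T x f" "g' \<in> loop_class T x g" for f' g'
  proof -
    have "loop_homotopic T x (loop_concat f g) (loop_concat f' g')"
      using that by (intro loop_homotopic_concat) (simp_all add: loop_class_def)
    then show ?thesis
      using loop_class_eq_iff[OF loop_concat_loops[OF f g], of "loop_concat f' g'"] by simp
  qed
  then have "(\<Union>f'\<in>loop_class T x f. \<Union>g'\<in>loop_class T x g. loop_class T x (loop_concat f' g')) =
      (\<Union>f'\<in>loop_class T x f. \<Union>g'\<in>loop_class T x g. loop_class T x (loop_concat f g))"
    by (intro SUP_cong refl)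
  also have "\<dots> = loop_class T x (loop_concat f g)"
    using loop_class_self[OF f] loop_class_self[OF g] by (simp add: ex_in_conv[symmetric]) blast
  finally show ?thesis
    by (simp add: fundamental_group_def)
qed

lemma carrier_fundamental_group: "carrier (fundamental_group T x) = loop_class T x ` loops T x"
  and one_fundamental_group: "\<one>\<^bsub>fundamental_group T x\<^esub> = loop_class T x (\<lambda>_. x)"
  by (simp_all add: fundamental_group_def)

lemma loop_class_in_carrier: "f \<in> loops T x \<Longrightarrow> loop_class T x f \<in> carrier (fundamental_group T x)"
  by (simp add: carrier_fundamental_group)

lemma loop_class_eq_one_iff:
  assumes "f \<in> loops T x"
  shows "loop_class T x f = \<one>\<^bsub>fundamental_group T x\<^esub> \<longleftrightarrow> loop_homotopic T x f (\<lambda>_. x)"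
  using assms by (simp add: one_fundamental_group loop_class_eq_iff)

lemma group_fundamental_group:
  assumes x: "x \<in> topspace T"
  shows "group (fundamental_group T x)"
proof (rule groupI)
  fix a assume "a \<in> carrier (fundamental_group T x)"
  then obtain f where f: "f \<in> loops T x" "a = loop_class T x f"
    by (auto simp: carrier_fundamental_group)
  show "\<one>\<^bsub>fundamental_group T x\<^esub> \<otimes>\<^bsub>fundamental_group T x\<^esub> a = a"
    using f x by (simp add: one_fundamental_group fundamental_group_mult const_loop
        loop_class_eq_iff loop_concat_loops loop_concat_const_left)
  show "\<exists>b\<in>carrier (fundamental_group T x).
      b \<otimes>\<^bsub>fundamental_group T x\<^esub> a = \<one>\<^bsub>fundamental_group T x\<^esub>"
    using f x loop_concat_reverse(2)[OF f(1)]
    by (intro bexI[of _ "loop_class T x (\<lambda>t. f (1 - t))"])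
       (simp_all add: fundamental_group_mult loop_class_in_carrier loop_reverse_loops
        loop_class_eq_one_iff loop_concat_loops)
  fix b assume "b \<in> carrier (fundamental_group T x)"
  then obtain g where g: "g \<in> loops T x" "b = loop_class T x g"
    by (auto simp: carrier_fundamental_group)
  show "a \<otimes>\<^bsub>fundamental_group T x\<^esub> b \<in> carrier (fundamental_group T x)"
    using f g by (simp add: fundamental_group_mult loop_concat_loops loop_class_in_carrier)
  fix c assume "c \<in> carrier (fundamental_group T x)"
  then obtain h where h: "h \<in> loops T x" "c = loop_class T x h"
    by (auto simp: carrier_fundamental_group)
  show "a \<otimes>\<^bsub>fundamental_group T x\<^esub> b \<otimes>\<^bsub>fundamental_group T x\<^esub> c =
      a \<otimes>\<^bsub>fundamental_group T x\<^esub> (b \<otimes>\<^bsub>fundamental_group T x\<^esub> c)"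
    using f g h by (simp add: fundamental_group_mult loop_concat_loops loop_class_eq_iff loop_concat_assoc)
qed (use x in \<open>simp add: one_fundamental_group const_loop loop_class_in_carrier\<close>)

section \<open>Induced homomorphisms\<close>

lemma continuous_image_loops:
  assumes "continuous_map T T' \<phi>" "f \<in> loops T x"
  shows "\<phi> \<circ> f \<in> loops T' (\<phi> x)"
  using assms by (auto simp: loops_def intro: pathin_compose)

lemma loop_homotopic_image:
  assumes "continuous_map T T' \<phi>" "loop_homotopic T x f g"
  shows "loop_homotopic T' (\<phi> x) (\<phi> \<circ> f) (\<phi> \<circ> g)"
  using assms unfolding loop_homotopic_def
  by (intro homotopic_with_compose_continuous_map_left[where p = "\<lambda>h. h 0 = x \<and> h 1 = x"]) auto

lemma induced_map_loop_class:
  assumes "continuous_map T T' \<phi>" "\<phi> x = y" "f \<in> loops T x"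
  shows "induced_map \<phi> T' y (loop_class T x f) = loop_class T' y (\<phi> \<circ> f)"
proof -
  have "loop_class T' y (\<phi> \<circ> g) = loop_class T' y (\<phi> \<circ> f)" if "g \<in> loop_class T x f" for g
  proof -
    have "loop_homotopic T' y (\<phi> \<circ> f) (\<phi> \<circ> g)"
      using loop_homotopic_image[OF assms(1), of x f g] that assms(2) by (simp add: loop_class_def)
    then show ?thesis
      using loop_class_eq_iff[of "\<phi> \<circ> f" T' y "\<phi> \<circ> g"] continuous_image_loops[OF assms(1,3)] assms(2)
      by simp
  qed
  then have "induced_map \<phi> T' y (loop_class T x f) = (\<Union>g\<in>loop_class T x f. loop_class T' y (\<phi> \<circ> f))"
    unfolding induced_map_def by (intro SUP_cong refl)
  also have "\<dots> = loop_class T' y (\<phi> \<circ> f)"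
    using loop_class_self[OF assms(3)] by (simp add: ex_in_conv[symmetric]) blast
  finally show ?thesis .
qed

lemma group_hom_induced_map:
  assumes \<phi>: "continuous_map T T' \<phi>" "\<phi> x = y" and x: "x \<in> topspace T"
  shows "group_hom (fundamental_group T x) (fundamental_group T' y) (induced_map \<phi> T' y)"
proof -
  have y: "y \<in> topspace T'"
    using \<phi> x by (auto simp: continuous_map_def)
  have c: "\<phi> \<circ> loop_concat f g = loop_concat (\<phi> \<circ> f) (\<phi> \<circ> g)" for f g :: "real \<Rightarrow> 'a"
    by (auto simp: loop_concat_def fun_eq_iff)
  have l: "\<phi> \<circ> f \<in> loops T' y" if "f \<in> loops T x" for f
    using continuous_image_loops[OF \<phi>(1) that] \<phi>(2) by simp
  have "induced_map \<phi> T' y \<in> hom (fundamental_group T x) (fundamental_group T' y)"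
    by (rule homI)
       (auto simp: carrier_fundamental_group fundamental_group_mult loop_concat_loops l c
         induced_map_loop_class[OF \<phi>])
  then show ?thesis
    using group_fundamental_group[OF x] group_fundamental_group[OF y]
    by (simp add: group_hom_def group_hom_axioms_def)
qed

section \<open>Free groups\<close>

lemma inv_letter_inv_letter [simp]: "inv_letter (inv_letter c) = c"
  by (simp add: inv_letter_def)

lemma inv_letter_neq [simp]: "inv_letter c \<noteq> c" "c \<noteq> inv_letter c"
  by (auto simp: inv_letter_def prod_eq_iff)

lemma fst_inv_letter [simp]: "fst (inv_letter c) = fst c"
  by (simp add: inv_letter_def)

text \<open>Reduced words are kept as stacks, with the last letter of the word on top, so that
  multiplication by a letter on the right is a push or a pop.\<close>

fun push :: "'a letter \<Rightarrow> 'a letter list \<Rightarrow> 'a letter list" where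
  "push c [] = [c]"
| "push c (x # xs) = (if x = inv_letter c then xs else c # x # xs)"

fun reduced :: "'a letter list \<Rightarrow> bool" where
  "reduced (x # y # xs) \<longleftrightarrow> y \<noteq> inv_letter x \<and> reduced (y # xs)"
| "reduced _ \<longleftrightarrow> True"

definition reduce :: "'a letter list \<Rightarrow> 'a letter list" where
  "reduce u = fold push u []"

lemma reduced_tl: "reduced (x # xs) \<Longrightarrow> reduced xs"
  by (cases xs) auto

lemma reduced_push: "reduced st \<Longrightarrow> reduced (push c st)"
  by (cases st) (auto simp: reduced_tl)

lemma reduced_fold_push: "reduced st \<Longrightarrow> reduced (fold push u st)"
  by (induction u arbitrary: st) (auto simp: reduced_push)

lemma reduced_reduce: "reduced (reduce u)"
  by (simp add: reduce_def reduced_fold_push)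

text \<open>Reducedness matters: popping \<open>inv_letter c\<close> from another stack could expose
  \<open>c\<close> itself, which the second push would pop as well.\<close>

lemma push_inv_push: "reduced st \<Longrightarrow> push (inv_letter c) (push c st) = st"
proof (cases st)
  case (Cons x xs)
  assume "reduced st"
  then show ?thesis using Cons by (cases xs) auto
qed simp

lemma cancels_toI:
  "set (xs @ [c, inv_letter c] @ ys) \<subseteq> F \<times> UNIV \<Longrightarrow>
    cancels_to F (xs @ [c, inv_letter c] @ ys) (xs @ ys)"
  unfolding cancels_to_def by blast

lemma fold_push_cancels_to:
  assumes "cancels_to F u v" "reduced st"
  shows "fold push u st = fold push v st"
  using assms by (auto simp: cancels_to_def push_inv_push reduced_fold_push)

text \<open>Van der Waerden's argument: pushes define an action of the free group on reduced words,
  because cancelling pairs act trivially. Applied to the empty stack this makes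
  \<open>reduce\<close> an invariant without any confluence argument.\<close>

lemma free_group_eq_fold_push:
  assumes "free_group_eq F u v" "reduced st"
  shows "fold push u st = fold push v st"
  using assms(1) unfolding free_group_eq_def
proof (induction rule: equivclp_induct)
  case (step v w)
  then show ?case using fold_push_cancels_to[OF _ assms(2)] by metis
qed simp

lemma free_group_eq_refl: "free_group_eq F u u"
  by (simp add: free_group_eq_def)

lemma free_group_eq_sym: "free_group_eq F u v \<Longrightarrow> free_group_eq F v u"
  by (simp add: free_group_eq_def equivclp_sym)

lemma free_group_eq_trans: "free_group_eq F u v \<Longrightarrow> free_group_eq F v w \<Longrightarrow> free_group_eq F u w"
  unfolding free_group_eq_def by (rule equivclp_trans)

lemma free_group_eq_map:
  assumes "\<And>u v. cancels_to F u v \<Longrightarrow> free_group_eq F' (\<phi> u) (\<phi> v)" "free_group_eq F u v"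
  shows "free_group_eq F' (\<phi> u) (\<phi> v)"
  using assms(2) unfolding free_group_eq_def[of F]
proof (induction rule: equivclp_induct)
  case base
  show ?case by (rule free_group_eq_refl)
next
  case (step v w)
  then show ?case
    using assms(1) free_group_eq_sym free_group_eq_trans by metis
qed

lemma cancels_to_free_group_eq: "cancels_to F u v \<Longrightarrow> free_group_eq F u v"
  unfolding free_group_eq_def by (rule r_into_equivclp)

lemma free_group_eq_append_letter:
  assumes "free_group_eq F u v" "fst c \<in> F"
  shows "free_group_eq F (u @ [c]) (v @ [c])"
  using _ assms(1)
proof (rule free_group_eq_map[where \<phi> = "\<lambda>u. u @ [c]"])
  fix u v assume "cancels_to F u v"
  then have "cancels_to F (u @ [c]) (v @ [c])"
    using assms(2) unfolding cancels_to_def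
    by (auto simp: mem_Times_iff) (metis append.assoc append_Cons)
  then show "free_group_eq F (u @ [c]) (v @ [c])" by (rule cancels_to_free_group_eq)
qed

lemma free_group_eq_reduce:
  assumes "set u \<subseteq> F \<times> UNIV"
  shows "free_group_eq F u (rev (reduce u)) \<and> set (reduce u) \<subseteq> F \<times> UNIV"
  using assms
proof (induction u rule: rev_induct)
  case Nil
  then show ?case by (simp add: reduce_def free_group_eq_refl)
next
  case (snoc c u)
  then have IH: "free_group_eq F (u @ [c]) (rev (reduce u) @ [c])" "set (reduce u) \<subseteq> F \<times> UNIV"
    and c: "c \<in> F \<times> UNIV"
    using free_group_eq_append_letter[of F u "rev (reduce u)" c] by (auto simp: mem_Times_iff)
  have r: "reduce (u @ [c]) = push c (reduce u)"
    by (simp add: reduce_def)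
  show ?case
  proof (cases "\<exists>xs. reduce u = inv_letter c # xs")
    case True
    then obtain xs where xs: "reduce u = inv_letter c # xs" by blast
    have "cancels_to F (rev xs @ [inv_letter c, c]) (rev xs)"
      using cancels_toI[of "rev xs" "inv_letter c" "[]" F] IH(2) c xs by (simp add: mem_Times_iff)
    then have "free_group_eq F (u @ [c]) (rev xs)"
      using IH(1) xs cancels_to_free_group_eq free_group_eq_trans by fastforce
    then show ?thesis using IH(2) xs by (simp add: r)
  next
    case False
    then have "push c (reduce u) = c # reduce u"
      by (cases "reduce u") auto
    then show ?thesis using IH c by (simp add: r)
  qed
qed

text \<open>Each word is equivalent within \<open>F\<close> to its reduced form, and that form does
  not depend on \<open>F\<close>. So the free groups on all alphabets can be handled inside the free
  group on all letters.\<close>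

lemma free_group_eq_iff_reduce:
  assumes "set u \<subseteq> F \<times> UNIV" "set v \<subseteq> F \<times> UNIV"
  shows "free_group_eq F u v \<longleftrightarrow> reduce u = reduce v"
proof
  show "reduce u = reduce v" if "free_group_eq F u v"
    unfolding reduce_def using free_group_eq_fold_push[OF that, of "[]"] by simp
  show "free_group_eq F u v" if "reduce u = reduce v"
    using free_group_eq_reduce[OF assms(1)] free_group_eq_reduce[OF assms(2)] that
      free_group_eq_sym free_group_eq_trans by metis
qed

lemma free_group_eq_UNIV_iff: "free_group_eq UNIV u v \<longleftrightarrow> reduce u = reduce v"
  by (rule free_group_eq_iff_reduce) auto

lemma reduce_map:
  assumes "\<And>u v. cancels_to UNIV u v \<Longrightarrow> reduce (\<phi> u) = reduce (\<phi> v)" "reduce u = reduce v"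
  shows "reduce (\<phi> u) = reduce (\<phi> v)"
  using free_group_eq_map[of UNIV UNIV \<phi> u v] assms by (simp add: free_group_eq_UNIV_iff)

lemma reduce_cancel: "reduce (xs @ c # inv_letter c # ys) = reduce (xs @ ys)"
  by (rule free_group_eq_UNIV_iff[THEN iffD1, OF cancels_to_free_group_eq])
     (use cancels_toI[of xs c ys UNIV] in simp)

lemma reduce_cancel': "reduce (xs @ inv_letter c # c # ys) = reduce (xs @ ys)"
  using reduce_cancel[of xs "inv_letter c" ys] by simp

lemma reduce_append_cong:
  assumes "reduce u = reduce u'" "reduce v = reduce v'"
  shows "reduce (u @ v) = reduce (u' @ v')"
proof -
  have "fold push v (reduce u) = fold push v' (reduce u)"
    by (rule free_group_eq_fold_push[OF _ reduced_reduce])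
       (use assms(2) free_group_eq_UNIV_iff in blast)
  then show ?thesis using assms(1) by (simp add: reduce_def)
qed

section \<open>The free group on all letters as a type\<close>

definition inv_word :: "'a letter list \<Rightarrow> 'a letter list" where
  "inv_word u = rev (map inv_letter u)"

lemma inv_word_append: "reduce (inv_word u @ u) = []"
proof (induction u)
  case (Cons c u)
  then show ?case
    using reduce_cancel'[of "inv_word u" c u] by (simp add: inv_word_def)
qed (simp add: inv_word_def reduce_def)

lemma reduce_inv_word:
  assumes "reduce u = reduce v"
  shows "reduce (inv_word u) = reduce (inv_word v)"
  using _ assms
proof (rule reduce_map)
  fix u v :: "'a letter list" assume "cancels_to UNIV u v"
  then obtain xs c ys where "u = xs @ [c, inv_letter c] @ ys" "v = xs @ ys"
    by (auto simp: cancels_to_def)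
  then show "reduce (inv_word u) = reduce (inv_word v)"
    using reduce_cancel[of "inv_word ys" c "inv_word xs"] by (simp add: inv_word_def)
qed

lemma reduce_filter:
  assumes "reduce u = reduce v"
  shows "reduce (filter (\<lambda>c. fst c \<in> F) u) = reduce (filter (\<lambda>c. fst c \<in> F) v)"
  using _ assms
proof (rule reduce_map)
  fix u v :: "'a letter list" assume "cancels_to UNIV u v"
  then obtain xs c ys where "u = xs @ [c, inv_letter c] @ ys" "v = xs @ ys"
    by (auto simp: cancels_to_def)
  then show "reduce (filter (\<lambda>c. fst c \<in> F) u) = reduce (filter (\<lambda>c. fst c \<in> F) v)"
    by (auto simp: reduce_cancel)
qed

\<comment> \<open>One type for the free groups of all levels, so that values for different finite
  alphabets can be compared directly. The group is written additively although it is not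
  commutative.\<close>
quotient_type 'a free_group = "'a letter list" / "\<lambda>u v. reduce u = reduce v"
  morphisms rep_free_group word_val
  by (intro equivpI reflpI sympI transpI) auto

lemma word_val_eq_iff: "word_val u = word_val v \<longleftrightarrow> reduce u = reduce v"
  by (rule free_group.abs_eq_iff)

instantiation free_group :: (type) group_add
begin

lift_definition zero_free_group :: "'a free_group" is "[]" .

lift_definition plus_free_group :: "'a free_group \<Rightarrow> 'a free_group \<Rightarrow> 'a free_group" is "(@)"
  by (rule reduce_append_cong)

lift_definition uminus_free_group :: "'a free_group \<Rightarrow> 'a free_group" is inv_word
  by (rule reduce_inv_word)

definition minus_free_group :: "'a free_group \<Rightarrow> 'a free_group \<Rightarrow> 'a free_group" where
  "minus_free_group a b = a + - b"

instance
proof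
  fix a b c :: "'a free_group"
  show "a + b + c = a + (b + c)" by transfer simp
  show "0 + a = a" by transfer simp
  show "a + 0 = a" by transfer simp
  show "- a + a = 0" by transfer (simp add: inv_word_append reduce_def[of "[]"])
  show "a + - b = a - b" by (simp add: minus_free_group_def)
qed

end

lemma word_val_Nil: "word_val [] = 0"
  by (simp add: zero_free_group.abs_eq)

lemma word_val_append: "word_val (u @ v) = word_val u + word_val v"
  by (simp add: plus_free_group.abs_eq)

lemma word_val_inv_letter: "word_val [inv_letter c] = - word_val [c]"
  by (simp add: uminus_free_group.abs_eq inv_word_def)

lemma word_val_letter_neq_0 [simp]: "word_val [c] \<noteq> 0"
  by (simp add: word_val_eq_iff reduce_def flip: word_val_Nil)

lemma word_val_letter_eq_iff: "word_val [c] = word_val [d] \<longleftrightarrow> c = d"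
  by (simp add: word_val_eq_iff reduce_def)

text \<open>Deleting letters turns a cancelling pair into a cancelling pair or into nothing. These
  homomorphisms connect the levels.\<close>

lift_definition free_group_restrict :: "'a set \<Rightarrow> 'a free_group \<Rightarrow> 'a free_group"
  is "\<lambda>F. filter (\<lambda>c. fst c \<in> F)"
  by (rule reduce_filter)

lemma free_group_restrict_zero [simp]: "free_group_restrict F 0 = 0"
  by transfer simp

lemma free_group_restrict_add:
  "free_group_restrict F (a + b) = free_group_restrict F a + free_group_restrict F b"
  by transfer simp

lemma free_group_restrict_letter:
  "free_group_restrict F (word_val [c]) = (if fst c \<in> F then word_val [c] else 0)"
  by (simp add: free_group_restrict.abs_eq word_val_Nil)

text \<open>Tells in which branch at the root of the Cayley tree a vertex lies. The stack has the
  first letter of the word at its bottom, hence \<open>last\<close>.\<close>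

lift_definition first_letter :: "'a free_group \<Rightarrow> 'a letter option"
  is "\<lambda>u. if reduce u = [] then None else Some (last (reduce u))"
  by simp

lemma first_letter_zero: "first_letter 0 = None"
  by transfer (simp add: reduce_def)

text \<open>Multiplication on the right acts on the top of the stack, so it reaches the bottom only
  if the stack is empty or consists of the one letter that is cancelled.\<close>

lemma first_letter_add_letter:
  "first_letter (g + word_val [c]) =
    (if g = 0 then Some c else if g = word_val [inv_letter c] then None else first_letter g)"
proof (induction g rule: free_group.abs_induct)
  case (1 u)
  have r: "reduce (u @ [c]) = push c (reduce u)"
    by (simp add: reduce_def)
  have 0: "word_val u = 0 \<longleftrightarrow> reduce u = []"
    by (simp add: word_val_eq_iff flip: word_val_Nil) (simp add: reduce_def)
  have i: "word_val u = word_val [inv_letter c] \<longleftrightarrow> reduce u = [inv_letter c]"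
    by (simp add: word_val_eq_iff) (simp add: reduce_def)
  have "first_letter (word_val u + word_val [c]) =
      (if push c (reduce u) = [] then None else Some (last (push c (reduce u))))"
    by (simp add: first_letter.abs_eq r flip: word_val_append)
  also have "\<dots> = (if reduce u = [] then Some c else if reduce u = [inv_letter c] then None
      else first_letter (word_val u))"
    by (cases "reduce u") (auto simp: first_letter.abs_eq)
  finally show ?case by (simp only: 0 i)
qed

section \<open>The free \<open>\<sigma>\<close>-product\<close>

text \<open>The heads of two sorted enumerations of the same set are both least elements, so the
  enumerations agree entry by entry. This evaluates the definite description.\<close>

lemma list_in_order_eqI:
  assumes r: "Linear_order r" and A: "set xs \<subseteq> Field r" "set xs = A"
    and xs: "distinct xs" "sorted_wrt (\<lambda>\<alpha> \<beta>. (\<alpha>, \<beta>) \<in> r) xs"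
  shows "list_in_order r A = xs"
proof -
  have an: "antisym r"
    using r by (auto simp: order_on_defs)
  let ?P = "\<lambda>A xs. set xs = A \<and> distinct xs \<and> sorted_wrt (\<lambda>\<alpha> \<beta>. (\<alpha>, \<beta>) \<in> r) xs"
  have uniq: "xs = ys" if "?P A xs" "?P A ys" for A xs ys
    using that
  proof (induction xs arbitrary: A ys)
    case (Cons a xs)
    then obtain b zs where ys: "ys = b # zs" by (cases ys) auto
    have "a = b"
    proof (rule ccontr)
      assume "a \<noteq> b"
      then have "a \<in> set zs" "b \<in> set xs"
        using Cons.prems ys by auto
      then show False
        using Cons.prems ys antisymD[OF an, of a b] \<open>a \<noteq> b\<close> by auto
    qed
    moreover have "?P (A - {a}) xs" "?P (A - {a}) zs"
      using Cons.prems ys \<open>a = b\<close> by auto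
    ultimately show ?case using Cons.IH ys by blast
  qed auto
  show ?thesis
    using uniq[where A = A and xs = "list_in_order r A" and ys = xs] list_in_order[OF r, of A] A xs
    by (metis List.finite_set)
qed

lemma finite_sigma_word_letters:
  assumes "(r, w) \<in> sigma_words D" "finite F"
  shows "finite {\<alpha> \<in> Field r. fst (w \<alpha>) \<in> F}"
proof -
  have "{\<alpha> \<in> Field r. fst (w \<alpha>) \<in> F} = (\<Union>c\<in>F \<times> UNIV. {\<alpha> \<in> Field r. w \<alpha> = c})"
    by (auto simp: mem_Times_iff)
  then show ?thesis
    using assms by (simp add: sigma_words_def)
qed

lemma list_in_order_sigma_word:
  assumes "(r, w) \<in> sigma_words D" "finite F"
  shows "set (list_in_order r {\<alpha> \<in> Field r. fst (w \<alpha>) \<in> F}) = {\<alpha> \<in> Field r. fst (w \<alpha>) \<in> F}"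
    and "distinct (list_in_order r {\<alpha> \<in> Field r. fst (w \<alpha>) \<in> F})"
    and "sorted_wrt (\<lambda>\<alpha> \<beta>. (\<alpha>, \<beta>) \<in> r) (list_in_order r {\<alpha> \<in> Field r. fst (w \<alpha>) \<in> F})"
  using list_in_order[of r "{\<alpha> \<in> Field r. fst (w \<alpha>) \<in> F}"] finite_sigma_word_letters[OF assms] assms(1)
  by (auto simp: sigma_words_def)

lemma set_restrict_word:
  assumes "V \<in> sigma_words D" "finite F"
  shows "set (restrict_word F V) \<subseteq> F \<times> UNIV"
proof -
  obtain r w where V: "V = (r, w)" by (cases V)
  show ?thesis
    using list_in_order_sigma_word(1)[of r w D F] assms V
    by (simp add: restrict_word_def image_subset_iff mem_Times_iff)
qed

lemma restrict_word_filter: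
  assumes "V \<in> sigma_words D" "finite F'" "F \<subseteq> F'"
  shows "restrict_word F V = filter (\<lambda>c. fst c \<in> F) (restrict_word F' V)"
proof -
  obtain r w where V: "V = (r, w)" by (cases V)
  have V': "(r, w) \<in> sigma_words D" using assms V by simp
  note L = list_in_order_sigma_word[OF V' assms(2)]
  let ?xs = "filter (\<lambda>\<alpha>. fst (w \<alpha>) \<in> F) (list_in_order r {\<alpha> \<in> Field r. fst (w \<alpha>) \<in> F'})"
  have "list_in_order r {\<alpha> \<in> Field r. fst (w \<alpha>) \<in> F} = ?xs"
  proof (rule list_in_order_eqI)
    show "Linear_order r" using V' by (simp add: sigma_words_def)
    show "set ?xs \<subseteq> Field r" "set ?xs = {\<alpha> \<in> Field r. fst (w \<alpha>) \<in> F}"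
      using L(1) assms(3) by auto
  qed (use L in \<open>simp_all add: sorted_wrt_filter\<close>)
  then show ?thesis
    by (simp add: V restrict_word_def filter_map o_def)
qed

text \<open>The image of a word in the free group on \<open>F\<close>, placed in the common type so
  that the images for different \<open>F\<close> are related by deletion of letters.\<close>

definition sigma_val :: "'a set \<Rightarrow> 'a sigma_word \<Rightarrow> 'a free_group" where
  "sigma_val F V = word_val (restrict_word F V)"

lemma sigma_val_restrict:
  assumes "V \<in> sigma_words D" "finite F'" "F \<subseteq> F'"
  shows "sigma_val F V = free_group_restrict F (sigma_val F' V)"
  unfolding sigma_val_def restrict_word_filter[OF assms] by (simp add: free_group_restrict.abs_eq)

lemma sigma_equiv_iff:
  assumes "V \<in> sigma_words D" "W \<in> sigma_words D"
  shows "sigma_equiv D V W \<longleftrightarrow> (\<forall>F. finite F \<and> F \<subseteq> D \<longrightarrow> sigma_val F V = sigma_val F W)"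
  using assms set_restrict_word
  unfolding sigma_equiv_def sigma_val_def word_val_eq_iff
  by (metis free_group_eq_iff_reduce)

section \<open>Concatenation of words\<close>

lemma sum_encode_cases:
  obtains \<alpha> where "n = sum_encode (Inl \<alpha>)" | \<alpha> where "n = sum_encode (Inr \<alpha>)"
  by (metis sum_decode_inverse sum.exhaust)

lemma order_sum_iff [simp]:
  "(sum_encode (Inl \<alpha>), sum_encode (Inl \<beta>)) \<in> order_sum r s \<longleftrightarrow> (\<alpha>, \<beta>) \<in> r"
  "(sum_encode (Inr \<alpha>), sum_encode (Inr \<beta>)) \<in> order_sum r s \<longleftrightarrow> (\<alpha>, \<beta>) \<in> s"
  "(sum_encode (Inl \<alpha>), sum_encode (Inr \<beta>)) \<in> order_sum r s \<longleftrightarrow> \<alpha> \<in> Field r \<and> \<beta> \<in> Field s"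
  "(sum_encode (Inr \<alpha>), sum_encode (Inl \<beta>)) \<notin> order_sum r s"
  by (auto simp: order_sum_def sum_encode_eq)

lemma Field_order_sum:
  assumes "Linear_order r" "Linear_order s"
  shows "sum_encode (Inl \<alpha>) \<in> Field (order_sum r s) \<longleftrightarrow> \<alpha> \<in> Field r"
    and "sum_encode (Inr \<alpha>) \<in> Field (order_sum r s) \<longleftrightarrow> \<alpha> \<in> Field s"
proof -
  have refl: "(\<alpha>, \<alpha>) \<in> r" if "\<alpha> \<in> Field r" for \<alpha>
    using assms that by (auto simp: order_on_defs refl_on_def)
  have refl': "(\<alpha>, \<alpha>) \<in> s" if "\<alpha> \<in> Field s" for \<alpha>
    using assms that by (auto simp: order_on_defs refl_on_def)
  show "sum_encode (Inl \<alpha>) \<in> Field (order_sum r s) \<longleftrightarrow> \<alpha> \<in> Field r"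
  proof
    assume "\<alpha> \<in> Field r"
    then have "(sum_encode (Inl \<alpha>), sum_encode (Inl \<alpha>)) \<in> order_sum r s" using refl by simp
    then show "sum_encode (Inl \<alpha>) \<in> Field (order_sum r s)" by (rule FieldI1)
  qed (auto simp: Field_def order_sum_def sum_encode_eq)
  show "sum_encode (Inr \<alpha>) \<in> Field (order_sum r s) \<longleftrightarrow> \<alpha> \<in> Field s"
  proof
    assume "\<alpha> \<in> Field s"
    then have "(sum_encode (Inr \<alpha>), sum_encode (Inr \<alpha>)) \<in> order_sum r s" using refl' by simp
    then show "sum_encode (Inr \<alpha>) \<in> Field (order_sum r s)" by (rule FieldI1)
  qed (auto simp: Field_def order_sum_def sum_encode_eq)
qed

lemma Linear_orderI:
  assumes "\<And>a. a \<in> Field r \<Longrightarrow> (a, a) \<in> r"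
    and "\<And>a b c. (a, b) \<in> r \<Longrightarrow> (b, c) \<in> r \<Longrightarrow> (a, c) \<in> r"
    and "\<And>a b. (a, b) \<in> r \<Longrightarrow> (b, a) \<in> r \<Longrightarrow> a = b"
    and "\<And>a b. a \<in> Field r \<Longrightarrow> b \<in> Field r \<Longrightarrow> (a, b) \<in> r \<or> (b, a) \<in> r"
  shows "Linear_order r"
proof -
  have "refl_on (Field r) r" "r \<subseteq> Field r \<times> Field r"
    using assms(1) by (auto simp: refl_on_def Field_def)
  moreover have "trans r" using assms(2) by (rule transI)
  moreover have "antisym r" using assms(3) by (rule antisymI)
  moreover have "total_on (Field r) r" using assms(4) by (simp add: total_on_def)
  ultimately show ?thesis by (simp add: order_on_defs)
qed

lemma Linear_orderD:
  assumes "Linear_order r"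
  shows "\<And>a. a \<in> Field r \<Longrightarrow> (a, a) \<in> r"
    and "\<And>a b c. (a, b) \<in> r \<Longrightarrow> (b, c) \<in> r \<Longrightarrow> (a, c) \<in> r"
    and "\<And>a b. (a, b) \<in> r \<Longrightarrow> (b, a) \<in> r \<Longrightarrow> a = b"
    and "\<And>a b. a \<in> Field r \<Longrightarrow> b \<in> Field r \<Longrightarrow> (a, b) \<in> r \<or> (b, a) \<in> r"
proof -
  have r: "refl_on (Field r) r" "trans r" "antisym r" "total_on (Field r) r"
    using assms by (auto simp: order_on_defs)
  show refl: "(a, a) \<in> r" if "a \<in> Field r" for a using r(1) that by (simp add: refl_on_def)
  show "(a, c) \<in> r" if "(a, b) \<in> r" "(b, c) \<in> r" for a b c using r(2) that by (rule transD)
  show "a = b" if "(a, b) \<in> r" "(b, a) \<in> r" for a b using r(3) that by (rule antisymD)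
  show "(a, b) \<in> r \<or> (b, a) \<in> r" if "a \<in> Field r" "b \<in> Field r" for a b
    using r(4) that refl by (cases "a = b") (auto simp: total_on_def)
qed

lemma Linear_order_order_sum:
  assumes r: "Linear_order r" and s: "Linear_order s"
  shows "Linear_order (order_sum r s)"
proof (rule Linear_orderI)
  note F = Field_order_sum[OF r s]
  fix a
  show "(a, a) \<in> order_sum r s" if "a \<in> Field (order_sum r s)"
    using that by (cases a rule: sum_encode_cases) (simp_all add: F Linear_orderD(1)[OF r] Linear_orderD(1)[OF s])
  fix b
  show "a = b" if "(a, b) \<in> order_sum r s" "(b, a) \<in> order_sum r s"
    using that
    by (cases a rule: sum_encode_cases; cases b rule: sum_encode_cases)
       (auto dest: Linear_orderD(3)[OF r] Linear_orderD(3)[OF s])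
  show "(a, b) \<in> order_sum r s \<or> (b, a) \<in> order_sum r s"
    if "a \<in> Field (order_sum r s)" "b \<in> Field (order_sum r s)"
    using that
    by (cases a rule: sum_encode_cases; cases b rule: sum_encode_cases)
       (simp_all add: F Linear_orderD(4)[OF r] Linear_orderD(4)[OF s])
  fix c
  show "(a, c) \<in> order_sum r s" if "(a, b) \<in> order_sum r s" "(b, c) \<in> order_sum r s"
    using that
    by (cases a rule: sum_encode_cases; cases b rule: sum_encode_cases; cases c rule: sum_encode_cases)
       (auto intro: FieldI1 FieldI2 Linear_orderD(2)[OF r] Linear_orderD(2)[OF s])
qed

lemma restrict_concat_word:
  assumes V: "V \<in> sigma_words D" and W: "W \<in> sigma_words D" and F: "finite F"
  shows "restrict_word F (concat_word V W) = restrict_word F V @ restrict_word F W"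
proof -
  obtain r v where rv: "V = (r, v)" by (cases V)
  obtain s w where sw: "W = (s, w)" by (cases W)
  have r: "Linear_order r" and s: "Linear_order s"
    using V W rv sw by (auto simp: sigma_words_def)
  note V' = list_in_order_sigma_word[OF V[unfolded rv] F]
  note W' = list_in_order_sigma_word[OF W[unfolded sw] F]
  define u where "u = (\<lambda>n. case sum_decode n of Inl \<alpha> \<Rightarrow> v \<alpha> | Inr \<beta> \<Rightarrow> w \<beta>)"
  have u: "u (sum_encode (Inl \<alpha>)) = v \<alpha>" "u (sum_encode (Inr \<alpha>)) = w \<alpha>" for \<alpha>
    by (simp_all add: u_def)
  let ?xs = "list_in_order r {\<alpha> \<in> Field r. fst (v \<alpha>) \<in> F}"
  let ?ys = "list_in_order s {\<alpha> \<in> Field s. fst (w \<alpha>) \<in> F}"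
  let ?zs = "map (\<lambda>\<alpha>. sum_encode (Inl \<alpha>)) ?xs @ map (\<lambda>\<alpha>. sum_encode (Inr \<alpha>)) ?ys"
  have set_eq: "set ?zs = {\<gamma> \<in> Field (order_sum r s). fst (u \<gamma>) \<in> F}"
  proof (rule Set.set_eqI)
    fix n show "n \<in> set ?zs \<longleftrightarrow> n \<in> {\<gamma> \<in> Field (order_sum r s). fst (u \<gamma>) \<in> F}"
      by (cases n rule: sum_encode_cases)
         (auto simp: V'(1) W'(1) Field_order_sum[OF r s] u sum_encode_eq)
  qed
  have "list_in_order (order_sum r s) {\<gamma> \<in> Field (order_sum r s). fst (u \<gamma>) \<in> F} = ?zs"
  proof (rule list_in_order_eqI[OF Linear_order_order_sum[OF r s]])
    show "distinct ?zs"
      using V'(2) W'(2) by (auto simp: distinct_map inj_on_def sum_encode_eq)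
    show "sorted_wrt (\<lambda>\<alpha> \<beta>. (\<alpha>, \<beta>) \<in> order_sum r s) ?zs"
      using V'(1,3) W'(1,3) by (auto simp: sorted_wrt_append sorted_wrt_map)
    show "set ?zs = {\<gamma> \<in> Field (order_sum r s). fst (u \<gamma>) \<in> F}" by (fact set_eq)
    then show "set ?zs \<subseteq> Field (order_sum r s)" by blast
  qed
  then show ?thesis
    by (simp add: rv sw concat_word_def restrict_word_def u_def[symmetric] u o_def)
qed

lemma concat_word_in_sigma_words:
  assumes "V \<in> sigma_words D" "W \<in> sigma_words D"
  shows "concat_word V W \<in> sigma_words D"
proof -
  obtain r v where rv: "V = (r, v)" by (cases V)
  obtain s w where sw: "W = (s, w)" by (cases W)
  have r: "Linear_order r" "v ` Field r \<subseteq> D \<times> UNIV" "\<And>c. finite {\<alpha> \<in> Field r. v \<alpha> = c}"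
    and s: "Linear_order s" "w ` Field s \<subseteq> D \<times> UNIV" "\<And>c. finite {\<alpha> \<in> Field s. w \<alpha> = c}"
    using assms rv sw by (auto simp: sigma_words_def)
  define u where "u = (\<lambda>n. case sum_decode n of Inl \<alpha> \<Rightarrow> v \<alpha> | Inr \<beta> \<Rightarrow> w \<beta>)"
  have u: "u (sum_encode (Inl \<alpha>)) = v \<alpha>" "u (sum_encode (Inr \<alpha>)) = w \<alpha>" for \<alpha>
    by (simp_all add: u_def)
  note F = Field_order_sum[OF r(1) s(1)]
  have "u n \<in> D \<times> UNIV" if "n \<in> Field (order_sum r s)" for n
    using that r(2) s(2) by (cases n rule: sum_encode_cases) (auto simp: F u image_subset_iff)
  moreover have "finite {n \<in> Field (order_sum r s). u n = c}" for c
  proof (rule finite_subset)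
    show "{n \<in> Field (order_sum r s). u n = c} \<subseteq>
        (\<lambda>\<alpha>. sum_encode (Inl \<alpha>)) ` {\<alpha> \<in> Field r. v \<alpha> = c} \<union>
        (\<lambda>\<alpha>. sum_encode (Inr \<alpha>)) ` {\<alpha> \<in> Field s. w \<alpha> = c}"
    proof
      fix n assume "n \<in> {n \<in> Field (order_sum r s). u n = c}"
      then show "n \<in> (\<lambda>\<alpha>. sum_encode (Inl \<alpha>)) ` {\<alpha> \<in> Field r. v \<alpha> = c} \<union>
        (\<lambda>\<alpha>. sum_encode (Inr \<alpha>)) ` {\<alpha> \<in> Field s. w \<alpha> = c}"
        by (cases n rule: sum_encode_cases) (auto simp: F u)
    qed
  qed (use r s in simp)
  ultimately show ?thesis
    using Linear_order_order_sum[OF r(1) s(1)]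
    by (simp add: rv sw sigma_words_def concat_word_def u_def[symmetric] image_subset_iff)
qed

lemma sigma_val_concat:
  assumes "V \<in> sigma_words D" "W \<in> sigma_words D" "finite F"
  shows "sigma_val F (concat_word V W) = sigma_val F V + sigma_val F W"
  by (simp add: sigma_val_def restrict_concat_word[OF assms] word_val_append)

lemma empty_word_in_sigma_words: "({}, undefined) \<in> sigma_words D"
  by (auto simp: sigma_words_def order_on_defs refl_on_def trans_def antisym_def total_on_def)

lemma sigma_val_empty: "sigma_val F ({}, undefined) = 0"
proof -
  have "list_in_order {} {} = ([] :: nat list)"
    using list_in_order_eqI[of "{}" "[]" "{}"] by (simp add: Linear_orderI)
  then show ?thesis
    by (simp add: sigma_val_def restrict_word_def word_val_Nil)
qed

lemma sigma_class_eq_iff: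
  assumes "V \<in> sigma_words D" "W \<in> sigma_words D"
  shows "sigma_class D V = sigma_class D W \<longleftrightarrow>
    (\<forall>F. finite F \<and> F \<subseteq> D \<longrightarrow> sigma_val F V = sigma_val F W)"
proof
  assume "sigma_class D V = sigma_class D W"
  moreover have "W \<in> sigma_class D W"
    using assms by (simp add: sigma_class_def sigma_equiv_iff)
  ultimately have "W \<in> sigma_class D V" by simp
  then show "\<forall>F. finite F \<and> F \<subseteq> D \<longrightarrow> sigma_val F V = sigma_val F W"
    using assms by (simp add: sigma_class_def sigma_equiv_iff)
next
  assume "\<forall>F. finite F \<and> F \<subseteq> D \<longrightarrow> sigma_val F V = sigma_val F W"
  then show "sigma_class D V = sigma_class D W"
    using assms by (auto simp: sigma_class_def sigma_equiv_iff)
qed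

text \<open>As for loop classes, all members of the defining union coincide: a class is determined
  by the values \<open>sigma_val\<close>, and these are additive.\<close>

lemma free_sigma_product_mult:
  assumes V: "V \<in> sigma_words D" and W: "W \<in> sigma_words D"
  shows "sigma_class D V \<otimes>\<^bsub>free_sigma_product D\<^esub> sigma_class D W = sigma_class D (concat_word V W)"
proof -
  have self: "V \<in> sigma_class D V" if "V \<in> sigma_words D" for V
    using that by (simp add: sigma_class_def sigma_equiv_iff)
  have "sigma_class D (concat_word V' W') = sigma_class D (concat_word V W)"
    if "V' \<in> sigma_class D V" "W' \<in> sigma_class D W" for V' W'
  proof -
    have "V' \<in> sigma_words D" "W' \<in> sigma_words D"
      and "\<And>F. finite F \<Longrightarrow> F \<subseteq> D \<Longrightarrow> sigma_val F V = sigma_val F V'"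
      and "\<And>F. finite F \<Longrightarrow> F \<subseteq> D \<Longrightarrow> sigma_val F W = sigma_val F W'"
      using that V W by (auto simp: sigma_class_def sigma_equiv_iff)
    then show ?thesis
      using V W by (simp add: sigma_class_eq_iff concat_word_in_sigma_words sigma_val_concat)
  qed
  then have "(\<Union>V'\<in>sigma_class D V. \<Union>W'\<in>sigma_class D W. sigma_class D (concat_word V' W')) =
      (\<Union>V'\<in>sigma_class D V. \<Union>W'\<in>sigma_class D W. sigma_class D (concat_word V W))"
    by (intro SUP_cong refl)
  also have "\<dots> = sigma_class D (concat_word V W)"
    using self[OF V] self[OF W] by blast
  finally show ?thesis
    by (simp add: free_sigma_product_def)
qed

lemma carrier_free_sigma_product: "carrier (free_sigma_product D) = sigma_class D ` sigma_words D"
  and one_free_sigma_product: "\<one>\<^bsub>free_sigma_product D\<^esub> = sigma_class D ({}, undefined)"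
  by (simp_all add: free_sigma_product_def)

lemma monoid_free_sigma_product: "monoid (free_sigma_product D)"
proof (rule monoidI)
  fix a assume "a \<in> carrier (free_sigma_product D)"
  then obtain V where V: "V \<in> sigma_words D" "a = sigma_class D V"
    by (auto simp: carrier_free_sigma_product)
  note e = empty_word_in_sigma_words[of D]
  show "\<one>\<^bsub>free_sigma_product D\<^esub> \<otimes>\<^bsub>free_sigma_product D\<^esub> a = a"
    using V e by (simp add: one_free_sigma_product free_sigma_product_mult sigma_class_eq_iff
        concat_word_in_sigma_words sigma_val_concat sigma_val_empty)
  show "a \<otimes>\<^bsub>free_sigma_product D\<^esub> \<one>\<^bsub>free_sigma_product D\<^esub> = a"
    using V e by (simp add: one_free_sigma_product free_sigma_product_mult sigma_class_eq_iff
        concat_word_in_sigma_words sigma_val_concat sigma_val_empty)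
  fix b assume "b \<in> carrier (free_sigma_product D)"
  then obtain W where W: "W \<in> sigma_words D" "b = sigma_class D W"
    by (auto simp: carrier_free_sigma_product)
  show "a \<otimes>\<^bsub>free_sigma_product D\<^esub> b \<in> carrier (free_sigma_product D)"
    using V W by (simp add: free_sigma_product_mult concat_word_in_sigma_words carrier_free_sigma_product)
  fix c assume "c \<in> carrier (free_sigma_product D)"
  then obtain U where U: "U \<in> sigma_words D" "c = sigma_class D U"
    by (auto simp: carrier_free_sigma_product)
  show "a \<otimes>\<^bsub>free_sigma_product D\<^esub> b \<otimes>\<^bsub>free_sigma_product D\<^esub> c =
      a \<otimes>\<^bsub>free_sigma_product D\<^esub> (b \<otimes>\<^bsub>free_sigma_product D\<^esub> c)"
    using V W U by (simp add: free_sigma_product_mult sigma_class_eq_iff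
        concat_word_in_sigma_words sigma_val_concat[of _ D] add.assoc)
qed (use empty_word_in_sigma_words in \<open>auto simp: one_free_sigma_product carrier_free_sigma_product\<close>)

text \<open>The \<open>\<sigma>\<close>-product is a group, but for the image of a group to be a subgroup it suffices that
  inverses in a monoid are unique.\<close>

lemma hom_image_subgroup_iso:
  assumes G: "group G" and S: "monoid S"
    and \<phi>: "\<phi> \<in> hom G S" "\<phi> \<one>\<^bsub>G\<^esub> = \<one>\<^bsub>S\<^esub>"
    and ker: "\<And>a. a \<in> carrier G \<Longrightarrow> \<phi> a = \<one>\<^bsub>S\<^esub> \<Longrightarrow> a = \<one>\<^bsub>G\<^esub>"
  shows "inj_on \<phi> (carrier G)" "\<exists>H. subgroup H S \<and> G \<cong> S\<lparr>carrier := H\<rparr>"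
proof -
  interpret G: group G by fact
  interpret S: monoid S by fact
  have in_S: "\<phi> a \<in> carrier S" if "a \<in> carrier G" for a
    using \<phi> that by (auto simp: hom_def)
  have mult: "\<phi> (a \<otimes>\<^bsub>G\<^esub> b) = \<phi> a \<otimes>\<^bsub>S\<^esub> \<phi> b" if "a \<in> carrier G" "b \<in> carrier G" for a b
    using \<phi> that by (auto simp: hom_def)
  have inv: "\<phi> a \<otimes>\<^bsub>S\<^esub> \<phi> (inv\<^bsub>G\<^esub> a) = \<one>\<^bsub>S\<^esub>" "\<phi> (inv\<^bsub>G\<^esub> a) \<otimes>\<^bsub>S\<^esub> \<phi> a = \<one>\<^bsub>S\<^esub>" if "a \<in> carrier G" for a
    using that by (simp_all add: \<phi>(2) flip: mult)
  show inj: "inj_on \<phi> (carrier G)"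
  proof (rule inj_onI)
    fix a b assume ab: "a \<in> carrier G" "b \<in> carrier G" "\<phi> a = \<phi> b"
    then have "\<phi> (a \<otimes>\<^bsub>G\<^esub> inv\<^bsub>G\<^esub> b) = \<one>\<^bsub>S\<^esub>"
      using inv by (simp add: mult)
    then have "a \<otimes>\<^bsub>G\<^esub> inv\<^bsub>G\<^esub> b = \<one>\<^bsub>G\<^esub>"
      using ab by (intro ker) auto
    then show "a = b"
      using ab by (metis G.inv_closed G.inv_equality G.inv_inv)
  qed
  have inv_S: "inv\<^bsub>S\<^esub> (\<phi> a) = \<phi> (inv\<^bsub>G\<^esub> a)" if "a \<in> carrier G" for a
    using that inv in_S by (intro S.inv_unique'[symmetric]) auto
  have "subgroup (\<phi> ` carrier G) S"
  proof
    show "\<phi> ` carrier G \<subseteq> carrier S" using in_S by auto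
    show "a \<otimes>\<^bsub>S\<^esub> b \<in> \<phi> ` carrier G" if "a \<in> \<phi> ` carrier G" "b \<in> \<phi> ` carrier G" for a b
      using that by (auto simp flip: mult)
    show "\<one>\<^bsub>S\<^esub> \<in> \<phi> ` carrier G" by (metis G.one_closed \<phi>(2) imageI)
    show "inv\<^bsub>S\<^esub> a \<in> \<phi> ` carrier G" if "a \<in> \<phi> ` carrier G" for a
      using that inv_S by auto
  qed
  moreover have "\<phi> \<in> iso G (S\<lparr>carrier := \<phi> ` carrier G\<rparr>)"
    using inj mult by (auto simp: iso_def hom_def bij_betw_def)
  ultimately show "\<exists>H. subgroup H S \<and> G \<cong> S\<lparr>carrier := H\<rparr>"
    by (intro exI[of _ "\<phi> ` carrier G"]) (auto simp: is_iso_def)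
qed

section \<open>The earring space and the Hawaiian earring\<close>

lemma continuous_map_mtopology_of:
  "continuous_map T (mtopology_of m) f \<longleftrightarrow>
    (\<forall>x\<in>topspace T. f x \<in> mspace m \<and>
      (\<forall>\<epsilon>>0. \<exists>U. openin T U \<and> x \<in> U \<and> (\<forall>y\<in>U. f y \<in> mspace m \<and> mdist m (f x) (f y) < \<epsilon>)))"
proof -
  interpret Metric_space "mspace m" "mdist m" by (rule Metric_space_mspace_mdist)
  show ?thesis
    unfolding mtopology_of_def continuous_map_to_metric in_mball
  proof (intro ball_cong refl iffI conjI allI impI)
    fix x
    assume *: "\<forall>\<epsilon>>0. \<exists>U. openin T U \<and> x \<in> U \<and>
      (\<forall>y\<in>U. f x \<in> mspace m \<and> f y \<in> mspace m \<and> mdist m (f x) (f y) < \<epsilon>)"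
    from *[rule_format, OF zero_less_one] show "f x \<in> mspace m" by blast
    fix \<epsilon> :: real assume "0 < \<epsilon>"
    from *[rule_format, OF this]
    show "\<exists>U. openin T U \<and> x \<in> U \<and> (\<forall>y\<in>U. f y \<in> mspace m \<and> mdist m (f x) (f y) < \<epsilon>)"
      by blast
  next
    fix x and \<epsilon> :: real
    assume *: "f x \<in> mspace m \<and> (\<forall>\<epsilon>>0. \<exists>U. openin T U \<and> x \<in> U \<and>
      (\<forall>y\<in>U. f y \<in> mspace m \<and> mdist m (f x) (f y) < \<epsilon>))" and \<epsilon>: "0 < \<epsilon>"
    from *[THEN conjunct2, rule_format, OF \<epsilon>] obtain U where "openin T U" "x \<in> U" "\<forall>y\<in>U. f y \<in> mspace m \<and> mdist m (f x) (f y) < \<epsilon>"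
      by blast
    then show "\<exists>U. openin T U \<and> x \<in> U \<and>
      (\<forall>y\<in>U. f x \<in> mspace m \<and> f y \<in> mspace m \<and> mdist m (f x) (f y) < \<epsilon>)"
      using * by (intro exI[of _ U]) simp
  qed
qed

lemma openin_mtopology_of_ball:
  assumes "continuous_map T (mtopology_of m) f" "a \<in> mspace m"
  shows "openin T {x \<in> topspace T. mdist m a (f x) < \<epsilon>}"
proof -
  interpret Metric_space "mspace m" "mdist m" by (rule Metric_space_mspace_mdist)
  have "openin T {x \<in> topspace T. f x \<in> mball a \<epsilon>}"
    using openin_continuous_map_preimage[OF assms(1), of "mball a \<epsilon>"] by (simp add: mtopology_of_def)
  moreover have "f x \<in> mspace m" if "x \<in> topspace T" for x
    using continuous_map_image_subset_topspace[OF assms(1)] that by (auto simp: image_subset_iff)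
  ultimately show ?thesis
    using assms(2) by (auto simp: in_mball elim!: back_subst[of "openin T"])
qed

lemma mdist_self: "x \<in> mspace m \<Longrightarrow> mdist m x x = 0"
  by simp

lemma continuous_map_Lipschitz:
  assumes "\<And>x. x \<in> mspace m \<Longrightarrow> f x \<in> mspace m'"
    and "\<And>x y. x \<in> mspace m \<Longrightarrow> y \<in> mspace m \<Longrightarrow> mdist m' (f x) (f y) \<le> B * mdist m x y"
  shows "continuous_map (mtopology_of m) (mtopology_of m') f"
  by (rule Lipschitz_continuous_imp_continuous_map)
     (use assms in \<open>auto simp: Lipschitz_continuous_map_def\<close>)

text \<open>In this form the number of the circle through a point other than the origin is the
  quotient of -2a by the squared norm, a continuous function of the point. The continuity of the
  retraction below rests on this.\<close>

lemma hawaiian_earring_iff: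
  "(a, b) \<in> hawaiian_earring \<longleftrightarrow> (\<exists>n::nat. 1 \<le> n \<and> real n * (a\<^sup>2 + b\<^sup>2) = - 2 * a)"
proof -
  have "(a + 1 / real n)\<^sup>2 + b\<^sup>2 = (1 / real n)\<^sup>2 \<longleftrightarrow> real n * (a\<^sup>2 + b\<^sup>2) = - 2 * a" if "1 \<le> n" for n
  proof -
    have "(a + 1 / real n)\<^sup>2 + b\<^sup>2 - (1 / real n)\<^sup>2 = (real n * (a\<^sup>2 + b\<^sup>2) + 2 * a) / real n"
      using that by (simp add: field_simps power2_eq_square)
    then have "(a + 1 / real n)\<^sup>2 + b\<^sup>2 - (1 / real n)\<^sup>2 = 0 \<longleftrightarrow> real n * (a\<^sup>2 + b\<^sup>2) + 2 * a = 0"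
      using that by simp
    then show ?thesis by linarith
  qed
  then show ?thesis
    by (auto simp: hawaiian_earring_def)
qed

locale earring =
  fixes X :: "'a metric" and D :: "'a set" and \<nu> :: "'a \<Rightarrow> nat"
    and C :: "complex metric" and p :: complex
  assumes D_sub: "D \<subseteq> mspace X" and enum: "index_of_enumeration D \<nu>"
    and circle: "circle_metric C" and p_in: "p \<in> mspace C"
begin

abbreviation "E \<equiv> earring_metric X D \<nu> C p"
abbreviation "Q \<equiv> quotient_metric D \<nu> C p"
abbreviation "\<sigma> \<equiv> quotient_map_sigma p"

definition level :: "nat \<Rightarrow> 'a set" where
  "level n = {d \<in> D. \<nu> d \<le> n}"

text \<open>Circles are rotated so that the base point becomes \<open>1\<close>.\<close>

definition coord :: "'a \<Rightarrow> ('a \<times> complex) option \<Rightarrow> complex" where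
  "coord d q = (case q of None \<Rightarrow> 1 | Some (x, u) \<Rightarrow> if x = d then u / p else 1)"

lemma norm_p: "cmod p = 1" and p_nz: "p \<noteq> 0"
  using p_in circle by (auto simp: circle_metric_def)

lemma mspace_C: "mspace C = sphere 0 1" and mtopology_C: "mtopology_of C = top_of_set (sphere 0 1)"
  using circle by (auto simp: circle_metric_def)

lemma mdist_C_less_1: "u \<in> sphere 0 1 \<Longrightarrow> v \<in> sphere 0 1 \<Longrightarrow> mdist C u v < 1"
proof -
  assume uv: "u \<in> sphere 0 1" "v \<in> sphere 0 1"
  obtain r where "r < 1" "\<forall>u\<in>mspace C. \<forall>v\<in>mspace C. mdist C u v \<le> r"
    using circle by (auto simp: circle_metric_def)
  moreover have "u \<in> mspace C" "v \<in> mspace C" using uv by (simp_all only: mspace_C)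
  ultimately show ?thesis by (meson le_less_trans)
qed

lemma mspace_E: "mspace E = mspace X \<times> {p} \<union> D \<times> sphere 0 1"
  and mdist_E: "mdist E = earring_dist X D \<nu> C p"
  using mspace_earring_metric[OF D_sub enum p_in] by (simp_all add: mspace_C)

lemma mspace_Q: "mspace Q = insert None (Some ` (D \<times> (sphere 0 1 - {p})))"
  and mdist_Q: "mdist Q = quotient_dist \<nu> C p"
  using mspace_quotient_metric[OF enum p_in] by (simp_all add: mspace_C)

lemma index_ge_1: "d \<in> D \<Longrightarrow> 1 \<le> \<nu> d"
  using index_pos[OF enum] by fastforce

lemma inj_index: "inj_on \<nu> D"
  using enum by (simp add: index_of_enumeration_def bij_betw_def)

lemma finite_level: "finite (level n)"
proof (rule finite_imageD)
  show "inj_on \<nu> (level n)"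
    using inj_index by (auto simp: level_def intro: inj_on_subset)
  show "finite (\<nu> ` level n)"
    by (rule finite_subset[of _ "{..n}"]) (auto simp: level_def)
qed

lemma level_sub: "level n \<subseteq> D"
  by (auto simp: level_def)

lemma finite_subset_level:
  assumes "finite F" "F \<subseteq> D"
  obtains n where "F \<subseteq> level n"
proof
  show "F \<subseteq> level (Max (\<nu> ` F))"
    using assms by (auto simp: level_def)
qed

lemma norm_coord: "q \<in> mspace Q \<Longrightarrow> cmod (coord d q) = 1"
  by (auto simp: coord_def mspace_Q norm_divide norm_p split: if_splits)

lemma coord_neq_1_iff:
  "q \<in> mspace Q \<Longrightarrow> coord d q \<noteq> 1 \<longleftrightarrow> (d \<in> D \<and> q = Some (d, p * coord d q))"
  using p_nz by (auto simp: coord_def mspace_Q split: if_splits)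

lemma sphere_coord: "q \<in> mspace Q \<Longrightarrow> p * coord d q \<in> sphere 0 1"
  by (simp add: norm_mult norm_p norm_coord)

lemma coord_other: "coord d q \<noteq> 1 \<Longrightarrow> d' \<noteq> d \<Longrightarrow> coord d' q = 1"
  by (auto simp: coord_def split: option.splits if_splits)

lemma coord_eqI:
  assumes "q \<in> mspace Q" "q' \<in> mspace Q" "coord d q = coord d q'" "coord d q \<noteq> 1"
  shows "q = q'"
  using coord_neq_1_iff[of q d] coord_neq_1_iff[of q' d] assms by metis

text \<open>About the metric of \<open>C\<close> only its topology is known, so the Lipschitz
  estimate is made for \<open>p * coord d\<close> as a map into \<open>C\<close>; its constant
  \<open>\<nu> d\<close> undoes the shrinking of the circle of \<open>d\<close>. The passage to the
  complex plane is then purely topological.\<close>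

lemma continuous_map_coord:
  assumes d: "d \<in> D"
  shows "continuous_map (mtopology_of Q) euclidean (coord d)"
proof -
  have "continuous_map (mtopology_of Q) (mtopology_of C) (\<lambda>q. p * coord d q)"
  proof (rule continuous_map_Lipschitz[where B = "real (\<nu> d)"])
    show "p * coord d q \<in> mspace C" if "q \<in> mspace Q" for q
      using sphere_coord[OF that] by (simp add: mspace_C)
    fix q q' assume q: "q \<in> mspace Q" and q': "q' \<in> mspace Q"
    have nn: "mdist C p p = 0" using p_in by simp
    have nu: "real (\<nu> d) \<noteq> 0" using index_ge_1[OF d] by simp
    have r: "p * coord d q = (case q of None \<Rightarrow> p | Some (x, u) \<Rightarrow> if x = d then u else p)" for q
      using p_nz by (simp add: coord_def split: option.split prod.split)
    have le: "a \<le> real (\<nu> d) * (a / real (\<nu> d) + b / real n)" if "0 \<le> b" for a b n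
      using nu that by (simp add: distrib_left)
    show "mdist C (p * coord d q) (p * coord d q') \<le> real (\<nu> d) * mdist Q q q'"
    proof (cases q)
      case None
      show ?thesis
      proof (cases q')
        case (Some z')
        obtain y v where z': "z' = (y, v)" by (cases z')
        have "mdist C p v = mdist C v p" by (rule mdist_commute)
        then show ?thesis using \<open>q = None\<close> Some z' nu nn by (simp add: r mdist_Q)
      qed (use None nn in \<open>simp add: r mdist_Q\<close>)
    next
      case (Some z)
      obtain x u where z: "z = (x, u)" by (cases z)
      show ?thesis
      proof (cases q')
        case None
        then show ?thesis using Some z nu by (simp add: r mdist_Q nn)
      next
        case (Some z')
        obtain y v where z': "z' = (y, v)" by (cases z')
        consider "x = d" "y = d" | "x = d" "y \<noteq> d" | "x \<noteq> d" "y = d" | "x \<noteq> d" "y \<noteq> d" by blast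
        then show ?thesis
          using \<open>q = Some z\<close> Some z z' nu
            le[of "mdist C v p" "mdist C u p" "\<nu> y"] le[of "mdist C u p" "mdist C v p" "\<nu> x"]
            mdist_commute[of C p v]
          by cases (simp_all add: r mdist_Q nn add.commute)
      qed
    qed
  qed
  then have "continuous_map (mtopology_of Q) euclidean (\<lambda>q. p * coord d q)"
    by (simp add: mtopology_C continuous_map_in_subtopology)
  then have "continuous_map (mtopology_of Q) euclidean ((\<lambda>z. z / p) \<circ> (\<lambda>q. p * coord d q))"
  proof (rule continuous_map_compose)
    have "continuous_on UNIV (\<lambda>z. z / p)" using p_nz by (intro continuous_intros) auto
    then show "continuous_map euclidean euclidean (\<lambda>z. z / p)" by simp
  qed
  then show ?thesis using p_nz by (simp add: o_def)
qed

text \<open>The topology of \<open>Q(D)\<close> is that of coordinatewise convergence, although its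
  metric refers to all circles: away from the base point one coordinate decides, and only finitely
  many circles contain points at distance \<epsilon> or more from the base point.\<close>

lemma continuous_map_into_Q:
  assumes g: "\<And>t. t \<in> topspace T \<Longrightarrow> g t \<in> mspace Q"
    and c: "\<And>d. d \<in> D \<Longrightarrow> continuous_map T euclidean (\<lambda>t. coord d (g t))"
  shows "continuous_map T (mtopology_of Q) g"
  unfolding continuous_map_mtopology_of
proof (intro ballI conjI allI impI)
  fix t assume t: "t \<in> topspace T"
  show gt: "g t \<in> mspace Q" using g t by blast
  fix \<epsilon> :: real assume \<epsilon>: "0 < \<epsilon>"
  have pc: "continuous_map T (mtopology_of C) (\<lambda>t. p * coord d (g t))" if "d \<in> D" for d
  proof -
    have "continuous_on UNIV (\<lambda>z. p * z)" by (intro continuous_intros)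
    then have "continuous_map euclidean euclidean (\<lambda>z. p * z)" by simp
    from continuous_map_compose[OF c[OF that] this]
    have "continuous_map T euclidean (\<lambda>t. p * coord d (g t))" by (simp add: o_def)
    then show ?thesis
      unfolding mtopology_C continuous_map_in_subtopology using sphere_coord[OF g] by blast
  qed
  have sph: "p * coord d (g s) \<in> mspace C" if "s \<in> topspace T" for s d
    using sphere_coord[OF g[OF that]] by (simp add: mspace_C)
  show "\<exists>U. openin T U \<and> t \<in> U \<and> (\<forall>s\<in>U. g s \<in> mspace Q \<and> mdist Q (g t) (g s) < \<epsilon>)"
  proof (cases "g t")
    case None
    \<comment> \<open>As \<open>C\<close> has diameter less than 1, every circle of index above
      \<open>n\<close> lies within \<epsilon> of the base point.\<close>
    obtain n where n: "1 / \<epsilon> < real n"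
      using reals_Archimedean2 by blast
    define V where "V d = {s \<in> topspace T. mdist C p (p * coord d (g s)) < \<epsilon>}" for d
    define U where "U = (\<Inter>d\<in>level n. V d) \<inter> topspace T"
    have "openin T (V d)" if "d \<in> level n" for d
      using openin_mtopology_of_ball[OF pc p_in] that level_sub by (auto simp: V_def)
    then have "openin T U"
      unfolding U_def by (intro openin_INT finite_level)
    moreover have "t \<in> U"
      using t None \<epsilon> by (simp add: U_def V_def coord_def mdist_self[OF p_in])
    moreover have "mdist Q (g t) (g s) < \<epsilon>" if s: "s \<in> U" for s
    proof (cases "g s")
      case None
      then show ?thesis using \<open>g t = None\<close> \<epsilon> by (simp add: mdist_Q)
    next
      case (Some z)
      obtain d u where z: "z = (d, u)" by (cases z)
      have sT: "s \<in> topspace T" using s by (simp add: U_def)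
      then have du: "d \<in> D" "u \<in> sphere 0 1"
        using g[OF sT] Some z by (auto simp: mspace_Q)
      have co: "p * coord d (g s) = u" using Some z p_nz by (simp add: coord_def)
      have "mdist C u p / real (\<nu> d) < \<epsilon>"
      proof (cases "\<nu> d \<le> n")
        case True
        then have "s \<in> V d" using s du by (auto simp: U_def level_def)
        then have "mdist C u p < \<epsilon>" by (simp add: V_def co mdist_commute)
        moreover have "mdist C u p / real (\<nu> d) \<le> mdist C u p / 1"
          using index_ge_1[OF du(1)] by (intro divide_left_mono) auto
        ultimately show ?thesis by simp
      next
        case False
        have "mdist C u p / real (\<nu> d) \<le> 1 / real (\<nu> d)"
          using mdist_C_less_1[of u p] du p_in by (intro divide_right_mono) (auto simp: mspace_C)
        also have "\<dots> < \<epsilon>"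
        proof -
          have "1 / \<epsilon> < real (\<nu> d)" using n False by linarith
          then show ?thesis using \<epsilon> index_ge_1[OF du(1)] by (simp add: field_simps)
        qed
        finally show ?thesis .
      qed
      then show ?thesis using \<open>g t = None\<close> Some z by (simp add: mdist_Q)
    qed
    moreover have "g s \<in> mspace Q" if "s \<in> U" for s
      using g that by (simp add: U_def)
    ultimately show ?thesis by blast
  next
    case (Some z)
    obtain d u where z: "z = (d, u)" by (cases z)
    have du: "d \<in> D" "u \<in> sphere 0 1" "u \<noteq> p"
      using gt Some z by (auto simp: mspace_Q)
    have co: "p * coord d (g t) = u" using Some z p_nz by (simp add: coord_def)
    \<comment> \<open>The first bound compensates for the factor \<open>1 / \<nu> d\<close>; the
      second keeps \<open>coord d\<close> away from 1, so that the point stays in the circle of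
      \<open>d\<close>.\<close>
    define \<eta> where "\<eta> = min (\<epsilon> * real (\<nu> d)) (mdist C u p)"
    have \<eta>: "0 < \<eta>"
      using \<epsilon> index_ge_1[OF du(1)] mdist_pos[of u C p] du p_in by (simp add: \<eta>_def mspace_C)
    define U where "U = {s \<in> topspace T. mdist C u (p * coord d (g s)) < \<eta>}"
    have "openin T U"
      unfolding U_def using openin_mtopology_of_ball[OF pc[OF du(1)]] du(2) by (simp add: mspace_C)
    moreover have "t \<in> U" using t \<eta> mdist_self[of u C, unfolded mspace_C, OF du(2)] by (simp add: U_def co mspace_C)
    moreover have "mdist Q (g t) (g s) < \<epsilon>" if s: "s \<in> U" for s
    proof -
      have sT: "s \<in> topspace T" and s': "mdist C u (p * coord d (g s)) < \<eta>"
        using s by (auto simp: U_def)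
      have "coord d (g s) \<noteq> 1"
      proof
        assume "coord d (g s) = 1"
        then show False using s' by (simp add: \<eta>_def)
      qed
      then have gs: "g s = Some (d, p * coord d (g s))"
        using coord_neq_1_iff[OF g[OF sT]] by blast
      have "mdist Q (g t) (g s) = mdist C u (p * coord d (g s)) / real (\<nu> d)"
        by (subst gs) (simp add: Some z mdist_Q)
      also have "\<dots> < \<epsilon>"
        using s' index_ge_1[OF du(1)] by (simp add: \<eta>_def divide_less_eq)
      finally show ?thesis .
    qed
    moreover have "g s \<in> mspace Q" if "s \<in> U" for s
      using g that by (simp add: U_def)
    ultimately show ?thesis by blast
  qed
qed

section \<open>Maps between \<open>X\<close>, \<open>E(X, D)\<close> and \<open>Q(D)\<close>\<close>

lemma continuous_map_sigma: "continuous_map (mtopology_of E) (mtopology_of Q) \<sigma>"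
proof (rule continuous_map_Lipschitz[where B = 1])
  show "\<sigma> z \<in> mspace Q" if "z \<in> mspace E" for z
    using that by (auto simp: mspace_E mspace_Q quotient_map_sigma_def split: if_splits)
  fix a b assume "a \<in> mspace E" "b \<in> mspace E"
  moreover obtain x u y v where "a = (x, u)" "b = (y, v)" by (cases a; cases b)
  ultimately show "mdist Q (\<sigma> a) (\<sigma> b) \<le> 1 * mdist E a b"
    using mdist_self[OF p_in]
    by (auto simp: mdist_E mdist_Q mspace_E quotient_map_sigma_def fibre_dist_def mdist_commute)
qed

lemma continuous_map_fst_E: "continuous_map (mtopology_of E) (mtopology_of X) fst"
proof (rule continuous_map_Lipschitz[where B = 1])
  show "fst z \<in> mspace X" if "z \<in> mspace E" for z
    using that D_sub by (auto simp: mspace_E)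
  fix a b assume "a \<in> mspace E" "b \<in> mspace E"
  moreover obtain x u y v where "a = (x, u)" "b = (y, v)" by (cases a; cases b)
  ultimately show "mdist X (fst a) (fst b) \<le> 1 * mdist E a b"
    using D_sub by (auto simp: mdist_E mspace_E fibre_dist_def mdist_self)
qed

lemma mdist_E_base:
  assumes "x \<in> mspace X" "y \<in> mspace X"
  shows "mdist E (x, p) (y, p) = mdist X x y"
  using mdist_self[OF p_in] mdist_self[OF assms(1)] by (auto simp: mdist_E fibre_dist_def)

lemma continuous_map_base: "continuous_map (mtopology_of X) (mtopology_of E) (\<lambda>x. (x, p))"
  by (rule continuous_map_Lipschitz[where B = 1]) (auto simp: mdist_E_base mspace_E)

section \<open>\<open>Q(D)\<close> as a retract of the Hawaiian earring\<close>

definition earring_embed :: "('a \<times> complex) option \<Rightarrow> real \<times> real" where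
  "earring_embed q = (case q of None \<Rightarrow> (0, 0) | Some (x, u) \<Rightarrow>
     ((Re (u / p) - 1) / real (\<nu> x), Im (u / p) / real (\<nu> x)))"

text \<open>\<open>earring_embed\<close> sends the point with rotated coordinate \<open>w\<close> in
  the circle of \<open>d\<close> to (w - 1) / \<nu> d in the plane, which runs through circle number
  \<open>\<nu> d\<close>. The retraction inverts this and collapses the circles whose number is not
  the index of an element of \<open>D\<close>; so finite and infinite \<open>D\<close> are treated
  alike.\<close>

definition earring_retract :: "real \<times> real \<Rightarrow> ('a \<times> complex) option" where
  "earring_retract z = (case z of (a, b) \<Rightarrow>
     if \<exists>d\<in>D. (a, b) \<noteq> (0, 0) \<and> real (\<nu> d) * (a\<^sup>2 + b\<^sup>2) = - 2 * a
     then let d = (SOME d. d \<in> D \<and> real (\<nu> d) * (a\<^sup>2 + b\<^sup>2) = - 2 * a)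
       in Some (d, p * (1 + of_nat (\<nu> d) * Complex a b))
     else None)"

lemma earring_retract_Some:
  assumes d: "d \<in> D" and ab: "(a, b) \<noteq> (0, 0)" "real (\<nu> d) * (a\<^sup>2 + b\<^sup>2) = - 2 * a"
  shows "earring_retract (a, b) = Some (d, p * (1 + of_nat (\<nu> d) * Complex a b))"
proof -
  have pos: "a\<^sup>2 + b\<^sup>2 \<noteq> 0"
    using ab(1) by (simp add: sum_power2_eq_zero_iff del: not_sum_power2_lt_zero)
  have "d' = d" if "d' \<in> D" "real (\<nu> d') * (a\<^sup>2 + b\<^sup>2) = - 2 * a" for d'
  proof -
    have "real (\<nu> d') * (a\<^sup>2 + b\<^sup>2) = real (\<nu> d) * (a\<^sup>2 + b\<^sup>2)"
      using that(2) ab(2) by simp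
    then have "\<nu> d' = \<nu> d" using pos by auto
    then show ?thesis using inj_onD[OF inj_index _ that(1) d] by simp
  qed
  then have some: "(SOME d. d \<in> D \<and> real (\<nu> d) * (a\<^sup>2 + b\<^sup>2) = - 2 * a) = d"
    using d ab(2) by (intro some_equality) blast+
  have "\<exists>d\<in>D. (a, b) \<noteq> (0, 0) \<and> real (\<nu> d) * (a\<^sup>2 + b\<^sup>2) = - 2 * a"
    using assms by blast
  then show ?thesis
    unfolding earring_retract_def prod.case Let_def some by (rule if_P)
qed

lemma norm_earring_circle:
  assumes "real n * (a\<^sup>2 + b\<^sup>2) = - 2 * a"
  shows "cmod (1 + of_nat n * Complex a b) = 1"
proof -
  have "(cmod (1 + of_nat n * Complex a b))\<^sup>2 = (1 + real n * a)\<^sup>2 + (real n * b)\<^sup>2"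
    by (simp add: cmod_power2)
  also have "\<dots> = 1 + real n * (2 * a + real n * (a\<^sup>2 + b\<^sup>2))"
    by (simp add: power2_eq_square algebra_simps)
  also have "\<dots> = 1" using assms by simp
  finally show ?thesis by (simp add: power2_eq_1_iff) (smt (verit) norm_ge_zero)
qed

lemma earring_retract_in:
  "earring_retract z \<in> mspace Q"
proof -
  obtain a b where z: "z = (a, b)" by (cases z)
  show ?thesis
  proof (cases "\<exists>d\<in>D. (a, b) \<noteq> (0, 0) \<and> real (\<nu> d) * (a\<^sup>2 + b\<^sup>2) = - 2 * a")
    case True
    then obtain d where d: "d \<in> D" "(a, b) \<noteq> (0, 0)" "real (\<nu> d) * (a\<^sup>2 + b\<^sup>2) = - 2 * a" by blast
    have "cmod (p * (1 + of_nat (\<nu> d) * Complex a b)) = 1"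
      using norm_earring_circle[OF d(3)] norm_p by (simp add: norm_mult)
    moreover have "p * (1 + of_nat (\<nu> d) * Complex a b) \<noteq> p"
    proof -
      have "of_nat (\<nu> d) * Complex a b \<noteq> 0"
        using d(2) index_ge_1[OF d(1)] by (auto simp: Complex_eq_0)
      then show ?thesis using p_nz by (simp add: distrib_left)
    qed
    ultimately show ?thesis
      using d(1) by (simp add: z earring_retract_Some[OF d] mspace_Q image_iff)
  next
    case False
    then have "earring_retract z = None"
      unfolding earring_retract_def z by (simp only: prod.case if_False)
    then show ?thesis by (simp add: mspace_Q)
  qed
qed

lemma coord_earring_retract:
  "d \<in> D \<Longrightarrow> coord d (earring_retract (a, b)) =
    (if real (\<nu> d) * (a\<^sup>2 + b\<^sup>2) = - 2 * a then 1 + of_nat (\<nu> d) * Complex a b else 1)"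
proof (cases "\<exists>d\<in>D. (a, b) \<noteq> (0, 0) \<and> real (\<nu> d) * (a\<^sup>2 + b\<^sup>2) = - 2 * a")
  case True
  assume d: "d \<in> D"
  obtain d' where d': "d' \<in> D" "(a, b) \<noteq> (0, 0)" "real (\<nu> d') * (a\<^sup>2 + b\<^sup>2) = - 2 * a"
    using True by blast
  have "d = d'" if "real (\<nu> d) * (a\<^sup>2 + b\<^sup>2) = - 2 * a"
    using earring_retract_Some[OF d d'(2) that] earring_retract_Some[OF d'] by simp
  then show ?thesis
    using d' p_nz by (auto simp: earring_retract_Some[OF d'] coord_def)
next
  case False
  assume d: "d \<in> D"
  have "earring_retract (a, b) = None"
    unfolding earring_retract_def using False by (simp only: prod.case if_False)
  moreover have "Complex a b = 0" if "real (\<nu> d) * (a\<^sup>2 + b\<^sup>2) = - 2 * a"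
    using False d that by (auto simp: Complex_eq_0)
  ultimately show ?thesis by (simp add: coord_def)
qed

text \<open>Away from the origin the circle number \<open>m\<close> is continuous and integer valued
  on the earring, hence locally constant, and a coordinate is locally \<open>h\<close> or 1. At the
  origin the coordinate is always at least as close to 1 as \<open>h\<close>, which tends to 1
  there.\<close>

lemma continuous_map_earring_retract:
  "continuous_map (top_of_set hawaiian_earring) (mtopology_of Q) earring_retract"
proof (rule continuous_map_into_Q)
  fix d assume d: "d \<in> D"
  define m where "m = (\<lambda>z::real \<times> real. - 2 * fst z / ((fst z)\<^sup>2 + (snd z)\<^sup>2))"
  define h where "h = (\<lambda>z::real \<times> real. 1 + of_nat (\<nu> d) * Complex (fst z) (snd z))"
  have co: "coord d (earring_retract z) = (if real (\<nu> d) * ((fst z)\<^sup>2 + (snd z)\<^sup>2) = - 2 * fst z then h z else 1)" for z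
    using coord_earring_retract[OF d, of "fst z" "snd z"] by (simp add: h_def)
  have h: "continuous_on UNIV h"
    unfolding h_def Complex_eq by (intro continuous_intros)
  have h_lim: "(h \<longlongrightarrow> h z) (at z within S)" for z S
    by (rule tendsto_within_subset[of _ _ _ UNIV]) (use h in \<open>simp_all only: continuous_on_def UNIV_I subset_UNIV\<close>)
  have "continuous (at z within hawaiian_earring) (\<lambda>z. coord d (earring_retract z))"
    if z: "z \<in> hawaiian_earring" for z
  proof (cases "z = (0, 0)")
    case True
    have "((\<lambda>y. coord d (earring_retract y) - 1) \<longlongrightarrow> 0) (at z within hawaiian_earring)"
    proof (rule Lim_transform_bound)
      show "eventually (\<lambda>y. norm (coord d (earring_retract y) - 1) \<le> norm (h y - 1)) (at z within hawaiian_earring)"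
        by (rule eventuallyI) (simp add: co)
      have "h z = 1" using True by (simp add: h_def complex_eq_iff)
      moreover have "(h \<longlongrightarrow> h z) (at z within hawaiian_earring)"
        by (rule h_lim)
      ultimately show "((\<lambda>y. h y - 1) \<longlongrightarrow> 0) (at z within hawaiian_earring)"
        using LIM_zero[of h "h z"] by simp
    qed
    then have "((\<lambda>y. coord d (earring_retract y)) \<longlongrightarrow> 1) (at z within hawaiian_earring)"
      by (rule LIM_zero_cancel)
    moreover have "coord d (earring_retract z) = 1"
      using True by (simp add: co h_def complex_eq_iff)
    ultimately show ?thesis by (simp only: continuous_within)
  next
    case False
    have nz: "(fst z)\<^sup>2 + (snd z)\<^sup>2 \<noteq> 0"
      using False by (simp add: sum_power2_eq_zero_iff prod_eq_iff)
    have mz: "\<exists>k::nat. m y = real k" if y: "y \<in> hawaiian_earring" for y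
    proof (cases "(fst y)\<^sup>2 + (snd y)\<^sup>2 = 0")
      case True
      \<comment> \<open>At the origin the quotient \<open>m\<close> is 0 by the convention for
        division by zero.\<close>
      then show ?thesis by (intro exI[of _ 0]) (simp add: m_def)
    next
      case False
      obtain k :: nat where "real k * ((fst y)\<^sup>2 + (snd y)\<^sup>2) = - 2 * fst y"
        using y hawaiian_earring_iff[of "fst y" "snd y"] unfolding prod.collapse by blast
      then have "m y = real k"
        unfolding m_def using False by (metis nonzero_mult_div_cancel_right)
      then show ?thesis ..
    qed
    have "(m \<longlongrightarrow> m z) (at z within hawaiian_earring)"
      unfolding m_def using nz by (intro tendsto_intros)
    then have "eventually (\<lambda>y. dist (m y) (m z) < 1) (at z within hawaiian_earring)"
      by (rule tendstoD) simp
    moreover have "eventually (\<lambda>y. y \<in> hawaiian_earring) (at z within hawaiian_earring)"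
      by (simp add: eventually_at_filter)
    moreover have "eventually (\<lambda>y. (fst y)\<^sup>2 + (snd y)\<^sup>2 \<noteq> 0) (at z within hawaiian_earring)"
    proof (rule tendsto_imp_eventually_ne[OF _ nz])
      show "((\<lambda>y. (fst y)\<^sup>2 + (snd y)\<^sup>2) \<longlongrightarrow> (fst z)\<^sup>2 + (snd z)\<^sup>2) (at z within hawaiian_earring)"
        by (intro tendsto_intros)
    qed
    ultimately have ev: "eventually (\<lambda>y. coord d (earring_retract y) =
        (if real (\<nu> d) = m z then h y else 1)) (at z within hawaiian_earring)"
    proof eventually_elim
      case (elim y)
      obtain k l :: nat where "m y = real k" "m z = real l" using mz[OF elim(2)] mz[OF z] by blast
      then have "m y = m z" using elim by (simp add: dist_real_def)
      moreover have "real (\<nu> d) = m y \<longleftrightarrow> real (\<nu> d) * ((fst y)\<^sup>2 + (snd y)\<^sup>2) = - 2 * fst y"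
        unfolding m_def by (rule nonzero_eq_divide_eq[OF elim(3)])
      ultimately show ?case by (simp add: co)
    qed
    have eq: "coord d (earring_retract z) = (if real (\<nu> d) = m z then h z else 1)"
      unfolding m_def nonzero_eq_divide_eq[OF nz] by (rule co)
    have "((\<lambda>y. if real (\<nu> d) = m z then h y else 1) \<longlongrightarrow> (if real (\<nu> d) = m z then h z else 1))
        (at z within hawaiian_earring)"
      using h_lim by simp
    then show ?thesis
      unfolding continuous_within eq using ev by (simp add: tendsto_cong)
  qed
  then show "continuous_map (top_of_set hawaiian_earring) euclidean (\<lambda>z. coord d (earring_retract z))"
    by (simp add: continuous_on_eq_continuous_within)
qed (simp add: earring_retract_in)

lemma unit_circle_eq: "cmod w = 1 \<Longrightarrow> (Re w)\<^sup>2 + (Im w)\<^sup>2 = 1"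
  using cmod_power2[of w] by simp

lemma earring_embed_in: "q \<in> mspace Q \<Longrightarrow> earring_embed q \<in> hawaiian_earring"
proof (cases q)
  case None
  then show ?thesis by (auto simp: earring_embed_def hawaiian_earring_iff)
next
  case (Some z)
  obtain d u where z: "z = (d, u)" by (cases z)
  assume "q \<in> mspace Q"
  then have d: "d \<in> D" and u: "cmod (u / p) = 1"
    using Some z by (auto simp: mspace_Q norm_divide norm_p)
  have "real (\<nu> d) * (((Re (u / p) - 1) / real (\<nu> d))\<^sup>2 + (Im (u / p) / real (\<nu> d))\<^sup>2) =
      - 2 * ((Re (u / p) - 1) / real (\<nu> d))"
    using unit_circle_eq[OF u] index_ge_1[OF d] by (simp add: field_simps power2_eq_square)
  then show ?thesis
    using Some z index_ge_1[OF d] by (auto simp: earring_embed_def hawaiian_earring_iff)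
qed

lemma earring_retract_embed: "q \<in> mspace Q \<Longrightarrow> earring_retract (earring_embed q) = q"
proof (cases q)
  case None
  then show ?thesis by (auto simp: earring_embed_def earring_retract_def)
next
  case (Some z)
  obtain d u where z: "z = (d, u)" by (cases z)
  assume "q \<in> mspace Q"
  then have d: "d \<in> D" and u: "cmod (u / p) = 1" and up: "u / p \<noteq> 1"
    using Some z p_nz by (auto simp: mspace_Q norm_divide norm_p)
  let ?a = "(Re (u / p) - 1) / real (\<nu> d)" and ?b = "Im (u / p) / real (\<nu> d)"
  have e: "real (\<nu> d) * (?a\<^sup>2 + ?b\<^sup>2) = - 2 * ?a"
    using unit_circle_eq[OF u] index_ge_1[OF d] by (simp add: field_simps power2_eq_square)
  have nz: "(?a, ?b) \<noteq> (0, 0)"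
    using up index_ge_1[OF d] by (auto simp: complex_eq_iff)
  have "1 + of_nat (\<nu> d) * Complex ?a ?b = u / p"
    using index_ge_1[OF d] by (simp add: complex_eq_iff)
  then show ?thesis
    using earring_retract_Some[OF d nz e] Some z p_nz by (simp add: earring_embed_def)
qed

text \<open>No Lipschitz estimate is at hand, since the metric of \<open>C\<close> is tied to the
  Euclidean one only by its topology. Instead the embedding is the uniform limit of the sums
  \<open>S n\<close> over the first \<open>n\<close> circles: at most one summand is nonzero at any
  point, and a circle left out has Euclidean diameter at most 2 / (n + 1).\<close>

lemma continuous_map_earring_embed:
  "continuous_map (mtopology_of Q) (top_of_set hawaiian_earring) earring_embed"
proof -
  define e where "e = (\<lambda>d q. ((Re (coord d q) - 1) / real (\<nu> d), Im (coord d q) / real (\<nu> d)))"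
  have c: "continuous_map (mtopology_of Q) euclidean (e d)" if "d \<in> D" for d
  proof -
    have "continuous_on UNIV (\<lambda>z. ((Re z - 1) / real (\<nu> d), Im z / real (\<nu> d)))"
      using index_ge_1[OF that] by (intro continuous_intros) auto
    then show ?thesis
      using continuous_map_compose[OF continuous_map_coord[OF that],
          of euclidean "\<lambda>z. ((Re z - 1) / real (\<nu> d), Im z / real (\<nu> d))"]
      by (simp add: e_def o_def)
  qed
  define S where "S n q = (\<Sum>d\<in>level n. e d q)" for n q
  have S: "continuous_map (mtopology_of Q) euclidean (S n)" for n
    unfolding S_def using c level_sub by (intro continuous_map_sum finite_level) auto
  have S_eq: "S n q = (case q of None \<Rightarrow> 0 | Some (x, u) \<Rightarrow> if x \<in> level n then earring_embed q else 0)" for n q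
  proof -
    have "S n q = (\<Sum>d\<in>level n. case q of None \<Rightarrow> 0 | Some (x, u) \<Rightarrow> if d = x then earring_embed q else 0)"
      unfolding S_def
      by (rule sum.cong) (auto simp: e_def coord_def earring_embed_def zero_prod_def split: option.splits)
    also have "\<dots> = (case q of None \<Rightarrow> 0 | Some (x, u) \<Rightarrow> if x \<in> level n then earring_embed q else 0)"
      using finite_level[of n] by (auto split: option.splits simp: sum.delta)
    finally show ?thesis .
  qed
  have small: "dist (S n q) (earring_embed q) \<le> 2 / real (Suc n)" if q: "q \<in> mspace Q" for n q
  proof (cases "\<exists>x u. q = Some (x, u) \<and> x \<notin> level n")
    case True
    then obtain x u where xu: "q = Some (x, u)" "x \<notin> level n" by blast
    have x: "x \<in> D" and u: "cmod (u / p) = 1"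
      using q xu by (auto simp: mspace_Q norm_divide norm_p)
    have nx: "Suc n \<le> \<nu> x" using xu x by (auto simp: level_def)
    have "earring_embed q = (Re (u / p - 1) / real (\<nu> x), Im (u / p - 1) / real (\<nu> x))"
      by (simp add: xu earring_embed_def)
    then have "norm (earring_embed q) = cmod (u / p - 1) / real (\<nu> x)"
      by (simp add: norm_prod_def cmod_def power_divide real_sqrt_divide flip: add_divide_distrib)
    also have "\<dots> \<le> 2 / real (\<nu> x)"
      using norm_triangle_ineq4[of "u / p" 1] u by (intro divide_right_mono) auto
    also have "\<dots> \<le> 2 / real (Suc n)"
      using nx by (intro divide_left_mono) auto
    finally show ?thesis using xu by (simp add: S_eq dist_norm)
  next
    case False
    then have "S n q = earring_embed q"
      by (auto simp: S_eq earring_embed_def zero_prod_def split: option.splits)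
    then show ?thesis by simp
  qed
  have "continuous_map (mtopology_of Q) Met_TC.mtopology earring_embed"
  proof (rule Met_TC.continuous_map_uniform_limit)
    show "\<forall>\<^sub>F n in sequentially. continuous_map (mtopology_of Q) Met_TC.mtopology (S n)"
      using S by simp
    fix \<epsilon> :: real assume "0 < \<epsilon>"
    then have "\<forall>\<^sub>F n in sequentially. 2 / real (Suc n) < \<epsilon>"
      by (intro order_tendstoD(2)[of _ 0]) (rule LIMSEQ_Suc[OF lim_const_over_n], assumption)
    then show "\<forall>\<^sub>F n in sequentially. \<forall>q\<in>topspace (mtopology_of Q).
        earring_embed q \<in> UNIV \<and> dist (S n q) (earring_embed q) < \<epsilon>"
    proof eventually_elim
      case (elim n)
      then show ?case using small by (fastforce intro: le_less_trans)
    qed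
  qed simp
  then show ?thesis
    using earring_embed_in by (simp add: continuous_map_in_subtopology image_subset_iff)
qed

end

section \<open>Lifting along a local cocycle\<close>

text \<open>The discrete form of lifting a path to a covering: \<open>\<gamma>\<close> has the
  prescribed increments \<open>c s t\<close>, but only between times that are close.\<close>

definition local_lift :: "(real \<Rightarrow> real \<Rightarrow> 'g) \<Rightarrow> (real \<Rightarrow> 'g::group_add) \<Rightarrow> bool" where
  "local_lift c \<gamma> \<longleftrightarrow>
     (\<exists>\<delta>>0. \<forall>s\<in>{0..1}. \<forall>t\<in>{0..1}. \<bar>s - t\<bar> < \<delta> \<longrightarrow> \<gamma> t = \<gamma> s + c s t)"

definition local_cocycle :: "(real \<Rightarrow> real \<Rightarrow> 'g::group_add) \<Rightarrow> bool" where
  "local_cocycle c \<longleftrightarrow> (\<exists>\<delta>>0. \<forall>r\<in>{0..1}. \<forall>s\<in>{0..1}. \<forall>t\<in>{0..1}.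
     \<bar>r - s\<bar> < \<delta> \<longrightarrow> \<bar>s - t\<bar> < \<delta> \<longrightarrow> \<bar>r - t\<bar> < \<delta> \<longrightarrow> c r s + c s t = c r t)"

lemma locally_constant_01:
  fixes f :: "real \<Rightarrow> 'b"
  assumes "0 < \<delta>" "\<And>s t. s \<in> {0..1} \<Longrightarrow> t \<in> {0..1} \<Longrightarrow> \<bar>s - t\<bar> < \<delta> \<Longrightarrow> f s = f t" "t \<in> {0..1}"
  shows "f t = f 0"
proof -
  have "\<forall>t\<in>{0..1}. t \<le> real k * (\<delta> / 2) \<longrightarrow> f t = f 0" for k
  proof (induction k)
    case (Suc k)
    show ?case
    proof (intro ballI impI)
      fix t :: real assume t: "t \<in> {0..1}" "t \<le> real (Suc k) * (\<delta> / 2)"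
      define s where "s = max 0 (t - \<delta> / 2)"
      have "s \<in> {0..1}" "s \<le> real k * (\<delta> / 2)" "\<bar>s - t\<bar> < \<delta>"
        using t assms(1) by (auto simp: s_def algebra_simps max_def)
      then show "f t = f 0" using Suc assms(2)[of s t] t(1) by metis
    qed
  qed (auto intro: arg_cong[where f = f])
  moreover obtain k where "2 / \<delta> < real k" using reals_Archimedean2 by blast
  moreover have "t \<le> real k * (\<delta> / 2)"
    using \<open>2 / \<delta> < real k\<close> assms(1,3) by (auto simp: field_simps)
  ultimately show ?thesis using assms(3) by blast
qed

text \<open>Increments are added on the right, so they cancel in
  \<open>\<gamma>' t - \<gamma> t\<close> even in a non-commutative group, and this difference is
  locally constant.\<close>

lemma local_lift_unique:
  fixes \<gamma> \<gamma>' :: "real \<Rightarrow> 'g::group_add"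
  assumes "local_lift c \<gamma>" "local_lift c \<gamma>'" "t \<in> {0..1}"
  shows "\<gamma>' t - \<gamma> t = \<gamma>' 0 - \<gamma> 0"
proof -
  obtain \<delta> where \<delta>: "\<delta> > 0" "\<forall>s\<in>{0..1}. \<forall>t\<in>{0..1}. \<bar>s - t\<bar> < \<delta> \<longrightarrow> \<gamma> t = \<gamma> s + c s t"
    using assms(1) by (auto simp: local_lift_def)
  obtain \<delta>' where \<delta>': "\<delta>' > 0" "\<forall>s\<in>{0..1}. \<forall>t\<in>{0..1}. \<bar>s - t\<bar> < \<delta>' \<longrightarrow> \<gamma>' t = \<gamma>' s + c s t"
    using assms(2) by (auto simp: local_lift_def)
  show ?thesis
  proof (rule locally_constant_01[of "min \<delta> \<delta>'"])
    fix s t :: real assume st: "s \<in> {0..1}" "t \<in> {0..1}" "\<bar>s - t\<bar> < min \<delta> \<delta>'"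
    have "\<gamma> t = \<gamma> s + c s t" "\<gamma>' t = \<gamma>' s + c s t"
      using st \<delta>(2) \<delta>'(2) by auto
    then show "\<gamma>' s - \<gamma> s = \<gamma>' t - \<gamma> t"
      by (simp add: diff_conv_add_uminus add.assoc minus_add del: add_uminus_conv_diff)
  qed (use \<delta> \<delta>' assms(3) in auto)
qed

lemma add_idem_imp_0: "a + a = a \<Longrightarrow> a = (0::'g::group_add)"
  using add_left_cancel[of a a 0] by simp

text \<open>By the cocycle law \<open>c t t = 0\<close>, so the increment of a reversed interval is
  the negative of the original one and intervals run forwards suffice.\<close>

lemma local_lift_ordered:
  fixes \<gamma> :: "real \<Rightarrow> 'g::group_add"
  assumes "local_cocycle c" "0 < \<delta>"
    and "\<And>s t. s \<in> {0..1} \<Longrightarrow> t \<in> {0..1} \<Longrightarrow> s \<le> t \<Longrightarrow> t - s < \<delta> \<Longrightarrow> \<gamma> t = \<gamma> s + c s t"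
  shows "local_lift c \<gamma>"
proof -
  from assms(1) obtain \<delta>' where "0 < \<delta>'" and \<delta>'0: "\<forall>r\<in>{0..1}. \<forall>s\<in>{0..1}. \<forall>t\<in>{0..1}.
     \<bar>r - s\<bar> < \<delta>' \<longrightarrow> \<bar>s - t\<bar> < \<delta>' \<longrightarrow> \<bar>r - t\<bar> < \<delta>' \<longrightarrow> c r s + c s t = c r t"
    unfolding local_cocycle_def by (elim exE conjE)
  note \<delta>' = \<open>0 < \<delta>'\<close> \<delta>'0[rule_format]
  have law: "\<gamma> t = \<gamma> s + c s t" if st: "s \<in> {0..1}" "t \<in> {0..1}" "\<bar>s - t\<bar> < min \<delta> \<delta>'" for s t
  proof (cases "s \<le> t")
    case True
    then show ?thesis using assms(3)[of s t] st by simp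
  next
    case False
    then have 1: "\<gamma> s = \<gamma> t + c t s" using assms(3)[of t s] st by simp
    have ts: "\<bar>t - s\<bar> < \<delta>'" "\<bar>s - t\<bar> < \<delta>'" "\<bar>t - t\<bar> < \<delta>'"
      using st(3) \<delta>'(1) by linarith+
    have "c t t = 0"
      using add_idem_imp_0[OF \<delta>'(2)[OF st(2) st(2) st(2) ts(3) ts(3) ts(3)]] .
    then have "c t s + c s t = 0"
      using \<delta>'(2)[OF st(2) st(1) st(2) ts(1) ts(2) ts(3)] by simp
    then show ?thesis
      unfolding 1 add.assoc by simp
  qed
  show ?thesis
    unfolding local_lift_def
  proof (intro exI[of _ "min \<delta> \<delta>'"] conjI ballI impI)
    show "0 < min \<delta> \<delta>'" using assms(2) \<delta>'(1) by simp
  qed (rule law)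
qed

lemma local_lift_exists:
  fixes c :: "real \<Rightarrow> real \<Rightarrow> 'g::group_add"
  assumes c: "local_cocycle c"
  shows "\<exists>\<gamma>. \<gamma> 0 = 0 \<and> local_lift c \<gamma>"
proof -
  from c obtain \<delta> where "0 < \<delta>" and \<delta>0: "\<forall>r\<in>{0..1}. \<forall>s\<in>{0..1}. \<forall>t\<in>{0..1}.
     \<bar>r - s\<bar> < \<delta> \<longrightarrow> \<bar>s - t\<bar> < \<delta> \<longrightarrow> \<bar>r - t\<bar> < \<delta> \<longrightarrow> c r s + c s t = c r t"
    unfolding local_cocycle_def by (elim exE conjE)
  note \<delta> = \<open>0 < \<delta>\<close> \<delta>0[rule_format]
  \<comment> \<open>Two steps of the grid of mesh 1 / N are shorter than \<delta>, so points in
    neighbouring cells are close enough for the cocycle law.\<close>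
  obtain N :: nat where N: "2 / \<delta> < real N" using reals_Archimedean2 by blast
  have N0: "0 < real N" using N \<delta>(1) by (metis divide_pos_pos order_less_trans zero_less_numeral)
  have N2: "2 / real N < \<delta>" using N N0 \<delta>(1) by (simp add: field_simps)
  \<comment> \<open>The sum of the increments along the grid; \<open>\<gamma>\<close> continues it
    from the last grid point up to \<open>t\<close>.\<close>
  define g where "g = rec_nat 0 (\<lambda>j a. a + c (real j / real N) (real (Suc j) / real N))"
  have g: "g 0 = 0" "g (Suc j) = g j + c (real j / real N) (real (Suc j) / real N)" for j
    by (simp_all add: g_def)
  define k where "k t = nat \<lfloor>t * real N\<rfloor>" for t :: real
  define \<gamma> where "\<gamma> t = g (k t) + c (real (k t) / real N) t" for t
  have k: "real (k t) / real N \<le> t" "t < real (k t) / real N + 1 / real N" if "0 \<le> t" for t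
  proof -
    have "0 \<le> t * real N" using that N0 by simp
    then have "real (k t) \<le> t * real N" "t * real N < real (k t) + 1"
      unfolding k_def by linarith+
    then show "real (k t) / real N \<le> t" "t < real (k t) / real N + 1 / real N"
      using N0 by (simp_all add: field_simps)
  qed
  have "local_lift c \<gamma>"
  proof (rule local_lift_ordered[OF c, of "1 / real N"])
    show "0 < 1 / real N" using N0 by simp
    fix s t :: real assume s: "s \<in> {0..1}" and t: "t \<in> {0..1}" and st: "s \<le> t" "t - s < 1 / real N"
    note ks = k[of s] and kt = k[of t]
    have b: "real (k s) / real N \<in> {0..1}" "real (k t) / real N \<in> {0..1}"
      using ks kt s t by (auto intro: order_trans)
    have half: "1 / real N + 1 / real N = 2 / real N" by simp
    have 1: "c (real (k s) / real N) s + c s t = c (real (k s) / real N) t"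
      using ks kt s t st b N2 half by (intro \<delta>(2)) auto
    have "k s \<le> k t" using st N0 unfolding k_def by (intro nat_mono floor_mono mult_right_mono) auto
    moreover have "k t \<le> Suc (k s)"
    proof -
      have "t * real N < s * real N + 1" using st N0 by (simp add: field_simps)
      then show ?thesis unfolding k_def by linarith
    qed
    ultimately consider "k t = k s" | "k t = Suc (k s)" by linarith
    then show "\<gamma> t = \<gamma> s + c s t"
    proof cases
      case 1
      then show ?thesis using \<open>c (real (k s) / real N) s + c s t = _\<close>
        by (simp add: \<gamma>_def add.assoc)
    next
      case 2
      have e: "real (Suc (k s)) / real N = real (k s) / real N + 1 / real N"
        by (simp add: add_divide_distrib)
      have "c (real (k s) / real N) (real (k t) / real N) + c (real (k t) / real N) t = c (real (k s) / real N) t"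
        using ks kt s t st b N2 half by (intro \<delta>(2)) (auto simp: 2 e)
      then show ?thesis using 1 by (simp add: \<gamma>_def 2 g add.assoc)
    qed
  qed
  moreover have "\<gamma> 0 = 0"
    using \<delta>(2)[of 0 0 0] \<delta>(1) add_idem_imp_0[of "c 0 0"] by (simp add: \<gamma>_def k_def g)
  ultimately show ?thesis by blast
qed

section \<open>The winding of a loop in \<open>Q(D)\<close>\<close>

text \<open>Meant for points that are close. The circle is cut at -1: passing from the upper to the
  lower half there, that is counterclockwise, spells \<open>d\<close>, passing back spells its
  inverse, and passing through the base point 1 spells nothing, since then the real parts are not
  negative. The cut point counts as upper.\<close>

definition crossing :: "'a \<Rightarrow> complex \<Rightarrow> complex \<Rightarrow> 'a free_group" where
  "crossing d w w' =
    (if Re w < 0 \<and> Re w' < 0 then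
       if 0 \<le> Im w \<and> Im w' < 0 then word_val [(d, True)]
       else if Im w < 0 \<and> 0 \<le> Im w' then word_val [(d, False)] else 0
     else 0)"

text \<open>A unit vector with real part between -1/2 and 0 has an imaginary part of modulus above
  1/2, so a move by less than 1/2 cannot change its sign. This is the origin of the constant 1/2 in
  \<open>near\<close>.\<close>

lemma same_side:
  assumes "cmod v = 1" "- 1 / 2 < Re v" "cmod (v - w) < 1 / 2" "Re v < 0"
  shows "0 \<le> Im v \<longleftrightarrow> 0 \<le> Im w"
proof -
  have "(Re v)\<^sup>2 + (Im v)\<^sup>2 = 1" using cmod_power2[of v] assms(1) by simp
  moreover have "(Re v)\<^sup>2 < 1 / 4"
    using abs_square_less_1[of "2 * Re v"] assms(2,4) by (simp add: power_mult_distrib)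
  ultimately have "1 / 4 < (Im v)\<^sup>2" by linarith
  then have "(1 / 2)\<^sup>2 < \<bar>Im v\<bar>\<^sup>2" by (simp add: power2_eq_square)
  then have "1 / 2 < \<bar>Im v\<bar>" by (rule power2_less_imp_less) simp
  moreover have "\<bar>Im v - Im w\<bar> < 1 / 2"
    using abs_Im_le_cmod[of "v - w"] assms(3) by simp
  ultimately show ?thesis by linarith
qed

text \<open>If a point near \<open>v\<close> lies in the right half plane, then \<open>v\<close> is
  too far from the cut for a short move to cross it.\<close>

lemma crossing_zero:
  assumes "0 \<le> Re u" "cmod (u - v) < 1 / 2" "cmod (v - w) < 1 / 2" "cmod v = 1"
  shows "crossing d v w = 0"
proof (cases "Re v < 0")
  case True
  have "\<bar>Re u - Re v\<bar> < 1 / 2"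
    using abs_Re_le_cmod[of "u - v"] assms(2) by simp
  then have "- 1 / 2 < Re v" using assms(1) by linarith
  from same_side[OF assms(4) this assms(3) True] show ?thesis by (auto simp: crossing_def)
qed (simp add: crossing_def)

lemma crossing_cocycle:
  assumes "cmod u = 1" "cmod v = 1" "cmod w = 1"
    and "cmod (u - v) < 1 / 2" "cmod (v - w) < 1 / 2" "cmod (u - w) < 1 / 2"
  shows "crossing d u v + crossing d v w = crossing d u w"
proof -
  have sym: "cmod (v - u) < 1 / 2" "cmod (w - v) < 1 / 2" "cmod (w - u) < 1 / 2"
    using assms by (simp_all add: norm_minus_commute)
  have i: "word_val [(d, False)] = - word_val [(d, True)]"
    using word_val_inv_letter[of "(d, True)"] by (simp add: inv_letter_def)
  show ?thesis
  proof (cases "Re u < 0 \<and> Re v < 0 \<and> Re w < 0")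
    case True
    then show ?thesis by (auto simp: crossing_def i)
  next
    case False
    then consider "0 \<le> Re u" | "0 \<le> Re v" | "0 \<le> Re w" by linarith
    then show ?thesis
    proof cases
      case 1
      then show ?thesis
        using crossing_zero[of u v w d] assms by (simp add: crossing_def)
    next
      case 2
      then show ?thesis
        using crossing_zero[of v u w d] assms sym by (simp add: crossing_def)
    next
      case 3
      then show ?thesis
        using crossing_zero[of w u v d] assms sym by (simp add: crossing_def)
    qed
  qed
qed

context earring
begin

text \<open>The circle is read off from \<open>q\<close> alone. If \<open>q'\<close> lies in another
  circle, its coordinate in the circle of \<open>q\<close> is 1 and the crossing vanishes.\<close>

definition step :: "nat \<Rightarrow> ('a \<times> complex) option \<Rightarrow> ('a \<times> complex) option \<Rightarrow> 'a free_group" where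
  "step n q q' = (case q of None \<Rightarrow> 0 | Some (d, u) \<Rightarrow>
     if d \<in> level n then crossing d (coord d q) (coord d q') else 0)"

definition near :: "nat \<Rightarrow> ('a \<times> complex) option \<Rightarrow> ('a \<times> complex) option \<Rightarrow> bool" where
  "near n q q' \<longleftrightarrow> (\<forall>d\<in>level n. cmod (coord d q - coord d q') < 1 / 2)"

lemma near_sym: "near n q q' \<Longrightarrow> near n q' q"
  by (simp add: near_def norm_minus_commute)

lemma near_refl [simp]: "near n q q"
  by (simp add: near_def)

lemma step_None [simp]: "step n None q = 0"
  by (simp add: step_def)

lemma crossing_1 [simp]: "crossing d 1 w = 0" "crossing d w 1 = 0"
  by (simp_all add: crossing_def)

text \<open>Nearby points can be treated as if they lay in one circle \<open>d\<close>: if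
  \<open>q\<close> is in a different circle \<open>x\<close>, then \<open>coord x r = 1\<close>, so
  \<open>q\<close> is far from the cut of \<open>x\<close> and its step is 0, like the crossing in
  \<open>d\<close> that starts from 1. This reduces the cocycle law for steps to that for
  crossings.\<close>

lemma step_crossing:
  assumes q: "q \<in> mspace Q" "q' \<in> mspace Q" and d: "d \<in> level n" "coord d r \<noteq> 1"
    and near: "near n r q" "near n q q'"
  shows "step n q q' = crossing d (coord d q) (coord d q')"
proof (cases "coord d q = 1")
  case True
  show ?thesis
  proof (cases q)
    case (Some z)
    obtain x u where z: "z = (x, u)" by (cases z)
    have "x \<noteq> d" using True Some z q(1) p_nz by (auto simp: coord_def mspace_Q)
    then have "coord x r = 1" using coord_other[OF d(2)] by blast
    have "crossing x (coord x q) (coord x q') = 0" if "x \<in> level n"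
    proof (rule crossing_zero[of "coord x r"])
      show "0 \<le> Re (coord x r)" by (simp add: \<open>coord x r = 1\<close>)
    qed (use near that norm_coord[OF q(1)] in \<open>auto simp: near_def\<close>)
    then show ?thesis using Some z True by (simp add: step_def)
  qed (simp add: coord_def)
next
  case False
  then have "q = Some (d, p * coord d q)" using coord_neq_1_iff[OF q(1)] by blast
  then obtain u where "q = Some (d, u)" by blast
  then show ?thesis using d(1) by (simp add: step_def)
qed

lemma step_zero:
  assumes "q \<in> mspace Q" "\<And>d. d \<in> level n \<Longrightarrow> coord d q = 1"
  shows "step n q q' = 0"
  using assms by (auto simp: step_def split: option.split)

lemma step_cocycle:
  assumes q: "q \<in> mspace Q" "q' \<in> mspace Q" "q'' \<in> mspace Q"
    and near: "near n q q'" "near n q' q''" "near n q q''"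
  shows "step n q q' + step n q' q'' = step n q q''"
proof (cases "\<exists>d\<in>level n. \<exists>r\<in>{q, q', q''}. coord d r \<noteq> 1")
  case True
  then obtain d r where d: "d \<in> level n" "coord d r \<noteq> 1" and r: "r \<in> {q, q', q''}" by blast
  have nr: "near n r q" "near n r q'"
    using r near near_sym by auto
  note s = step_crossing[OF _ _ d]
  have "crossing d (coord d q) (coord d q') + crossing d (coord d q') (coord d q'') =
      crossing d (coord d q) (coord d q'')"
    by (rule crossing_cocycle) (use q near d(1) norm_coord in \<open>auto simp: near_def\<close>)
  then show ?thesis
    using s[of q q'] s[of q' q''] s[of q q''] q near nr by simp
next
  case False
  then show ?thesis using step_zero[OF q(1)] step_zero[OF q(2)] by simp
qed

lemma uniformly_near:
  fixes g :: "'b::metric_space \<Rightarrow> ('a \<times> complex) option"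
  assumes S: "compact S" and g: "continuous_map (top_of_set S) (mtopology_of Q) g" and \<epsilon>: "0 < \<epsilon>"
  shows "\<exists>\<delta>>0. \<forall>x\<in>S. \<forall>y\<in>S. dist x y < \<delta> \<longrightarrow> (\<forall>d\<in>level n. cmod (coord d (g x) - coord d (g y)) < \<epsilon>)"
proof -
  have "\<exists>\<delta>>0. \<forall>x\<in>S. \<forall>y\<in>S. dist x y < \<delta> \<longrightarrow> cmod (coord d (g x) - coord d (g y)) < \<epsilon>"
    if "d \<in> level n" for d
  proof -
    have "d \<in> D" using that level_sub by blast
    from continuous_map_compose[OF g continuous_map_coord[OF this]]
    have "continuous_on S (\<lambda>x. coord d (g x))" by (simp add: o_def)
    then have "uniformly_continuous_on S (\<lambda>x. coord d (g x))"
      using S by (rule compact_uniformly_continuous)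
    from uniformly_continuous_onE[OF this \<epsilon>] obtain \<delta> where "\<delta> > 0"
      "\<And>x y. x \<in> S \<Longrightarrow> y \<in> S \<Longrightarrow> dist y x < \<delta> \<Longrightarrow> dist (coord d (g y)) (coord d (g x)) < \<epsilon>"
      by blast
    then show ?thesis by (intro exI[of _ \<delta>]) (auto simp: dist_norm)
  qed
  then obtain \<delta> where \<delta>: "\<And>d. d \<in> level n \<Longrightarrow> 0 < \<delta> d"
    "\<And>d x y. d \<in> level n \<Longrightarrow> x \<in> S \<Longrightarrow> y \<in> S \<Longrightarrow> dist x y < \<delta> d \<Longrightarrow> cmod (coord d (g x) - coord d (g y)) < \<epsilon>"
    by metis
  define m where "m = Min (insert 1 (\<delta> ` level n))"
  have "0 < m" using finite_level[of n] \<delta>(1) by (simp add: m_def)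
  moreover have "m \<le> \<delta> d" if "d \<in> level n" for d
    using finite_level[of n] that by (auto simp: m_def)
  ultimately show ?thesis
    using \<delta>(2) by (intro exI[of _ m]) (meson less_le_trans)
qed

lemma path_in_Q: "pathin (mtopology_of Q) f \<Longrightarrow> t \<in> {0..1} \<Longrightarrow> f t \<in> mspace Q"
  using continuous_map_image_subset_topspace[of "top_of_set {0..1}" "mtopology_of Q" f]
  by (auto simp: pathin_def image_subset_iff)

lemma path_near:
  assumes "pathin (mtopology_of Q) f"
  shows "\<exists>\<delta>>0. \<forall>s\<in>{0..1}. \<forall>t\<in>{0..1}. \<bar>s - t\<bar> < \<delta> \<longrightarrow> near n (f s) (f t)"
  using uniformly_near[of "{0..1::real}" f "1/2" n] assms
  by (simp add: pathin_def near_def dist_real_def)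

lemma path_local_cocycle:
  assumes f: "pathin (mtopology_of Q) f"
  shows "local_cocycle (\<lambda>s t. step n (f s) (f t))"
proof -
  obtain \<delta> where "\<delta> > 0" "\<forall>s\<in>{0..1}. \<forall>t\<in>{0..1}. \<bar>s - t\<bar> < \<delta> \<longrightarrow> near n (f s) (f t)"
    using path_near[OF f] by blast
  then show ?thesis
    unfolding local_cocycle_def using path_in_Q[OF f]
    by (intro exI[of _ \<delta>]) (simp add: step_cocycle)
qed

section \<open>Windings of paths, their homotopy invariance and additivity\<close>

definition winding :: "nat \<Rightarrow> (real \<Rightarrow> ('a \<times> complex) option) \<Rightarrow> real \<Rightarrow> 'a free_group" where
  "winding n f = (SOME \<gamma>. \<gamma> 0 = 0 \<and> local_lift (\<lambda>s t. step n (f s) (f t)) \<gamma>)"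

lemma winding:
  assumes "pathin (mtopology_of Q) f"
  shows "winding n f 0 = 0" "local_lift (\<lambda>s t. step n (f s) (f t)) (winding n f)"
  using someI_ex[OF local_lift_exists[OF path_local_cocycle[OF assms, of n]]]
  by (simp_all add: winding_def)

lemma winding_unique:
  assumes "pathin (mtopology_of Q) f" "local_lift (\<lambda>s t. step n (f s) (f t)) \<gamma>" "t \<in> {0..1}"
  shows "\<gamma> t = \<gamma> 0 + winding n f t"
proof -
  have "\<gamma> t - winding n f t = \<gamma> 0"
    using local_lift_unique[OF winding(2)[OF assms(1)] assms(2,3)] winding(1)[OF assms(1)] by simp
  then show ?thesis by (simp add: diff_eq_eq)
qed

text \<open>Adding the step across turns a lift along one row of the homotopy into a lift along a
  nearby row, by the cocycle law on small rectangles. All rows begin and end in the base point,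
  where this correction is 0; so the final winding is locally constant in the homotopy
  parameter.\<close>

lemma winding_homotopic:
  assumes "loop_homotopic (mtopology_of Q) None f g"
  shows "winding n f 1 = winding n g 1"
proof -
  obtain h where h: "continuous_map (top_of_set unit_square) (mtopology_of Q) h"
    "\<And>t. h (0, t) = f t" "\<And>t. h (1, t) = g t"
    "\<And>s. s \<in> {0..1} \<Longrightarrow> h (s, 0) = None" "\<And>s. s \<in> {0..1} \<Longrightarrow> h (s, 1) = None"
    using loop_homotopicE[OF assms] by metis
  have "compact unit_square" by (intro compact_Times compact_Icc)
  from uniformly_near[where \<epsilon> = "1/2" and n = n, OF this h(1)] have "\<exists>\<delta>>0. \<forall>x\<in>unit_square.
      \<forall>y\<in>unit_square. dist x y < \<delta> \<longrightarrow> (\<forall>d\<in>level n. cmod (coord d (h x) - coord d (h y)) < 1/2)"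
    by simp
  then obtain \<delta> where "0 < \<delta>"
    and \<delta>0: "\<forall>x\<in>unit_square. \<forall>y\<in>unit_square. dist x y < \<delta> \<longrightarrow>
      (\<forall>d\<in>level n. cmod (coord d (h x) - coord d (h y)) < 1/2)"
    by (elim exE conjE)
  note \<delta> = \<open>0 < \<delta>\<close> \<delta>0[folded near_def, rule_format]
  have path: "pathin (mtopology_of Q) (\<lambda>t. h (s, t))" if "s \<in> {0..1}" for s
    unfolding pathin_def
    by (rule continuous_map_compose_on[OF h(1)]) (use that in \<open>auto intro!: continuous_intros\<close>)
  have inQ: "h (s, t) \<in> mspace Q" if "s \<in> {0..1}" "t \<in> {0..1}" for s t
    using path_in_Q[OF path[OF that(1)] that(2)] .
  have near: "near n (h (s, t)) (h (s', t'))"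
    if "s \<in> {0..1}" "t \<in> {0..1}" "s' \<in> {0..1}" "t' \<in> {0..1}" "\<bar>s - s'\<bar> < \<delta> / 2" "\<bar>t - t'\<bar> < \<delta> / 2" for s t s' t'
  proof (rule \<delta>(2))
    have "dist (s, t) (s', t') \<le> \<bar>s - s'\<bar> + \<bar>t - t'\<bar>"
      using sqrt_sum_squares_le_sum_abs[of "dist s s'" "dist t t'"]
      by (simp add: dist_Pair_Pair dist_real_def)
    then show "dist (s, t) (s', t') < \<delta>" using that by linarith
  qed (use that in auto)
  have law: "winding n (\<lambda>t. h (s, t)) 1 = winding n (\<lambda>t. h (s', t)) 1"
    if s: "s \<in> {0..1}" and s': "s' \<in> {0..1}" and ss': "\<bar>s - s'\<bar> < \<delta> / 2" for s s'
  proof -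
    define \<gamma> where "\<gamma> t = winding n (\<lambda>t. h (s, t)) t + step n (h (s, t)) (h (s', t))" for t
    obtain \<delta>' where "0 < \<delta>'" and \<delta>'0: "\<forall>t\<in>{0..1}. \<forall>t'\<in>{0..1}. \<bar>t - t'\<bar> < \<delta>' \<longrightarrow>
        winding n (\<lambda>t. h (s, t)) t' = winding n (\<lambda>t. h (s, t)) t + step n (h (s, t)) (h (s, t'))"
      using winding(2)[OF path[OF s], of n] unfolding local_lift_def by (elim exE conjE)
    note \<delta>' = \<open>0 < \<delta>'\<close> \<delta>'0[rule_format]
    have "local_lift (\<lambda>t t'. step n (h (s', t)) (h (s', t'))) \<gamma>"
      unfolding local_lift_def
    proof (intro exI[of _ "min (\<delta> / 2) \<delta>'"] conjI ballI impI)
      fix t t' :: real assume t: "t \<in> {0..1}" and t': "t' \<in> {0..1}" and "\<bar>t - t'\<bar> < min (\<delta> / 2) \<delta>'"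
      then have tt': "\<bar>t - t'\<bar> < \<delta> / 2" "\<bar>t - t'\<bar> < \<delta>'" by auto
      have z: "\<bar>s - s\<bar> < \<delta> / 2" "\<bar>s' - s'\<bar> < \<delta> / 2" "\<bar>t - t\<bar> < \<delta> / 2" "\<bar>t' - t'\<bar> < \<delta> / 2" using \<delta>(1) by auto
      have 1: "step n (h (s, t)) (h (s, t')) + step n (h (s, t')) (h (s', t')) = step n (h (s, t)) (h (s', t'))"
        by (intro step_cocycle inQ near s s' t t' z ss' tt')
      have 2: "step n (h (s, t)) (h (s', t)) + step n (h (s', t)) (h (s', t')) = step n (h (s, t)) (h (s', t'))"
        by (intro step_cocycle inQ near s s' t t' z ss' tt')
      show "\<gamma> t' = \<gamma> t + step n (h (s', t)) (h (s', t'))"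
        unfolding \<gamma>_def \<delta>'(2)[OF t t' tt'(2)] add.assoc 1 2 ..
    qed (use \<delta> \<delta>' in auto)
    from winding_unique[OF path[OF s'] this, of 1]
    have "\<gamma> 1 = \<gamma> 0 + winding n (\<lambda>t. h (s', t)) 1" by simp
    then show ?thesis
      using winding(1)[OF path[OF s]] h(4,5)[OF s] by (simp add: \<gamma>_def)
  qed
  have "winding n (\<lambda>t. h (1, t)) 1 = winding n (\<lambda>t. h (0, t)) 1"
  proof (rule locally_constant_01[of "\<delta> / 2" "\<lambda>s. winding n (\<lambda>t. h (s, t)) 1" 1])
    show "0 < \<delta> / 2" using \<delta>(1) by simp
  qed (rule law, auto)
  then show ?thesis by (simp add: h(2,3))
qed

text \<open>The lifts of \<open>f\<close> and \<open>g\<close> are glued at time 1/2. The law for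
  the glued lift is new only across the junction, where the path is in the base point and steps
  starting there are 0.\<close>

lemma winding_concat:
  assumes f: "f \<in> loops (mtopology_of Q) None" and g: "g \<in> loops (mtopology_of Q) None"
  shows "winding n (loop_concat f g) 1 = winding n f 1 + winding n g 1"
proof -
  let ?k = "loop_concat f g"
  have pf: "pathin (mtopology_of Q) f" "f 0 = None" "f 1 = None"
    and pg: "pathin (mtopology_of Q) g" "g 0 = None" "g 1 = None"
    and pk: "pathin (mtopology_of Q) ?k"
    using f g loop_concat_loops[OF f g] by (auto simp: loops_def)
  obtain \<delta>1 where "0 < \<delta>1" and \<delta>10: "\<forall>s\<in>{0..1}. \<forall>t\<in>{0..1}. \<bar>s - t\<bar> < \<delta>1 \<longrightarrow>
        winding n f t = winding n f s + step n (f s) (f t)"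
      using winding(2)[OF pf(1), of n] unfolding local_lift_def by (elim exE conjE)
    note \<delta>1 = \<open>0 < \<delta>1\<close> \<delta>10[rule_format]
  obtain \<delta>2 where "0 < \<delta>2" and \<delta>20: "\<forall>s\<in>{0..1}. \<forall>t\<in>{0..1}. \<bar>s - t\<bar> < \<delta>2 \<longrightarrow>
        winding n g t = winding n g s + step n (g s) (g t)"
      using winding(2)[OF pg(1), of n] unfolding local_lift_def by (elim exE conjE)
    note \<delta>2 = \<open>0 < \<delta>2\<close> \<delta>20[rule_format]
  obtain \<delta>3 where "0 < \<delta>3" and \<delta>30: "\<forall>s\<in>{0..1}. \<forall>t\<in>{0..1}. \<bar>s - t\<bar> < \<delta>3 \<longrightarrow> near n (?k s) (?k t)"
    using path_near[OF pk, of n] by (elim exE conjE)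
  note \<delta>3 = \<open>0 < \<delta>3\<close> \<delta>30[rule_format]
  define \<gamma> where "\<gamma> t = (if t \<le> 1/2 then winding n f (2 * t) else winding n f 1 + winding n g (2 * t - 1))" for t
  have "local_lift (\<lambda>s t. step n (?k s) (?k t)) \<gamma>"
  proof (rule local_lift_ordered[OF path_local_cocycle[OF pk], of "min (min (\<delta>1/2) (\<delta>2/2)) \<delta>3"])
    show "0 < min (min (\<delta>1/2) (\<delta>2/2)) \<delta>3" using \<delta>1 \<delta>2 \<delta>3 by simp
    fix s t :: real assume st: "s \<in> {0..1}" "t \<in> {0..1}" "s \<le> t" "t - s < min (min (\<delta>1/2) (\<delta>2/2)) \<delta>3"
    consider "t \<le> 1/2" | "1/2 < s" | "s \<le> 1/2" "1/2 < t" using st by linarith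
    then show "\<gamma> t = \<gamma> s + step n (?k s) (?k t)"
    proof cases
      case 1
      then show ?thesis using st \<delta>1(2)[of "2 * s" "2 * t"] by (simp add: \<gamma>_def loop_concat_def)
    next
      case 2
      then show ?thesis using st \<delta>2(2)[of "2 * s - 1" "2 * t - 1"]
        by (simp add: \<gamma>_def loop_concat_def add.assoc)
    next
      case 3
      have km: "?k (1/2) = None" by (simp add: loop_concat_def pf)
      have "step n (?k s) (?k (1/2)) + step n (?k (1/2)) (?k t) = step n (?k s) (?k t)"
        using st 3 by (intro step_cocycle path_in_Q[OF pk] \<delta>3(2)) auto
      then have c: "step n (f (2 * s)) None = step n (?k s) (?k t)"
        unfolding km using 3 by (simp add: loop_concat_def)
      have "winding n f 1 = winding n f (2 * s) + step n (f (2 * s)) None"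
        using \<delta>1(2)[of "2 * s" 1] st 3 pf(3) by simp
      moreover have "winding n g (2 * t - 1) = 0"
        using \<delta>2(2)[of 0 "2 * t - 1"] st 3 pg(2) winding(1)[OF pg(1)] by simp
      ultimately show ?thesis using 3 c by (simp add: \<gamma>_def)
    qed
  qed
  from winding_unique[OF pk this, of 1] show ?thesis
    using winding(1)[OF pf(1)] by (simp add: \<gamma>_def)
qed

end

section \<open>The word of a loop\<close>

lemma sorted_list_of_set_union:
  fixes A B :: "'b::linorder set"
  assumes "finite A" "finite B" "\<And>a b. a \<in> A \<Longrightarrow> b \<in> B \<Longrightarrow> a < b"
  shows "sorted_list_of_set (A \<union> B) = sorted_list_of_set A @ sorted_list_of_set B"
proof (rule sorted_distinct_set_unique)
  show "sorted (sorted_list_of_set A @ sorted_list_of_set B)"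
    using assms by (auto simp: sorted_append intro: less_imp_le)
  show "distinct (sorted_list_of_set A @ sorted_list_of_set B)"
    using assms by (fastforce simp: distinct_append disjoint_iff)
qed (use assms in auto)

lemma finite_reals_separated:
  fixes A :: "real set"
  assumes "finite A"
  shows "\<exists>\<delta>>0. \<forall>x\<in>A. \<forall>y\<in>A. \<bar>x - y\<bar> < \<delta> \<longrightarrow> x = y"
proof -
  define B where "B = (\<lambda>(x, y). \<bar>x - y\<bar>) ` {(x, y) \<in> A \<times> A. x \<noteq> y}"
  have fin: "finite B"
    unfolding B_def by (rule finite_imageI, rule finite_subset[of _ "A \<times> A"]) (use assms in auto)
  have pos: "b > 0" if "b \<in> B" for b
    using that by (auto simp: B_def)
  show ?thesis
  proof (intro exI[of _ "Min (insert 1 B)"] conjI ballI impI)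
    show "0 < Min (insert 1 B)" using fin pos by simp
    fix x y assume "x \<in> A" "y \<in> A" "\<bar>x - y\<bar> < Min (insert 1 B)"
    moreover have "Min (insert 1 B) \<le> \<bar>x - y\<bar>" if "x \<noteq> y"
      using fin that \<open>x \<in> A\<close> \<open>y \<in> A\<close> by (intro Min_le) (auto simp: B_def)
    ultimately show "x = y" by linarith
  qed
qed

context earring
begin

lemma step_restrict:
  assumes "n \<le> m"
  shows "step n q q' = free_group_restrict (level n) (step m q q')"
proof -
  have "free_group_restrict (level n) (crossing d u v) = (if d \<in> level n then crossing d u v else 0)" for d u v
    by (simp add: crossing_def free_group_restrict_letter)
  moreover have "level n \<subseteq> level m" using assms by (auto simp: level_def)
  ultimately show ?thesis
    by (auto simp: step_def split: option.split)
qed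

text \<open>Deleting letters is a homomorphism that takes steps of level \<open>m\<close> to steps
  of level \<open>n\<close>, hence lifts to lifts; uniqueness of lifts does the rest.\<close>

lemma winding_restrict:
  assumes f: "pathin (mtopology_of Q) f" and "n \<le> m" "t \<in> {0..1}"
  shows "winding n f t = free_group_restrict (level n) (winding m f t)"
proof -
  let ?g = "\<lambda>t. free_group_restrict (level n) (winding m f t)"
  obtain \<delta> where \<delta>: "0 < \<delta>" "\<forall>s\<in>{0..1}. \<forall>t\<in>{0..1}. \<bar>s - t\<bar> < \<delta> \<longrightarrow>
      winding m f t = winding m f s + step m (f s) (f t)"
    using winding(2)[OF f, of m] unfolding local_lift_def by (elim exE conjE)
  have "local_lift (\<lambda>s t. step n (f s) (f t)) ?g"
    unfolding local_lift_def
  proof (intro exI[of _ \<delta>] conjI ballI impI)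
    fix s t :: real assume "s \<in> {0..1}" "t \<in> {0..1}" "\<bar>s - t\<bar> < \<delta>"
    then have "winding m f t = winding m f s + step m (f s) (f t)" using \<delta>(2) by blast
    then show "?g t = ?g s + step n (f s) (f t)"
      by (simp only: free_group_restrict_add step_restrict[OF assms(2)])
  qed (rule \<delta>(1))
  from winding_unique[OF f this assms(3)] show ?thesis
    using winding(1)[OF f, of m] by simp
qed

lemma crossing_neq_0:
  assumes "crossing d v w \<noteq> 0"
  shows "Re v < 0" "Re w < 0" "crossing d v w = word_val [(d, 0 \<le> Im v)]"
  using assms by (auto simp: crossing_def split: if_splits)

lemma crossing_self [simp]: "crossing d v v = 0"
  by (simp add: crossing_def)

text \<open>The side of the cut just before a crossing determines its direction, so the letter can
  be read off at the grid point before it. The value at the base point is immaterial, as the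
  recorded times have negative real part.\<close>

definition letter_at :: "(real \<Rightarrow> ('a \<times> complex) option) \<Rightarrow> real \<Rightarrow> 'a letter" where
  "letter_at f t = (case f t of None \<Rightarrow> undefined | Some (d, u) \<Rightarrow> (d, 0 \<le> Im (u / p)))"

text \<open>A path may cross a cut infinitely often. Only crossings between consecutive points of a
  grid of mesh 1 / M are recorded, each at its left grid point, which makes each letter occur
  finitely often.\<close>

definition crossing_times :: "(real \<Rightarrow> ('a \<times> complex) option) \<Rightarrow> nat \<Rightarrow> 'a \<Rightarrow> real set" where
  "crossing_times f M d =
     {real i / real M | i. i < M \<and> crossing d (coord d (f (real i / real M))) (coord d (f (real (Suc i) / real M))) \<noteq> 0}"

lemma finite_crossing_times: "finite (crossing_times f M d)"
  by (rule finite_subset[of _ "(\<lambda>i. real i / real M) ` {..<M}"]) (auto simp: crossing_times_def)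

lemma crossing_times_01: "t \<in> crossing_times f M d \<Longrightarrow> 0 \<le> t \<and> t < 1"
  by (auto simp: crossing_times_def divide_less_eq)

lemma crossing_times_circle:
  assumes f: "pathin (mtopology_of Q) f" and t: "t \<in> crossing_times f M d"
  shows "Re (coord d (f t)) < 0" "letter_at f t = (d, 0 \<le> Im (coord d (f t)))"
proof -
  show re: "Re (coord d (f t)) < 0"
    using t crossing_neq_0(1) by (auto simp: crossing_times_def)
  have "f t \<in> mspace Q" using path_in_Q[OF f] crossing_times_01[OF t] by simp
  moreover have "coord d (f t) \<noteq> 1" using re by auto
  ultimately have "f t = Some (d, p * coord d (f t))" using coord_neq_1_iff by blast
  then obtain u where "f t = Some (d, u)" by blast
  then show "letter_at f t = (d, 0 \<le> Im (coord d (f t)))"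
    by (simp add: letter_at_def coord_def)
qed

text \<open>\<open>B t\<close> is the word of the recorded crossings before \<open>t\<close>, and
  \<open>b t\<close> is the crossing from the next grid point back to \<open>t\<close>, in the
  circle of \<open>f t\<close>. Their sum is a lift, because over a short interval at most one
  recorded crossing of a single circle occurs; as \<open>f\<close> is in the base point at times 0
  and 1, \<open>b\<close> vanishes there, and uniqueness of lifts gives the claim.\<close>

lemma winding_eq_word_val:
  fixes M :: "'a \<Rightarrow> nat"
  assumes f: "f \<in> loops (mtopology_of Q) None"
    and M0: "\<And>d. d \<in> D \<Longrightarrow> 0 < M d"
    and M: "\<And>d s t. d \<in> D \<Longrightarrow> s \<in> {0..1} \<Longrightarrow> t \<in> {0..1} \<Longrightarrow> \<bar>s - t\<bar> \<le> 1 / real (M d) \<Longrightarrow>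
      cmod (coord d (f s) - coord d (f t)) < 1 / 8"
  shows "winding n f 1 =
    word_val (map (letter_at f) (sorted_list_of_set (\<Union>d\<in>level n. crossing_times f (M d) d)))"
proof -
  have pf: "pathin (mtopology_of Q) f" and f01: "f 0 = None" "f 1 = None"
    using f by (auto simp: loops_def)
  define c where "c d t = coord d (f t)" for d t
  have inQ: "f t \<in> mspace Q" if "t \<in> {0..1}" for t
    using path_in_Q[OF pf that] .
  have nc: "cmod (c d t) = 1" if "t \<in> {0..1}" for d t
    using norm_coord[OF inQ[OF that]] by (simp add: c_def)
  \<comment> \<open>Rounding is upwards because a crossing enters \<open>B t\<close> as soon as its
    left grid point lies strictly before \<open>t\<close>; \<open>b t\<close> then takes back the
    part between \<open>t\<close> and the right grid point.\<close>
  define up where "up d t = real_of_int \<lceil>t * real (M d)\<rceil> / real (M d)" for d t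
  have up: "t \<le> up d t" "up d t < t + 1 / real (M d)" "up d t \<in> {0..1}" if "d \<in> D" "t \<in> {0..1}" for d t
  proof -
    have m: "0 < real (M d)" using M0[OF that(1)] by simp
    have "t * real (M d) \<le> of_int \<lceil>t * real (M d)\<rceil>" "of_int \<lceil>t * real (M d)\<rceil> < t * real (M d) + 1"
      by linarith+
    then show "t \<le> up d t" "up d t < t + 1 / real (M d)"
      using m by (simp_all add: up_def field_simps)
    have "t * real (M d) \<le> real (M d)" using that(2) m by simp
    then have "\<lceil>t * real (M d)\<rceil> \<le> int (M d)" by (simp add: ceiling_le_iff)
    then have "real_of_int \<lceil>t * real (M d)\<rceil> \<le> real (M d)" by linarith
    then show "up d t \<in> {0..1}"
      using \<open>t \<le> up d t\<close> that(2) m by (simp add: up_def)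
  qed
  define T where "T = (\<Union>d\<in>level n. crossing_times f (M d) d)"
  have finT: "finite T"
    unfolding T_def using finite_level finite_crossing_times by blast
  define B where "B t = word_val (map (letter_at f) (sorted_list_of_set {\<tau> \<in> T. \<tau> < t}))" for t
  define b where "b t = (case f t of None \<Rightarrow> 0 | Some (d, u) \<Rightarrow>
    if d \<in> level n then crossing d (c d (up d t)) (c d t) else 0)" for t
  obtain \<delta>1 where \<delta>1: "0 < \<delta>1" "\<forall>x\<in>T. \<forall>y\<in>T. \<bar>x - y\<bar> < \<delta>1 \<longrightarrow> x = y"
    using finite_reals_separated[OF finT] by (elim exE conjE)
  define \<delta>2 where "\<delta>2 = Min (insert 1 ((\<lambda>d. 1 / real (M d)) ` level n))"
  have \<delta>2: "0 < \<delta>2" "\<And>d. d \<in> level n \<Longrightarrow> \<delta>2 \<le> 1 / real (M d)"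
    using finite_level[of n] M0 level_sub by (auto simp: \<delta>2_def)
  have law: "B t + b t = B s + b s + step n (f s) (f t)"
    if s: "s \<in> {0..1}" and t: "t \<in> {0..1}" and st: "s \<le> t" "t - s < min \<delta>1 \<delta>2" for s t
  proof -
    define A where "A = {\<tau> \<in> T. s \<le> \<tau> \<and> \<tau> < t}"
    have Bt: "B t = B s + word_val (map (letter_at f) (sorted_list_of_set A))"
    proof -
      have "{\<tau> \<in> T. \<tau> < t} = {\<tau> \<in> T. \<tau> < s} \<union> A"
        using st by (auto simp: A_def)
      moreover have "sorted_list_of_set ({\<tau> \<in> T. \<tau> < s} \<union> A) =
          sorted_list_of_set {\<tau> \<in> T. \<tau> < s} @ sorted_list_of_set A"
        by (rule sorted_list_of_set_union) (use finT in \<open>auto simp: A_def\<close>)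
      ultimately show ?thesis by (simp add: B_def word_val_append)
    qed
    have close: "cmod (c d x - c d y) < 1 / 8" if "d \<in> level n" "x \<in> {0..1}" "y \<in> {0..1}" "\<bar>x - y\<bar> \<le> 1 / real (M d)" for d x y
      using M[of d x y] that level_sub by (auto simp: c_def)
    have ts: "\<bar>s - t\<bar> \<le> 1 / real (M d)" if "d \<in> level n" for d
      using \<delta>2(2)[OF that] st by linarith
    \<comment> \<open>A point in the left half plane has distance at least 1 from the base
      coordinate 1, while the coordinate moves by less than 1/8 + 1/8 on the way to
      \<open>t\<close>. So \<open>f s\<close> and \<open>f t\<close> both lie in the circle of
      \<open>d\<close>, off the base point.\<close>
    have active: "f s = Some (d, p * c d s) \<and> f t = Some (d, p * c d t)"
      if d: "d \<in> level n" and x: "x \<in> {0..1}" "\<bar>x - s\<bar> \<le> 1 / real (M d)" "Re (c d x) < 0" for d x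
    proof -
      have far: "1 \<le> cmod (c d x - 1)"
        using abs_Re_le_cmod[of "c d x - 1"] x(3) by simp
      have xs: "cmod (c d x - c d s) < 1 / 8" using close[OF d x(1) s x(2)] .
      have st': "cmod (c d s - c d t) < 1 / 8" using close[OF d s t ts[OF d]] .
      have "c d s \<noteq> 1" using far xs by auto
      moreover have "c d t \<noteq> 1"
      proof
        assume "c d t = 1"
        then have "cmod (c d x - 1) \<le> cmod (c d x - c d s) + cmod (c d s - c d t)"
          using norm_triangle_ineq[of "c d x - c d s" "c d s - c d t"] by simp
        then show False using far xs st' by linarith
      qed
      ultimately show ?thesis
        using coord_neq_1_iff[OF inQ[OF s], of d] coord_neq_1_iff[OF inQ[OF t], of d] unfolding c_def by blast
    qed
    have actA: "\<exists>d\<in>level n. \<tau> \<in> crossing_times f (M d) d \<and> f s = Some (d, p * c d s)" if \<tau>: "\<tau> \<in> A" for \<tau>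
    proof -
      obtain d where d: "d \<in> level n" "\<tau> \<in> crossing_times f (M d) d"
        using \<tau> by (auto simp: A_def T_def)
      have "\<tau> \<in> {0..1}" using crossing_times_01[OF d(2)] by simp
      moreover have "\<bar>\<tau> - s\<bar> \<le> 1 / real (M d)"
        using \<tau> st \<delta>2(2)[OF d(1)] by (auto simp: A_def)
      moreover have "Re (c d \<tau>) < 0" using crossing_times_circle(1)[OF pf d(2)] by (simp add: c_def)
      ultimately show ?thesis using active[OF d(1)] d by blast
    qed
    show ?thesis
    proof (cases "\<exists>d\<in>level n. \<exists>x\<in>{0..1}. \<bar>x - s\<bar> \<le> 1 / real (M d) \<and> Re (c d x) < 0")
      case True
      then obtain d x where d: "d \<in> level n" and x: "x \<in> {0..1}" "\<bar>x - s\<bar> \<le> 1 / real (M d)" "Re (c d x) < 0"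
        by blast
      have dD: "d \<in> D" using d level_sub by blast
      note act = active[OF d x]
      obtain u v where u: "f s = Some (d, u)" and v: "f t = Some (d, v)" using act by blast
      have bs: "b s = crossing d (c d (up d s)) (c d s)" using u d by (simp add: b_def)
      have bt: "b t = crossing d (c d (up d t)) (c d t)" using v d by (simp add: b_def)
      have step: "step n (f s) (f t) = crossing d (c d s) (c d t)"
        using u d by (simp add: step_def c_def)
      note us = up[OF dD s] and ut = up[OF dD t]
      have m: "0 < real (M d)" using M0[OF dD] by simp
      \<comment> \<open>The constant 1/8 is chosen for this: it puts \<open>s\<close>,
        \<open>t\<close> and their next grid points pairwise within 3/8, so that the cocycle law for
        moves below 1/2 applies.\<close>
      have cl1: "cmod (c d (up d s) - c d s) < 1 / 8" by (rule close[OF d us(3) s]) (use us in linarith)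
      have cl2: "cmod (c d (up d t) - c d t) < 1 / 8" by (rule close[OF d ut(3) t]) (use ut in linarith)
      have cl3: "cmod (c d s - c d t) < 1 / 8" by (rule close[OF d s t ts[OF d]])
      have tri: "cmod (a - e) \<le> cmod (a - b) + cmod (b - e)" for a b e :: complex
        using norm_triangle_ineq[of "a - b" "b - e"] by simp
      have cl4: "cmod (c d (up d s) - c d t) < 1 / 4"
        using tri[of "c d (up d s)" "c d t" "c d s"] cl1 cl3 by linarith
      have cl5: "cmod (c d (up d s) - c d (up d t)) < 1 / 2"
        using tri[of "c d (up d s)" "c d (up d t)" "c d t"] cl4 cl2 norm_minus_commute[of "c d t" "c d (up d t)"]
        by linarith
      have coc1: "crossing d (c d (up d s)) (c d s) + crossing d (c d s) (c d t) = crossing d (c d (up d s)) (c d t)"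
        by (rule crossing_cocycle[OF nc[OF us(3)] nc[OF s] nc[OF t]]) (use cl1 cl3 cl4 in linarith)+
      have coc2: "crossing d (c d (up d s)) (c d (up d t)) + crossing d (c d (up d t)) (c d t) = crossing d (c d (up d s)) (c d t)"
        by (rule crossing_cocycle[OF nc[OF us(3)] nc[OF ut(3)] nc[OF t]]) (use cl2 cl4 cl5 in linarith)+
      have A_d: "\<tau> \<in> crossing_times f (M d) d" if "\<tau> \<in> A" for \<tau>
        using actA[OF that] u by auto
      have "word_val (map (letter_at f) (sorted_list_of_set A)) = crossing d (c d (up d s)) (c d (up d t))"
      proof -
        define k where "k = nat \<lceil>s * real (M d)\<rceil>"
        have k: "real k = of_int \<lceil>s * real (M d)\<rceil>"
        proof -
          have "0 \<le> s * real (M d)" using s m by simp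
          then show ?thesis unfolding k_def by simp
        qed
        have upk: "up d s = real k / real (M d)" by (simp add: up_def k)
        have le: "\<lceil>s * real (M d)\<rceil> \<le> \<lceil>t * real (M d)\<rceil>"
          using st m by (intro ceiling_mono mult_right_mono) auto
        have "t * real (M d) < s * real (M d) + 1"
        proof -
          have "(t - s) * real (M d) < 1 / real (M d) * real (M d)"
            using st(2) \<delta>2(2)[OF d] m by (intro mult_strict_right_mono) auto
          then show ?thesis using m by (simp add: algebra_simps)
        qed
        then have ge: "\<lceil>t * real (M d)\<rceil> \<le> \<lceil>s * real (M d)\<rceil> + 1" by linarith
        \<comment> \<open>An interval shorter than the mesh contains at most one grid point, which
          must then be the next one after \<open>s\<close>.\<close>
        have grid: "\<tau> = up d s \<and> \<lceil>t * real (M d)\<rceil> = \<lceil>s * real (M d)\<rceil> + 1" if \<tau>: "\<tau> \<in> A" for \<tau>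
        proof -
          obtain i where i: "\<tau> = real i / real (M d)" using A_d[OF \<tau>] by (auto simp: crossing_times_def)
          have "s * real (M d) \<le> real i" "real i < t * real (M d)"
            using \<tau> m by (auto simp: A_def i field_simps)
          then have "\<lceil>s * real (M d)\<rceil> \<le> int i" "int i < \<lceil>t * real (M d)\<rceil>"
            by linarith+
          then have "int i = \<lceil>s * real (M d)\<rceil>" "\<lceil>t * real (M d)\<rceil> = \<lceil>s * real (M d)\<rceil> + 1" using ge by linarith+
          then show ?thesis by (simp add: i up_def flip: \<open>int i = _\<close>)
        qed
        show ?thesis
        proof (cases "A = {}")
          case False
          then obtain \<tau> where \<tau>: "\<tau> \<in> A" by blast
          have A: "A = {up d s}" using grid \<tau> by blast
          have \<tau>e: "\<tau> = up d s" using grid \<tau> by blast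
          have "up d s \<in> crossing_times f (M d) d" using A_d A by blast
          then obtain i where i: "up d s = real i / real (M d)" "i < M d"
            "crossing d (c d (real i / real (M d))) (c d (real (Suc i) / real (M d))) \<noteq> 0"
            by (auto simp: crossing_times_def c_def)
          have "real i = real k" using i(1) upk m by simp
          then have ik: "i = k" by simp
          have ut': "up d t = real (Suc i) / real (M d)"
            using grid[OF \<tau>] by (simp add: up_def ik k)
          have "crossing d (c d (up d s)) (c d (up d t)) = word_val [(d, 0 \<le> Im (c d (up d s)))]"
            using crossing_neq_0(3)[OF i(3)] i(1) ut' by simp
          moreover have "letter_at f (up d s) = (d, 0 \<le> Im (c d (up d s)))"
            using crossing_times_circle(2)[OF pf \<open>up d s \<in> crossing_times f (M d) d\<close>] by (simp add: c_def)
          ultimately show ?thesis by (simp add: A)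
        next
          case True
          have "crossing d (c d (up d s)) (c d (up d t)) = 0"
          proof (rule ccontr)
            assume ne: "crossing d (c d (up d s)) (c d (up d t)) \<noteq> 0"
            then have "up d s \<noteq> up d t" by auto
            then have "\<lceil>t * real (M d)\<rceil> \<noteq> \<lceil>s * real (M d)\<rceil>" by (auto simp: up_def)
            then have e: "\<lceil>t * real (M d)\<rceil> = \<lceil>s * real (M d)\<rceil> + 1" using le ge by linarith
            then have ut': "up d t = real (Suc k) / real (M d)" by (simp add: up_def k)
            have "real k < t * real (M d)" using e k by linarith
            then have lt: "up d s < t" using m by (simp add: upk field_simps)
            have "real (Suc k) \<le> real (M d)" using ut(3) ut' m by simp
            then have "k < M d" by simp
            then have "up d s \<in> crossing_times f (M d) d"
              using ne unfolding crossing_times_def ut' upk c_def by blast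
            then have "up d s \<in> A" using lt us(1) d by (auto simp: A_def T_def)
            then show False using True by simp
          qed
          then show ?thesis by (simp add: True word_val_Nil)
        qed
      qed
      then show ?thesis
        unfolding Bt bs bt step using coc1 coc2 by (simp add: add.assoc)
    next
      case False
      then have pos: "0 \<le> Re (c d x)" if "d \<in> level n" "x \<in> {0..1}" "\<bar>x - s\<bar> \<le> 1 / real (M d)" for d x
        using that by (meson not_le)
      have zs: "0 \<le> Re (c d s)" if "d \<in> level n" for d using pos[OF that s] by simp
      have zt: "0 \<le> Re (c d t)" if "d \<in> level n" for d using pos[OF that t] ts[OF that] by (simp add: abs_minus_commute)
      have "A = {}"
      proof (rule ccontr)
        assume "A \<noteq> {}"
        then obtain \<tau> where "\<tau> \<in> A" by blast
        then obtain d where d: "d \<in> level n" "\<tau> \<in> crossing_times f (M d) d" by (auto simp: A_def T_def)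
        have "0 \<le> Re (c d \<tau>)"
          using \<open>\<tau> \<in> A\<close> crossing_times_01[OF d(2)] st \<delta>2(2)[OF d(1)] by (intro pos[OF d(1)]) (auto simp: A_def)
        then show False using crossing_times_circle(1)[OF pf d(2)] by (simp add: c_def)
      qed
      moreover have "b s = 0" "step n (f s) (f t) = 0"
        using zs by (auto simp: b_def step_def crossing_def c_def[symmetric] not_less[symmetric] split: option.split)
      moreover have "b t = 0"
        using zt by (auto simp: b_def crossing_def not_less[symmetric] split: option.split)
      ultimately show ?thesis by (simp add: Bt word_val_Nil)
    qed
  qed
  have "local_lift (\<lambda>s t. step n (f s) (f t)) (\<lambda>t. B t + b t)"
  proof (rule local_lift_ordered[OF path_local_cocycle[OF pf], of "min \<delta>1 \<delta>2"])
    show "0 < min \<delta>1 \<delta>2" using \<delta>1 \<delta>2 by simp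
  qed (rule law)
  from winding_unique[OF pf this, of 1] have "B 1 + b 1 = B 0 + b 0 + winding n f 1" by simp
  moreover have "b 0 = 0" "b 1 = 0" by (simp_all add: b_def f01)
  moreover have "B 0 = 0"
  proof -
    have e: "{\<tau> \<in> T. \<tau> < 0} = {}"
      using crossing_times_01 by (fastforce simp: T_def)
    show ?thesis unfolding B_def e by (simp add: word_val_Nil)
  qed
  moreover have "B 1 = word_val (map (letter_at f) (sorted_list_of_set T))"
  proof -
    have e: "{\<tau> \<in> T. \<tau> < 1} = T"
      using crossing_times_01 by (fastforce simp: T_def)
    show ?thesis unfolding B_def e ..
  qed
  ultimately show ?thesis by (simp add: T_def)
qed

lemma countable_D: "countable D"
  by (rule countableI[OF inj_index])

text \<open>The index set consists of the recorded crossing times of all circles, ordered as real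
  numbers and encoded by natural numbers. The mesh depends on the circle, since the coordinates of
  infinitely many circles need not have a common modulus of continuity. Any order type of a
  countable set of reals may arise.\<close>

lemma sigma_word_exists:
  assumes f: "f \<in> loops (mtopology_of Q) None"
  shows "\<exists>W. W \<in> sigma_words D \<and> (\<forall>n. sigma_val (level n) W = winding n f 1)"
proof -
  have pf: "pathin (mtopology_of Q) f" using f by (simp add: loops_def)
  have "\<exists>m>0. \<forall>s\<in>{0..1}. \<forall>t\<in>{0..1}. \<bar>s - t\<bar> \<le> 1 / real m \<longrightarrow> cmod (coord d (f s) - coord d (f t)) < 1 / 8"
    if d: "d \<in> D" for d
  proof -
    have "\<exists>\<delta>>0. \<forall>s\<in>{0..1}. \<forall>t\<in>{0..1}. dist s t < \<delta> \<longrightarrow>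
        (\<forall>d\<in>level (\<nu> d). cmod (coord d (f s) - coord d (f t)) < 1 / 8)"
      using uniformly_near[of "{0..1::real}" f "1/8" "\<nu> d"] pf by (simp add: pathin_def)
    then obtain \<delta> where \<delta>: "0 < \<delta>" "\<forall>s\<in>{0..1}. \<forall>t\<in>{0..1}. dist s t < \<delta> \<longrightarrow>
        (\<forall>d\<in>level (\<nu> d). cmod (coord d (f s) - coord d (f t)) < 1 / 8)"
      by (elim exE conjE)
    obtain m where m: "inverse (real (Suc m)) < \<delta>" using reals_Archimedean[OF \<delta>(1)] by blast
    have "d \<in> level (\<nu> d)" using d by (simp add: level_def)
    then show ?thesis
      using \<delta>(2) m by (intro exI[of _ "Suc m"] conjI ballI impI) (auto simp: dist_real_def inverse_eq_divide)
  qed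
  then obtain M where M0: "\<And>d. d \<in> D \<Longrightarrow> 0 < M d"
    and M: "\<And>d s t. d \<in> D \<Longrightarrow> s \<in> {0..1} \<Longrightarrow> t \<in> {0..1} \<Longrightarrow> \<bar>s - t\<bar> \<le> 1 / real (M d) \<Longrightarrow>
      cmod (coord d (f s) - coord d (f t)) < 1 / 8"
    by metis
  define T where "T = (\<Union>d\<in>D. crossing_times f (M d) d)"
  have cT: "countable T"
    unfolding T_def by (rule countable_UN[OF countable_D], rule countable_finite, rule finite_crossing_times)
  define enc where "enc = to_nat_on T"
  have enc: "inj_on enc T" unfolding enc_def by (rule inj_on_to_nat_on[OF cT])
  define w where "w k = letter_at f (from_nat_into T k)" for k
  have w: "w (enc \<tau>) = letter_at f \<tau>" if "\<tau> \<in> T" for \<tau>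
    using from_nat_into_to_nat_on[OF cT that] by (simp add: w_def enc_def)
  have fst_letter: "fst (letter_at f \<tau>) = d" if "\<tau> \<in> crossing_times f (M d) d" for \<tau> d
    using crossing_times_circle(2)[OF pf that] by simp
  define r where "r = {(enc s, enc t) | s t. s \<in> T \<and> t \<in> T \<and> s \<le> t}"
  have r: "(enc s, enc t) \<in> r \<longleftrightarrow> s \<le> t" if "s \<in> T" "t \<in> T" for s t
    using that enc by (auto simp: r_def inj_on_eq_iff)
  have rE: "\<exists>s t. a = enc s \<and> b = enc t \<and> s \<in> T \<and> t \<in> T \<and> s \<le> t" if "(a, b) \<in> r" for a b
    using that by (auto simp: r_def)
  have Field: "Field r = enc ` T"
  proof
    show "Field r \<subseteq> enc ` T" by (auto simp: r_def Field_def)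
    show "enc ` T \<subseteq> Field r" using r by (auto intro: FieldI1)
  qed
  have lin: "Linear_order r"
  proof (rule Linear_orderI)
    show "(a, a) \<in> r" if "a \<in> Field r" for a
      using that r by (auto simp: Field)
    show "(a, c) \<in> r" if ab: "(a, b) \<in> r" and bc: "(b, c) \<in> r" for a b c
    proof -
      obtain s t where st: "a = enc s" "b = enc t" "s \<in> T" "t \<in> T" "s \<le> t" using rE[OF ab] by blast
      obtain t' u where tu: "b = enc t'" "c = enc u" "t' \<in> T" "u \<in> T" "t' \<le> u" using rE[OF bc] by blast
      have "t = t'" by (rule inj_onD[OF enc]) (use st tu in auto)
      then show ?thesis using r[OF st(3) tu(4)] st tu by simp
    qed
    show "a = b" if ab: "(a, b) \<in> r" and ba: "(b, a) \<in> r" for a b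
    proof -
      obtain s t where st: "a = enc s" "b = enc t" "s \<in> T" "t \<in> T" "s \<le> t" using rE[OF ab] by blast
      then show ?thesis using r[OF st(4) st(3)] ba by simp
    qed
    show "(a, b) \<in> r \<or> (b, a) \<in> r" if "a \<in> Field r" "b \<in> Field r" for a b
      using that r by (auto simp: Field)
  qed
  have W: "(r, w) \<in> sigma_words D"
  proof -
    have 1: "w \<alpha> \<in> D \<times> UNIV" if \<alpha>: "\<alpha> \<in> Field r" for \<alpha>
    proof -
      obtain \<tau> where \<tau>: "\<tau> \<in> T" "\<alpha> = enc \<tau>" using \<alpha> unfolding Field by (elim imageE)
      then obtain d where "d \<in> D" "\<tau> \<in> crossing_times f (M d) d" by (auto simp: T_def)
      then show ?thesis using w[OF \<tau>(1)] fst_letter[of \<tau> d] \<tau>(2) by (simp add: mem_Times_iff)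
    qed
    have 2: "finite {\<alpha> \<in> Field r. w \<alpha> = c}" for c
    proof (rule finite_subset)
      show "{\<alpha> \<in> Field r. w \<alpha> = c} \<subseteq> enc ` crossing_times f (M (fst c)) (fst c)"
      proof
        fix \<alpha> assume "\<alpha> \<in> {\<alpha> \<in> Field r. w \<alpha> = c}"
        then have \<alpha>: "\<alpha> \<in> enc ` T" "w \<alpha> = c" unfolding Field by simp_all
        then obtain \<tau> where \<tau>: "\<tau> \<in> T" "\<alpha> = enc \<tau>" by (elim imageE)
        then obtain d where d: "\<tau> \<in> crossing_times f (M d) d" by (auto simp: T_def)
        have "fst c = d" using fst_letter[OF d] w[OF \<tau>(1)] \<tau>(2) \<alpha>(2) by simp
        then show "\<alpha> \<in> enc ` crossing_times f (M (fst c)) (fst c)" using d \<tau>(2) by blast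
      qed
    qed (simp add: finite_crossing_times)
    have "w ` Field r \<subseteq> D \<times> UNIV" by (rule image_subsetI) (rule 1)
    then show ?thesis
      unfolding sigma_words_def mem_Collect_eq prod.case using lin 2 by (intro conjI allI)
  qed
  have "sigma_val (level n) (r, w) = winding n f 1" for n
  proof -
    define Tn where "Tn = (\<Union>d\<in>level n. crossing_times f (M d) d)"
    have TnT: "Tn \<subseteq> T" using level_sub by (auto simp: Tn_def T_def)
    have fin: "finite Tn" unfolding Tn_def using finite_level finite_crossing_times by blast
    have Tn: "Tn = {\<tau> \<in> T. fst (letter_at f \<tau>) \<in> level n}"
    proof (intro equalityI subsetI)
      fix \<tau> assume "\<tau> \<in> {\<tau> \<in> T. fst (letter_at f \<tau>) \<in> level n}"
      then obtain d where d: "\<tau> \<in> crossing_times f (M d) d" "fst (letter_at f \<tau>) \<in> level n"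
        by (auto simp: T_def)
      then have "d \<in> level n" using fst_letter[OF d(1)] by simp
      then show "\<tau> \<in> Tn" using d(1) by (auto simp: Tn_def)
    next
      fix \<tau> assume \<tau>: "\<tau> \<in> Tn"
      then obtain d where d: "d \<in> level n" "\<tau> \<in> crossing_times f (M d) d" by (auto simp: Tn_def)
      then show "\<tau> \<in> {\<tau> \<in> T. fst (letter_at f \<tau>) \<in> level n}"
        using TnT \<tau> fst_letter[OF d(2)] by auto
    qed
    have "list_in_order r {\<alpha> \<in> Field r. fst (w \<alpha>) \<in> level n} = map enc (sorted_list_of_set Tn)"
    proof (rule list_in_order_eqI[OF lin])
      show "set (map enc (sorted_list_of_set Tn)) \<subseteq> Field r"
        using fin TnT Field by auto
      show "set (map enc (sorted_list_of_set Tn)) = {\<alpha> \<in> Field r. fst (w \<alpha>) \<in> level n}"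
      proof -
        have "{\<alpha> \<in> Field r. fst (w \<alpha>) \<in> level n} = enc ` {\<tau> \<in> T. fst (letter_at f \<tau>) \<in> level n}"
          unfolding Field by (auto simp: w)
        then show ?thesis using fin by (simp add: Tn[symmetric])
      qed
      show "distinct (map enc (sorted_list_of_set Tn))"
        using inj_on_subset[OF enc TnT] fin by (simp add: distinct_map)
      have "sorted_wrt (\<le>) (sorted_list_of_set Tn)" by simp
      then show "sorted_wrt (\<lambda>\<alpha> \<beta>. (\<alpha>, \<beta>) \<in> r) (map enc (sorted_list_of_set Tn))"
        unfolding sorted_wrt_map
      proof (rule sorted_wrt_mono_rel[rotated])
        fix s t assume "s \<in> set (sorted_list_of_set Tn)" "t \<in> set (sorted_list_of_set Tn)" "s \<le> t"
        then show "(enc s, enc t) \<in> r" using fin TnT r[of s t] by auto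
      qed
    qed
    moreover have "map w (map enc (sorted_list_of_set Tn)) = map (letter_at f) (sorted_list_of_set Tn)"
      using fin TnT by (auto simp: w)
    ultimately have "restrict_word (level n) (r, w) = map (letter_at f) (sorted_list_of_set Tn)"
      by (simp add: restrict_word_def)
    moreover have "winding n f 1 = word_val (map (letter_at f) (sorted_list_of_set Tn))"
      unfolding Tn_def by (rule winding_eq_word_val[OF f M0 M])
    ultimately show ?thesis by (simp only: sigma_val_def)
  qed
  with W show ?thesis by (intro exI[of _ "(r, w)"] conjI allI)
qed

text \<open>The levels are cofinal among the finite subsets of \<open>D\<close>.\<close>

lemma sigma_class_eq_iff_level:
  assumes "V \<in> sigma_words D" "W \<in> sigma_words D"
  shows "sigma_class D V = sigma_class D W \<longleftrightarrow> (\<forall>n. sigma_val (level n) V = sigma_val (level n) W)"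
  unfolding sigma_class_eq_iff[OF assms]
proof (intro iffI allI impI)
  fix n assume "\<forall>F. finite F \<and> F \<subseteq> D \<longrightarrow> sigma_val F V = sigma_val F W"
  then show "sigma_val (level n) V = sigma_val (level n) W"
    using finite_level level_sub by blast
next
  fix F assume *: "\<forall>n. sigma_val (level n) V = sigma_val (level n) W" and F: "finite F \<and> F \<subseteq> D"
  obtain n where n: "F \<subseteq> level n" using finite_subset_level F by blast
  show "sigma_val F V = sigma_val F W"
    using sigma_val_restrict[OF assms(1) finite_level n] sigma_val_restrict[OF assms(2) finite_level n] * by simp
qed

section \<open>The homomorphism into the \<sigma>-product\<close>

definition word_of :: "(real \<Rightarrow> ('a \<times> complex) option) \<Rightarrow> 'a sigma_word" where
  "word_of f = (SOME W. W \<in> sigma_words D \<and> (\<forall>n. sigma_val (level n) W = winding n f 1))"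

lemma word_of:
  assumes "f \<in> loops (mtopology_of Q) None"
  shows "word_of f \<in> sigma_words D" "sigma_val (level n) (word_of f) = winding n f 1"
  using someI_ex[OF sigma_word_exists[OF assms]] by (simp_all add: word_of_def)

definition word_map :: "(real \<Rightarrow> ('a \<times> complex) option) set \<Rightarrow> 'a sigma_word set" where
  "word_map A = (\<Union>f\<in>A. sigma_class D (word_of f))"

lemma word_map_loop_class:
  assumes f: "f \<in> loops (mtopology_of Q) None"
  shows "word_map (loop_class (mtopology_of Q) None f) = sigma_class D (word_of f)"
proof -
  have "sigma_class D (word_of g) = sigma_class D (word_of f)" if "g \<in> loop_class (mtopology_of Q) None f" for g
  proof -
    have h: "loop_homotopic (mtopology_of Q) None f g" using that by (simp add: loop_class_def)
    show ?thesis
      using word_of[OF f] word_of[OF loop_homotopic_loops(2)[OF h]] winding_homotopic[OF h]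
      by (simp add: sigma_class_eq_iff_level)
  qed
  then have "word_map (loop_class (mtopology_of Q) None f) =
      (\<Union>g\<in>loop_class (mtopology_of Q) None f. sigma_class D (word_of f))"
    unfolding word_map_def by (intro SUP_cong refl)
  also have "\<dots> = sigma_class D (word_of f)"
    using loop_class_self[OF f] by blast
  finally show ?thesis .
qed

lemma word_map_hom: "word_map \<in> hom (fundamental_group (mtopology_of Q) None) (free_sigma_product D)"
proof (rule homI)
  fix A assume "A \<in> carrier (fundamental_group (mtopology_of Q) None)"
  then obtain f where f: "f \<in> loops (mtopology_of Q) None" "A = loop_class (mtopology_of Q) None f"
    by (auto simp: carrier_fundamental_group)
  show "word_map A \<in> carrier (free_sigma_product D)"
    using word_of(1)[OF f(1)] by (simp add: f(2) word_map_loop_class[OF f(1)] carrier_free_sigma_product)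
  fix B assume "B \<in> carrier (fundamental_group (mtopology_of Q) None)"
  then obtain g where g: "g \<in> loops (mtopology_of Q) None" "B = loop_class (mtopology_of Q) None g"
    by (auto simp: carrier_fundamental_group)
  note fg = loop_concat_loops[OF f(1) g(1)]
  have "sigma_class D (word_of (loop_concat f g)) = sigma_class D (concat_word (word_of f) (word_of g))"
    using word_of[OF f(1)] word_of[OF g(1)] word_of[OF fg]
    by (simp add: sigma_class_eq_iff_level concat_word_in_sigma_words
        sigma_val_concat[OF _ _ finite_level, of _ D] winding_concat[OF f(1) g(1)])
  then show "word_map (A \<otimes>\<^bsub>fundamental_group (mtopology_of Q) None\<^esub> B) =
      word_map A \<otimes>\<^bsub>free_sigma_product D\<^esub> word_map B"
    using word_of(1)[OF f(1)] word_of(1)[OF g(1)]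
    by (simp add: f(2) g(2) fundamental_group_mult[OF f(1) g(1)] word_map_loop_class[OF f(1)]
        word_map_loop_class[OF g(1)] word_map_loop_class[OF fg] free_sigma_product_mult)
qed

lemma word_map_eq_one_iff:
  assumes f: "f \<in> loops (mtopology_of Q) None"
  shows "word_map (loop_class (mtopology_of Q) None f) = \<one>\<^bsub>free_sigma_product D\<^esub> \<longleftrightarrow>
    (\<forall>n. winding n f 1 = 0)"
  using word_of[OF f] empty_word_in_sigma_words[of D]
  by (simp add: word_map_loop_class[OF f] one_free_sigma_product sigma_class_eq_iff_level sigma_val_empty)

end

section \<open>Collapsing the gaps of closed subsets of the unit interval\<close>

definition end_closed :: "real set \<Rightarrow> bool" where
  "end_closed K \<longleftrightarrow> closed K \<and> K \<subseteq> {0..1} \<and> 0 \<in> K \<and> 1 \<in> K"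

text \<open>For \<open>t\<close> outside \<open>K\<close>, \<open>lo K t\<close> and
  \<open>hi K t\<close> are the ends of the gap of \<open>K\<close> around \<open>t\<close>; for
  \<open>t\<close> in \<open>K\<close> both equal \<open>t\<close>.\<close>

definition lo :: "real set \<Rightarrow> real \<Rightarrow> real" where
  "lo K t = Sup (K \<inter> {..t})"

definition hi :: "real set \<Rightarrow> real \<Rightarrow> real" where
  "hi K t = Inf (K \<inter> {t..})"

lemma lo:
  assumes K: "end_closed K" and t: "t \<in> {0..1}"
  shows lo_in: "lo K t \<in> K" and lo_le: "lo K t \<le> t" and lo_01: "lo K t \<in> {0..1}"
    and lo_upper: "\<And>k. k \<in> K \<Longrightarrow> k \<le> t \<Longrightarrow> k \<le> lo K t"
proof -
  have bdd: "bdd_above (K \<inter> {..t})" by (rule bdd_aboveI[of _ t]) auto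
  have "lo K t \<in> K \<inter> {..t}"
    unfolding lo_def using K t by (intro closed_contains_Sup bdd) (auto simp: end_closed_def)
  then show "lo K t \<in> K" "lo K t \<le> t" by auto
  then show "lo K t \<in> {0..1}" using K by (auto simp: end_closed_def)
  show "k \<le> lo K t" if "k \<in> K" "k \<le> t" for k
    unfolding lo_def using that by (intro cSup_upper bdd) auto
qed

lemma hi:
  assumes K: "end_closed K" and t: "t \<in> {0..1}"
  shows hi_in: "hi K t \<in> K" and hi_ge: "t \<le> hi K t" and hi_01: "hi K t \<in> {0..1}"
    and hi_lower: "\<And>k. k \<in> K \<Longrightarrow> t \<le> k \<Longrightarrow> hi K t \<le> k"
proof -
  have bdd: "bdd_below (K \<inter> {t..})" by (rule bdd_belowI[of _ t]) auto
  have "hi K t \<in> K \<inter> {t..}"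
    unfolding hi_def using K t by (intro closed_contains_Inf bdd) (auto simp: end_closed_def)
  then show "hi K t \<in> K" "t \<le> hi K t" by auto
  then show "hi K t \<in> {0..1}" using K by (auto simp: end_closed_def)
  show "hi K t \<le> k" if "k \<in> K" "t \<le> k" for k
    unfolding hi_def using that by (intro cInf_lower bdd) auto
qed

lemma end_closedD: "end_closed K \<Longrightarrow> k \<in> K \<Longrightarrow> k \<in> {0..1}"
  by (auto simp: end_closed_def)

lemma lo_eq: "end_closed K \<Longrightarrow> t \<in> K \<Longrightarrow> lo K t = t"
  using lo_le[of K t] lo_upper[of K t t] end_closedD[of K t] by force

lemma hi_eq: "end_closed K \<Longrightarrow> t \<in> K \<Longrightarrow> hi K t = t"
  using hi_ge[of K t] hi_lower[of K t t] end_closedD[of K t] by force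

lemma lo_hi_gap:
  assumes "end_closed K" "t \<in> {0..1}" "k \<in> K"
  shows "k \<le> lo K t \<or> hi K t \<le> k"
  using lo_upper[OF assms(1,2,3)] hi_lower[OF assms(1,2,3)] by linarith

text \<open>The case split behind the continuity of stopped paths. In the second case a stopped path
  can be compared at \<open>hi K s\<close> and \<open>lo K t\<close>, which lie between
  \<open>s\<close> and \<open>t\<close>, because it has equal values at the two ends of the gap
  around \<open>s\<close>.\<close>

lemma lo_cases:
  assumes K: "end_closed K" and s: "s \<in> {0..1}" and t: "t \<in> {0..1}" and "s \<le> t"
  obtains "lo K s = lo K t" | "s \<le> hi K s" "hi K s \<le> lo K t" "lo K t \<le> t"
proof (cases "lo K t \<le> s")
  case True
  have "lo K s = lo K t"
    using lo_upper[OF K s lo_in[OF K t] True] lo_upper[OF K t lo_in[OF K s]] lo_le[OF K s] \<open>s \<le> t\<close> by linarith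
  then show ?thesis by (rule that(1))
next
  case False
  then have "s \<le> lo K t" by simp
  from hi_lower[OF K s lo_in[OF K t] this] show ?thesis
    using hi_ge[OF K s] lo_le[OF K t] by (intro that(2))
qed

lemma lo_antimono:
  assumes "end_closed K" "end_closed K'" "K' \<subseteq> K" "t \<in> {0..1}"
  shows "lo K' t \<le> lo K t" "hi K t \<le> hi K' t"
  using lo_upper[OF assms(1,4)] lo_in[OF assms(2,4)] lo_le[OF assms(2,4)]
    hi_lower[OF assms(1,4)] hi_in[OF assms(2,4)] hi_ge[OF assms(2,4)] assms(3) by blast+

lemma end_closed_compact: "end_closed K \<Longrightarrow> compact K"
  using compact_Int_closed[of "{0..1::real}" K] by (auto simp: end_closed_def Int_absorb1)

lemma infdist_close:
  fixes K :: "real set"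
  assumes "end_closed K" "\<And>k. k \<in> K \<Longrightarrow> infdist k A \<le> \<epsilon>"
  shows "infdist q A \<le> infdist q K + \<epsilon>"
proof -
  have "closed K" "K \<noteq> {}" using assms(1) by (auto simp: end_closed_def)
  then obtain k where k: "k \<in> K" "infdist q K = dist q k" by (rule infdist_attains_inf)
  have "infdist q A \<le> infdist k A + dist q k" by (rule infdist_triangle)
  then show ?thesis using assms(2)[OF k(1)] k(2) by linarith
qed

text \<open>Strictly antitone and Hausdorff-continuous: turns a maximal chain of sets into a time parameter.\<close>

definition gap_size :: "real set \<Rightarrow> real" where
  "gap_size K = integral {0..1} (\<lambda>q. infdist q K)"

lemma infdist_integrable: "(\<lambda>q. infdist q K) integrable_on {a..b::real}"
  by (intro integrable_continuous_real continuous_intros)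

lemma gap_size_mono:
  assumes "end_closed K'" "K' \<subseteq> K"
  shows "gap_size K \<le> gap_size K'"
  unfolding gap_size_def
  by (intro integral_le infdist_integrable infdist_mono assms) (use assms in \<open>auto simp: end_closed_def\<close>)

lemma gap_size_close:
  assumes "end_closed K" "\<And>k. k \<in> K \<Longrightarrow> infdist k A \<le> \<epsilon>"
  shows "gap_size A \<le> gap_size K + \<epsilon>"
proof -
  have "gap_size A \<le> integral {0..1} (\<lambda>q. infdist q K + \<epsilon>)"
    unfolding gap_size_def
    by (intro integral_le infdist_integrable integrable_add infdist_close assms) auto
  also have "\<dots> = gap_size K + \<epsilon>"
    unfolding gap_size_def by (subst integral_add) (auto intro: infdist_integrable)
  finally show ?thesis .
qed

text \<open>On the interval of length \<eta> / 3 around a point \<open>k\<close> of \<open>K\<close>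
  at distance at least \<eta> from \<open>K'\<close>, the two distance functions differ by at least
  \<eta> / 3. This turns a small difference of \<open>gap_size\<close> into Hausdorff
  closeness.\<close>

lemma gap_size_quantitative:
  assumes K: "end_closed K" and K': "end_closed K'" and sub: "K' \<subseteq> K"
    and k: "k \<in> K" and \<eta>: "0 < \<eta>" "\<eta> \<le> infdist k K'"
  shows "gap_size K + \<eta> * \<eta> / 9 \<le> gap_size K'"
proof -
  define J where "J = {k - \<eta>/6..k + \<eta>/6}"
  have k01: "k \<in> {0..1}" using K k by (auto simp: end_closed_def)
  \<comment> \<open>As 0 and 1 belong to \<open>K'\<close>, the point \<open>k\<close> is at least
    \<eta> away from both, so \<open>J\<close> stays inside the range of integration.\<close>
  have "infdist k K' \<le> dist k 0" "infdist k K' \<le> dist k 1"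
    using infdist_le[of 0 K' k] infdist_le[of 1 K' k] K' by (simp_all add: end_closed_def)
  then have J: "J \<subseteq> {0..1}" using k01 \<eta> by (auto simp: J_def dist_real_def)
  let ?g = "\<lambda>q. infdist q K' - infdist q K"
  have nonneg: "0 \<le> ?g q" for q
    using infdist_mono[OF sub] K' by (auto simp: end_closed_def)
  have big: "\<eta> / 3 \<le> ?g q" if "q \<in> J" for q
  proof -
    have d: "dist q k \<le> \<eta> / 6" using that unfolding J_def dist_real_def atLeastAtMost_iff by linarith
    have "infdist k K' \<le> infdist q K' + dist k q" by (rule infdist_triangle)
    moreover have "infdist q K \<le> dist q k" by (rule infdist_le[OF k])
    ultimately show ?thesis using d \<eta> by (simp add: dist_commute[of k q])
  qed
  have int: "?g integrable_on {a..b}" for a b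
    by (intro integrable_diff infdist_integrable)
  have "\<eta> * \<eta> / 9 = integral J (\<lambda>_. \<eta> / 3)"
    using \<eta>(1) by (simp add: J_def)
  also have "\<dots> \<le> integral J ?g"
    using int big unfolding J_def by (intro integral_le integrable_const_ivl)
  also have "\<dots> \<le> integral {0..1} ?g"
    using J int nonneg unfolding J_def by (intro integral_subset_le) auto
  also have "\<dots> = gap_size K' - gap_size K"
    unfolding gap_size_def by (intro integral_diff infdist_integrable)
  finally show ?thesis by simp
qed

lemma gap_size_strict:
  assumes "end_closed K" "end_closed K'" "K' \<subset> K"
  shows "gap_size K < gap_size K'"
proof -
  obtain k where k: "k \<in> K" "k \<notin> K'" using assms by blast
  have pos: "0 < infdist k K'"
    using assms(2) k(2) by (intro infdist_pos_not_in_closed) (auto simp: end_closed_def)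
  have "gap_size K + infdist k K' * infdist k K' / 9 \<le> gap_size K'"
    using gap_size_quantitative[OF assms(1,2) _ k(1) pos] assms(3) by blast
  moreover have "0 < infdist k K' * infdist k K' / 9" using pos by simp
  ultimately show ?thesis by linarith
qed

section \<open>Limits of chains of closed sets\<close>

lemma chain_some_empty:
  fixes S :: "'i \<Rightarrow> real set"
  assumes "\<And>i. i \<in> I \<Longrightarrow> compact (S i)"
    and "\<And>i j. i \<in> I \<Longrightarrow> j \<in> I \<Longrightarrow> S i \<subseteq> S j \<or> S j \<subseteq> S i"
    and "(\<Inter>i\<in>I. S i) = {}"
  shows "\<exists>i\<in>I. S i = {}"
proof (rule ccontr)
  assume *: "\<not> (\<exists>i\<in>I. S i = {})"
  have "\<Inter>(S ` I) \<noteq> {}"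
  proof (rule compact_chain)
    show "compact X" if "X \<in> S ` I" for X using that assms(1) by auto
    show "{} \<notin> S ` I" using * by auto
    show "X \<subseteq> Y \<or> Y \<subseteq> X" if "X \<in> S ` I \<and> Y \<in> S ` I" for X Y
      using that assms(2) by auto
  qed
  then show False using assms(3) by simp
qed

text \<open>The points of the members at distance at least \<epsilon> from the intersection form a
  chain of compact sets with empty intersection, so one of these is empty.\<close>

lemma chain_Inter_close:
  assumes ne: "\<D> \<noteq> {}" and ec: "\<And>K. K \<in> \<D> \<Longrightarrow> end_closed K"
    and chain: "\<And>K L. K \<in> \<D> \<Longrightarrow> L \<in> \<D> \<Longrightarrow> K \<subseteq> L \<or> L \<subseteq> K" and \<epsilon>: "0 < \<epsilon>"
  shows "\<exists>K\<in>\<D>. \<forall>k\<in>K. infdist k (\<Inter>\<D>) \<le> \<epsilon>"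
proof -
  let ?S = "\<lambda>K. K \<inter> {x. \<epsilon> \<le> infdist x (\<Inter>\<D>)}"
  have "\<exists>K\<in>\<D>. ?S K = {}"
  proof (rule chain_some_empty)
    show "compact (?S K)" if "K \<in> \<D>" for K
      by (intro compact_Int_closed end_closed_compact ec that closed_Collect_le continuous_intros)
    show "?S K \<subseteq> ?S L \<or> ?S L \<subseteq> ?S K" if "K \<in> \<D>" "L \<in> \<D>" for K L
      using chain[OF that] by blast
    show "(\<Inter>K\<in>\<D>. ?S K) = {}"
    proof -
      have "x \<notin> (\<Inter>K\<in>\<D>. ?S K)" for x
      proof
        assume x: "x \<in> (\<Inter>K\<in>\<D>. ?S K)"
        then have "x \<in> \<Inter>\<D>" by blast
        then have "infdist x (\<Inter>\<D>) = 0" by (rule infdist_zero)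
        moreover have "\<epsilon> \<le> infdist x (\<Inter>\<D>)" using x ne by blast
        ultimately show False using \<epsilon> by simp
      qed
      then show ?thesis by blast
    qed
  qed
  then obtain K where "K \<in> \<D>" "?S K = {}" by blast
  then show ?thesis by (intro bexI[of _ K] ballI) (auto simp: not_le disjoint_iff intro: less_imp_le)
qed

text \<open>Dually, the points of the closed union at distance at least \<epsilon> from
  \<open>K\<close> form compact sets that shrink as \<open>K\<close> grows, with empty
  intersection.\<close>

lemma chain_Union_close:
  assumes ne: "\<D> \<noteq> {}" and ec: "\<And>K. K \<in> \<D> \<Longrightarrow> end_closed K"
    and chain: "\<And>K L. K \<in> \<D> \<Longrightarrow> L \<in> \<D> \<Longrightarrow> K \<subseteq> L \<or> L \<subseteq> K" and \<epsilon>: "0 < \<epsilon>"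
  shows "\<exists>K\<in>\<D>. \<forall>k\<in>closure (\<Union>\<D>). infdist k K \<le> \<epsilon>"
proof -
  let ?U = "closure (\<Union>\<D>)"
  have U: "compact ?U"
  proof (rule compact_closure[THEN iffD2])
    have "\<Union>\<D> \<subseteq> {0..1}" using ec end_closedD by blast
    then show "bounded (\<Union>\<D>)" by (rule bounded_subset[OF bounded_closed_interval])
  qed
  let ?S = "\<lambda>K. ?U \<inter> {x. \<epsilon> \<le> infdist x K}"
  have "\<exists>K\<in>\<D>. ?S K = {}"
  proof (rule chain_some_empty)
    show "compact (?S K)" if "K \<in> \<D>" for K
      by (intro compact_Int_closed U closed_Collect_le continuous_intros)
    have mono: "?S L \<subseteq> ?S K" if "K \<subseteq> L" "K \<in> \<D>" for K L
    proof
      fix x assume x: "x \<in> ?S L"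
      have "infdist x L \<le> infdist x K"
        using that ec[OF that(2)] by (intro infdist_mono) (auto simp: end_closed_def)
      then show "x \<in> ?S K" using x by auto
    qed
    show "?S K \<subseteq> ?S L \<or> ?S L \<subseteq> ?S K" if "K \<in> \<D>" "L \<in> \<D>" for K L
      using chain[OF that] mono that by blast
    have "x \<notin> (\<Inter>K\<in>\<D>. ?S K)" for x
    proof
      assume x: "x \<in> (\<Inter>K\<in>\<D>. ?S K)"
      then have "x \<in> ?U" using ne by blast
      then obtain y where y: "y \<in> \<Union>\<D>" "dist y x < \<epsilon>" using \<epsilon> closure_approachable by blast
      then obtain K where K: "K \<in> \<D>" "y \<in> K" by blast
      have "infdist x K \<le> dist x y" by (rule infdist_le[OF K(2)])
      moreover have "\<epsilon> \<le> infdist x K" using x K(1) by blast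
      ultimately show False using y(2) by (simp add: dist_commute)
    qed
    then show "(\<Inter>K\<in>\<D>. ?S K) = {}" by blast
  qed
  then obtain K where "K \<in> \<D>" "?S K = {}" by blast
  then show ?thesis by (intro bexI[of _ K] ballI) (auto simp: not_le disjoint_iff intro: less_imp_le)
qed

lemma end_closed_Inter:
  assumes "\<D> \<noteq> {}" "\<And>K. K \<in> \<D> \<Longrightarrow> end_closed K"
  shows "end_closed (\<Inter>\<D>)"
  unfolding end_closed_def
proof (intro conjI closed_Inter ballI)
  show "closed K" if "K \<in> \<D>" for K using assms(2)[OF that] by (simp add: end_closed_def)
  show "\<Inter>\<D> \<subseteq> {0..1}" using assms end_closedD by blast
  show "0 \<in> \<Inter>\<D>" "1 \<in> \<Inter>\<D>" using assms(2) by (auto simp: end_closed_def)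
qed

lemma end_closed_closure_Union:
  assumes "\<D> \<noteq> {}" "\<And>K. K \<in> \<D> \<Longrightarrow> end_closed K"
  shows "end_closed (closure (\<Union>\<D>))"
proof -
  have sub: "\<Union>\<D> \<subseteq> {0..1}" using assms(2) end_closedD by blast
  have "closure (\<Union>\<D>) \<subseteq> {0..1}" by (rule closure_minimal[OF sub]) simp
  moreover have "0 \<in> \<Union>\<D>" "1 \<in> \<Union>\<D>" using assms by (auto simp: end_closed_def)
  ultimately show ?thesis
    using closure_subset[of "\<Union>\<D>"] by (auto simp: end_closed_def)
qed

lemma continuous_map_uniform:
  fixes h :: "'a::metric_space \<Rightarrow> 'b"
  assumes S: "compact S" and h: "continuous_map (top_of_set S) (mtopology_of m) h" and \<epsilon>: "0 < \<epsilon>"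
  shows "\<exists>\<delta>>0. \<forall>x\<in>S. \<forall>y\<in>S. dist x y < \<delta> \<longrightarrow> mdist m (h x) (h y) < \<epsilon>"
proof -
  let ?I = "submetric euclidean_metric S"
  have "continuous_map (mtopology_of ?I) (mtopology_of m) h"
    using h by (simp add: mtopology_of_submetric)
  moreover have "compact_space (mtopology_of ?I)"
    using S by (simp add: mtopology_of_submetric compact_space_subtopology)
  ultimately have "uniformly_continuous_map ?I m h"
    using continuous_eq_uniformly_continuous_map by blast
  then have "\<forall>\<epsilon>>0. \<exists>\<delta>>0. \<forall>x\<in>S. \<forall>y\<in>S. dist y x < \<delta> \<longrightarrow> mdist m (h y) (h x) < \<epsilon>"
    unfolding uniformly_continuous_map_def by simp
  from this[rule_format, OF \<epsilon>] obtain \<delta> where "0 < \<delta>"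
    "\<forall>x\<in>S. \<forall>y\<in>S. dist y x < \<delta> \<longrightarrow> mdist m (h y) (h x) < \<epsilon>"
    by (elim exE conjE)
  then show ?thesis
    by (intro exI[of _ \<delta>] conjI ballI impI) (simp_all add: dist_commute mdist_commute)
qed

text \<open>What collapsing gaps uses of the equivalence \<open>G\<close> of times. Closedness of
  \<open>G\<close> is the property that lets good sets pass to limits.\<close>

locale collapse =
  fixes m :: "'m metric" and f :: "real \<Rightarrow> 'm" and G :: "real \<Rightarrow> real \<Rightarrow> bool"
  assumes f: "pathin (mtopology_of m) f"
    and G_f: "\<And>s t. s \<in> {0..1} \<Longrightarrow> t \<in> {0..1} \<Longrightarrow> G s t \<Longrightarrow> f s = f t"
    and G_refl: "\<And>t. t \<in> {0..1} \<Longrightarrow> G t t"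
    and G_01: "G 0 1"
    and G_closed: "\<And>s t a b. (\<And>n::nat. s n \<in> {0..1} \<and> t n \<in> {0..1} \<and> G (s n) (t n)) \<Longrightarrow>
      s \<longlonglongrightarrow> a \<Longrightarrow> t \<longlonglongrightarrow> b \<Longrightarrow> G a b"
begin

definition Good :: "real set \<Rightarrow> bool" where
  "Good K \<longleftrightarrow> end_closed K \<and> (\<forall>t\<in>{0..1}. G (lo K t) (hi K t))"

definition collapsed :: "real set \<Rightarrow> real \<Rightarrow> 'm" where
  "collapsed K t = f (lo K t)"

lemma Good_end_closed: "Good K \<Longrightarrow> end_closed K"
  by (simp add: Good_def)

lemma f_in: "t \<in> {0..1} \<Longrightarrow> f t \<in> mspace m"
  using continuous_map_image_subset_topspace[of "top_of_set {0..1}" "mtopology_of m" f] f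
  by (auto simp: pathin_def image_subset_iff)

lemma collapsed_hi:
  assumes K: "Good K" and t: "t \<in> {0..1}"
  shows "collapsed K t = f (hi K t)"
  unfolding collapsed_def
  by (rule G_f[OF lo_01[OF Good_end_closed[OF K] t] hi_01[OF Good_end_closed[OF K] t]])
     (use K t in \<open>simp add: Good_def\<close>)

lemma collapsed_in: "Good K \<Longrightarrow> t \<in> {0..1} \<Longrightarrow> collapsed K t \<in> mspace m"
  unfolding collapsed_def by (rule f_in[OF lo_01[OF Good_end_closed]])

lemma collapsed_eq: "Good K \<Longrightarrow> t \<in> K \<Longrightarrow> collapsed K t = f t"
  by (simp add: collapsed_def lo_eq Good_end_closed)

lemma f_uniform:
  assumes "0 < \<epsilon>"
  shows "\<exists>\<delta>>0. \<forall>s\<in>{0..1}. \<forall>t\<in>{0..1}. \<bar>s - t\<bar> < \<delta> \<longrightarrow> mdist m (f s) (f t) < \<epsilon>"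
  using continuous_map_uniform[of "{0..1}" m f, OF _ _ assms] f by (simp add: pathin_def dist_real_def)

text \<open>A Hausdorff limit of good sets is good: the ends of the gaps around \<open>t\<close> of
  the approximating sets converge to the ends of the gap of \<open>K\<close>, and \<open>G\<close>
  is closed.\<close>

lemma Good_limit:
  assumes K: "end_closed K" and approx: "\<And>\<epsilon>. 0 < \<epsilon> \<Longrightarrow> \<exists>L. Good L \<and> (\<forall>x\<in>L. infdist x K \<le> \<epsilon>) \<and> (\<forall>x\<in>K. infdist x L \<le> \<epsilon>)"
  shows "Good K"
  unfolding Good_def
proof (intro conjI ballI K)
  fix t :: real assume t: "t \<in> {0..1}"
  define l h where "l = lo K t" and "h = hi K t"
  have Kne: "K \<noteq> {}" "closed K" using K by (auto simp: end_closed_def)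
  show "G (lo K t) (hi K t)"
  proof (cases "t \<in> K")
    case True
    then show ?thesis using lo_eq[OF K True] hi_eq[OF K True] G_refl[OF t] by simp
  next
    case False
    have l: "l \<in> K" "l \<le> t" and h: "h \<in> K" "t \<le> h"
      unfolding l_def h_def using lo_in[OF K t] lo_le[OF K t] hi_in[OF K t] hi_ge[OF K t] by auto
    have lt: "l < t" "t < h" using l h False by (auto simp: less_le)
    have ex: "\<exists>L. Good L \<and> lo L t \<in> {0..1} \<and> hi L t \<in> {0..1} \<and> \<bar>lo L t - l\<bar> \<le> 2 * \<epsilon> \<and> \<bar>hi L t - h\<bar> \<le> 2 * \<epsilon>"
      if \<epsilon>: "0 < \<epsilon>" "3 * \<epsilon> < t - l" "3 * \<epsilon> < h - t" for \<epsilon>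
    proof -
      obtain L where L: "Good L" "\<forall>x\<in>L. infdist x K \<le> \<epsilon>" "\<forall>x\<in>K. infdist x L \<le> \<epsilon>"
        using approx[OF \<epsilon>(1)] by blast
      have Lc: "end_closed L" using L(1) by (rule Good_end_closed)
      then have Lne: "L \<noteq> {}" "closed L" by (auto simp: end_closed_def)
      \<comment> \<open>\<open>L\<close> is within \<epsilon> of \<open>K\<close>, so it has no
        points deep inside the gap from \<open>l\<close> to \<open>h\<close>; and it has points
        within \<epsilon> of both ends. As \<open>t\<close> is more than 3\<epsilon> from the ends,
        these points lie on the correct sides of \<open>t\<close>.\<close>
      have free: "x \<le> l + \<epsilon> \<or> h - \<epsilon> \<le> x" if "x \<in> L" for x
      proof -
        obtain k where k: "k \<in> K" "infdist x K = dist x k" using infdist_attains_inf[OF Kne(2,1)] by blast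
        have "dist x k \<le> \<epsilon>" using L(2) that k(2) by auto
        moreover have "k \<le> l \<or> h \<le> k" using lo_hi_gap[OF K t k(1)] by (simp add: l_def h_def)
        ultimately show ?thesis by (auto simp: dist_real_def)
      qed
      obtain a where a: "a \<in> L" "infdist l L = dist l a" using infdist_attains_inf[OF Lne(2,1)] by blast
      obtain b where b: "b \<in> L" "infdist h L = dist h b" using infdist_attains_inf[OF Lne(2,1)] by blast
      have ab: "\<bar>l - a\<bar> \<le> \<epsilon>" "\<bar>h - b\<bar> \<le> \<epsilon>" using L(3) l(1) h(1) a(2) b(2) by (auto simp: dist_real_def)
      have "a \<le> t" "t \<le> b" using ab \<epsilon> by linarith+
      have "a \<le> lo L t" by (rule lo_upper[OF Lc t a(1) \<open>a \<le> t\<close>])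
      moreover have "hi L t \<le> b" by (rule hi_lower[OF Lc t b(1) \<open>t \<le> b\<close>])
      moreover have "lo L t \<le> l + \<epsilon>"
        using free[OF lo_in[OF Lc t]] lo_le[OF Lc t] \<epsilon> by linarith
      moreover have "h - \<epsilon> \<le> hi L t"
        using free[OF hi_in[OF Lc t]] hi_ge[OF Lc t] \<epsilon> by linarith
      ultimately show ?thesis
        using ab \<epsilon> L(1) lo_01[OF Lc t] hi_01[OF Lc t] by (intro exI[of _ L] conjI) linarith+
    qed
    define \<epsilon>0 where "\<epsilon>0 = min (t - l) (h - t) / 4"
    have \<epsilon>0: "0 < \<epsilon>0" "3 * \<epsilon>0 < t - l" "3 * \<epsilon>0 < h - t" using lt unfolding \<epsilon>0_def min_def by auto
    have "\<exists>L. Good L \<and> lo L t \<in> {0..1} \<and> hi L t \<in> {0..1} \<and>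
        \<bar>lo L t - l\<bar> \<le> 2 * (\<epsilon>0 / real (Suc n)) \<and> \<bar>hi L t - h\<bar> \<le> 2 * (\<epsilon>0 / real (Suc n))" for n
    proof (rule ex)
      have "\<epsilon>0 / real (Suc n) \<le> \<epsilon>0 / 1" using \<epsilon>0(1) by (intro divide_left_mono) auto
      then show "3 * (\<epsilon>0 / real (Suc n)) < t - l" "3 * (\<epsilon>0 / real (Suc n)) < h - t" using \<epsilon>0 by linarith+
    qed (use \<epsilon>0 in simp)
    then obtain L where L: "\<And>n. Good (L n) \<and> lo (L n) t \<in> {0..1} \<and> hi (L n) t \<in> {0..1} \<and>
        \<bar>lo (L n) t - l\<bar> \<le> 2 * (\<epsilon>0 / real (Suc n)) \<and> \<bar>hi (L n) t - h\<bar> \<le> 2 * (\<epsilon>0 / real (Suc n))"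
      by metis
    have lim: "(\<lambda>n. 2 * (\<epsilon>0 / real (Suc n))) \<longlonglongrightarrow> 0"
      using tendsto_mult_right_zero[OF LIMSEQ_Suc[OF lim_const_over_n[of \<epsilon>0]], of 2] .
    have "(\<lambda>n. lo (L n) t - l) \<longlonglongrightarrow> 0" "(\<lambda>n. hi (L n) t - h) \<longlonglongrightarrow> 0"
      by (rule Lim_null_comparison[OF _ lim]; use L in \<open>auto simp: eventually_sequentially\<close>)+
    then have "(\<lambda>n. lo (L n) t) \<longlonglongrightarrow> l" "(\<lambda>n. hi (L n) t) \<longlonglongrightarrow> h"
      by (auto intro: LIM_zero_cancel)
    moreover have "lo (L n) t \<in> {0..1} \<and> hi (L n) t \<in> {0..1} \<and> G (lo (L n) t) (hi (L n) t)" for n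
      using L[of n] t by (auto simp: Good_def)
    ultimately show ?thesis
      using G_closed[of "\<lambda>n. lo (L n) t" "\<lambda>n. hi (L n) t" l h] by (simp add: l_def h_def)
  qed
qed

lemma Good_Inter:
  assumes "\<D> \<noteq> {}" "\<And>K. K \<in> \<D> \<Longrightarrow> Good K" "\<And>K L. K \<in> \<D> \<Longrightarrow> L \<in> \<D> \<Longrightarrow> K \<subseteq> L \<or> L \<subseteq> K"
  shows "Good (\<Inter>\<D>)"
proof (rule Good_limit)
  have ec: "\<And>K. K \<in> \<D> \<Longrightarrow> end_closed K" using assms(2) Good_end_closed by blast
  show "end_closed (\<Inter>\<D>)" by (rule end_closed_Inter[OF assms(1) ec])
  fix \<epsilon> :: real assume \<epsilon>: "0 < \<epsilon>"
  obtain L where L: "L \<in> \<D>" "\<forall>x\<in>L. infdist x (\<Inter>\<D>) \<le> \<epsilon>"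
    using chain_Inter_close[OF assms(1) ec assms(3) \<epsilon>] by blast
  have 1: "infdist x L \<le> \<epsilon>" if "x \<in> \<Inter>\<D>" for x
  proof -
    have "x \<in> L" using that L(1) by (rule InterD)
    then show ?thesis using \<epsilon> by (simp only: infdist_zero less_imp_le)
  qed
  show "\<exists>L. Good L \<and> (\<forall>x\<in>L. infdist x (\<Inter>\<D>) \<le> \<epsilon>) \<and> (\<forall>x\<in>\<Inter>\<D>. infdist x L \<le> \<epsilon>)"
    by (rule exI[of _ L], intro conjI assms(2) L ballI 1)
qed

lemma Good_closure_Union:
  assumes "\<D> \<noteq> {}" "\<And>K. K \<in> \<D> \<Longrightarrow> Good K" "\<And>K L. K \<in> \<D> \<Longrightarrow> L \<in> \<D> \<Longrightarrow> K \<subseteq> L \<or> L \<subseteq> K"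
  shows "Good (closure (\<Union>\<D>))"
proof (rule Good_limit)
  have ec: "\<And>K. K \<in> \<D> \<Longrightarrow> end_closed K" using assms(2) Good_end_closed by blast
  show "end_closed (closure (\<Union>\<D>))" by (rule end_closed_closure_Union[OF assms(1) ec])
  fix \<epsilon> :: real assume \<epsilon>: "0 < \<epsilon>"
  obtain L where L: "L \<in> \<D>" "\<forall>x\<in>closure (\<Union>\<D>). infdist x L \<le> \<epsilon>"
    using chain_Union_close[OF assms(1) ec assms(3) \<epsilon>] by blast
  have 1: "infdist x (closure (\<Union>\<D>)) \<le> \<epsilon>" if "x \<in> L" for x
  proof -
    have "x \<in> \<Union>\<D>" using L(1) that by (rule UnionI)
    then have "x \<in> closure (\<Union>\<D>)" by (rule subsetD[OF closure_subset])
    then show ?thesis using \<epsilon> by (simp only: infdist_zero less_imp_le)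
  qed
  show "\<exists>L. Good L \<and> (\<forall>x\<in>L. infdist x (closure (\<Union>\<D>)) \<le> \<epsilon>) \<and> (\<forall>x\<in>closure (\<Union>\<D>). infdist x L \<le> \<epsilon>)"
    by (rule exI[of _ L], intro conjI assms(2) L ballI 1)
qed

text \<open>If the values of \<open>gap_size\<close> are close, \<open>lo K t\<close> is near some
  point of \<open>K'\<close> and therefore near one end of the gap of \<open>K'\<close> around
  \<open>t\<close>. Which end it is does not matter, since \<open>f\<close> has the same value at
  both.\<close>

lemma collapsed_close:
  assumes "0 < \<epsilon>"
  shows "\<exists>\<delta>>0. \<forall>K K'. Good K \<longrightarrow> Good K' \<longrightarrow> K' \<subseteq> K \<longrightarrow> gap_size K' - gap_size K < \<delta> \<longrightarrow>
    (\<forall>t\<in>{0..1}. mdist m (collapsed K t) (collapsed K' t) < \<epsilon>)"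
proof -
  obtain \<eta> where \<eta>: "0 < \<eta>" "\<forall>s\<in>{0..1}. \<forall>t\<in>{0..1}. \<bar>s - t\<bar> < \<eta> \<longrightarrow> mdist m (f s) (f t) < \<epsilon>"
    using f_uniform[OF assms] by (elim exE conjE)
  show ?thesis
  proof (intro exI[of _ "\<eta> * \<eta> / 9"] conjI allI impI ballI)
    show "0 < \<eta> * \<eta> / 9" using \<eta>(1) by simp
    fix K K' and t :: real
    assume K: "Good K" and K': "Good K'" and sub: "K' \<subseteq> K" and less: "gap_size K' - gap_size K < \<eta> * \<eta> / 9"
      and t: "t \<in> {0..1}"
    note c = Good_end_closed[OF K] and c' = Good_end_closed[OF K']
    define k where "k = lo K t"
    define l where "l = lo K' t"
    define h where "h = hi K' t"
    have k: "k \<in> K" "k \<le> t" "k \<in> {0..1}" unfolding k_def using lo[OF c t] by auto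
    have l: "l \<in> K'" "l \<in> {0..1}" "l \<le> k" unfolding l_def k_def using lo[OF c' t] lo_antimono[OF c c' sub t] by auto
    have h: "h \<in> K'" "h \<in> {0..1}" "k \<le> h" unfolding h_def using hi[OF c' t] k by auto
    have "\<not> \<eta> \<le> infdist k K'"
      using gap_size_quantitative[OF c c' sub k(1) \<eta>(1)] less by linarith
    moreover obtain x where x: "x \<in> K'" "infdist k K' = dist k x"
      using infdist_attains_inf[of K' k] c' by (auto simp: end_closed_def)
    moreover have "x \<le> l \<or> h \<le> x" using lo_hi_gap[OF c' t x(1)] by (simp add: l_def h_def)
    ultimately have "\<bar>k - l\<bar> < \<eta> \<or> \<bar>k - h\<bar> < \<eta>" using l(3) h(3) by (auto simp: dist_real_def)
    then have "mdist m (f k) (f l) < \<epsilon> \<or> mdist m (f k) (f h) < \<epsilon>" using \<eta>(2) k l h by blast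
    moreover have "f l = f h" using collapsed_hi[OF K' t] by (simp add: collapsed_def l_def h_def)
    ultimately show "mdist m (collapsed K t) (collapsed K' t) < \<epsilon>"
      by (auto simp: collapsed_def k_def l_def)
  qed
qed

text \<open>The modulus of continuity of \<open>f\<close> serves all good sets at once.\<close>

lemma collapsed_continuous:
  assumes "0 < \<epsilon>"
  shows "\<exists>\<delta>>0. \<forall>K. Good K \<longrightarrow> (\<forall>s\<in>{0..1}. \<forall>t\<in>{0..1}. \<bar>s - t\<bar> < \<delta> \<longrightarrow> mdist m (collapsed K s) (collapsed K t) < \<epsilon>)"
proof -
  obtain \<eta> where \<eta>: "0 < \<eta>" "\<forall>s\<in>{0..1}. \<forall>t\<in>{0..1}. \<bar>s - t\<bar> < \<eta> \<longrightarrow> mdist m (f s) (f t) < \<epsilon>"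
    using f_uniform[OF assms] by (elim exE conjE)
  have *: "mdist m (collapsed K s) (collapsed K t) < \<epsilon>"
    if K: "Good K" and s: "s \<in> {0..1}" and t: "t \<in> {0..1}" and st: "s \<le> t" "\<bar>s - t\<bar> < \<eta>" for K s t
  proof -
    note c = Good_end_closed[OF K]
    show ?thesis
    proof (rule lo_cases[OF c s t st(1)])
      assume "lo K s = lo K t"
      then show ?thesis using mdist_self[OF f_in[OF lo_01[OF c t]]] assms by (simp add: collapsed_def)
    next
      assume b: "s \<le> hi K s" "hi K s \<le> lo K t" "lo K t \<le> t"
      then have "\<bar>hi K s - lo K t\<bar> < \<eta>" using st by linarith
      then have "mdist m (f (hi K s)) (f (lo K t)) < \<epsilon>" using \<eta>(2) hi_01[OF c s] lo_01[OF c t] by blast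
      then show ?thesis using collapsed_hi[OF K s] by (simp add: collapsed_def)
    qed
  qed
  show ?thesis
  proof (intro exI[of _ \<eta>] conjI allI impI ballI)
    fix K and s t :: real assume a: "Good K" "s \<in> {0..1}" "t \<in> {0..1}" "\<bar>s - t\<bar> < \<eta>"
    show "mdist m (collapsed K s) (collapsed K t) < \<epsilon>"
    proof (cases "s \<le> t")
      case True
      then show ?thesis using * a by blast
    next
      case False
      then have "mdist m (collapsed K t) (collapsed K s) < \<epsilon>" using *[of K t s] a by (simp add: abs_minus_commute)
      then show ?thesis by (simp add: mdist_commute)
    qed
  qed (rule \<eta>(1))
qed

end

section \<open>Contracting along a maximal chain\<close>

context collapse
begin

text \<open>A jump of the chain from \<open>A\<close> down to \<open>B\<close>. The case
  \<open>A = B\<close> is included; it describes a time at which the chain does not jump.\<close>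

definition consecutive :: "real set \<Rightarrow> real set \<Rightarrow> bool" where
  "consecutive B A \<longleftrightarrow> Good A \<and> Good B \<and> B \<subseteq> A \<and> (\<forall>K. Good K \<longrightarrow> B \<subseteq> K \<longrightarrow> K \<subseteq> A \<longrightarrow> K = A \<or> K = B)"

lemma end_closed_ends: "end_closed {0, 1}" and end_closed_interval: "end_closed {0..1}"
  by (auto simp: end_closed_def)

lemma Good_interval: "Good {0..1}"
  using G_refl by (simp add: Good_def end_closed_interval lo_eq hi_eq)

lemma lo_ends: "0 \<le> t \<Longrightarrow> t < 1 \<Longrightarrow> lo {0, 1} t = 0"
  using lo_in[OF end_closed_ends, of t] lo_le[OF end_closed_ends, of t] by auto

lemma Good_ends: "Good {0, 1}"
  unfolding Good_def
proof (intro conjI ballI end_closed_ends)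
  fix t :: real assume t: "t \<in> {0..1}"
  show "G (lo {0, 1} t) (hi {0, 1} t)"
  proof (cases "t = 0 \<or> t = 1")
    case True
    then show ?thesis
      using lo_eq[OF end_closed_ends, of t] hi_eq[OF end_closed_ends, of t] G_refl[OF t] by auto
  next
    case False
    then have "lo {0, 1} t = 0" "hi {0, 1} t = 1"
      using lo_ends[of t] hi_in[OF end_closed_ends t] hi_ge[OF end_closed_ends t] t by auto
    then show ?thesis using G_01 by simp
  qed
qed

end

text \<open>A maximal chain with a homotopy across each jump. There may be infinitely many jumps,
  and \<open>H_small\<close> is the uniformity under which their homotopies fit together
  continuously.\<close>

locale collapse_chain = collapse +
  fixes CC :: "real set set" and H :: "real set \<Rightarrow> real set \<Rightarrow> real \<times> real \<Rightarrow> 'a"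
  assumes CC_Good: "\<And>K. K \<in> CC \<Longrightarrow> Good K"
    and CC_chain: "\<And>K L. K \<in> CC \<Longrightarrow> L \<in> CC \<Longrightarrow> K \<subseteq> L \<or> L \<subseteq> K"
    and CC_max: "\<And>K. Good K \<Longrightarrow> (\<And>L. L \<in> CC \<Longrightarrow> K \<subseteq> L \<or> L \<subseteq> K) \<Longrightarrow> K \<in> CC"
    and H_cont: "\<And>A B. consecutive B A \<Longrightarrow> continuous_map (top_of_set unit_square) (mtopology_of m) (H B A)"
    and H_0: "\<And>A B t. consecutive B A \<Longrightarrow> t \<in> {0..1} \<Longrightarrow> H B A (0, t) = collapsed A t"
    and H_1: "\<And>A B t. consecutive B A \<Longrightarrow> t \<in> {0..1} \<Longrightarrow> H B A (1, t) = collapsed B t"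
    and H_ends: "\<And>A B s. consecutive B A \<Longrightarrow> s \<in> {0..1} \<Longrightarrow> H B A (s, 0) = f 0"
      "\<And>A B s. consecutive B A \<Longrightarrow> s \<in> {0..1} \<Longrightarrow> H B A (s, 1) = f 1"
    and H_small: "\<And>\<epsilon>. 0 < \<epsilon> \<Longrightarrow> \<exists>\<delta>>0. \<forall>A B. consecutive B A \<longrightarrow> gap_size B - gap_size A < \<delta> \<longrightarrow>
      (\<forall>s\<in>{0..1}. \<forall>t\<in>{0..1}. mdist m (H B A (s, t)) (collapsed A t) < \<epsilon>)"
begin

lemma CC_end_closed: "K \<in> CC \<Longrightarrow> end_closed K"
  using CC_Good Good_end_closed by blast

lemma interval_in_CC: "{0..1} \<in> CC"
  by (rule CC_max[OF Good_interval]) (use CC_end_closed in \<open>auto simp: end_closed_def\<close>)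

lemma ends_in_CC: "{0, 1} \<in> CC"
  by (rule CC_max[OF Good_ends]) (use CC_end_closed in \<open>auto simp: end_closed_def\<close>)

section \<open>The chain parametrized by \<open>gap_size\<close>\<close>

definition total :: real where
  "total = gap_size {0, 1}"

lemma gap_size_interval: "gap_size {0..1} = 0"
proof -
  have "gap_size {0..1} = integral {0..1} (\<lambda>q::real. 0::real)"
    unfolding gap_size_def by (rule integral_cong) simp
  then show ?thesis by simp
qed

lemma gap_size_CC: "K \<in> CC \<Longrightarrow> 0 \<le> gap_size K \<and> gap_size K \<le> total"
  using gap_size_mono[OF CC_end_closed, of K "{0..1}"] gap_size_mono[OF end_closed_ends, of K] CC_end_closed[of K]
  by (auto simp: gap_size_interval total_def end_closed_def)

lemma gap_size_less_iff:
  assumes "K \<in> CC" "L \<in> CC"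
  shows "gap_size K \<le> gap_size L \<longleftrightarrow> L \<subseteq> K"
  using assms CC_chain[OF assms] gap_size_mono[OF CC_end_closed[OF assms(2)], of K]
    gap_size_strict[OF CC_end_closed[OF assms(2)] CC_end_closed[OF assms(1)]] by force

lemma gap_size_eq_iff:
  assumes "K \<in> CC" "L \<in> CC"
  shows "gap_size K = gap_size L \<longleftrightarrow> L = K"
  using gap_size_less_iff[OF assms] gap_size_less_iff[OF assms(2,1)] by force

text \<open>\<open>after z\<close> is the smallest member of the chain with \<open>gap_size\<close>
  at most \<open>z\<close>, and \<open>before z\<close> the greatest one with
  \<open>gap_size\<close> at least \<open>z\<close>, so \<open>before z\<close> is contained in
  \<open>after z\<close>. If \<open>gap_size\<close> takes the value \<open>z\<close> on the chain,
  both are the member where it does; otherwise they are the two sides of a jump.\<close>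

definition after :: "real \<Rightarrow> real set" where
  "after z = \<Inter>{K \<in> CC. gap_size K \<le> z}"

definition before :: "real \<Rightarrow> real set" where
  "before z = closure (\<Union>{K \<in> CC. z \<le> gap_size K})"

text \<open>The intersection is good and comparable with all members, so it belongs to the chain by
  maximality. The bound on \<open>gap_size\<close> survives in the limit because
  \<open>gap_size\<close> is continuous for the Hausdorff distance.\<close>

lemma
  assumes z: "0 \<le> z"
  shows after_in: "after z \<in> CC" and gap_size_after: "gap_size (after z) \<le> z"
    and after_least: "\<And>K. K \<in> CC \<Longrightarrow> gap_size K \<le> z \<Longrightarrow> after z \<subseteq> K"
proof -
  let ?D = "{K \<in> CC. gap_size K \<le> z}"
  have ne: "?D \<noteq> {}" using interval_in_CC gap_size_interval z by auto
  have ec: "end_closed K" if "K \<in> ?D" for K using that CC_end_closed by simp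
  have ch: "K \<subseteq> L \<or> L \<subseteq> K" if "K \<in> ?D" "L \<in> ?D" for K L using that CC_chain by simp
  show least: "after z \<subseteq> K" if "K \<in> CC" "gap_size K \<le> z" for K
    unfolding after_def using that by blast
  have good: "Good (after z)"
    unfolding after_def by (rule Good_Inter[OF ne _ ch]) (use CC_Good in auto)
  show "after z \<in> CC"
  proof (rule CC_max[OF good])
    fix L assume L: "L \<in> CC"
    show "after z \<subseteq> L \<or> L \<subseteq> after z"
    proof (cases "\<exists>K\<in>?D. K \<subseteq> L")
      case True
      then show ?thesis using least by blast
    next
      case False
      then have "L \<subseteq> K" if "K \<in> ?D" for K using CC_chain[of L K] that L by blast
      then show ?thesis unfolding after_def by blast
    qed
  qed
  show "gap_size (after z) \<le> z"
  proof (rule field_le_epsilon)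
    fix e :: real assume "0 < e"
    then obtain K where K: "K \<in> ?D" "\<forall>k\<in>K. infdist k (after z) \<le> e"
      using chain_Inter_close[OF ne ec ch] unfolding after_def by blast
    have "gap_size (after z) \<le> gap_size K + e" using K by (intro gap_size_close ec) auto
    then show "gap_size (after z) \<le> z + e" using K(1) by simp
  qed
qed

lemma
  assumes z: "z \<le> total"
  shows before_in: "before z \<in> CC" and gap_size_before: "z \<le> gap_size (before z)"
    and before_greatest: "\<And>K. K \<in> CC \<Longrightarrow> z \<le> gap_size K \<Longrightarrow> K \<subseteq> before z"
proof -
  let ?D = "{K \<in> CC. z \<le> gap_size K}"
  have ne: "?D \<noteq> {}" using ends_in_CC z by (auto simp: total_def)
  have ec: "end_closed K" if "K \<in> ?D" for K using that CC_end_closed by simp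
  have ch: "K \<subseteq> L \<or> L \<subseteq> K" if "K \<in> ?D" "L \<in> ?D" for K L using that CC_chain by simp
  show greatest: "K \<subseteq> before z" if "K \<in> CC" "z \<le> gap_size K" for K
    unfolding before_def by (rule order_trans[OF _ closure_subset]) (use that in blast)
  have good: "Good (before z)"
    unfolding before_def by (rule Good_closure_Union[OF ne _ ch]) (use CC_Good in auto)
  show "before z \<in> CC"
  proof (rule CC_max[OF good])
    fix L assume L: "L \<in> CC"
    show "before z \<subseteq> L \<or> L \<subseteq> before z"
    proof (cases "\<exists>K\<in>?D. L \<subseteq> K")
      case True
      then show ?thesis using greatest by blast
    next
      case False
      then have "K \<subseteq> L" if "K \<in> ?D" for K using CC_chain[of L K] that L by blast
      then have "\<Union>?D \<subseteq> L" by blast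
      moreover have "closed L" using CC_end_closed[OF L] by (simp add: end_closed_def)
      ultimately show ?thesis unfolding before_def by (intro disjI1 closure_minimal)
    qed
  qed
  show "z \<le> gap_size (before z)"
  proof (rule field_le_epsilon)
    fix e :: real assume "0 < e"
    then obtain K where K: "K \<in> ?D" "\<forall>k\<in>before z. infdist k K \<le> e"
      using chain_Union_close[OF ne ec ch] unfolding before_def by blast
    have "gap_size K \<le> gap_size (before z) + e"
      using K by (intro gap_size_close Good_end_closed good) auto
    then show "z \<le> gap_size (before z) + e" using K(1) by simp
  qed
qed

lemma before_after_sub:
  assumes "0 \<le> z" "z \<le> total"
  shows "before z \<subseteq> after z"
  using gap_size_less_iff[OF after_in before_in] gap_size_after gap_size_before assms order_trans by blast

lemma CC_dichotomy:
  assumes "0 \<le> z" "z \<le> total" "K \<in> CC"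
  shows "after z \<subseteq> K \<or> K \<subseteq> before z"
  using after_least[OF assms(1,3)] before_greatest[OF assms(2,3)] by linarith

text \<open>A good set between the two is comparable with the whole chain, hence a member of it, and
  no member lies strictly between.\<close>

lemma consecutive_before_after:
  assumes z: "0 \<le> z" "z \<le> total"
  shows "consecutive (before z) (after z)"
  unfolding consecutive_def
proof (intro conjI allI impI)
  fix K assume K: "Good K" "before z \<subseteq> K" "K \<subseteq> after z"
  have "K \<in> CC"
    by (rule CC_max[OF K(1)]) (use CC_dichotomy[OF z] K(2,3) in blast)
  then show "K = after z \<or> K = before z"
    using CC_dichotomy[OF z] K(2,3) by blast
qed (use CC_Good after_in[OF z(1)] before_in[OF z(2)] before_after_sub[OF z] in auto)

lemma after_before_CC:
  assumes "K \<in> CC"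
  shows "after (gap_size K) = K" "before (gap_size K) = K"
proof -
  note z = gap_size_CC[OF assms, THEN conjunct1] gap_size_CC[OF assms, THEN conjunct2]
  have a: "after (gap_size K) \<subseteq> K" "K \<subseteq> before (gap_size K)"
    using after_least[OF z(1) assms] before_greatest[OF z(2) assms] by auto
  show "after (gap_size K) = K" "before (gap_size K) = K"
    using a before_after_sub[OF z] by blast+
qed

text \<open>At a value of \<open>gap_size\<close> on the chain this is the stopped loop; between two
  values, across a jump, \<open>H\<close> is run at constant speed.\<close>

definition contraction :: "real \<Rightarrow> real \<Rightarrow> 'a" where
  "contraction z t = (if after z = before z then collapsed (after z) t
     else H (before z) (after z) ((z - gap_size (after z)) / (gap_size (before z) - gap_size (after z)), t))"

lemma contraction_CC: "K \<in> CC \<Longrightarrow> contraction (gap_size K) t = collapsed K t"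
  by (simp add: contraction_def after_before_CC)

text \<open>At both ends of the time interval of a jump the other branch of the definition applies;
  the boundary values of \<open>H\<close> make the formula for the jump valid there as well.\<close>

lemma contraction_gap:
  assumes z: "0 \<le> z" "z \<le> total" and ne: "after z \<noteq> before z"
    and z': "gap_size (after z) \<le> z'" "z' \<le> gap_size (before z)" and t: "t \<in> {0..1}"
  shows "contraction z' t =
    H (before z) (after z) ((z' - gap_size (after z)) / (gap_size (before z) - gap_size (after z)), t)"
proof -
  note A = after_in[OF z(1)] and B = before_in[OF z(2)]
  have lt: "gap_size (after z) < gap_size (before z)"
    using gap_size_eq_iff[OF A B] ne z' by force
  note c = consecutive_before_after[OF z]
  consider "z' = gap_size (after z)" | "z' = gap_size (before z)"
    | "gap_size (after z) < z'" "z' < gap_size (before z)" using z' by linarith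
  then show ?thesis
  proof cases
    case 1
    then show ?thesis using contraction_CC[OF A] H_0[OF c t] by simp
  next
    case 2
    then show ?thesis using contraction_CC[OF B] H_1[OF c t] lt by simp
  next
    case 3
    have z'01: "0 \<le> z'" "z' \<le> total" using 3 gap_size_CC[OF A] gap_size_CC[OF B] by auto
    have "after z' \<subseteq> after z" using after_least[OF z'01(1) A] 3 by simp
    moreover have "\<not> after z' \<subseteq> before z"
      using gap_size_less_iff[OF B after_in[OF z'01(1)]] gap_size_after[OF z'01(1)] 3 by linarith
    ultimately have a: "after z' = after z" using CC_dichotomy[OF z after_in[OF z'01(1)]] by blast
    have "before z \<subseteq> before z'" using before_greatest[OF z'01(2) B] 3 by simp
    moreover have "\<not> after z \<subseteq> before z'"
      using gap_size_less_iff[OF before_in[OF z'01(2)] A] gap_size_before[OF z'01(2)] 3 by linarith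
    ultimately have b: "before z' = before z" using CC_dichotomy[OF z before_in[OF z'01(2)]] by blast
    show ?thesis using ne by (simp add: contraction_def a b)
  qed
qed

text \<open>The time intervals of different jumps overlap in at most an end point, so the lower ends
  of jumps of length at least \<delta> differ by at least \<delta>. Their quotients by \<delta>,
  rounded down, are distinct and bounded.\<close>

lemma finite_big_gaps:
  assumes "0 < \<delta>"
  shows "finite {(before z, after z) | z. 0 \<le> z \<and> z \<le> total \<and> \<delta> \<le> gap_size (before z) - gap_size (after z)}"
    (is "finite ?S")
proof (rule inj_on_finite)
  let ?g = "\<lambda>p. nat \<lfloor>gap_size (snd p :: real set) / \<delta>\<rfloor>"
  show "inj_on ?g ?S"
  proof (rule inj_onI)
    fix p q assume p: "p \<in> ?S" and q: "q \<in> ?S" and e: "?g p = ?g q"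
    obtain y where y: "p = (before y, after y)" "0 \<le> y" "y \<le> total" "\<delta> \<le> gap_size (before y) - gap_size (after y)"
      using p by blast
    obtain z where z: "q = (before z, after z)" "0 \<le> z" "z \<le> total" "\<delta> \<le> gap_size (before z) - gap_size (after z)"
      using q by blast
    note Ay = after_in[OF y(2)] and By = before_in[OF y(3)] and Az = after_in[OF z(2)] and Bz = before_in[OF z(3)]
    have "0 \<le> gap_size (after y) / \<delta>" "0 \<le> gap_size (after z) / \<delta>"
      using gap_size_CC[OF Ay] gap_size_CC[OF Az] assms by auto
    then have fl: "\<lfloor>gap_size (after y) / \<delta>\<rfloor> = \<lfloor>gap_size (after z) / \<delta>\<rfloor>"
      using e by (simp add: y(1) z(1) nat_eq_iff)
    then have "\<bar>gap_size (after y) / \<delta> - gap_size (after z) / \<delta>\<bar> < 1" by linarith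
    then have "\<bar>(gap_size (after y) - gap_size (after z)) / \<delta>\<bar> < 1" by (simp add: diff_divide_distrib)
    then have close: "\<bar>gap_size (after y) - gap_size (after z)\<bar> < \<delta>"
      using assms by (simp add: abs_divide)
    have "\<not> gap_size (before y) \<le> gap_size (after z)" "\<not> gap_size (before z) \<le> gap_size (after y)"
      using close y(4) z(4) by linarith+
    then have n: "\<not> after z \<subseteq> before y" "\<not> after y \<subseteq> before z"
      using gap_size_less_iff[OF By Az] gap_size_less_iff[OF Bz Ay] by auto
    have "after y \<subseteq> after z" "after z \<subseteq> after y"
      using CC_dichotomy[OF y(2,3) Az] CC_dichotomy[OF z(2,3) Ay] n by auto
    then have a: "after y = after z" by blast
    have "\<not> after y \<subseteq> before y"
      using n a by simp
    then have "before z \<subseteq> before y" "before y \<subseteq> before z"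
      using CC_dichotomy[OF y(2,3) Bz] CC_dichotomy[OF z(2,3) By] n a by auto
    then show "p = q" using a y z by blast
  qed
  show "?g ` ?S \<subseteq> {..nat \<lfloor>total / \<delta>\<rfloor>}"
  proof
    fix n assume "n \<in> ?g ` ?S"
    then obtain p where p: "p \<in> ?S" "n = ?g p" by blast
    then obtain z where z: "p = (before z, after z)" "0 \<le> z" by blast
    have "gap_size (after z) / \<delta> \<le> total / \<delta>"
      using gap_size_CC[OF after_in[OF z(2)]] assms by (intro divide_right_mono) auto
    then show "n \<in> {..nat \<lfloor>total / \<delta>\<rfloor>}"
      using p(2) z(1) by (auto intro!: nat_mono floor_mono)
  qed
qed simp

lemma H_in: "consecutive B A \<Longrightarrow> s \<in> {0..1} \<Longrightarrow> t \<in> {0..1} \<Longrightarrow> H B A (s, t) \<in> mspace m"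
  using continuous_map_image_subset_topspace[OF H_cont] by (auto simp: image_subset_iff)

text \<open>Jumps shorter than \<open>\<delta>1\<close> move points little by
  \<open>H_small\<close>; the finitely many others share a modulus of uniform continuity.\<close>

lemma contraction_uniform_gap:
  assumes \<epsilon>: "0 < \<epsilon>"
  shows "\<exists>\<delta>>0. \<forall>z z' t. 0 \<le> z \<longrightarrow> z \<le> total \<longrightarrow> gap_size (after z) \<le> z' \<longrightarrow> z' \<le> gap_size (before z) \<longrightarrow>
    \<bar>z - z'\<bar> < \<delta> \<longrightarrow> t \<in> {0..1} \<longrightarrow> mdist m (contraction z t) (contraction z' t) < \<epsilon>"
proof -
  have "0 < \<epsilon> / 2" using \<epsilon> by simp
  from H_small[OF this] obtain \<delta>1 where \<delta>1: "0 < \<delta>1" "\<forall>A B. consecutive B A \<longrightarrow> gap_size B - gap_size A < \<delta>1 \<longrightarrow>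
      (\<forall>s\<in>{0..1}. \<forall>t\<in>{0..1}. mdist m (H B A (s, t)) (collapsed A t) < \<epsilon> / 2)"
    by (elim exE conjE)
  define S where "S = {(before z, after z) | z. 0 \<le> z \<and> z \<le> total \<and> \<delta>1 \<le> gap_size (before z) - gap_size (after z)}"
  have finS: "finite S" unfolding S_def by (rule finite_big_gaps[OF \<delta>1(1)])
  have "\<exists>\<eta>>0. \<forall>x\<in>unit_square. \<forall>y\<in>unit_square. dist x y < \<eta> \<longrightarrow> mdist m (H (fst p) (snd p) x) (H (fst p) (snd p) y) < \<epsilon>"
    if p: "p \<in> S" for p
  proof -
    obtain z where z: "p = (before z, after z)" "0 \<le> z" "z \<le> total" using p unfolding S_def by blast
    show ?thesis
      using continuous_map_uniform[OF _ H_cont[OF consecutive_before_after[OF z(2,3)]] \<epsilon>] z(1)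
      by (simp add: compact_Times)
  qed
  then obtain \<eta> where \<eta>: "\<And>p. p \<in> S \<Longrightarrow> 0 < \<eta> p"
    "\<And>p x y. p \<in> S \<Longrightarrow> x \<in> unit_square \<Longrightarrow> y \<in> unit_square \<Longrightarrow> dist x y < \<eta> p \<Longrightarrow>
      mdist m (H (fst p) (snd p) x) (H (fst p) (snd p) y) < \<epsilon>"
    by metis
  define \<eta>0 where "\<eta>0 = Min (insert 1 (\<eta> ` S))"
  have \<eta>0: "0 < \<eta>0" "\<And>p. p \<in> S \<Longrightarrow> \<eta>0 \<le> \<eta> p"
    unfolding \<eta>0_def using finS \<eta>(1) by (auto simp: Min_gr_iff)
  show ?thesis
  \<comment> \<open>A jump of length at least \<open>\<delta>1\<close> is rescaled to the unit
    interval, which stretches time by a factor of at most \<open>1 / \<delta>1\<close>.\<close>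
  proof (intro exI[of _ "\<eta>0 * \<delta>1"] conjI allI impI)
    show "0 < \<eta>0 * \<delta>1" using \<eta>0 \<delta>1 by simp
    fix z z' t :: real
    assume z: "0 \<le> z" "z \<le> total" and z': "gap_size (after z) \<le> z'" "z' \<le> gap_size (before z)"
      and zz: "\<bar>z - z'\<bar> < \<eta>0 * \<delta>1" and t: "t \<in> {0..1}"
    note c = consecutive_before_after[OF z]
    note A = after_in[OF z(1)] and B = before_in[OF z(2)]
    let ?a = "gap_size (after z)" and ?b = "gap_size (before z)"
    have az: "?a \<le> z" "z \<le> ?b" using gap_size_after[OF z(1)] gap_size_before[OF z(2)] by auto
    show "mdist m (contraction z t) (contraction z' t) < \<epsilon>"
    proof (cases "after z = before z")
      case True
      then have "z' = z" using az z' by simp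
      moreover have "contraction z t \<in> mspace m"
        using True collapsed_in[OF CC_Good[OF A] t] by (simp add: contraction_def)
      ultimately have "z' = z" "mdist m (contraction z t) (contraction z t) = 0" by (auto intro: mdist_self)
      then show ?thesis using \<epsilon> by simp
    next
      case False
      have lt: "?a < ?b" using gap_size_eq_iff[OF A B] False az by force
      define w where "w x = (x - ?a) / (?b - ?a)" for x
      have w: "w z \<in> {0..1}" "w z' \<in> {0..1}" using az z' lt by (auto simp: w_def)
      have cz: "contraction z t = H (before z) (after z) (w z, t)" "contraction z' t = H (before z) (after z) (w z', t)"
        unfolding w_def by (rule contraction_gap[OF z False _ _ t]; use az z' in simp)+
      show ?thesis
      proof (cases "?b - ?a < \<delta>1")
        case True
        have 1: "mdist m (H (before z) (after z) (w z, t)) (collapsed (after z) t) < \<epsilon> / 2"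
          "mdist m (H (before z) (after z) (w z', t)) (collapsed (after z) t) < \<epsilon> / 2"
          using \<delta>1(2) c True w t by blast+
        have "mdist m (contraction z t) (contraction z' t) \<le>
            mdist m (contraction z t) (collapsed (after z) t) + mdist m (collapsed (after z) t) (contraction z' t)"
          unfolding cz by (intro mdist_triangle H_in[OF c] w t collapsed_in CC_Good A)
        then show ?thesis using 1 mdist_commute[of m "collapsed (after z) t" "contraction z' t"] unfolding cz by linarith
      next
        case False
        then have S: "(before z, after z) \<in> S" using z unfolding S_def by force
        have "w z - w z' = (z - z') / (?b - ?a)" by (simp add: w_def diff_divide_distrib)
        then have "\<bar>w z - w z'\<bar> = \<bar>z - z'\<bar> / (?b - ?a)" using lt by (simp add: abs_divide)
        also have "\<dots> \<le> \<bar>z - z'\<bar> / \<delta>1" using False \<delta>1(1) by (intro divide_left_mono) auto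
        also have "\<dots> < \<eta>0" using zz \<delta>1(1) by (simp add: divide_less_eq)
        also have "\<dots> \<le> \<eta> (before z, after z)" by (rule \<eta>0(2)[OF S])
        finally have "dist (w z, t) (w z', t) < \<eta> (before z, after z)" by (simp add: dist_Pair_Pair dist_real_def)
        then show ?thesis
          using \<eta>(2)[OF S, of "(w z, t)" "(w z', t)"] w t by (simp add: cz)
      qed
    qed
  qed
qed

lemma contraction_in:
  assumes z: "0 \<le> z" "z \<le> total" and t: "t \<in> {0..1}"
  shows "contraction z t \<in> mspace m"
proof (cases "after z = before z")
  case True
  then show ?thesis using collapsed_in[OF CC_Good[OF after_in[OF z(1)]] t] by (simp add: contraction_def)
next
  case False
  have "(z - gap_size (after z)) / (gap_size (before z) - gap_size (after z)) \<in> {0..1}"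
    using gap_size_after[OF z(1)] gap_size_before[OF z(2)] by (auto simp: divide_le_eq_1)
  then show ?thesis
    using False H_in[OF consecutive_before_after[OF z] _ t] by (simp add: contraction_def)
qed

text \<open>Times in different jumps are compared through the end of the first jump and the start of
  the second. Both are members of the chain, and between them \<open>collapsed_close\<close>
  applies; hence three errors of \<epsilon> / 3.\<close>

lemma contraction_uniform:
  assumes \<epsilon>: "0 < \<epsilon>"
  shows "\<exists>\<delta>>0. \<forall>z z' t. 0 \<le> z \<longrightarrow> z \<le> z' \<longrightarrow> z' \<le> total \<longrightarrow> z' - z < \<delta> \<longrightarrow> t \<in> {0..1} \<longrightarrow>
    mdist m (contraction z t) (contraction z' t) < \<epsilon>"
proof -
  have e3: "0 < \<epsilon> / 3" using \<epsilon> by simp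
  from contraction_uniform_gap[OF e3] obtain \<delta>1 where \<delta>1: "0 < \<delta>1"
    "\<forall>z z' t. 0 \<le> z \<longrightarrow> z \<le> total \<longrightarrow> gap_size (after z) \<le> z' \<longrightarrow> z' \<le> gap_size (before z) \<longrightarrow>
      \<bar>z - z'\<bar> < \<delta>1 \<longrightarrow> t \<in> {0..1} \<longrightarrow> mdist m (contraction z t) (contraction z' t) < \<epsilon> / 3"
    by (elim exE conjE)
  from collapsed_close[OF e3] obtain \<delta>2 where \<delta>2: "0 < \<delta>2"
    "\<forall>K K'. Good K \<longrightarrow> Good K' \<longrightarrow> K' \<subseteq> K \<longrightarrow> gap_size K' - gap_size K < \<delta>2 \<longrightarrow>
      (\<forall>t\<in>{0..1}. mdist m (collapsed K t) (collapsed K' t) < \<epsilon> / 3)"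
    by (elim exE conjE)
  show ?thesis
  proof (intro exI[of _ "min \<delta>1 \<delta>2"] conjI allI impI)
    show "0 < min \<delta>1 \<delta>2" using \<delta>1 \<delta>2 by simp
    fix z z' t :: real assume z0: "0 \<le> z" and zz': "z \<le> z'" and z'1: "z' \<le> total"
      and less: "z' - z < min \<delta>1 \<delta>2" and t: "t \<in> {0..1}"
    have z1: "z \<le> total" and z'0: "0 \<le> z'" using z0 zz' z'1 by auto
    note A = after_in[OF z'0] and B = before_in[OF z1]
    have az: "gap_size (after z) \<le> z" "z \<le> gap_size (before z)" "gap_size (after z') \<le> z'" "z' \<le> gap_size (before z')"
      using gap_size_after[OF z0] gap_size_before[OF z1] gap_size_after[OF z'0] gap_size_before[OF z'1] by auto
    show "mdist m (contraction z t) (contraction z' t) < \<epsilon>"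
    proof (cases "z' \<le> gap_size (before z)")
      case True
      have "mdist m (contraction z t) (contraction z' t) < \<epsilon> / 3"
        by (rule \<delta>1(2)[rule_format, OF z0 z1 _ True _ t]) (use az zz' less in auto)
      then show ?thesis using \<epsilon> by simp
    next
      case False
      let ?b = "gap_size (before z)" and ?a = "gap_size (after z')"
      have sub: "after z' \<subseteq> before z" using after_least[OF z'0 B] False by simp
      then have ba: "?b \<le> ?a" using gap_size_less_iff[OF B A] by simp
      have b01: "0 \<le> ?b" "?b \<le> total" and a01: "0 \<le> ?a" "?a \<le> total"
        using gap_size_CC[OF B] gap_size_CC[OF A] by auto
      have 1: "mdist m (contraction z t) (contraction ?b t) < \<epsilon> / 3"
        by (rule \<delta>1(2)[rule_format, OF z0 z1 _ _ _ t]) (use az ba less in auto)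
      have 3: "mdist m (contraction z' t) (contraction ?a t) < \<epsilon> / 3"
        by (rule \<delta>1(2)[rule_format, OF z'0 z'1 _ _ _ t]) (use az ba less in auto)
      have 2: "mdist m (contraction ?b t) (contraction ?a t) < \<epsilon> / 3"
        unfolding contraction_CC[OF A] contraction_CC[OF B]
        by (rule \<delta>2(2)[rule_format, OF CC_Good[OF B] CC_Good[OF A] sub _ t]) (use az less in auto)
      note i = contraction_in[OF z0 z1 t] contraction_in[OF z'0 z'1 t] contraction_in[OF b01 t] contraction_in[OF a01 t]
      have "mdist m (contraction z t) (contraction z' t) \<le>
          mdist m (contraction z t) (contraction ?b t) + mdist m (contraction ?b t) (contraction z' t)"
        by (rule mdist_triangle[OF i(1,3,2)])
      moreover have "mdist m (contraction ?b t) (contraction z' t) \<le>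
          mdist m (contraction ?b t) (contraction ?a t) + mdist m (contraction ?a t) (contraction z' t)"
        by (rule mdist_triangle[OF i(3,4,2)])
      ultimately show ?thesis using 1 2 3 mdist_commute[of m "contraction ?a t" "contraction z' t"] by linarith
    qed
  qed
qed

lemma contraction_continuous_slice:
  assumes z: "0 \<le> z" "z \<le> total" and t: "t \<in> {0..1}" and \<epsilon>: "0 < \<epsilon>"
  shows "\<exists>\<delta>>0. \<forall>t'\<in>{0..1}. \<bar>t - t'\<bar> < \<delta> \<longrightarrow> mdist m (contraction z t) (contraction z t') < \<epsilon>"
proof (cases "after z = before z")
  case True
  obtain \<delta> where "0 < \<delta>" "\<forall>K. Good K \<longrightarrow> (\<forall>s\<in>{0..1}. \<forall>t\<in>{0..1}. \<bar>s - t\<bar> < \<delta> \<longrightarrow> mdist m (collapsed K s) (collapsed K t) < \<epsilon>)"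
    using collapsed_continuous[OF \<epsilon>] by (elim exE conjE)
  then show ?thesis
    using True CC_Good[OF after_in[OF z(1)]] t by (intro exI[of _ \<delta>]) (simp add: contraction_def)
next
  case False
  let ?h = "H (before z) (after z)"
  define w where "w = (z - gap_size (after z)) / (gap_size (before z) - gap_size (after z))"
  have w: "w \<in> {0..1}"
    unfolding w_def using gap_size_after[OF z(1)] gap_size_before[OF z(2)] by (auto simp: divide_le_eq_1)
  have "compact unit_square" by (intro compact_Times compact_Icc)
  from continuous_map_uniform[OF this H_cont[OF consecutive_before_after[OF z]] \<epsilon>] obtain \<delta> where \<delta>: "0 < \<delta>"
    "\<forall>x\<in>unit_square. \<forall>y\<in>unit_square. dist x y < \<delta> \<longrightarrow> mdist m (?h x) (?h y) < \<epsilon>"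
    by (elim exE conjE)
  have "mdist m (?h (w, t)) (?h (w, t')) < \<epsilon>" if "t' \<in> {0..1}" "\<bar>t - t'\<bar> < \<delta>" for t'
    using \<delta>(2) w t that by (auto simp: dist_Pair_Pair dist_real_def)
  then show ?thesis
    using False \<delta>(1) by (intro exI[of _ \<delta>]) (simp add: contraction_def w_def)
qed

lemma continuous_contraction:
  "continuous_map (top_of_set unit_square) (mtopology_of m) (\<lambda>x. contraction (fst x * total) (snd x))"
  unfolding continuous_map_mtopology_of
proof (intro ballI conjI allI impI)
  have tot: "0 \<le> total" using gap_size_CC[OF ends_in_CC] by simp
  have st: "0 \<le> s * total" "s * total \<le> total" if "s \<in> {0..1}" for s
    using that tot mult_right_mono[of s 1 total] by auto
  fix x :: "real \<times> real" assume "x \<in> topspace (top_of_set unit_square)"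
  then have x: "fst x \<in> {0..1}" "snd x \<in> {0..1}" by (auto simp: mem_Times_iff)
  show "contraction (fst x * total) (snd x) \<in> mspace m"
    by (rule contraction_in[OF st[OF x(1)] x(2)])
  fix \<epsilon> :: real assume "0 < \<epsilon>"
  then have e2: "0 < \<epsilon> / 2" by simp
  from contraction_uniform[OF e2] obtain \<delta>1 where \<delta>1: "0 < \<delta>1" "\<forall>z z' t. 0 \<le> z \<longrightarrow> z \<le> z' \<longrightarrow> z' \<le> total \<longrightarrow>
      z' - z < \<delta>1 \<longrightarrow> t \<in> {0..1} \<longrightarrow> mdist m (contraction z t) (contraction z' t) < \<epsilon> / 2"
    by (elim exE conjE)
  from contraction_continuous_slice[OF st[OF x(1)] x(2) e2] obtain \<delta>2 where \<delta>2: "0 < \<delta>2"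
    "\<forall>t'\<in>{0..1}. \<bar>snd x - t'\<bar> < \<delta>2 \<longrightarrow> mdist m (contraction (fst x * total) (snd x)) (contraction (fst x * total) t') < \<epsilon> / 2"
    by (elim exE conjE)
  \<comment> \<open>Adding 1 keeps the divisor positive when all that is known is that
    \<open>total\<close> is nonnegative.\<close>
  define r where "r = min (\<delta>1 / (total + 1)) \<delta>2"
  have r: "0 < r" using \<delta>1 \<delta>2 tot by (simp add: r_def)
  show "\<exists>U. openin (top_of_set unit_square) U \<and> x \<in> U \<and>
      (\<forall>y\<in>U. contraction (fst y * total) (snd y) \<in> mspace m \<and>
        mdist m (contraction (fst x * total) (snd x)) (contraction (fst y * total) (snd y)) < \<epsilon>)"
  proof (intro exI[of _ "unit_square \<inter> ball x r"] conjI ballI)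
    show "openin (top_of_set unit_square) (unit_square \<inter> ball x r)" by (simp add: openin_open_Int)
    show "x \<in> unit_square \<inter> ball x r" using x r by (auto simp: mem_Times_iff)
    fix y assume y: "y \<in> unit_square \<inter> ball x r"
    then have y01: "fst y \<in> {0..1}" "snd y \<in> {0..1}" by (auto simp: mem_Times_iff)
    show yin: "contraction (fst y * total) (snd y) \<in> mspace m"
      by (rule contraction_in[OF st[OF y01(1)] y01(2)])
    have d: "\<bar>fst x - fst y\<bar> < r" "\<bar>snd x - snd y\<bar> < r"
      using y dist_fst_le[of x y] dist_snd_le[of x y] by (auto simp: dist_real_def)
    have "\<bar>fst x - fst y\<bar> * total \<le> \<bar>fst x - fst y\<bar> * (total + 1)" by (intro mult_left_mono) auto
    also have "\<dots> < \<delta>1" using d(1) tot by (simp add: r_def pos_less_divide_eq)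
    finally have d1: "\<bar>fst x * total - fst y * total\<bar> < \<delta>1"
      using tot by (simp add: abs_mult flip: left_diff_distrib)
    have 1: "mdist m (contraction (fst x * total) (snd x)) (contraction (fst x * total) (snd y)) < \<epsilon> / 2"
      using \<delta>2(2) y01(2) d(2) by (simp add: r_def)
    have 2: "mdist m (contraction (fst x * total) (snd y)) (contraction (fst y * total) (snd y)) < \<epsilon> / 2"
    proof (cases "fst x * total \<le> fst y * total")
      case True
      show ?thesis
        by (rule \<delta>1(2)[rule_format, OF st(1)[OF x(1)] True st(2)[OF y01(1)] _ y01(2)]) (use d1 in linarith)
    next
      case False
      then have "mdist m (contraction (fst y * total) (snd y)) (contraction (fst x * total) (snd y)) < \<epsilon> / 2"
        by (intro \<delta>1(2)[rule_format, OF st(1)[OF y01(1)] _ st(2)[OF x(1)] _ y01(2)]) (use d1 in linarith)+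
      then show ?thesis by (simp add: mdist_commute)
    qed
    have "mdist m (contraction (fst x * total) (snd x)) (contraction (fst y * total) (snd y)) \<le>
        mdist m (contraction (fst x * total) (snd x)) (contraction (fst x * total) (snd y)) +
        mdist m (contraction (fst x * total) (snd y)) (contraction (fst y * total) (snd y))"
      by (intro mdist_triangle contraction_in st x y01)
    then show "mdist m (contraction (fst x * total) (snd x)) (contraction (fst y * total) (snd y)) < \<epsilon>"
      using 1 2 by linarith
  qed
qed

lemma contraction_ends:
  assumes z: "0 \<le> z" "z \<le> total"
  shows "contraction z 0 = f 0" "contraction z 1 = f 1"
proof -
  have c: "collapsed K 0 = f 0" "collapsed K 1 = f 1" if "Good K" for K
    using collapsed_eq[OF that] Good_end_closed[OF that] by (auto simp: end_closed_def)
  have w: "(z - gap_size (after z)) / (gap_size (before z) - gap_size (after z)) \<in> {0..1}"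
    using gap_size_after[OF z(1)] gap_size_before[OF z(2)] by (auto simp: divide_le_eq_1)
  show "contraction z 0 = f 0" "contraction z 1 = f 1"
    using c[OF CC_Good[OF after_in[OF z(1)]]] H_ends[OF consecutive_before_after[OF z] w]
    by (cases "after z = before z"; simp add: contraction_def)+
qed

lemma null_homotopic: "loop_homotopic (mtopology_of m) (f 0) f (\<lambda>_. f 0)"
proof (rule loop_homotopicI[OF continuous_contraction])
  have tot: "0 \<le> total" using gap_size_CC[OF ends_in_CC] by simp
  have st: "0 \<le> s * total" "s * total \<le> total" if "s \<in> {0..1}" for s
    using that tot mult_right_mono[of s 1 total] by auto
  have f01: "f 0 = f 1" by (rule G_f[OF _ _ G_01]) auto
  fix t :: real assume t: "t \<in> {0..1}"
  show "contraction (fst (0, t) * total) (snd (0, t)) = f t"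
    using contraction_CC[OF interval_in_CC, of t] collapsed_eq[OF Good_interval t] by (simp add: gap_size_interval)
  have "collapsed {0, 1} t = f 0"
  proof (cases "t = 1")
    case True
    then show ?thesis using collapsed_eq[OF Good_ends, of t] f01 by simp
  next
    case False
    then show ?thesis using lo_ends[of t] t by (simp add: collapsed_def)
  qed
  then show "contraction (fst (1, t) * total) (snd (1, t)) = f 0"
    using contraction_CC[OF ends_in_CC, of t] by (simp add: total_def)
  show "contraction (fst (t, 0) * total) (snd (t, 0)) = f 0"
    using contraction_ends(1)[OF st[OF t]] by simp
  show "contraction (fst (t, 1) * total) (snd (t, 1)) = f 0"
    using contraction_ends(2)[OF st[OF t]] f01 by simp
qed

end

context collapse
begin

lemma maximal_chain_exists:
  "\<exists>CC. (\<forall>K\<in>CC. Good K) \<and> (\<forall>K\<in>CC. \<forall>L\<in>CC. K \<subseteq> L \<or> L \<subseteq> K) \<and>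
    (\<forall>K. Good K \<longrightarrow> (\<forall>L\<in>CC. K \<subseteq> L \<or> L \<subseteq> K) \<longrightarrow> K \<in> CC)"
proof -
  obtain CC where CC: "subset.maxchain {K. Good K} CC"
    using subset.Hausdorff[of "{K. Good K}"] by blast
  have ch: "CC \<subseteq> {K. Good K}" "\<forall>K\<in>CC. \<forall>L\<in>CC. K \<subseteq> L \<or> L \<subseteq> K"
    using CC by (auto simp: subset.maxchain_def subset_chain_def)
  have "K \<in> CC" if K: "Good K" "\<forall>L\<in>CC. K \<subseteq> L \<or> L \<subseteq> K" for K
  proof (rule ccontr)
    assume "K \<notin> CC"
    have "subset.chain {K. Good K} (insert K CC)"
      unfolding subset_chain_def using ch K by blast
    moreover have "CC \<subset> insert K CC" using \<open>K \<notin> CC\<close> by blast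
    ultimately show False using CC by (auto simp: subset.maxchain_def)
  qed
  then show ?thesis using ch by blast
qed

lemma null_homotopic_if_jumps:
  fixes H :: "real set \<Rightarrow> real set \<Rightarrow> real \<times> real \<Rightarrow> 'm"
  assumes "\<And>A B. consecutive B A \<Longrightarrow> continuous_map (top_of_set unit_square) (mtopology_of m) (H B A)"
    and "\<And>A B t. consecutive B A \<Longrightarrow> t \<in> {0..1} \<Longrightarrow> H B A (0, t) = collapsed A t"
    and "\<And>A B t. consecutive B A \<Longrightarrow> t \<in> {0..1} \<Longrightarrow> H B A (1, t) = collapsed B t"
    and "\<And>A B s. consecutive B A \<Longrightarrow> s \<in> {0..1} \<Longrightarrow> H B A (s, 0) = f 0"
    and "\<And>A B s. consecutive B A \<Longrightarrow> s \<in> {0..1} \<Longrightarrow> H B A (s, 1) = f 1"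
    and "\<And>\<epsilon>. 0 < \<epsilon> \<Longrightarrow> \<exists>\<delta>>0. \<forall>A B. consecutive B A \<longrightarrow> gap_size B - gap_size A < \<delta> \<longrightarrow>
      (\<forall>s\<in>{0..1}. \<forall>t\<in>{0..1}. mdist m (H B A (s, t)) (collapsed A t) < \<epsilon>)"
  shows "loop_homotopic (mtopology_of m) (f 0) f (\<lambda>_. f 0)"
proof -
  obtain CC where CC: "\<forall>K\<in>CC. Good K" "\<forall>K\<in>CC. \<forall>L\<in>CC. K \<subseteq> L \<or> L \<subseteq> K"
    "\<forall>K. Good K \<longrightarrow> (\<forall>L\<in>CC. K \<subseteq> L \<or> L \<subseteq> K) \<longrightarrow> K \<in> CC"
    using maximal_chain_exists by (elim exE conjE)
  interpret collapse_chain m f G CC H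
  proof
    show "Good K" if "K \<in> CC" for K using CC(1) that by blast
    show "K \<subseteq> L \<or> L \<subseteq> K" if "K \<in> CC" "L \<in> CC" for K L using CC(2) that by blast
    show "K \<in> CC" if "Good K" "\<And>L. L \<in> CC \<Longrightarrow> K \<subseteq> L \<or> L \<subseteq> K" for K using CC(3) that by blast
  qed (fact assms)+
  show ?thesis by (rule null_homotopic)
qed

end

section \<open>Projecting to an edge of the Cayley tree\<close>

definition edge_pos :: "complex \<Rightarrow> real" where
  "edge_pos w = (if 0 \<le> Im w then (1 - Re w) / 4 else (3 + Re w) / 4)"

text \<open>The point \<open>(u, w)\<close> of the Cayley tree, \<open>w\<close> being the coordinate in the circle of \<open>d\<close> cut at
  \<open>-1\<close>, is projected to the edge from \<open>0\<close> to \<open>d\<close>, which is identified with \<open>[0, 1]\<close>.\<close>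

definition edge :: "'a \<Rightarrow> 'a free_group \<Rightarrow> complex \<Rightarrow> real" where
  "edge d u w =
    (if u = 0 then if 0 \<le> Im w then (1 - Re w) / 4 else 0
     else if u = word_val [(d, True)] then if Im w < 0 then (3 + Re w) / 4 else 1
     else if first_letter u = Some (d, True) then 1 else 0)"

lemma unit_bounds: "cmod w = 1 \<Longrightarrow> - 1 \<le> Re w \<and> Re w \<le> 1"
  using abs_Re_le_cmod[of w] by linarith

lemma edge_pos_bounds: "cmod w = 1 \<Longrightarrow> 0 \<le> edge_pos w \<and> edge_pos w < 1"
proof -
  assume w: "cmod w = 1"
  have "Re w < 1" if "Im w < 0"
  proof (rule ccontr)
    assume "\<not> Re w < 1"
    then have "Re w = 1" using unit_bounds[OF w] by linarith
    then have "(Im w)\<^sup>2 = 0" using cmod_power2[of w] w by simp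
    then show False using that by simp
  qed
  then show ?thesis using unit_bounds[OF w] by (auto simp: edge_pos_def)
qed

lemma edge_pos_inj:
  assumes "cmod v = 1" "cmod w = 1" "edge_pos v = edge_pos w"
  shows "v = w"
proof -
  have vw: "(Re v)\<^sup>2 + (Im v)\<^sup>2 = 1" "(Re w)\<^sup>2 + (Im w)\<^sup>2 = 1"
    using cmod_power2[of v] cmod_power2[of w] assms(1,2) by simp_all
  have half: "edge_pos u \<le> 1/2 \<longleftrightarrow> 0 \<le> Im u" if u: "cmod u = 1" for u
  proof -
    have "- 1 < Re u" if "Im u < 0"
    proof (rule ccontr)
      assume "\<not> - 1 < Re u"
      then have "Re u = - 1" using unit_bounds[OF u] by linarith
      then have "(Im u)\<^sup>2 = 0" using cmod_power2[of u] u by simp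
      then show False using that by simp
    qed
    then show ?thesis using unit_bounds[OF u] by (auto simp: edge_pos_def)
  qed
  have side: "0 \<le> Im v \<longleftrightarrow> 0 \<le> Im w" using half[OF assms(1)] half[OF assms(2)] assms(3) by simp
  then have re: "Re v = Re w" using assms(3) by (auto simp: edge_pos_def split: if_splits)
  then have "(Im v)\<^sup>2 = (Im w)\<^sup>2" using vw by simp
  then have "Im v = Im w" using side by (auto simp: power2_eq_iff)
  then show ?thesis using re by (simp add: complex_eq_iff)
qed

lemma edge_pos_surj:
  assumes "0 < c" "c < 1"
  shows "\<exists>w. cmod w = 1 \<and> w \<noteq> 1 \<and> edge_pos w = c"
proof (cases "c \<le> 1/2")
  case True
  define a where "a = 1 - 4 * c"
  have a: "- 1 \<le> a" "a < 1" using True assms by (auto simp: a_def)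
  then have a2: "a\<^sup>2 \<le> 1" using abs_square_le_1[of a] by (simp add: abs_le_iff)
  let ?w = "Complex a (sqrt (1 - a\<^sup>2))"
  have "cmod ?w = 1" using a2 by (simp add: cmod_def)
  moreover have "edge_pos ?w = c" using a2 by (simp add: edge_pos_def a_def)
  moreover have "?w \<noteq> 1" using a by (simp add: complex_eq_iff)
  ultimately show ?thesis by blast
next
  case False
  define a where "a = 4 * c - 3"
  have a: "- 1 < a" "a < 1" using False assms by (auto simp: a_def)
  then have a2: "a\<^sup>2 < 1" using abs_square_less_1[of a] by (simp add: abs_less_iff)
  let ?w = "Complex a (- sqrt (1 - a\<^sup>2))"
  have "cmod ?w = 1" using a2 by (simp add: cmod_def)
  moreover have "edge_pos ?w = c" using a2 by (simp add: edge_pos_def a_def)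
  moreover have "?w \<noteq> 1" using a by (simp add: complex_eq_iff)
  ultimately show ?thesis by blast
qed

lemma first_letter_letter: "first_letter (word_val [c]) = Some c"
  using first_letter_add_letter[of 0 c] by simp

lemma word_val_False: "word_val [(d, False)] = - word_val [(d, True)]"
  using word_val_inv_letter[of "(d, True)"] by (simp add: inv_letter_def)

lemma edge_1: "edge d u 1 = (if first_letter u = Some (d, True) then 1 else 0)"
  by (simp add: edge_def first_letter_zero first_letter_letter)

text \<open>An edge with another label can leave or reach the root only through another branch, so
  it does not change whether the first letter is \<open>d\<close>.\<close>

lemma edge_other_letter:
  assumes "fst c \<noteq> d"
  shows "edge d (u + word_val [c]) 1 = edge d u 1"
proof -
  have "first_letter (u + word_val [c]) = Some (d, True) \<longleftrightarrow> first_letter u = Some (d, True)"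
  proof -
    have "c \<noteq> (d, True)" "inv_letter c \<noteq> (d, True)" using assms by (auto simp: inv_letter_def)
    moreover have "first_letter (word_val [inv_letter c]) = Some (inv_letter c)"
      by (rule first_letter_letter)
    ultimately show ?thesis
      by (cases "u = 0"; cases "u = word_val [inv_letter c]")
        (auto simp: first_letter_add_letter first_letter_zero first_letter_letter)
  qed
  then show ?thesis by (simp add: edge_1)
qed

text \<open>For a unit vector \<open>1 - \<bar>Re v\<bar>\<close> is at most the square of the
  imaginary part, hence at most its modulus.\<close>

lemma small_arc:
  assumes "cmod v = 1" "\<bar>Im v\<bar> \<le> r" "0 \<le> r"
  shows "0 \<le> Re v \<Longrightarrow> 1 - Re v \<le> r" "Re v \<le> 0 \<Longrightarrow> 1 + Re v \<le> r"
proof -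
  have 1: "(Re v)\<^sup>2 + (Im v)\<^sup>2 = 1" using cmod_power2[of v] assms(1) by simp
  have "\<bar>Im v\<bar> \<le> 1" using abs_Im_le_cmod[of v] assms(1) by simp
  then have "\<bar>Im v\<bar> * \<bar>Im v\<bar> \<le> \<bar>Im v\<bar> * 1" by (intro mult_left_mono) auto
  then have 2: "(Im v)\<^sup>2 \<le> r" using assms(2) by (simp add: power2_eq_square)
  have b: "- 1 \<le> Re v" "Re v \<le> 1" using unit_bounds[OF assms(1)] by auto
  show "1 - Re v \<le> r" if "0 \<le> Re v"
  proof -
    have "Re v * Re v \<le> Re v * 1" using that b by (intro mult_left_mono) auto
    then show ?thesis using 1 2 by (simp add: power2_eq_square)
  qed
  show "1 + Re v \<le> r" if "Re v \<le> 0"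
  proof -
    have "- Re v * - Re v \<le> - Re v * 1" using that b by (intro mult_left_mono) auto
    then show ?thesis using 1 2 by (simp add: power2_eq_square)
  qed
qed

text \<open>At the cut, the first half of the edge from \<open>u\<close> to \<open>u + d\<close> is
  continued by the second half. If \<open>u = 0\<close>, this is the edge projected to, and both
  values are close to 1/2. In the other three cases the edge avoids the interior of that one and
  both values agree.\<close>

lemma edge_crossing_up:
  assumes v: "cmod v = 1" and w: "cmod w = 1" and s: "Re v < 0" "Re w < 0" "0 \<le> Im v" "Im w < 0"
  shows "\<bar>edge d u v - edge d (u + word_val [(d, True)]) w\<bar> \<le> cmod (v - w)"
proof -
  let ?d = "word_val [(d, True)]"
  have im: "\<bar>Im v - Im w\<bar> \<le> cmod (v - w)" using abs_Im_le_cmod[of "v - w"] by simp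
  have nd: "?d + ?d \<noteq> ?d" "?d + ?d \<noteq> 0"
  proof -
    show "?d + ?d \<noteq> ?d" using add_left_cancel[of ?d ?d 0] word_val_letter_neq_0[of "(d, True)"] by simp
    have "first_letter (?d + ?d) = Some (d, True)"
      by (simp add: first_letter_add_letter first_letter_letter word_val_letter_eq_iff)
    then show "?d + ?d \<noteq> 0" using first_letter_zero by (metis option.distinct(1))
  qed
  have first: "first_letter (u + ?d) = (if u = 0 then Some (d, True) else if u = - ?d then None else first_letter u)" for u
    using first_letter_add_letter[of u "(d, True)"] word_val_inv_letter[of "(d, True)"] by simp
  have neg: "- ?d \<noteq> 0" by simp
  have negd: "- ?d \<noteq> ?d"
    using word_val_letter_eq_iff[of "(d, False)" "(d, True)"] by (simp add: word_val_False)
  have firstneg: "first_letter (- ?d) = Some (d, False)"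
    using first_letter_letter[of "(d, False)"] by (simp add: word_val_False)
  consider "u = 0" | "u = ?d" | "u = - ?d" | "u \<noteq> 0" "u \<noteq> ?d" "u \<noteq> - ?d" by blast
  then show ?thesis
  proof cases
    case 1
    have "1 + Re v \<le> cmod (v - w)" "1 + Re w \<le> cmod (v - w)"
      using small_arc(2)[OF v, of "cmod (v - w)"] small_arc(2)[OF w, of "cmod (v - w)"] im s by auto
    moreover have "edge d u v - edge d (u + ?d) w = - ((1 + Re v) + (1 + Re w)) / 4"
      using s 1 by (simp add: edge_def field_simps)
    moreover have "- 1 \<le> Re v" "- 1 \<le> Re w" using unit_bounds v w by auto
    ultimately show ?thesis by (simp add: abs_if)
  next
    case 2
    have "edge d u v = 1" using s 2 by (simp add: edge_def)
    moreover have "edge d (u + ?d) w = 1"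
      using nd first[of ?d] first_letter_letter[of "(d, True)"] negd 2 by (simp add: edge_def)
    ultimately show ?thesis by simp
  next
    case 3
    have "edge d u v = 0" using neg negd firstneg 3 by (simp add: edge_def)
    moreover have "edge d (u + ?d) w = 0" using s 3 by (simp add: edge_def)
    ultimately show ?thesis by simp
  next
    case 4
    have "u + ?d \<noteq> 0" using 4(3) by (metis add_eq_0_iff2)
    moreover have "u + ?d \<noteq> ?d" using add_right_cancel[of u ?d 0] 4(1) by simp
    ultimately show ?thesis using 4 first[of u] by (simp add: edge_def)
  qed
qed

text \<open>Makes the projection continuous along paths. The halves of a circle meet at the cut and
  at the base point; at the latter both values are close to the value at the vertex
  \<open>u\<close>, by \<open>small_arc\<close>.\<close>

lemma edge_crossing:
  assumes v: "cmod v = 1" and w: "cmod w = 1" and vw: "cmod (v - w) < 1 / 2"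
  shows "\<bar>edge d u v - edge d (u + crossing d v w) w\<bar> \<le> cmod (v - w)"
proof -
  have re: "\<bar>Re v - Re w\<bar> \<le> cmod (v - w)" and im: "\<bar>Im v - Im w\<bar> \<le> cmod (v - w)"
    using abs_Re_le_cmod[of "v - w"] abs_Im_le_cmod[of "v - w"] by simp_all
  consider (up) "Re v < 0" "Re w < 0" "0 \<le> Im v" "Im w < 0"
    | (down) "Re v < 0" "Re w < 0" "Im v < 0" "0 \<le> Im w"
    | (same) "0 \<le> Im v \<longleftrightarrow> 0 \<le> Im w"
    | (opp) "0 \<le> Re v \<or> 0 \<le> Re w" "(0 \<le> Im v) \<noteq> (0 \<le> Im w)" by linarith
  then show ?thesis
  proof cases
    case up
    then show ?thesis using edge_crossing_up[OF v w up] by (simp add: crossing_def)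
  next
    case down
    have c: "crossing d v w = - word_val [(d, True)]" using down by (simp add: crossing_def word_val_False)
    show ?thesis
      using edge_crossing_up[OF w v, of d "u + crossing d v w"] down
      by (simp add: c add.assoc abs_minus_commute norm_minus_commute)
  next
    case same
    then have "crossing d v w = 0" by (auto simp: crossing_def)
    moreover have "\<bar>(1 - Re v) / 4 - (1 - Re w) / 4\<bar> \<le> cmod (v - w)"
      "\<bar>(3 + Re v) / 4 - (3 + Re w) / 4\<bar> \<le> cmod (v - w)"
      using re norm_ge_zero[of "v - w"] by (auto simp: abs_le_iff field_simps)
    ultimately show ?thesis
      using same norm_ge_zero[of "v - w"] by (cases "0 \<le> Im v") (simp_all add: edge_def)
  next
    case opp
    have c: "crossing d v w = 0" using opp by (auto simp: crossing_def)
    have ims: "\<bar>Im v\<bar> \<le> cmod (v - w)" "\<bar>Im w\<bar> \<le> cmod (v - w)" using im opp(2) by linarith+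
    have pos: "0 \<le> Re x" if x: "cmod x = 1" "\<bar>Im x\<bar> < 1/2" "- 1/2 < Re x" for x
    proof (rule ccontr)
      assume "\<not> 0 \<le> Re x"
      then have "1 + Re x \<le> \<bar>Im x\<bar>" using small_arc(2)[OF x(1), of "\<bar>Im x\<bar>"] by simp
      then show False using x by linarith
    qed
    have "0 \<le> Re v" "0 \<le> Re w"
      using pos[OF v] pos[OF w] ims vw re opp(1) by linarith+
    then have "1 - Re v \<le> cmod (v - w)" "1 - Re w \<le> cmod (v - w)"
      using small_arc(1)[OF v ims(1)] small_arc(1)[OF w ims(2)] by simp_all
    moreover have "Re v \<le> 1" "Re w \<le> 1" using unit_bounds v w by auto
    ultimately show ?thesis using opp(2) by (auto simp: edge_def c abs_le_iff field_simps)
  qed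
qed

section \<open>The edge function of a path\<close>

context earring
begin

lemma step_letter:
  assumes "q \<in> mspace Q" "coord d q = 1" "step n q q' \<noteq> 0"
  shows "\<exists>c. fst c \<noteq> d \<and> step n q q' = word_val [c]"
proof -
  obtain x u where q: "q = Some (x, u)" and c: "crossing x (coord x q) (coord x q') \<noteq> 0"
    "step n q q' = crossing x (coord x q) (coord x q')"
    using assms(3) by (auto simp: step_def split: option.splits if_splits)
  have "x \<noteq> d" using crossing_neq_0(1)[OF c(1)] assms(2) by auto
  then show ?thesis using crossing_neq_0(3)[OF c(1)] c(2) by (intro exI[of _ "(x, 0 \<le> Im (coord x q))"]) simp
qed

text \<open>If both coordinates are 1, the step is 0 or a letter of another circle, which the
  projection does not see; otherwise it is the crossing in the circle of \<open>d\<close>.\<close>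

lemma edge_step:
  assumes q: "q \<in> mspace Q" "q' \<in> mspace Q" and d: "d \<in> level n" and near: "near n q q'"
  shows "\<bar>edge d u (coord d q) - edge d (u + step n q q') (coord d q')\<bar> \<le> cmod (coord d q - coord d q')"
proof (cases "coord d q = 1 \<and> coord d q' = 1")
  case True
  show ?thesis
  proof (cases "step n q q' = 0")
    case False
    then obtain c where "fst c \<noteq> d" "step n q q' = word_val [c]"
      using step_letter[OF q(1)] True by blast
    then show ?thesis using True edge_other_letter[of c d u] by simp
  qed (simp add: True)
next
  case False
  have "step n q q' = crossing d (coord d q) (coord d q')"
  proof (cases "coord d q = 1")
    case True
    then show ?thesis using step_crossing[OF q d, of q'] False near near_sym[OF near] by simp
  next
    case False
    then show ?thesis using step_crossing[OF q d, of q] near by simp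
  qed
  then show ?thesis
    using edge_crossing[OF norm_coord[OF q(1), of d] norm_coord[OF q(2), of d], of d u] near d
    by (simp add: near_def)
qed

text \<open>The lift of the path to the Cayley tree, translated so that the position at
  \<open>t0\<close> lies on the edge from 0 to \<open>d\<close>, and projected to this edge. A value
  in the open interval from 0 to 1 determines the point of the tree, hence both the position and the
  winding.\<close>

lemma edge_function:
  assumes g: "pathin (mtopology_of Q) g" and d: "d \<in> level n"
    and t0: "t0 \<in> {0..1}" "coord d (g t0) \<noteq> 1"
  obtains e where "continuous_on {0..1} e"
    and "\<forall>s t. g s = g t \<and> winding n g s = winding n g t \<longrightarrow> e s = e t"
    and "\<forall>s\<in>{0..1}. \<forall>t\<in>{0..1}. e s = e t \<and> 0 < e s \<and> e s < 1 \<longrightarrow>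
      g s = g t \<and> winding n g s = winding n g t"
    and "\<forall>t\<in>{0..1}. e t = 0 \<or> e t = 1 \<or> e t = edge_pos (coord d (g t)) \<and> coord d (g t) \<noteq> 1"
    and "e t0 = edge_pos (coord d (g t0))"
proof -
  let ?d = "word_val [(d, True)]"
  let ?c = "\<lambda>t. coord d (g t)"
  \<comment> \<open>The start of the edge that contains the position at \<open>t0\<close>: in the
    upper half of the circle the edge leaves the current vertex, in the lower half it arrives there.
    Translation is on the left, which does not affect the increments on the right.\<close>
  define b where "b = (if 0 \<le> Im (?c t0) then winding n g t0 else winding n g t0 - ?d)"
  define u where "u t = - b + winding n g t" for t
  define e where "e t = edge d (u t) (?c t)" for t
  have inQ: "g t \<in> mspace Q" if "t \<in> {0..1}" for t by (rule path_in_Q[OF g that])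
  have nc: "cmod (?c t) = 1" if "t \<in> {0..1}" for t by (rule norm_coord[OF inQ[OF that]])
  have u0: "u t0 = (if 0 \<le> Im (?c t0) then 0 else ?d)"
    by (simp add: u_def b_def minus_diff_eq)
  have cont: "continuous_on {0..1} e"
    unfolding continuous_on_iff
  proof (intro ballI allI impI)
    fix s \<epsilon> :: real assume s: "s \<in> {0..1}" and \<epsilon>: "0 < \<epsilon>"
    obtain \<delta>1 where \<delta>1: "0 < \<delta>1" "\<forall>s\<in>{0..1}. \<forall>t\<in>{0..1}. \<bar>s - t\<bar> < \<delta>1 \<longrightarrow>
        winding n g t = winding n g s + step n (g s) (g t)"
      using winding(2)[OF g, of n] unfolding local_lift_def by (elim exE conjE)
    obtain \<delta>2 where \<delta>2: "0 < \<delta>2" "\<forall>s\<in>{0..1}. \<forall>t\<in>{0..1}. \<bar>s - t\<bar> < \<delta>2 \<longrightarrow> near n (g s) (g t)"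
      using path_near[OF g, of n] by (elim exE conjE)
    have "\<exists>\<delta>>0. \<forall>x\<in>{0..1}. \<forall>y\<in>{0..1}. dist x y < \<delta> \<longrightarrow> (\<forall>d\<in>level n. cmod (coord d (g x) - coord d (g y)) < \<epsilon>)"
      by (rule uniformly_near[OF _ _ \<epsilon>]) (use g in \<open>simp_all add: pathin_def\<close>)
    then obtain \<delta>3 where \<delta>3: "0 < \<delta>3" "\<forall>x\<in>{0..1}. \<forall>y\<in>{0..1}. dist x y < \<delta>3 \<longrightarrow>
        (\<forall>d\<in>level n. cmod (coord d (g x) - coord d (g y)) < \<epsilon>)"
      by (elim exE conjE)
    show "\<exists>\<delta>>0. \<forall>t\<in>{0..1}. dist t s < \<delta> \<longrightarrow> dist (e t) (e s) < \<epsilon>"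
    proof (intro exI[of _ "min \<delta>1 (min \<delta>2 \<delta>3)"] conjI ballI impI)
      show "0 < min \<delta>1 (min \<delta>2 \<delta>3)" using \<delta>1 \<delta>2 \<delta>3 by simp
      fix t :: real assume t: "t \<in> {0..1}" and "dist t s < min \<delta>1 (min \<delta>2 \<delta>3)"
      then have st: "\<bar>s - t\<bar> < \<delta>1" "\<bar>s - t\<bar> < \<delta>2" "dist s t < \<delta>3" by (auto simp: dist_real_def)
      have "u t = u s + step n (g s) (g t)"
        using \<delta>1(2)[rule_format, OF s t st(1)] by (simp add: u_def add.assoc)
      then have "\<bar>e s - e t\<bar> \<le> cmod (?c s - ?c t)"
        using edge_step[OF inQ[OF s] inQ[OF t] d \<delta>2(2)[rule_format, OF s t st(2)], of "u s"] by (simp add: e_def)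
      also have "\<dots> < \<epsilon>" using \<delta>3(2)[rule_format, OF s t st(3) d] .
      finally show "dist (e t) (e s) < \<epsilon>" by (simp add: dist_real_def)
    qed
  qed
  have cases: "e t = 0 \<or> e t = 1 \<or> e t = edge_pos (?c t) \<and> ?c t \<noteq> 1 \<and>
      u t = (if 0 \<le> Im (?c t) then 0 else ?d)" for t
    by (auto simp: e_def edge_def edge_pos_def)
  have inj: "g s = g t \<and> winding n g s = winding n g t"
    if s: "s \<in> {0..1}" and t: "t \<in> {0..1}" and st: "e s = e t" "0 < e s" "e s < 1" for s t
  proof -
    have es: "e s = edge_pos (?c s)" "?c s \<noteq> 1" "u s = (if 0 \<le> Im (?c s) then 0 else ?d)"
      using cases[of s] st by auto
    have et: "e t = edge_pos (?c t)" "u t = (if 0 \<le> Im (?c t) then 0 else ?d)"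
      using cases[of t] st by auto
    have c: "?c s = ?c t" using edge_pos_inj[OF nc[OF s] nc[OF t]] es(1) et(1) st(1) by simp
    have "g s = g t" by (rule coord_eqI[OF inQ[OF s] inQ[OF t] c es(2)])
    moreover have "u s = u t" using es(3) et(2) c by simp
    ultimately show ?thesis by (simp add: u_def)
  qed
  show thesis
  proof (rule that[OF cont])
    show "\<forall>s t. g s = g t \<and> winding n g s = winding n g t \<longrightarrow> e s = e t"
      by (simp add: e_def u_def)
    show "\<forall>s\<in>{0..1}. \<forall>t\<in>{0..1}. e s = e t \<and> 0 < e s \<and> e s < 1 \<longrightarrow>
        g s = g t \<and> winding n g s = winding n g t"
      by (intro ballI impI inj) auto
    show "\<forall>t\<in>{0..1}. e t = 0 \<or> e t = 1 \<or> e t = edge_pos (?c t) \<and> ?c t \<noteq> 1"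
      using cases by blast
    show "e t0 = edge_pos (?c t0)"
      by (simp add: e_def u0 edge_def edge_pos_def)
  qed
qed

end

section \<open>Jumps of a loop without winding\<close>

context collapse
begin

text \<open>Describes gaps by neighbouring points of \<open>K\<close> instead of times inside them,
  the form in which sets are cut and joined below.\<close>

lemma Good_iff:
  "Good K \<longleftrightarrow> end_closed K \<and> (\<forall>a\<in>K. \<forall>b\<in>K. a < b \<longrightarrow> K \<inter> {a<..<b} = {} \<longrightarrow> G a b)"
proof (intro iffI conjI ballI impI)
  assume K: "Good K"
  then show ec: "end_closed K" by (rule Good_end_closed)
  fix a b assume ab: "a \<in> K" "b \<in> K" "a < b" "K \<inter> {a<..<b} = {}"
  let ?t = "(a + b) / 2"
  have t: "?t \<in> {0..1}" "a \<le> ?t" "?t \<le> b" "a < ?t" "?t < b"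
    using end_closedD[OF ec ab(1)] end_closedD[OF ec ab(2)] ab(3) by (auto simp: field_simps)
  have "lo K ?t = a"
    using lo_upper[OF ec t(1) ab(1) t(2)] lo_in[OF ec t(1)] lo_le[OF ec t(1)] ab(4) t(5)
    by (fastforce simp: disjoint_iff)
  moreover have "hi K ?t = b"
    using hi_lower[OF ec t(1) ab(2) t(3)] hi_in[OF ec t(1)] hi_ge[OF ec t(1)] ab(4) t(4)
    by (fastforce simp: disjoint_iff)
  ultimately show "G a b" using K t(1) unfolding Good_def by fastforce
next
  assume K: "end_closed K \<and> (\<forall>a\<in>K. \<forall>b\<in>K. a < b \<longrightarrow> K \<inter> {a<..<b} = {} \<longrightarrow> G a b)"
  then have ec: "end_closed K" by simp
  show "Good K"
    unfolding Good_def
  proof (intro conjI ballI ec)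
    fix t :: real assume t: "t \<in> {0..1}"
    show "G (lo K t) (hi K t)"
    proof (cases "t \<in> K")
      case True
      then show ?thesis using lo_eq[OF ec True] hi_eq[OF ec True] G_refl[OF t] by simp
    next
      case False
      have "lo K t \<noteq> t" "hi K t \<noteq> t" using lo_in[OF ec t] hi_in[OF ec t] False by auto
      then have "lo K t < hi K t" using lo_le[OF ec t] hi_ge[OF ec t] by linarith
      moreover have "K \<inter> {lo K t<..<hi K t} = {}"
        using lo_hi_gap[OF ec t] by fastforce
      ultimately show ?thesis using K lo_in[OF ec t] hi_in[OF ec t] by blast
    qed
  qed
qed

text \<open>Since \<open>l\<close> and \<open>h\<close> belong to both sets, no gap straddles them:
  gaps between \<open>l\<close> and \<open>h\<close> are gaps of \<open>A\<close>, all others are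
  gaps of \<open>B\<close>.\<close>

lemma Good_splice:
  assumes A: "Good A" and B: "Good B" "B \<subseteq> A" and lh: "l \<in> B" "h \<in> B"
  shows "Good (B \<union> (A \<inter> {l..h}))"
  unfolding Good_iff
proof (intro conjI ballI impI)
  let ?K = "B \<union> (A \<inter> {l..h})"
  have ec: "end_closed A" "end_closed B" using A B(1) Good_end_closed by auto
  then show "end_closed ?K" by (auto simp: end_closed_def)
  fix a b assume ab: "a \<in> ?K" "b \<in> ?K" "a < b" and gap: "?K \<inter> {a<..<b} = {}"
  have l: "\<not> (a < l \<and> l < b)" and h: "\<not> (a < h \<and> h < b)" using gap lh by auto
  show "G a b"
  proof (cases "l \<le> a \<and> a < h")
    case True
    then have b: "b \<le> h" using h ab(3) by linarith
    have "a \<in> A" "b \<in> A" using ab B(2) by auto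
    moreover have "A \<inter> {a<..<b} = {}"
    proof -
      have "A \<inter> {a<..<b} \<subseteq> ?K \<inter> {a<..<b}" using True b by auto
      then show ?thesis using gap by blast
    qed
    ultimately show ?thesis using A ab(3) unfolding Good_iff by blast
  next
    case False
    have "a \<in> B" using False ab(1) lh by (cases "a = h") auto
    moreover have "b \<in> B"
    proof (cases "b = l")
      case False
      then show ?thesis using \<open>\<not> (l \<le> a \<and> a < h)\<close> l ab by auto
    qed (use lh in simp)
    moreover have "B \<inter> {a<..<b} = {}" using gap by blast
    ultimately show ?thesis using B(1) ab(3) unfolding Good_iff by blast
  qed
qed

text \<open>A gap that is not already one of \<open>A\<close> must be the removed interval itself,
  whose ends are equivalent by assumption.\<close>

lemma Good_remove:
  assumes A: "Good A" and t: "t1 \<in> A" "t2 \<in> A" "G t1 t2"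
  shows "Good (A - {t1<..<t2})"
  unfolding Good_iff
proof (intro conjI ballI impI)
  let ?K = "A - {t1<..<t2}"
  have ec: "end_closed A" using A Good_end_closed by auto
  show "end_closed ?K"
    using ec end_closedD[OF ec t(1)] end_closedD[OF ec t(2)] closed_Diff[of A "{t1<..<t2}"]
    by (auto simp: end_closed_def)
  fix a b assume ab: "a \<in> ?K" "b \<in> ?K" "a < b" and gap: "?K \<inter> {a<..<b} = {}"
  show "G a b"
  proof (cases "A \<inter> {a<..<b} = {}")
    case True
    then show ?thesis using A ab unfolding Good_iff by blast
  next
    case False
    then obtain x where x: "x \<in> A" "a < x" "x < b" by auto
    then have "t1 < x" "x < t2" using gap by auto
    then have "a \<le> t1" "t2 \<le> b" using ab x by auto
    moreover have "t1 \<notin> {a<..<b}" "t2 \<notin> {a<..<b}" using gap t by auto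
    ultimately have "a = t1" "b = t2" using x \<open>t1 < x\<close> \<open>x < t2\<close> by auto
    then show ?thesis using t(3) by simp
  qed
qed

text \<open>Inserting \<open>t\<close> splits one gap of \<open>B\<close> into two, and the
  assumptions are exactly the conditions on these.\<close>

lemma Good_insert:
  assumes B: "Good B" and t: "t \<in> {0..1}" "G (lo B t) t" "G t (hi B t)"
  shows "Good (insert t B)"
  unfolding Good_iff
proof (intro conjI ballI impI)
  let ?K = "insert t B"
  have ec: "end_closed B" using B Good_end_closed by auto
  then show "end_closed ?K" using t(1) by (auto simp: end_closed_def)
  fix a b assume ab: "a \<in> ?K" "b \<in> ?K" "a < b" and gap: "?K \<inter> {a<..<b} = {}"
  consider "a = t" | "b = t" | "a \<in> B" "b \<in> B" using ab by blast
  then show "G a b"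
  proof cases
    case 1
    then have b: "b \<in> B" "t \<le> b" using ab by auto
    then have "hi B t \<le> b" by (rule hi_lower[OF ec t(1)])
    moreover have "hi B t \<notin> {a<..<b}" using gap hi_in[OF ec t(1)] by auto
    ultimately consider "hi B t = b" | "hi B t = t" using 1 hi_ge[OF ec t(1)] by force
    then show ?thesis
    proof cases
      case 2
      then have "t \<in> B" using hi_in[OF ec t(1)] by simp
      moreover have "B \<inter> {a<..<b} = {}" using gap by blast
      ultimately show ?thesis using B b ab(3) 1 unfolding Good_iff by blast
    qed (use t 1 in simp)
  next
    case 2
    then have a: "a \<in> B" "a \<le> t" using ab by auto
    then have "a \<le> lo B t" by (rule lo_upper[OF ec t(1)])
    moreover have "lo B t \<notin> {a<..<b}" using gap lo_in[OF ec t(1)] by auto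
    ultimately consider "lo B t = a" | "lo B t = t" using 2 lo_le[OF ec t(1)] by force
    then show ?thesis
    proof cases
      case 2
      then have "t \<in> B" using lo_in[OF ec t(1)] by simp
      moreover have "B \<inter> {a<..<b} = {}" using gap by blast
      ultimately show ?thesis using B a ab(3) \<open>b = t\<close> unfolding Good_iff by blast
    qed (use t 2 in simp)
  next
    case 3
    moreover have "B \<inter> {a<..<b} = {}" using gap by blast
    ultimately show ?thesis using B ab(3) unfolding Good_iff by blast
  qed
qed

lemma consecutiveD:
  "consecutive B A \<Longrightarrow> Good K \<Longrightarrow> B \<subseteq> K \<Longrightarrow> K \<subseteq> A \<Longrightarrow> K = A \<or> K = B"
  by (simp add: consecutive_def)

lemma continuous_on_lo:
  fixes e :: "real \<Rightarrow> real"
  assumes e: "continuous_on {0..1} e" and A: "Good A"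
    and eG: "\<And>s t. s \<in> {0..1} \<Longrightarrow> t \<in> {0..1} \<Longrightarrow> G s t \<Longrightarrow> e s = e t"
  shows "continuous_on {0..1} (\<lambda>t. e (lo A t))"
proof -
  note c = Good_end_closed[OF A]
  have lohi: "e (lo A t) = e (hi A t)" if t: "t \<in> {0..1}" for t
    by (rule eG[OF lo_01[OF c t] hi_01[OF c t]]) (use A t in \<open>simp add: Good_def\<close>)
  have u: "uniformly_continuous_on {0..1} e"
    by (rule compact_uniformly_continuous[OF e]) simp
  have "uniformly_continuous_on {0..1} (\<lambda>t. e (lo A t))"
    unfolding uniformly_continuous_on_def
  proof (intro allI impI)
    fix \<epsilon> :: real assume \<epsilon>: "0 < \<epsilon>"
    obtain \<delta> where \<delta>: "0 < \<delta>" "\<forall>s\<in>{0..1}. \<forall>t\<in>{0..1}. dist t s < \<delta> \<longrightarrow> dist (e t) (e s) < \<epsilon>"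
      using u[unfolded uniformly_continuous_on_def, rule_format, OF \<epsilon>] by (elim exE conjE)
    have *: "dist (e (lo A t)) (e (lo A s)) < \<epsilon>"
      if s: "s \<in> {0..1}" and t: "t \<in> {0..1}" and st: "s \<le> t" "dist t s < \<delta>" for s t
    proof (rule lo_cases[OF c s t st(1)])
      assume "lo A s = lo A t"
      then show ?thesis using \<epsilon> by simp
    next
      assume "s \<le> hi A s" "hi A s \<le> lo A t" "lo A t \<le> t"
      then have "dist (lo A t) (hi A s) < \<delta>" using st by (simp add: dist_real_def)
      then show ?thesis using \<delta>(2) hi_01[OF c s] lo_01[OF c t] lohi[OF s] by simp
    qed
    show "\<exists>\<delta>>0. \<forall>s\<in>{0..1}. \<forall>t\<in>{0..1}. dist t s < \<delta> \<longrightarrow> dist (e (lo A t)) (e (lo A s)) < \<epsilon>"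
    proof (intro exI[of _ \<delta>] conjI ballI impI)
      fix s t :: real assume st: "s \<in> {0..1}" "t \<in> {0..1}" "dist t s < \<delta>"
      show "dist (e (lo A t)) (e (lo A s)) < \<epsilon>"
      proof (cases "s \<le> t")
        case True
        then show ?thesis using * st by blast
      next
        case False
        then have "dist (e (lo A s)) (e (lo A t)) < \<epsilon>" using *[of t s] st by (simp add: dist_commute)
        then show ?thesis by (simp add: dist_commute)
      qed
    qed (rule \<delta>(1))
  qed
  then show ?thesis by (rule uniformly_continuous_imp_continuous)
qed

text \<open>The function stopped during the gaps of \<open>A\<close> is still continuous, and all
  its values are values at times of \<open>A\<close>. So intermediate values are attained on
  \<open>A\<close>, even if \<open>A\<close> is totally disconnected.\<close>

lemma intermediate_value_Good:
  fixes e :: "real \<Rightarrow> real"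
  assumes e: "continuous_on {0..1} e" and A: "Good A"
    and eG: "\<And>s t. s \<in> {0..1} \<Longrightarrow> t \<in> {0..1} \<Longrightarrow> G s t \<Longrightarrow> e s = e t"
    and st: "s \<in> A" "t \<in> A" "s \<le> t" and y: "min (e s) (e t) \<le> y" "y \<le> max (e s) (e t)"
  shows "\<exists>k\<in>A \<inter> {s..t}. e k = y"
proof -
  note c = Good_end_closed[OF A]
  have s01: "s \<in> {0..1}" and t01: "t \<in> {0..1}" using end_closedD[OF c] st by auto
  have "continuous_on {s..t} (\<lambda>t. e (lo A t))"
    by (rule continuous_on_subset[OF continuous_on_lo[OF e A eG]]) (use s01 t01 in auto)
  moreover have "lo A s = s" "lo A t = t" using lo_eq[OF c] st by auto
  ultimately obtain x where x: "s \<le> x" "x \<le> t" "e (lo A x) = y"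
    using IVT'[of "\<lambda>t. e (lo A t)" s y t] IVT2'[of "\<lambda>t. e (lo A t)" t y s] st(3) y
    by (cases "e s \<le> e t") (auto simp: min_def max_def)
  have x01: "x \<in> {0..1}" using x s01 t01 by auto
  have "lo A x \<in> A \<inter> {s..t}"
    using lo_in[OF c x01] lo_le[OF c x01] lo_upper[OF c x01 st(1) x(1)] x(2) by auto
  then show ?thesis using x(3) by blast
qed

end

lemma edge_pos_pos:
  assumes "cmod w = 1" "w \<noteq> 1"
  shows "0 < edge_pos w"
proof -
  have "edge_pos w \<noteq> edge_pos 1" using edge_pos_inj[OF assms(1), of 1] assms(2) by auto
  then show ?thesis using edge_pos_bounds[OF assms(1)] by (simp add: edge_pos_def)
qed

section \<open>Equivalent times of a loop without winding\<close>

locale null_loop = earring +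
  fixes f :: "real \<Rightarrow> 'a \<times> complex"
  assumes path: "pathin (mtopology_of E) f" and closed_path: "f 0 = f 1"
    and null: "\<And>n. winding n (\<sigma> \<circ> f) 1 = 0"
begin

definition same :: "nat \<Rightarrow> real \<Rightarrow> real \<Rightarrow> bool" where
  "same n s t \<longleftrightarrow> f s = f t \<and> winding n (\<sigma> \<circ> f) s = winding n (\<sigma> \<circ> f) t"

lemma path_Q: "pathin (mtopology_of Q) (\<sigma> \<circ> f)"
  using pathin_compose[OF path continuous_map_sigma] .

lemma path_in_E: "t \<in> {0..1} \<Longrightarrow> f t \<in> mspace E"
  using path continuous_map_image_subset_topspace[of "top_of_set {0..1}" "mtopology_of E" f]
  by (auto simp: pathin_def image_subset_iff)

text \<open>By continuity \<open>f a = f b\<close>, so the windings at \<open>a\<close> and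
  \<open>b\<close> arise from those at nearby equivalent times by adding the same step. The
  assumption holds only eventually because the pairs will be equivalent at levels that grow with
  \<open>k\<close>.\<close>

lemma same_limit:
  assumes st: "\<And>k. s k \<in> {0..1}" "\<And>k. t k \<in> {0..1}" and lim: "s \<longlonglongrightarrow> a" "t \<longlonglongrightarrow> b"
    and same: "\<forall>\<^sub>F k in sequentially. same n (s k) (t k)"
  shows "same n a b"
proof -
  let ?g = "\<sigma> \<circ> f"
  have ab: "a \<in> {0..1}" "b \<in> {0..1}"
    using closed_sequentially[OF closed_atLeastAtMost _ lim(1)] closed_sequentially[OF closed_atLeastAtMost _ lim(2)] st
    by blast+
  have close: "\<exists>k. same n (s k) (t k) \<and> \<bar>s k - a\<bar> < \<delta> \<and> \<bar>t k - b\<bar> < \<delta>" if \<delta>: "0 < \<delta>" for \<delta>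
  proof -
    have "\<forall>\<^sub>F k in sequentially. dist (s k) a < \<delta>" "\<forall>\<^sub>F k in sequentially. dist (t k) b < \<delta>"
      using lim \<delta> by (auto intro: tendstoD)
    then have "\<forall>\<^sub>F k in sequentially. same n (s k) (t k) \<and> \<bar>s k - a\<bar> < \<delta> \<and> \<bar>t k - b\<bar> < \<delta>"
      using same by eventually_elim (auto simp: dist_real_def)
    then show ?thesis by (rule eventually_happens'[OF sequentially_bot])
  qed
  have fab: "f a = f b"
  proof (rule ccontr)
    assume "f a \<noteq> f b"
    then have pos: "0 < mdist E (f a) (f b) / 2"
      using mdist_pos[OF path_in_E[OF ab(1)] path_in_E[OF ab(2)]] by simp
    obtain \<delta> where \<delta>: "0 < \<delta>" "\<forall>x\<in>{0..1}. \<forall>y\<in>{0..1}. dist x y < \<delta> \<longrightarrow> mdist E (f x) (f y) < mdist E (f a) (f b) / 2"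
      using continuous_map_uniform[OF _ _ pos, of "{0..1}" E f] path by (auto simp: pathin_def)
    obtain k where k: "same n (s k) (t k)" "\<bar>s k - a\<bar> < \<delta>" "\<bar>t k - b\<bar> < \<delta>" using close[OF \<delta>(1)] by blast
    have "mdist E (f a) (f (s k)) < mdist E (f a) (f b) / 2" "mdist E (f (t k)) (f b) < mdist E (f a) (f b) / 2"
      using \<delta>(2) k(2,3) ab st by (simp_all add: dist_real_def abs_minus_commute)
    moreover have "mdist E (f a) (f b) \<le> mdist E (f a) (f (s k)) + mdist E (f (t k)) (f b)"
      using mdist_triangle[of "f a" E "f (s k)" "f b"] path_in_E ab st k(1) by (simp add: same_def)
    ultimately show False by linarith
  qed
  obtain \<delta> where \<delta>: "0 < \<delta>" "\<forall>s\<in>{0..1}. \<forall>t\<in>{0..1}. \<bar>s - t\<bar> < \<delta> \<longrightarrow>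
      winding n ?g t = winding n ?g s + step n (?g s) (?g t)"
    using winding(2)[OF path_Q, of n] unfolding local_lift_def by (elim exE conjE)
  obtain k where k: "same n (s k) (t k)" "\<bar>s k - a\<bar> < \<delta>" "\<bar>t k - b\<bar> < \<delta>" using close[OF \<delta>(1)] by blast
  have "winding n ?g a = winding n ?g (s k) + step n (?g (s k)) (?g a)"
    "winding n ?g b = winding n ?g (t k) + step n (?g (t k)) (?g b)"
    using \<delta>(2)[rule_format, OF st(1) ab(1) k(2)] \<delta>(2)[rule_format, OF st(2) ab(2) k(3)] by simp_all
  then show ?thesis using fab k(1) by (simp add: same_def)
qed

sublocale collapse E f "\<lambda>s t. \<forall>n. same n s t"
proof
  show "pathin (mtopology_of E) f" by (rule path)
  show "\<forall>n. same n a b" if "\<And>k::nat. s k \<in> {0..1} \<and> t k \<in> {0..1} \<and> (\<forall>n. same n (s k) (t k))"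
    "s \<longlonglongrightarrow> a" "t \<longlonglongrightarrow> b" for s t a b
    using that(1) by (intro allI same_limit[OF _ _ that(2,3)]) auto
  show "\<forall>n. same n 0 1" using closed_path null winding(1)[OF path_Q] by (simp add: same_def)
qed (auto simp: same_def)

lemma same_mono:
  assumes "same m s t" "n \<le> m" "s \<in> {0..1}" "t \<in> {0..1}"
  shows "same n s t"
  using assms winding_restrict[OF path_Q assms(2)] by (simp add: same_def)

lemma sigma_eq_imp_eq:
  assumes "\<sigma> y = \<sigma> z" "\<sigma> y \<noteq> None"
  shows "y = z"
  using assms by (auto simp: quotient_map_sigma_def split: prod.splits if_splits)

lemma coord_path_limit:
  assumes "d \<in> D" "\<And>k. s k \<in> {0..1}" "s \<longlonglongrightarrow> a" "closed S" "\<And>k. coord d (\<sigma> (f (s k))) \<in> S"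
  shows "coord d (\<sigma> (f a)) \<in> S"
proof -
  have "continuous_map (top_of_set {0..1}) euclidean (coord d \<circ> (\<sigma> \<circ> f))"
    using path_Q continuous_map_coord[OF assms(1)] unfolding pathin_def by (rule continuous_map_compose)
  then have c: "continuous_on {0..1} (\<lambda>t. coord d (\<sigma> (f t)))" by (simp add: o_def)
  have a: "a \<in> {0..1}" using closed_sequentially[OF closed_atLeastAtMost _ assms(3)] assms(2) by blast
  have "(\<lambda>k. coord d (\<sigma> (f (s k)))) \<longlonglongrightarrow> coord d (\<sigma> (f a))"
    by (rule continuous_on_tendsto_compose[OF c assms(3) a eventuallyI]) (rule assms(2))
  then show ?thesis by (rule closed_sequentially[OF assms(4) assms(5)])
qed

text \<open>Splicing \<open>A\<close> into the single gap of \<open>B\<close> around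
  \<open>t0\<close> gives a good set that is larger than \<open>B\<close>, hence \<open>A\<close>
  itself: a jump fills exactly one gap.\<close>

lemma jump_structure:
  assumes c: "consecutive B A" and t0: "t0 \<in> A" "t0 \<notin> B"
  shows "A = B \<union> (A \<inter> {lo B t0..hi B t0})" "lo B t0 < t0" "t0 < hi B t0" "f (lo B t0) = f (hi B t0)"
proof -
  have A: "Good A" and B: "Good B" "B \<subseteq> A" using c by (auto simp: consecutive_def)
  note ec = Good_end_closed[OF B(1)]
  have t01: "t0 \<in> {0..1}" using end_closedD[OF Good_end_closed[OF A] t0(1)] .
  have lh: "lo B t0 \<in> B" "hi B t0 \<in> B" "lo B t0 \<le> t0" "t0 \<le> hi B t0"
    using lo_in[OF ec t01] hi_in[OF ec t01] lo_le[OF ec t01] hi_ge[OF ec t01] .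
  then show "lo B t0 < t0" "t0 < hi B t0" using t0(2) by (auto simp: less_le)
  have "Good (B \<union> (A \<inter> {lo B t0..hi B t0}))" by (rule Good_splice[OF A B lh(1,2)])
  moreover have "t0 \<in> B \<union> (A \<inter> {lo B t0..hi B t0})" using t0 lh by simp
  then have "B \<union> (A \<inter> {lo B t0..hi B t0}) \<noteq> B" using t0(2) by metis
  ultimately show "A = B \<union> (A \<inter> {lo B t0..hi B t0})"
    using consecutiveD[OF c, of "B \<union> (A \<inter> {lo B t0..hi B t0})"] B(2) by simp
  show "f (lo B t0) = f (hi B t0)" using collapsed_hi[OF B(1) t01] by (simp add: collapsed_def)
qed

text \<open>The edge functions of all levels agree at \<open>t0\<close> with the position \<open>c\<close> in its circle, and at
  the ends of the gap they take one of the values \<open>0\<close>, \<open>1\<close> and \<open>a\<close>. Hence they all pass through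
  one of two values \<open>c0\<close>, \<open>c1\<close> separating \<open>c\<close> from \<open>0\<close>, \<open>1\<close> and \<open>a\<close>, on both sides of \<open>t0\<close>.\<close>

lemma separating_positions:
  fixes a c :: real
  assumes "0 \<le> a" "a < 1" "0 < c" "c < 1"
  obtains c0 c1 where "0 < c0" "c0 < c" "c < c1" "c1 < 1" "c0 \<noteq> a" "c1 \<noteq> a"
    "\<forall>y. y = 0 \<or> y = 1 \<or> y = a \<longrightarrow> y \<noteq> c \<longrightarrow> y < c0 \<or> c1 < y"
proof
  let ?c0 = "if a < c then (a + c) / 2 else c / 2" and ?c1 = "if c < a then (a + c) / 2 else (1 + c) / 2"
  show "0 < ?c0" "?c0 < c" "c < ?c1" "?c1 < 1" "?c0 \<noteq> a" "?c1 \<noteq> a" using assms by auto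
  show "\<forall>y. y = 0 \<or> y = 1 \<or> y = a \<longrightarrow> y \<noteq> c \<longrightarrow> y < ?c0 \<or> ?c1 < y" using assms by auto
qed

text \<open>At each level the edge function takes one of the two separating values before and after
  \<open>t0\<close>, at times equivalent for this level. A limit of such pairs is equivalent for all
  levels. As the separating values do not depend on the level, they persist in the limit and keep
  \<open>f t1\<close> different from \<open>f t0\<close> and from the value at the gap ends.\<close>

lemma jump_return:
  assumes c: "consecutive B A" and t0: "t0 \<in> A" "t0 \<notin> B" and d: "d \<in> D" "coord d (\<sigma> (f t0)) \<noteq> 1"
    and ns: "\<not> (\<forall>n. same n (lo B t0) t0)"
  shows "\<exists>t1\<in>A \<inter> {lo B t0..t0}. \<exists>t2\<in>A \<inter> {t0..hi B t0}.
    (\<forall>n. same n t1 t2) \<and> f t1 \<noteq> f t0 \<and> f t1 \<noteq> f (lo B t0)"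
proof -
  define l h where "l = lo B t0" and "h = hi B t0"
  let ?g = "\<sigma> \<circ> f"
  let ?c = "\<lambda>t. coord d (\<sigma> (f t))"
  have A: "Good A" and B: "Good B" "B \<subseteq> A" using c by (auto simp: consecutive_def)
  note ec = Good_end_closed[OF B(1)] and eA = Good_end_closed[OF A]
  have t01: "t0 \<in> {0..1}" using end_closedD[OF eA t0(1)] .
  have lh: "l \<in> A" "h \<in> A" "l \<in> {0..1}" "h \<in> {0..1}" "l \<le> t0" "t0 \<le> h"
    using lo[OF ec t01] hi[OF ec t01] B(2) by (auto simp: l_def h_def)
  have nc: "cmod (?c t) = 1" if "t \<in> {0..1}" for t
    using norm_coord[OF path_in_Q[OF path_Q that], of d] by simp
  have samelh: "same n l h" for n using B(1) t01 by (simp add: Good_def l_def h_def)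
  obtain n0 where n0: "\<not> same n0 l t0" using ns by (auto simp: l_def)
    have pos: "0 < edge_pos (?c t0)" "edge_pos (?c t0) < 1"
    using edge_pos_bounds[OF nc[OF t01]] edge_pos_pos[OF nc[OF t01] d(2)] by auto
  have bl: "0 \<le> edge_pos (?c l)" "edge_pos (?c l) < 1" using edge_pos_bounds[OF nc[OF lh(3)]] by simp_all
  obtain c0 c1 where cc: "0 < c0" "c0 < edge_pos (?c t0)" "edge_pos (?c t0) < c1" "c1 < 1"
      "c0 \<noteq> edge_pos (?c l)" "c1 \<noteq> edge_pos (?c l)"
    and sep: "\<forall>y. y = 0 \<or> y = 1 \<or> y = edge_pos (?c l) \<longrightarrow> y \<noteq> edge_pos (?c t0) \<longrightarrow> y < c0 \<or> c1 < y"
    by (rule separating_positions[OF bl pos])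
  obtain w0 where w0: "cmod w0 = 1" "w0 \<noteq> 1" "edge_pos w0 = c0" using edge_pos_surj[of c0] cc by auto
  obtain w1 where w1: "cmod w1 = 1" "w1 \<noteq> 1" "edge_pos w1 = c1" using edge_pos_surj[of c1] cc by auto
  \<comment> \<open>From this level on the circle of \<open>d\<close> is seen and the left end of
    the gap is distinguished from \<open>t0\<close>.\<close>
  define N where "N = max n0 (\<nu> d)"
  have "\<exists>t1\<in>A \<inter> {l..t0}. \<exists>t2\<in>A \<inter> {t0..h}. same n t1 t2 \<and> ?c t1 \<in> {w0, w1}" if n: "N \<le> n" for n
  proof -
    have dn: "d \<in> level n" using d(1) n by (simp add: level_def N_def)
    have nsn: "\<not> same n l t0" using same_mono[of n l t0 n0] n0 n lh(3) t01 by (auto simp: N_def)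
    have ct0: "coord d (?g t0) \<noteq> 1" using d(2) by simp
    obtain e where e: "continuous_on {0..1} e"
      and e1: "\<forall>s t. ?g s = ?g t \<and> winding n ?g s = winding n ?g t \<longrightarrow> e s = e t"
      and e2: "\<forall>s\<in>{0..1}. \<forall>t\<in>{0..1}. e s = e t \<and> 0 < e s \<and> e s < 1 \<longrightarrow>
        ?g s = ?g t \<and> winding n ?g s = winding n ?g t"
      and e3: "\<forall>t\<in>{0..1}. e t = 0 \<or> e t = 1 \<or> e t = edge_pos (coord d (?g t)) \<and> coord d (?g t) \<noteq> 1"
      and e4: "e t0 = edge_pos (coord d (?g t0))"
      by (rule edge_function[OF path_Q dn t01 ct0])
    have eG: "e s = e t" if "\<forall>n. same n s t" for s t
    proof (rule e1[rule_format, OF conjI])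
      have "same n s t" using that by blast
      then show "?g s = ?g t" "winding n ?g s = winding n ?g t" by (simp_all add: same_def)
    qed
    have e5: "same n s t \<and> ?c s = w" if st: "s \<in> {0..1}" "t \<in> {0..1}" "e s = y" "e t = y"
      and w: "cmod w = 1" "edge_pos w = y" "0 < y" "y < 1" for s t y w
    proof -
      have g: "?g s = ?g t" "winding n ?g s = winding n ?g t" using e2[rule_format, OF st(1,2)] st w by auto
      have cs: "e s = edge_pos (?c s)" "?c s \<noteq> 1" using e3[rule_format, OF st(1)] st w by auto
      then have "\<sigma> (f s) \<noteq> None" by (auto simp: coord_def split: option.splits)
      then have "f s = f t" using g(1) sigma_eq_imp_eq[of "f s" "f t"] by simp
      moreover have "?c s = w" using edge_pos_inj[OF nc[OF st(1)] w(1)] cs st w by simp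
      ultimately show ?thesis using g(2) by (simp add: same_def)
    qed
    have el: "e l \<noteq> edge_pos (?c t0)"
    proof
      assume "e l = edge_pos (?c t0)"
      then have "same n t0 l" using e5[OF t01 lh(3), of "edge_pos (?c t0)" "?c t0"] e4 nc[OF t01] pos by simp
      then show False using nsn by (simp add: same_def)
    qed
    have elh: "e l = e h" using eG samelh by blast
    have IV: "\<exists>t1\<in>A \<inter> {l..t0}. \<exists>t2\<in>A \<inter> {t0..h}. same n t1 t2 \<and> ?c t1 = w"
      if w: "cmod w = 1" "edge_pos w = y" "0 < y" "y < 1"
        and y: "min (e l) (e t0) \<le> y" "y \<le> max (e l) (e t0)" for y w
    proof -
      obtain t1 where t1: "t1 \<in> A \<inter> {l..t0}" "e t1 = y"
        using intermediate_value_Good[OF e A eG lh(1) t0(1) lh(5) y] by blast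
      obtain t2 where t2: "t2 \<in> A \<inter> {t0..h}" "e t2 = y"
        using intermediate_value_Good[OF e A eG t0(1) lh(2) lh(6), of y] y elh
        by (auto simp: min.commute max.commute)
      have "same n t1 t2 \<and> ?c t1 = w"
        by (rule e5[of _ _ y]) (use t1 t2 lh t01 w in auto)
      then show ?thesis using t1(1) t2(1) by blast
    qed
    have "e l < c0 \<or> c1 < e l" using sep[rule_format, of "e l"] el e3[rule_format, OF lh(3)] by auto
    then show ?thesis
    proof
      assume "e l < c0"
      then show ?thesis using IV[OF w0(1,3)] cc e4 by fastforce
    next
      assume "c1 < e l"
      then show ?thesis using IV[OF w1(1,3)] cc e4 by fastforce
    qed
  qed
  then have "\<exists>t1 t2. t1 \<in> A \<inter> {l..t0} \<and> t2 \<in> A \<inter> {t0..h} \<and> same (N + n) t1 t2 \<and> ?c t1 \<in> {w0, w1}" for n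
    by (meson le_add1)
  then obtain T1 T2 where T: "\<And>n. T1 n \<in> A \<inter> {l..t0} \<and> T2 n \<in> A \<inter> {t0..h} \<and> same (N + n) (T1 n) (T2 n) \<and> ?c (T1 n) \<in> {w0, w1}"
    by metis
  have cA: "compact (A \<inter> {l..t0})" "compact (A \<inter> {t0..h})"
    using end_closed_compact[OF eA] by (auto intro: compact_Int_closed)
  have "\<forall>n. (T1 n, T2 n) \<in> (A \<inter> {l..t0}) \<times> (A \<inter> {t0..h})" using T by blast
  then obtain z r where z: "z \<in> (A \<inter> {l..t0}) \<times> (A \<inter> {t0..h})" and r: "strict_mono r"
    "((\<lambda>n. (T1 n, T2 n)) \<circ> r) \<longlonglongrightarrow> z"
    by (rule seq_compactE[OF compact_Times[OF cA, unfolded compact_eq_seq_compact_metric]])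
  obtain t1 t2 where z12: "z = (t1, t2)" by (cases z)
  have lim: "(\<lambda>n. T1 (r n)) \<longlonglongrightarrow> t1" "(\<lambda>n. T2 (r n)) \<longlonglongrightarrow> t2"
    using tendsto_fst[OF r(2)] tendsto_snd[OF r(2)] by (simp_all add: z12 o_def)
  have T01: "T1 n \<in> {0..1}" "T2 n \<in> {0..1}" for n using T[of n] end_closedD[OF eA] by auto
  have "same n t1 t2" for n
  proof (rule same_limit[OF T01(1) T01(2) lim])
    have "same n (T1 (r k)) (T2 (r k))" if "n \<le> k" for k
    proof (rule same_mono[OF _ _ T01])
      show "same (N + r k) (T1 (r k)) (T2 (r k))" using T by blast
      show "n \<le> N + r k" using seq_suble[OF r(1), of k] that by linarith
    qed
    then show "\<forall>\<^sub>F k in sequentially. same n (T1 (r k)) (T2 (r k))"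
      unfolding eventually_sequentially by blast
  qed
  moreover have ct1: "?c t1 \<in> {w0, w1}"
    by (rule coord_path_limit[OF d(1) T01(1) lim(1)]) (use T in auto)
  then have "edge_pos (?c t1) \<in> {c0, c1}" using w0 w1 by auto
  then have "f t1 \<noteq> f t0 \<and> f t1 \<noteq> f l" using cc by auto
  ultimately show ?thesis using z unfolding z12 l_def h_def by blast
qed

text \<open>If \<open>t0\<close> is equivalent to the ends of the gap, inserting it into
  \<open>B\<close> already yields \<open>A\<close>, and the jump does not change the loop. Otherwise
  removing the interval between the two return times from \<open>A\<close> gives a good set strictly
  between \<open>B\<close> and \<open>A\<close>, which is impossible.\<close>

lemma jump_off_base:
  assumes c: "consecutive B A" and t0: "t0 \<in> A" "t0 \<notin> B" and off: "\<sigma> (f t0) \<noteq> None"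
    and k: "k \<in> A \<inter> {lo B t0..hi B t0}"
  shows "f k = f (lo B t0)"
proof -
  have A: "Good A" and B: "Good B" "B \<subseteq> A" using c by (auto simp: consecutive_def)
  note ec = Good_end_closed[OF B(1)] and eA = Good_end_closed[OF A]
  have t01: "t0 \<in> {0..1}" using end_closedD[OF eA t0(1)] .
  note js = jump_structure[OF c t0]
  obtain d u where du: "\<sigma> (f t0) = Some (d, u)" using off by auto
  have "\<sigma> (f t0) \<in> mspace Q" using path_in_Q[OF path_Q t01] by simp
  then have d: "d \<in> D" "coord d (\<sigma> (f t0)) \<noteq> 1"
    using p_nz by (auto simp: du mspace_Q coord_def)
  show ?thesis
  proof (cases "\<forall>n. same n (lo B t0) t0")
    case True
    have G: "\<forall>n. same n (lo B t0) (hi B t0)" using B(1) t01 by (simp add: Good_def)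
    have "Good (insert t0 B)"
      by (rule Good_insert[OF B(1) t01 True]) (use G True in \<open>simp add: same_def\<close>)
    then have "A = insert t0 B" using consecutiveD[OF c, of "insert t0 B"] B(2) t0 by auto
    then consider "k = t0" | "k \<in> B" using k by blast
    then show ?thesis
    proof cases
      case 1
      then show ?thesis using True by (simp add: same_def)
    next
      case 2
      then have "k = lo B t0 \<or> k = hi B t0" using lo_hi_gap[OF ec t01 2] k by auto
      then show ?thesis using js(4) by auto
    qed
  next
    case False
    obtain t1 t2 where t: "t1 \<in> A \<inter> {lo B t0..t0}" "t2 \<in> A \<inter> {t0..hi B t0}" "\<forall>n. same n t1 t2"
      "f t1 \<noteq> f t0" "f t1 \<noteq> f (lo B t0)"
      using jump_return[OF c t0 d False] by blast
    have f12: "f t1 = f t2" using t(3) by (simp add: same_def)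
    have t12: "lo B t0 < t1" "t1 < t0" "t0 < t2" "t2 < hi B t0"
      using t js(4) f12 by (auto simp: less_le)
    have "Good (A - {t1<..<t2})" by (rule Good_remove[OF A _ _ t(3)]) (use t in auto)
    moreover have "B \<subseteq> A - {t1<..<t2}"
      using B(2) lo_hi_gap[OF ec t01] t12 by fastforce
    moreover have "A - {t1<..<t2} \<noteq> A" using t0(1) t12 by auto
    ultimately have "A - {t1<..<t2} = B" using consecutiveD[OF c, of "A - {t1<..<t2}"] by auto
    then have "t1 \<in> B" using t(1) by auto
    then show ?thesis using lo_hi_gap[OF ec t01] t12 by fastforce
  qed
qed

text \<open>Inside the gap a jump that changes the loop stays in the base, by
  \<open>jump_off_base\<close>. If the ends of the gap were off the base, the edge function would
  have to take a value strictly between 0 and 1 at a time of \<open>A\<close> inside the gap, which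
  is then off the base as well.\<close>

lemma jump_cases:
  assumes c: "consecutive B A" and t0: "t0 \<in> A" "t0 \<notin> B"
  shows "(\<forall>k\<in>A \<inter> {lo B t0..hi B t0}. f k = f (lo B t0)) \<or> (\<forall>k\<in>A \<inter> {lo B t0..hi B t0}. \<sigma> (f k) = None)"
proof (rule ccontr)
  assume "\<not> ?thesis"
  then obtain k0 k where k0: "k0 \<in> A \<inter> {lo B t0..hi B t0}" "f k0 \<noteq> f (lo B t0)"
    and k: "k \<in> A \<inter> {lo B t0..hi B t0}" "\<sigma> (f k) \<noteq> None" by blast
  have A: "Good A" and B: "Good B" "B \<subseteq> A" using c by (auto simp: consecutive_def)
  note ec = Good_end_closed[OF B(1)] and eA = Good_end_closed[OF A]
  have t01: "t0 \<in> {0..1}" using end_closedD[OF eA t0(1)] .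
  note js = jump_structure[OF c t0]
  have inner: "\<sigma> (f t) = None" if t: "t \<in> A" "lo B t0 < t" "t < hi B t0" for t
  proof (rule ccontr)
    assume off: "\<sigma> (f t) \<noteq> None"
    have t'01: "t \<in> {0..1}" using end_closedD[OF eA t(1)] .
    have tB: "t \<notin> B" using lo_hi_gap[OF ec t01, of t] t by auto
    have "lo B t0 \<le> lo B t" "hi B t \<le> hi B t0"
      using lo_upper[OF ec t'01 lo_in[OF ec t01]] hi_lower[OF ec t'01 hi_in[OF ec t01]] t by auto
    moreover have "lo B t \<le> lo B t0" "hi B t0 \<le> hi B t"
      using lo_hi_gap[OF ec t01 lo_in[OF ec t'01]] lo_hi_gap[OF ec t01 hi_in[OF ec t'01]]
        lo_le[OF ec t'01] hi_ge[OF ec t'01] t by auto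
    ultimately have "lo B t = lo B t0" "hi B t = hi B t0" by auto
    then show False using jump_off_base[OF c t(1) tB off, of k0] k0 by simp
  qed
  let ?l = "lo B t0"
  have l: "?l \<in> A" "?l \<in> {0..1}" using lo_in[OF ec t01] lo_01[OF ec t01] B(2) by auto
  have "k = ?l \<or> k = hi B t0" using inner[of k] k by force
  then have "\<sigma> (f ?l) \<noteq> None" using k(2) js(4) by auto
  then obtain d u where du: "\<sigma> (f ?l) = Some (d, u)" by auto
  have "\<sigma> (f ?l) \<in> mspace Q" using path_in_Q[OF path_Q l(2)] by simp
  then have d: "d \<in> D" "coord d ((\<sigma> \<circ> f) ?l) \<noteq> 1"
    using p_nz by (auto simp: du mspace_Q coord_def)
  then have dn: "d \<in> level (\<nu> d)" by (simp add: level_def)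
  obtain e where e: "continuous_on {0..1} e"
    and e1: "\<forall>s t. (\<sigma> \<circ> f) s = (\<sigma> \<circ> f) t \<and> winding (\<nu> d) (\<sigma> \<circ> f) s = winding (\<nu> d) (\<sigma> \<circ> f) t \<longrightarrow> e s = e t"
    and e2: "\<forall>s\<in>{0..1}. \<forall>t\<in>{0..1}. e s = e t \<and> 0 < e s \<and> e s < 1 \<longrightarrow>
      (\<sigma> \<circ> f) s = (\<sigma> \<circ> f) t \<and> winding (\<nu> d) (\<sigma> \<circ> f) s = winding (\<nu> d) (\<sigma> \<circ> f) t"
    and e3: "\<forall>t\<in>{0..1}. e t = 0 \<or> e t = 1 \<or> e t = edge_pos (coord d ((\<sigma> \<circ> f) t)) \<and> coord d ((\<sigma> \<circ> f) t) \<noteq> 1"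
    and e4: "e ?l = edge_pos (coord d ((\<sigma> \<circ> f) ?l))"
    by (rule edge_function[OF path_Q dn l(2) d(2)])
  have eG: "e s = e t" if "\<forall>n. same n s t" for s t
  proof (rule e1[rule_format, OF conjI])
    have "same (\<nu> d) s t" using that by blast
    then show "(\<sigma> \<circ> f) s = (\<sigma> \<circ> f) t" "winding (\<nu> d) (\<sigma> \<circ> f) s = winding (\<nu> d) (\<sigma> \<circ> f) t"
      by (simp_all add: same_def)
  qed
  have nc: "cmod (coord d ((\<sigma> \<circ> f) ?l)) = 1" using norm_coord[OF path_in_Q[OF path_Q l(2)], of d] .
  have el: "0 < e ?l" "e ?l < 1"
    using edge_pos_bounds[OF nc] edge_pos_pos[OF nc d(2)] e4 by auto
  have et: "e t0 = 0 \<or> e t0 = 1"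
    using e3[rule_format, OF t01] inner[OF t0(1) js(2,3)] by (simp add: coord_def)
  \<comment> \<open>The value at the gap ends lies in the open interval from 0 to 1, and the value
    at \<open>t0\<close> is 0 or 1. Their midpoint is still inside the open interval and differs
    from the former.\<close>
  define y where "y = (e ?l + e t0) / 2"
  have y: "0 < y" "y < 1" "y \<noteq> e ?l" "min (e ?l) (e t0) \<le> y" "y \<le> max (e ?l) (e t0)"
    using el et by (auto simp: y_def)
  obtain x where x: "x \<in> A \<inter> {?l..t0}" "e x = y"
    using intermediate_value_Good[OF e A eG l(1) t0(1) lo_le[OF ec t01] y(4,5)] by blast
  have "x \<noteq> ?l" using x(2) y(3) by auto
  then have x2: "x \<in> A" "?l < x" "x < hi B t0" using x(1) js(3) by auto
  have "coord d ((\<sigma> \<circ> f) x) \<noteq> 1"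
    using e3[rule_format, OF end_closedD[OF eA x2(1)]] x(2) y by auto
  moreover have "\<sigma> (f x) = None" by (rule inner[OF x2])
  ultimately show False by (simp add: coord_def)
qed

end

section \<open>Contracting the jumps in the base\<close>

definition null_homotopy :: "'m topology \<Rightarrow> 'm \<Rightarrow> (real \<Rightarrow> 'm) \<Rightarrow> (real \<times> real \<Rightarrow> 'm) \<Rightarrow> bool" where
  "null_homotopy T y \<beta> N \<longleftrightarrow> continuous_map (top_of_set unit_square) T N \<and>
     (\<forall>t\<in>{0..1}. N (0, t) = \<beta> t \<and> N (1, t) = y) \<and> (\<forall>s\<in>{0..1}. N (s, 0) = y \<and> N (s, 1) = y)"

lemma null_homotopy_exists:
  assumes "loop_homotopic T y \<beta> (\<lambda>_. y)"
  shows "\<exists>N. null_homotopy T y \<beta> N"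
  unfolding null_homotopy_def by (rule loop_homotopicE[OF assms]) blast

lemma simply_conn_null_homotopy:
  assumes "simply_conn_space T" "\<beta> \<in> loops T y"
  shows "\<exists>N. null_homotopy T y \<beta> N"
proof (rule null_homotopy_exists)
  have "pathin T \<beta>" "\<beta> 0 = y" using assms(2) by (auto simp: loops_def)
  then have "y \<in> topspace T"
    using continuous_map_image_subset_topspace[of "top_of_set {0..1}" T \<beta>] by (auto simp: pathin_def)
  then have "loop_class T y \<beta> = \<one>\<^bsub>fundamental_group T y\<^esub>"
    using assms(1) loop_class_in_carrier[OF assms(2)] by (auto simp: simply_conn_space_def)
  then show "loop_homotopic T y \<beta> (\<lambda>_. y)" using loop_class_eq_one_iff[OF assms(2)] by simp
qed

text \<open>A Lebesgue number argument: points with smaller and smaller admissible radius would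
  accumulate at a point that has none.\<close>

lemma uniform_radius:
  fixes P :: "real \<Rightarrow> real \<Rightarrow> bool"
  assumes local: "\<And>t. t \<in> {0..1} \<Longrightarrow> \<exists>\<rho>>0. \<forall>s\<in>{0..1}. \<bar>s - t\<bar> < \<rho> \<longrightarrow> P \<rho> s"
    and mono: "\<And>\<rho> \<rho>' s. P \<rho> s \<Longrightarrow> \<rho>' \<le> \<rho> \<Longrightarrow> P \<rho>' s"
  shows "\<exists>\<eta>>0. \<forall>s\<in>{0..1}. P \<eta> s"
proof (rule ccontr)
  assume *: "\<not> ?thesis"
  have "\<exists>s\<in>{0..1}. \<not> P (1 / real (Suc n)) s" for n
    using * by (meson of_nat_0_less_iff zero_less_Suc zero_less_divide_1_iff)
  then obtain s where s: "\<And>n. s n \<in> {0..1} \<and> \<not> P (1 / real (Suc n)) (s n)" by metis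
  have "\<forall>n. s n \<in> {0..1}" using s by blast
  then obtain t r where t: "t \<in> {0..1}" and r: "strict_mono r" "(s \<circ> r) \<longlonglongrightarrow> t"
    by (rule seq_compactE[OF compact_Icc[unfolded compact_eq_seq_compact_metric]])
  obtain \<rho> where \<rho>: "0 < \<rho>" "\<forall>s\<in>{0..1}. \<bar>s - t\<bar> < \<rho> \<longrightarrow> P \<rho> s"
    using local[OF t] by (elim exE conjE)
  have "\<forall>\<^sub>F n in sequentially. dist ((s \<circ> r) n) t < \<rho>" using r(2) \<rho>(1) by (rule tendstoD)
  moreover have "\<forall>\<^sub>F n in sequentially. 1 / real (Suc n) < \<rho>"
    using LIMSEQ_inverse_real_of_nat[THEN order_tendstoD(2), OF \<rho>(1)] by (simp add: inverse_eq_divide)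
  ultimately have "\<forall>\<^sub>F n in sequentially. dist ((s \<circ> r) n) t < \<rho> \<and> 1 / real (Suc n) < \<rho>"
    by (rule eventually_conj)
  then obtain n where n: "dist (s (r n)) t < \<rho>" "1 / real (Suc n) < \<rho>"
    using eventually_happens'[OF sequentially_bot] by fastforce
  have "1 / real (Suc (r n)) \<le> 1 / real (Suc n)"
    using seq_suble[OF r(1), of n] by (intro divide_left_mono) auto
  then have "1 / real (Suc (r n)) \<le> \<rho>" using n(2) by linarith
  moreover have "P \<rho> (s (r n))" using \<rho>(2) n(1) s by (simp add: dist_real_def)
  ultimately show False using mono s by blast
qed

text \<open>One null-homotopy must be fixed for a jump before the required precision is known. The
  precisions \<open>Z k\<close> are nested, so a choice for the largest available \<open>k\<close>
  below \<open>M\<close> serves them all. The bound \<open>M\<close> matters: there may be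
  arbitrarily good choices and no best one.\<close>

lemma best_choice:
  fixes Z :: "nat \<Rightarrow> 'b \<Rightarrow> bool"
  assumes "\<exists>N. Y N" "\<And>k N. Z k N \<Longrightarrow> Y N" "\<And>k N. Z (Suc k) N \<Longrightarrow> Z k N"
  shows "\<exists>N. Y N \<and> (\<forall>k<M. (\<exists>N'. Z k N') \<longrightarrow> Z k N)"
proof (induction M)
  case 0
  then show ?case using assms(1) by simp
next
  case (Suc M)
  show ?case
  proof (cases "\<exists>N. Z M N")
    case True
    then obtain N where N: "Z M N" ..
    have "Z k N" if "k \<le> M" for k
      using that by (induction k rule: inc_induct) (use N assms(3) in auto)
    then show ?thesis using N assms(2) less_Suc_eq_le by blast
  next
    case False
    then show ?thesis using Suc by (metis less_Suc_eq)
  qed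
qed

text \<open>Loops near \<open>z\<close> contract inside the ball of radius \<epsilon> / 2 around
  \<open>z\<close>, hence within \<epsilon> of their own base points. Leaving the base point
  \<open>y\<close> free is what makes the radius usable at all points near \<open>z\<close>.\<close>

lemma locally_simply_conn_contraction:
  assumes lsc: "locally_simply_conn_space (mtopology_of m)" and z: "z \<in> mspace m" and \<epsilon>: "0 < \<epsilon>"
  shows "\<exists>\<rho>>0. \<forall>y \<beta>. \<beta> \<in> loops (mtopology_of m) y \<longrightarrow> (\<forall>t\<in>{0..1}. mdist m z (\<beta> t) < \<rho>) \<longrightarrow>
    (\<exists>N. null_homotopy (mtopology_of m) y \<beta> N \<and> (\<forall>x\<in>unit_square. mdist m y (N x) < \<epsilon>))"
proof -
  define U where "U = {x \<in> mspace m. mdist m z x < \<epsilon> / 2}"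
  have "openin (mtopology_of m) U"
    using openin_mtopology_of_ball[of "mtopology_of m" m "\<lambda>x. x" z "\<epsilon> / 2"] z by (simp add: U_def)
  then have "nbhd_of (mtopology_of m) z U"
    unfolding nbhd_of_def using z \<epsilon> by (auto simp: U_def mdist_self)
  then obtain V where V: "nbhd_of (mtopology_of m) z V" "V \<subseteq> U"
    and VU: "\<forall>y. \<forall>\<beta>\<in>loops (subtopology (mtopology_of m) V) y. loop_homotopic (subtopology (mtopology_of m) U) y \<beta> (\<lambda>_. y)"
    using lsc z unfolding locally_simply_conn_space_def by force
  obtain W where W: "openin (mtopology_of m) W" "z \<in> W" "W \<subseteq> V" using V(1) by (auto simp: nbhd_of_def)
  obtain \<rho> where \<rho>: "0 < \<rho>" "Metric_space.mball (mspace m) (mdist m) z \<rho> \<subseteq> W"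
    using W(1,2) Metric_space.openin_mtopology[OF Metric_space_mspace_mdist, of m W]
    by (auto simp: mtopology_of_def)
  have ball: "x \<in> V" if "x \<in> mspace m" "mdist m z x < \<rho>" for x
    using that \<rho>(2) W(3) z by (auto simp: Metric_space.mball_def[OF Metric_space_mspace_mdist])
  show ?thesis
  proof (intro exI[of _ \<rho>] conjI allI impI \<rho>(1))
    fix y \<beta> assume \<beta>: "\<beta> \<in> loops (mtopology_of m) y" and small: "\<forall>t\<in>{0..1}. mdist m z (\<beta> t) < \<rho>"
    have p: "pathin (mtopology_of m) \<beta>" "\<beta> 0 = y" "\<beta> 1 = y" using \<beta> by (auto simp: loops_def)
    have inm: "\<beta> t \<in> mspace m" if "t \<in> {0..1}" for t
      using continuous_map_image_subset_topspace[of "top_of_set {0..1}" "mtopology_of m" \<beta>] p(1) that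
      by (auto simp: pathin_def)
    have "\<beta> \<in> loops (subtopology (mtopology_of m) V) y"
      unfolding loops_def pathin_subtopology using p inm small ball by auto
    then have "loop_homotopic (subtopology (mtopology_of m) U) y \<beta> (\<lambda>_. y)" using VU by blast
    then obtain N where N: "null_homotopy (subtopology (mtopology_of m) U) y \<beta> N"
      using null_homotopy_exists[of "subtopology (mtopology_of m) U" y \<beta>] by blast
    have c: "continuous_map (top_of_set unit_square) (subtopology (mtopology_of m) U) N"
      using N by (simp add: null_homotopy_def)
    have yU: "y \<in> U" using ball[OF inm, of 0] small p(2) V(2) by auto
    have "mdist m y (N x) < \<epsilon>" if x: "x \<in> unit_square" for x
    proof -
      have "N x \<in> U" using c x by (auto simp: continuous_map_in_subtopology)
      then have "mdist m y (N x) \<le> mdist m y z + mdist m z (N x)" "mdist m z (N x) < \<epsilon> / 2"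
        using mdist_triangle[of y m z "N x"] yU z by (auto simp: U_def)
      moreover have "mdist m y z < \<epsilon> / 2" using yU by (simp add: U_def mdist_commute)
      ultimately show ?thesis by linarith
    qed
    moreover have "null_homotopy (mtopology_of m) y \<beta> N"
      using N unfolding null_homotopy_def by (auto dest: continuous_map_into_fulltopology)
    ultimately show "\<exists>N. null_homotopy (mtopology_of m) y \<beta> N \<and> (\<forall>x\<in>unit_square. mdist m y (N x) < \<epsilon>)"
      by blast
  qed
qed

context collapse
begin

lemma continuous_map_collapsed:
  assumes K: "Good K"
  shows "continuous_map (top_of_set {0..1}) (mtopology_of m) (collapsed K)"
  unfolding continuous_map_mtopology_of
proof (intro ballI conjI allI impI)
  fix t assume "t \<in> topspace (top_of_set {0..1::real})"
  then have t: "t \<in> {0..1}" by simp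
  show "collapsed K t \<in> mspace m" by (rule collapsed_in[OF K t])
  fix \<epsilon> :: real assume \<epsilon>: "0 < \<epsilon>"
  obtain \<delta> where \<delta>: "0 < \<delta>" "\<forall>K. Good K \<longrightarrow> (\<forall>s\<in>{0..1}. \<forall>t\<in>{0..1}. \<bar>s - t\<bar> < \<delta> \<longrightarrow> mdist m (collapsed K s) (collapsed K t) < \<epsilon>)"
    using collapsed_continuous[OF \<epsilon>] by (elim exE conjE)
  show "\<exists>U. openin (top_of_set {0..1}) U \<and> t \<in> U \<and> (\<forall>s\<in>U. collapsed K s \<in> mspace m \<and> mdist m (collapsed K t) (collapsed K s) < \<epsilon>)"
    by (rule exI[of _ "{0..1} \<inter> ball t \<delta>"])
       (use \<delta> K t collapsed_in in \<open>auto simp: dist_real_def openin_open_Int\<close>)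
qed

end

section \<open>Contracting a jump whose path runs in \<open>X\<close>\<close>

locale null_loop_contract = null_loop +
  assumes sc: "simply_conn_space (mtopology_of X)" and lsc: "locally_simply_conn_space (mtopology_of X)"
begin

definition small_null_homotopy :: "real \<Rightarrow> 'a \<Rightarrow> (real \<Rightarrow> 'a) \<Rightarrow> (real \<times> real \<Rightarrow> 'a) \<Rightarrow> bool" where
  "small_null_homotopy \<epsilon> y \<beta> N \<longleftrightarrow>
     null_homotopy (mtopology_of X) y \<beta> N \<and> (\<forall>x\<in>unit_square. mdist X y (N x) < \<epsilon>)"

definition contractible_radius :: "real \<Rightarrow> real \<Rightarrow> real \<Rightarrow> bool" where
  "contractible_radius \<epsilon> \<eta> s \<longleftrightarrow> (\<forall>\<beta>. \<beta> \<in> loops (mtopology_of X) (fst (f s)) \<longrightarrow>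
     (\<forall>t\<in>{0..1}. mdist X (fst (f s)) (\<beta> t) < \<eta>) \<longrightarrow> (\<exists>N. small_null_homotopy \<epsilon> (fst (f s)) \<beta> N))"

lemma contractible_radius_mono:
  "contractible_radius \<epsilon> \<eta> s \<Longrightarrow> \<eta>' \<le> \<eta> \<Longrightarrow> contractible_radius \<epsilon> \<eta>' s"
  unfolding contractible_radius_def by (meson less_le_trans)

lemma fst_path_in: "s \<in> {0..1} \<Longrightarrow> fst (f s) \<in> mspace X"
  using path_in_E[of s] D_sub by (auto simp: mspace_E)

text \<open>The base points of the jumps lie on the compact image of \<open>fst \<circ> f\<close>,
  along which local simple connectivity becomes uniform. Half of the radius at \<open>t\<close> is
  spent on moving the base point, half on the loop.\<close>

lemma uniformly_contractible:
  assumes \<epsilon>: "0 < \<epsilon>"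
  shows "\<exists>\<eta>>0. \<forall>s\<in>{0..1}. contractible_radius \<epsilon> \<eta> s"
proof (rule uniform_radius)
  fix t :: real assume t: "t \<in> {0..1}"
  have z: "fst (f t) \<in> mspace X" by (rule fst_path_in[OF t])
  obtain \<rho> where \<rho>: "0 < \<rho>" and small: "\<forall>y \<beta>. \<beta> \<in> loops (mtopology_of X) y \<longrightarrow>
      (\<forall>s\<in>{0..1}. mdist X (fst (f t)) (\<beta> s) < \<rho>) \<longrightarrow>
      (\<exists>N. null_homotopy (mtopology_of X) y \<beta> N \<and> (\<forall>x\<in>unit_square. mdist X y (N x) < \<epsilon>))"
    using locally_simply_conn_contraction[OF lsc z \<epsilon>] by (elim exE conjE)
  have c: "continuous_map (top_of_set {0..1}) (mtopology_of X) (fst \<circ> f)"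
    using pathin_compose[OF path continuous_map_fst_E] by (simp add: pathin_def)
  have "0 < \<rho> / 2" using \<rho> by simp
  from continuous_map_uniform[OF compact_Icc c this]
  obtain \<delta> where \<delta>: "0 < \<delta>" "\<forall>x\<in>{0..1}. \<forall>y\<in>{0..1}. dist x y < \<delta> \<longrightarrow> mdist X ((fst \<circ> f) x) ((fst \<circ> f) y) < \<rho> / 2"
    by (elim exE conjE)
  show "\<exists>\<rho>>0. \<forall>s\<in>{0..1}. \<bar>s - t\<bar> < \<rho> \<longrightarrow> contractible_radius \<epsilon> \<rho> s"
  proof (intro exI[of _ "min \<delta> (\<rho> / 2)"] conjI ballI impI)
    show "0 < min \<delta> (\<rho> / 2)" using \<rho> \<delta>(1) by simp
    fix s :: real assume s: "s \<in> {0..1}" and st: "\<bar>s - t\<bar> < min \<delta> (\<rho> / 2)"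
    have d: "mdist X (fst (f t)) (fst (f s)) < \<rho> / 2"
      using \<delta>(2) s t st by (simp add: dist_real_def abs_minus_commute)
    show "contractible_radius \<epsilon> (min \<delta> (\<rho> / 2)) s"
      unfolding contractible_radius_def small_null_homotopy_def
    proof (intro allI impI)
      fix \<beta> assume \<beta>: "\<beta> \<in> loops (mtopology_of X) (fst (f s))"
        and near: "\<forall>r\<in>{0..1}. mdist X (fst (f s)) (\<beta> r) < min \<delta> (\<rho> / 2)"
      have "mdist X (fst (f t)) (\<beta> r) < \<rho>" if r: "r \<in> {0..1}" for r
      proof -
        have "\<beta> r \<in> mspace X"
          using \<beta> r continuous_map_image_subset_topspace[of "top_of_set {0..1}" "mtopology_of X" \<beta>]
          by (auto simp: loops_def pathin_def)
        then have "mdist X (fst (f t)) (\<beta> r) \<le> mdist X (fst (f t)) (fst (f s)) + mdist X (fst (f s)) (\<beta> r)"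
          using z fst_path_in[OF s] by (intro mdist_triangle)
        moreover have "mdist X (fst (f s)) (\<beta> r) < \<rho> / 2" using near r by simp
        ultimately show ?thesis using d by linarith
      qed
      then show "\<exists>N. null_homotopy (mtopology_of X) (fst (f s)) \<beta> N \<and> (\<forall>x\<in>unit_square. mdist X (fst (f s)) (N x) < \<epsilon>)"
        using small[rule_format, OF \<beta>] by blast
    qed
  qed
qed (rule contractible_radius_mono)

lemma base_point: "\<sigma> (f k) = None \<Longrightarrow> f k = (fst (f k), p)"
  by (cases "f k") (auto simp: quotient_map_sigma_def split: if_splits)

text \<open>The last clause bounds the size of the homotopy without reference to the choice of a
  null-homotopy: it is as small as any null-homotopy of the jump, up to the size of the gap.\<close>

lemma jump_homotopy:
  assumes c: "consecutive B A"
  shows "\<exists>H. continuous_map (top_of_set unit_square) (mtopology_of E) H \<and>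
    (\<forall>t\<in>{0..1}. H (0, t) = collapsed A t \<and> H (1, t) = collapsed B t) \<and>
    (\<forall>s\<in>{0..1}. H (s, 0) = f 0 \<and> H (s, 1) = f 1) \<and>
    (\<forall>k \<eta>. gap_size B - gap_size A < 1 / real (Suc k) \<longrightarrow>
      (\<forall>s\<in>{0..1}. contractible_radius (1 / real (Suc k)) \<eta> s) \<longrightarrow>
      (\<forall>t\<in>{0..1}. mdist E (collapsed A t) (collapsed B t) < \<eta>) \<longrightarrow>
      (\<forall>s\<in>{0..1}. \<forall>t\<in>{0..1}. mdist E (H (s, t)) (collapsed A t) < 1 / real (Suc k) + \<eta>))"
proof -
  have A: "Good A" and B: "Good B" "B \<subseteq> A" using c by (auto simp: consecutive_def)
  note ec = Good_end_closed[OF B(1)] and eA = Good_end_closed[OF A]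
  have ends: "0 \<in> A" "1 \<in> A" using eA by (auto simp: end_closed_def)
  have cA: "continuous_map (top_of_set S) (mtopology_of E) (\<lambda>x. collapsed A (snd x))"
    if "S \<subseteq> unit_square" for S :: "(real \<times> real) set"
    by (rule continuous_map_compose_on[OF continuous_map_collapsed[OF A]])
       (use that in \<open>auto intro!: continuous_intros\<close>)
  have \<eta>_pos: "0 < \<eta>" if "\<forall>t\<in>{0..1}. mdist E (collapsed A t) (collapsed B t) < \<eta>" for \<eta>
  proof -
    have "mdist E (collapsed A 0) (collapsed B 0) < \<eta>" using that by simp
    then show ?thesis using mdist_nonneg[of E "collapsed A 0" "collapsed B 0"] by linarith
  qed
  show ?thesis
  proof (cases "\<forall>t\<in>{0..1}. collapsed A t = collapsed B t")
    case True
    have "mdist E (collapsed A t) (collapsed A t) < 1 / real (Suc k) + \<eta>"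
      if "\<forall>t\<in>{0..1}. mdist E (collapsed A t) (collapsed B t) < \<eta>" "t \<in> {0..1}" for k \<eta> t
      using \<eta>_pos[OF that(1)] mdist_self[OF collapsed_in[OF A that(2)]] by (simp add: add_pos_pos)
    then show ?thesis
      using cA[OF subset_refl] True collapsed_eq[OF A ends(1)] collapsed_eq[OF A ends(2)]
      by (intro exI[of _ "\<lambda>x. collapsed A (snd x)"] conjI) auto
  next
    case False
    then have "A \<noteq> B" by auto
    then obtain t0 where t0: "t0 \<in> A" "t0 \<notin> B" using B(2) by blast
    have t01: "t0 \<in> {0..1}" using end_closedD[OF eA t0(1)] .
    note js = jump_structure[OF c t0]
    define l h where "l = lo B t0" and "h = hi B t0"
    have lh: "l \<in> B" "h \<in> B" "l \<in> {0..1}" "h \<in> {0..1}" "l < h" "f l = f h"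
      using lo_in[OF ec t01] hi_in[OF ec t01] lo_01[OF ec t01] hi_01[OF ec t01] js
      by (auto simp: l_def h_def)
    have gap: "b \<le> l \<or> h \<le> b" if "b \<in> B" for b using lo_hi_gap[OF ec t01 that] by (simp add: l_def h_def)
    have off: "collapsed A t = collapsed B t" if t: "t \<in> {0..1}" "t \<le> l \<or> h \<le> t" for t
    proof -
      have "lo A t \<in> B"
      proof (rule ccontr)
        assume n: "lo A t \<notin> B"
        have "lo A t \<in> A" by (rule lo_in[OF eA t(1)])
        then have lA: "l \<le> lo A t" "lo A t \<le> h" using js(1) n by (auto simp: l_def h_def)
        then have "lo A t \<noteq> l" "lo A t \<noteq> h" using n lh by auto
        then have "h \<le> t" using lo_le[OF eA t(1)] lA t(2) by auto
        then have "h \<le> lo A t" using lo_upper[OF eA t(1), of h] lh B(2) by auto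
        then show False using lA \<open>lo A t \<noteq> h\<close> by simp
      qed
      then have "lo A t \<le> lo B t" by (rule lo_upper[OF ec t(1) _ lo_le[OF eA t(1)]])
      moreover have "lo B t \<le> lo A t" by (rule lo_antimono(1)[OF eA ec B(2) t(1)])
      ultimately show ?thesis by (simp add: collapsed_def)
    qed
    have on_B: "collapsed B t = f l" if t: "l \<le> t" "t \<le> h" for t
    proof (cases "t = h")
      case True
      then show ?thesis using collapsed_eq[OF B(1) lh(2)] lh(6) by simp
    next
      case False
      have t01: "t \<in> {0..1}" using t lh by auto
      have "lo B t = l"
        using gap[OF lo_in[OF ec t01]] lo_le[OF ec t01] lo_upper[OF ec t01 lh(1) t(1)] t False by auto
      then show ?thesis by (simp add: collapsed_def)
    qed
    have on_A: "lo A t \<in> A \<inter> {l..h}" if t: "l \<le> t" "t \<le> h" for t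
    proof -
      have t01: "t \<in> {0..1}" using t lh by auto
      show ?thesis using lo_in[OF eA t01] lo_le[OF eA t01] lo_upper[OF eA t01 _ t(1)] lh(1) B(2) t by auto
    qed
    \<comment> \<open>A jump on which \<open>f\<close> is constant would leave the stopped loop
      unchanged, which is excluded here; so by \<open>jump_cases\<close> it runs in the
      base.\<close>
    have not_const: "\<not> (\<forall>k\<in>A \<inter> {l..h}. f k = f l)"
    proof
      assume const: "\<forall>k\<in>A \<inter> {l..h}. f k = f l"
      have "collapsed A t = collapsed B t" if t: "t \<in> {0..1}" for t
      proof (cases "l \<le> t \<and> t \<le> h")
        case True
        then show ?thesis using const on_A[of t] on_B[of t] by (simp add: collapsed_def)
      next
        case False
        then show ?thesis using off[OF t] by auto
      qed
      then show False using False by blast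
    qed
    then have base: "\<sigma> (f k) = None" if "k \<in> A \<inter> {l..h}" for k
      using jump_cases[OF c t0] that unfolding l_def h_def by blast
    have baseA: "collapsed A t = (fst (collapsed A t), p)" if "l \<le> t" "t \<le> h" for t
      unfolding collapsed_def by (rule base_point[OF base[OF on_A[OF that]]])
    define y where "y = fst (f l)"
    have fl: "f l = (y, p)" unfolding y_def by (rule base_point[OF base]) (use lh B(2) in auto)
    have y: "y \<in> mspace X" unfolding y_def by (rule fst_path_in[OF lh(3)])
    have cl: "collapsed A l = f l" "collapsed A h = f l"
      using collapsed_eq[OF A] lh B(2) by auto
    define u where "u r = l + r * (h - l)" for r :: real
    have u: "l \<le> u r \<and> u r \<le> h" if "r \<in> {0..1}" for r
    proof -
      have "0 \<le> r * (h - l)" "r * (h - l) \<le> 1 * (h - l)"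
        using that lh(5) by (auto intro!: mult_nonneg_nonneg mult_right_mono)
      then show ?thesis by (simp add: u_def)
    qed
    then have u01: "u r \<in> {0..1}" if "r \<in> {0..1}" for r using lh(3,4) that by fastforce
    define \<beta> where "\<beta> r = fst (collapsed A (u r))" for r
    have "continuous_map (top_of_set {0..1}) (mtopology_of E) (\<lambda>r. collapsed A (u r))"
      by (rule continuous_map_compose_on[OF continuous_map_collapsed[OF A] _ u01])
         (auto simp: u_def intro!: continuous_intros)
    from continuous_map_compose[OF this continuous_map_fst_E]
    have \<beta>: "\<beta> \<in> loops (mtopology_of X) y"
      using cl by (simp add: loops_def pathin_def \<beta>_def[abs_def] o_def u_def y_def)
    have "gap_size A < gap_size B" by (rule gap_size_strict[OF eA ec]) (use B(2) t0 in auto)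
    then have gs: "0 < gap_size B - gap_size A" by simp
    \<comment> \<open>A precision \<open>1 / Suc k\<close> is demanded only while it exceeds the
      size of the jump, so finitely many \<open>k\<close> matter, as \<open>best_choice\<close>
      requires.\<close>
    define M where "M = nat \<lceil>1 / (gap_size B - gap_size A)\<rceil>"
    have M: "k < M" if "gap_size B - gap_size A < 1 / real (Suc k)" for k
    proof -
      have "real (Suc k) < 1 / (gap_size B - gap_size A)"
        using that gs by (simp add: field_simps)
      then have "real (Suc k) < real M" unfolding M_def by linarith
      then show ?thesis by simp
    qed
    obtain N where N: "null_homotopy (mtopology_of X) y \<beta> N"
      and best: "\<forall>k<M. (\<exists>N. small_null_homotopy (1 / real (Suc k)) y \<beta> N) \<longrightarrow> small_null_homotopy (1 / real (Suc k)) y \<beta> N"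
    proof -
      have "\<exists>N. null_homotopy (mtopology_of X) y \<beta> N \<and>
        (\<forall>k<M. (\<exists>N'. small_null_homotopy (1 / real (Suc k)) y \<beta> N') \<longrightarrow> small_null_homotopy (1 / real (Suc k)) y \<beta> N)"
      proof (rule best_choice[OF simply_conn_null_homotopy[OF sc \<beta>]])
        show "null_homotopy (mtopology_of X) y \<beta> N" if "small_null_homotopy (1 / real (Suc k)) y \<beta> N" for k N
          using that by (simp add: small_null_homotopy_def)
        show "small_null_homotopy (1 / real (Suc k)) y \<beta> N"
          if "small_null_homotopy (1 / real (Suc (Suc k))) y \<beta> N" for k N
        proof -
          have "1 / real (Suc (Suc k)) \<le> 1 / real (Suc k)" by (intro divide_left_mono) auto
          then show ?thesis using that unfolding small_null_homotopy_def by (meson less_le_trans)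
        qed
      qed
      then show thesis using that by blast
    qed
    have Nc: "continuous_map (top_of_set unit_square) (mtopology_of X) N"
      and N01: "\<And>t. t \<in> {0..1} \<Longrightarrow> N (0, t) = \<beta> t" "\<And>t. t \<in> {0..1} \<Longrightarrow> N (1, t) = y"
      and Nends: "\<And>s. s \<in> {0..1} \<Longrightarrow> N (s, 0) = y" "\<And>s. s \<in> {0..1} \<Longrightarrow> N (s, 1) = y"
      using N by (auto simp: null_homotopy_def)
    define v where "v t = (t - l) / (h - l)" for t
    have v: "v t \<in> {0..1}" "u (v t) = t" if "l \<le> t" "t \<le> h" for t
      using that lh(5) by (auto simp: v_def u_def divide_le_eq)
    have vlh: "v l = 0" "v h = 1" using lh(5) by (auto simp: v_def)
    \<comment> \<open>The null-homotopy \<open>N\<close>, rescaled to the gap and placed in the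
      base; outside the gap the loop is left alone.\<close>
    define H where "H = (\<lambda>x. if snd x \<le> l then collapsed A (snd x)
      else if snd x \<le> h then (N (fst x, v (snd x)), p) else collapsed A (snd x))"
    have H_in: "H (s, t) = (N (s, v t), p)" if "s \<in> {0..1}" "l \<le> t" "t \<le> h" for s t
      using that Nends(1) vlh cl fl by (auto simp: H_def)
    have H_off: "H (s, t) = collapsed A t" if "t \<le> l \<or> h < t" for s t
      using that lh(5) by (auto simp: H_def)
    have H_cont: "continuous_map (top_of_set unit_square) (mtopology_of E) H"
      unfolding H_def
    proof (rule continuous_map_glue_le)
      show "continuous_on unit_square (snd :: real \<times> real \<Rightarrow> real)" by (intro continuous_intros)
      show "continuous_map (top_of_set {x \<in> unit_square. snd x \<le> l}) (mtopology_of E) (\<lambda>x. collapsed A (snd x))"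
        by (rule cA) auto
      show "continuous_map (top_of_set {x \<in> unit_square. l \<le> snd x}) (mtopology_of E)
        (\<lambda>x. if snd x \<le> h then (N (fst x, v (snd x)), p) else collapsed A (snd x))"
      proof (rule continuous_map_glue_le)
        let ?S = "{x \<in> {x \<in> unit_square. l \<le> snd x}. snd x \<le> h}"
        have "continuous_map (top_of_set ?S) (mtopology_of X) (\<lambda>x. N (fst x, v (snd x)))"
        proof (rule continuous_map_compose_on[OF Nc])
          show "continuous_on ?S (\<lambda>x. (fst x, v (snd x)))"
            unfolding v_def using lh(5) by (intro continuous_intros) auto
        qed (use v in auto)
        from continuous_map_compose[OF this continuous_map_base]
        show "continuous_map (top_of_set ?S) (mtopology_of E) (\<lambda>x. (N (fst x, v (snd x)), p))"
          by (simp add: o_def)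
        show "continuous_map (top_of_set {x \<in> {x \<in> unit_square. l \<le> snd x}. h \<le> snd x}) (mtopology_of E)
          (\<lambda>x. collapsed A (snd x))" by (rule cA) auto
        show "(N (fst x, v (snd x)), p) = collapsed A (snd x)" if "x \<in> {x \<in> unit_square. l \<le> snd x}" "snd x = h" for x
          using that Nends(2) vlh cl fl by auto
      qed (intro continuous_intros)
      show "collapsed A (snd x) = (if snd x \<le> h then (N (fst x, v (snd x)), p) else collapsed A (snd x))"
        if "x \<in> unit_square" "snd x = l" for x
        using that Nends(1) vlh cl fl by auto
    qed
    have H_01: "H (0, t) = collapsed A t \<and> H (1, t) = collapsed B t" if t: "t \<in> {0..1}" for t
    proof (cases "l \<le> t \<and> t \<le> h")
      case True
      then have "(\<beta> (v t), p) = collapsed A t" using v(2) baseA by (simp add: \<beta>_def)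
      then show ?thesis using True H_in[of 0 t] H_in[of 1 t] N01 v(1)[of t] on_B[of t] fl by simp
    next
      case False
      then show ?thesis using H_off[of t] off[OF t] by auto
    qed
    have H_ends: "H (s, 0) = f 0 \<and> H (s, 1) = f 1" if s: "s \<in> {0..1}" for s
    proof
      show "H (s, 0) = f 0" using H_off[of 0 s] lh(3) collapsed_eq[OF A ends(1)] by auto
      show "H (s, 1) = f 1"
      proof (cases "h = 1")
        case True
        then show ?thesis using H_in[OF s, of 1] lh(3,6) Nends(2)[OF s] vlh fl by auto
      next
        case False
        then show ?thesis using H_off[of 1 s] lh(4) collapsed_eq[OF A ends(2)] by auto
      qed
    qed
    have H_small: "mdist E (H (s, t)) (collapsed A t) < 1 / real (Suc k) + \<eta>"
      if k: "gap_size B - gap_size A < 1 / real (Suc k)"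
        and r: "\<forall>s\<in>{0..1}. contractible_radius (1 / real (Suc k)) \<eta> s"
        and d: "\<forall>t\<in>{0..1}. mdist E (collapsed A t) (collapsed B t) < \<eta>"
        and s: "s \<in> {0..1}" and t: "t \<in> {0..1}" for k \<eta> s t
    proof (cases "l \<le> t \<and> t \<le> h")
      case True
      have fstA: "fst (collapsed A t') \<in> mspace X" if "t' \<in> {0..1}" for t'
        unfolding collapsed_def by (rule fst_path_in[OF lo_01[OF eA that]])
      have close: "mdist X y (fst (collapsed A t')) < \<eta>" if t': "l \<le> t'" "t' \<le> h" for t'
      proof -
        have t'01: "t' \<in> {0..1}" using t' lh by auto
        have "mdist E (collapsed A t') (collapsed B t') = mdist E (fst (collapsed A t'), p) (y, p)"
          using baseA[OF t'] on_B[OF t'] fl by simp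
        also have "\<dots> = mdist X y (fst (collapsed A t'))"
          using mdist_E_base[OF fstA[OF t'01] y] by (simp add: mdist_commute)
        finally show ?thesis using d[rule_format, OF t'01] by simp
      qed
      have "\<exists>N. small_null_homotopy (1 / real (Suc k)) y \<beta> N"
      proof (rule r[rule_format, OF lh(3), unfolded contractible_radius_def, folded y_def, rule_format, OF \<beta>])
        show "mdist X y (\<beta> \<tau>) < \<eta>" if "\<tau> \<in> {0..1}" for \<tau>
          unfolding \<beta>_def using close u[OF that] by blast
      qed
      then have "small_null_homotopy (1 / real (Suc k)) y \<beta> N" using best M[OF k] by blast
      then have 1: "mdist X y (N (s, v t)) < 1 / real (Suc k)"
        using s v(1)[of t] True by (simp add: small_null_homotopy_def)
      have Nin: "N (s, v t) \<in> mspace X"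
        using continuous_map_image_subset_topspace[OF Nc] s v(1)[of t] True by auto
      have "mdist E (H (s, t)) (collapsed A t) = mdist E (N (s, v t), p) (fst (collapsed A t), p)"
        using H_in[OF s] True baseA[of t] by simp
      also have "\<dots> = mdist X (N (s, v t)) (fst (collapsed A t))"
        by (rule mdist_E_base[OF Nin fstA[OF t]])
      also have "\<dots> \<le> mdist X (N (s, v t)) y + mdist X y (fst (collapsed A t))"
        by (rule mdist_triangle[OF Nin y fstA[OF t]])
      finally show ?thesis using 1 close[of t] True mdist_commute[of X y "N (s, v t)"] by simp
    next
      case False
      then show ?thesis
        using H_off[of t s] mdist_self[OF collapsed_in[OF A t]] \<eta>_pos[OF d] by (auto simp: add_pos_pos)
    qed
    show ?thesis
    proof (rule exI[of _ H], intro conjI)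
      show "\<forall>t\<in>{0..1}. H (0, t) = collapsed A t \<and> H (1, t) = collapsed B t"
        by (intro ballI H_01)
      show "\<forall>s\<in>{0..1}. H (s, 0) = f 0 \<and> H (s, 1) = f 1"
        by (intro ballI H_ends)
    qed (rule H_cont, intro allI impI, intro ballI, rule H_small)
  qed
qed

lemma null_homotopic_if_null: "loop_homotopic (mtopology_of E) (f 0) f (\<lambda>_. f 0)"
proof -
  let ?P = "\<lambda>B A H. continuous_map (top_of_set unit_square) (mtopology_of E) H \<and>
    (\<forall>t\<in>{0..1}. H (0, t) = collapsed A t \<and> H (1, t) = collapsed B t) \<and>
    (\<forall>s\<in>{0..1}. H (s, 0) = f 0 \<and> H (s, 1) = f 1) \<and>
    (\<forall>k \<eta>. gap_size B - gap_size A < 1 / real (Suc k) \<longrightarrow>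
      (\<forall>s\<in>{0..1}. contractible_radius (1 / real (Suc k)) \<eta> s) \<longrightarrow>
      (\<forall>t\<in>{0..1}. mdist E (collapsed A t) (collapsed B t) < \<eta>) \<longrightarrow>
      (\<forall>s\<in>{0..1}. \<forall>t\<in>{0..1}. mdist E (H (s, t)) (collapsed A t) < 1 / real (Suc k) + \<eta>))"
  define H where "H B A = (SOME H. ?P B A H)" for B A
  have H: "?P B A (H B A)" if "consecutive B A" for B A
    unfolding H_def by (rule someI_ex[OF jump_homotopy[OF that]])
  show ?thesis
  proof (rule null_homotopic_if_jumps[of H])
    fix \<epsilon> :: real assume \<epsilon>: "0 < \<epsilon>"
    obtain k where k: "1 / real (Suc k) < \<epsilon> / 2"
      using nat_approx_posE[of "\<epsilon> / 2"] \<epsilon> by auto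
    have "0 < 1 / real (Suc k)" by simp
    from uniformly_contractible[OF this] obtain \<eta>0 where \<eta>0: "0 < \<eta>0"
      "\<forall>s\<in>{0..1}. contractible_radius (1 / real (Suc k)) \<eta>0 s" by (elim exE conjE)
    define \<eta> where "\<eta> = min \<eta>0 (\<epsilon> / 2)"
    have \<eta>: "0 < \<eta>" "\<eta> \<le> \<epsilon> / 2" using \<eta>0(1) \<epsilon> by (auto simp: \<eta>_def)
    have r: "\<forall>s\<in>{0..1}. contractible_radius (1 / real (Suc k)) \<eta> s"
      using \<eta>0(2) contractible_radius_mono[of _ \<eta>0 _ \<eta>] by (simp add: \<eta>_def)
    obtain \<delta> where \<delta>: "0 < \<delta>" "\<forall>K K'. Good K \<longrightarrow> Good K' \<longrightarrow> K' \<subseteq> K \<longrightarrow> gap_size K' - gap_size K < \<delta> \<longrightarrow>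
        (\<forall>t\<in>{0..1}. mdist E (collapsed K t) (collapsed K' t) < \<eta>)"
      using collapsed_close[OF \<eta>(1)] by (elim exE conjE)
    show "\<exists>\<delta>>0. \<forall>A B. consecutive B A \<longrightarrow> gap_size B - gap_size A < \<delta> \<longrightarrow>
      (\<forall>s\<in>{0..1}. \<forall>t\<in>{0..1}. mdist E (H B A (s, t)) (collapsed A t) < \<epsilon>)"
    proof (intro exI[of _ "min \<delta> (1 / real (Suc k))"] conjI allI impI ballI)
      show "0 < min \<delta> (1 / real (Suc k))" using \<delta>(1) by simp
      fix A B s t
      assume c: "consecutive B A" and gs: "gap_size B - gap_size A < min \<delta> (1 / real (Suc k))"
        and s: "s \<in> {0..1::real}" and t: "t \<in> {0..1::real}"
      have "Good A" "Good B" "B \<subseteq> A" using c by (auto simp: consecutive_def)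
      then have d: "\<forall>t\<in>{0..1}. mdist E (collapsed A t) (collapsed B t) < \<eta>" using \<delta>(2) gs by simp
      have "gap_size B - gap_size A < 1 / real (Suc k)" using gs by simp
      then have "mdist E (H B A (s, t)) (collapsed A t) < 1 / real (Suc k) + \<eta>"
        using H[OF c, THEN conjunct2, THEN conjunct2, THEN conjunct2, rule_format, of k \<eta> s t] r d s t by blast
      then show "mdist E (H B A (s, t)) (collapsed A t) < \<epsilon>" using k \<eta>(2) by linarith
    qed
  qed (use H in blast)+
qed

end

section \<open>The subgroups\<close>

context earring
begin

text \<open>The constant loop concatenated with itself is itself, and 0 is the only idempotent of a
  group.\<close>

lemma winding_const: "winding n (\<lambda>_. None) 1 = 0"
proof (rule add_idem_imp_0)
  have c: "(\<lambda>_. None) \<in> loops (mtopology_of Q) None"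
    by (rule const_loop) (simp add: mspace_Q)
  have "loop_concat (\<lambda>_. None) (\<lambda>_. None) = (\<lambda>_. None :: ('a \<times> complex) option)"
    by (auto simp: loop_concat_def)
  then show "winding n (\<lambda>_. None) 1 + winding n (\<lambda>_. None) 1 = winding n (\<lambda>_. None) 1"
    using winding_concat[OF c c, of n] by simp
qed

lemma winding_null_homotopic:
  assumes "loop_homotopic (mtopology_of Q) None g (\<lambda>_. None)"
  shows "winding n g 1 = 0"
  using winding_homotopic[OF assms] winding_const by simp

text \<open>All three injectivity claims come from \<open>kernel\<close>: a loop whose final
  windings vanish is trivial. Triviality of its image in the \<sigma>-product or in the group of
  \<open>Q(D)\<close> forces this directly; for the Hawaiian earring one first applies the
  retraction, which undoes the embedding.\<close>

lemma fundamental_group_earring: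
  assumes sc: "simply_conn_space (mtopology_of X)" and lsc: "locally_simply_conn_space (mtopology_of X)"
    and x: "x \<in> mspace X"
  defines "G \<equiv> fundamental_group (mtopology_of E) (x, p)"
    and "\<sigma>_star \<equiv> induced_map \<sigma> (mtopology_of Q) None"
    and "P \<equiv> fundamental_group (top_of_set hawaiian_earring) (0, 0)"
  shows "group_hom G (fundamental_group (mtopology_of Q) None) \<sigma>_star"
    and "inj_on \<sigma>_star (carrier G)"
    and "\<exists>H. subgroup H (free_sigma_product D) \<and> G \<cong> (free_sigma_product D)\<lparr>carrier := H\<rparr>"
    and "\<exists>K. subgroup K P \<and> G \<cong> P\<lparr>carrier := K\<rparr>"
proof -
  let ?Q = "fundamental_group (mtopology_of Q) None"
  have xE: "(x, p) \<in> topspace (mtopology_of E)" using x by (simp add: mspace_E)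
  have \<sigma>x: "\<sigma> (x, p) = None" by (simp add: quotient_map_sigma_def)
  show hom: "group_hom G ?Q \<sigma>_star"
    unfolding G_def \<sigma>_star_def by (rule group_hom_induced_map[OF continuous_map_sigma \<sigma>x xE])
  interpret \<sigma>: group_hom G ?Q \<sigma>_star by (rule hom)
  have G: "group G" unfolding G_def by (rule group_fundamental_group[OF xE])
  have rep: "\<exists>f\<in>loops (mtopology_of E) (x, p). a = loop_class (mtopology_of E) (x, p) f \<and>
      \<sigma> \<circ> f \<in> loops (mtopology_of Q) None \<and> \<sigma>_star a = loop_class (mtopology_of Q) None (\<sigma> \<circ> f)"
    if a: "a \<in> carrier G" for a
  proof -
    obtain f where f: "f \<in> loops (mtopology_of E) (x, p)" "a = loop_class (mtopology_of E) (x, p) f"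
      using a by (auto simp: G_def carrier_fundamental_group)
    have "\<sigma> \<circ> f \<in> loops (mtopology_of Q) None"
      using continuous_image_loops[OF continuous_map_sigma f(1)] \<sigma>x by simp
    moreover have "\<sigma>_star a = loop_class (mtopology_of Q) None (\<sigma> \<circ> f)"
      unfolding \<sigma>_star_def f(2) by (rule induced_map_loop_class[OF continuous_map_sigma \<sigma>x f(1)])
    ultimately show ?thesis using f by blast
  qed
  have kernel: "loop_class (mtopology_of E) (x, p) f = \<one>\<^bsub>G\<^esub>"
    if loop: "f \<in> loops (mtopology_of E) (x, p)" and w: "\<And>n. winding n (\<sigma> \<circ> f) 1 = 0" for f
  proof -
    interpret null_loop_contract X D \<nu> C p f
      by unfold_locales (use loop w sc lsc in \<open>simp_all add: loops_def\<close>)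
    have "loop_homotopic (mtopology_of E) (x, p) f (\<lambda>_. (x, p))"
      using null_homotopic_if_null loop by (simp add: loops_def)
    then show ?thesis unfolding G_def using loop_class_eq_one_iff[OF loop] by blast
  qed
  have trivial: "a = \<one>\<^bsub>G\<^esub>" if a: "a \<in> carrier G" "\<sigma>_star a = \<one>\<^bsub>?Q\<^esub>" for a
  proof -
    obtain f where f: "f \<in> loops (mtopology_of E) (x, p)" "a = loop_class (mtopology_of E) (x, p) f"
      "\<sigma> \<circ> f \<in> loops (mtopology_of Q) None" "\<sigma>_star a = loop_class (mtopology_of Q) None (\<sigma> \<circ> f)"
      using rep[OF a(1)] by blast
    have "loop_homotopic (mtopology_of Q) None (\<sigma> \<circ> f) (\<lambda>_. None)"
      using a(2) f(4) loop_class_eq_one_iff[OF f(3)] by simp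
    from kernel[OF f(1) winding_null_homotopic[OF this]] show ?thesis using f(2) by simp
  qed
  show "inj_on \<sigma>_star (carrier G)"
    by (rule hom_image_subgroup_iso(1)[OF G \<sigma>.H.monoid_axioms \<sigma>.homh \<sigma>.hom_one trivial])
  show "\<exists>H. subgroup H (free_sigma_product D) \<and> G \<cong> (free_sigma_product D)\<lparr>carrier := H\<rparr>"
  proof (rule hom_image_subgroup_iso(2)[OF G monoid_free_sigma_product])
    show "word_map \<circ> \<sigma>_star \<in> hom G (free_sigma_product D)"
      by (rule hom_compose[OF \<sigma>.homh word_map_hom])
    \<comment> \<open>Both directions are used: the target is available only as a monoid, where
      preservation of the unit does not follow from multiplicativity.\<close>
    have word: "word_map (\<sigma>_star a) = \<one>\<^bsub>free_sigma_product D\<^esub> \<longleftrightarrow> a = \<one>\<^bsub>G\<^esub>" if a: "a \<in> carrier G" for a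
    proof -
      obtain f where f: "f \<in> loops (mtopology_of E) (x, p)" "a = loop_class (mtopology_of E) (x, p) f"
        "\<sigma> \<circ> f \<in> loops (mtopology_of Q) None" "\<sigma>_star a = loop_class (mtopology_of Q) None (\<sigma> \<circ> f)"
        using rep[OF a] by blast
      have w: "word_map (\<sigma>_star a) = \<one>\<^bsub>free_sigma_product D\<^esub> \<longleftrightarrow> (\<forall>n. winding n (\<sigma> \<circ> f) 1 = 0)"
        unfolding f(4) by (rule word_map_eq_one_iff[OF f(3)])
      show ?thesis
      proof
        assume "word_map (\<sigma>_star a) = \<one>\<^bsub>free_sigma_product D\<^esub>"
        then have "winding n (\<sigma> \<circ> f) 1 = 0" for n using w by simp
        from kernel[OF f(1) this] show "a = \<one>\<^bsub>G\<^esub>" using f(2) by simp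
      next
        assume "a = \<one>\<^bsub>G\<^esub>"
        then have "\<sigma>_star a = \<one>\<^bsub>?Q\<^esub>" by (simp only: \<sigma>.hom_one)
        then have "loop_homotopic (mtopology_of Q) None (\<sigma> \<circ> f) (\<lambda>_. None)"
          using f(4) loop_class_eq_one_iff[OF f(3)] by simp
        from winding_null_homotopic[OF this] show "word_map (\<sigma>_star a) = \<one>\<^bsub>free_sigma_product D\<^esub>"
          using w by simp
      qed
    qed
    show "(word_map \<circ> \<sigma>_star) \<one>\<^bsub>G\<^esub> = \<one>\<^bsub>free_sigma_product D\<^esub>" using word[OF \<sigma>.G.one_closed] by simp
    show "a = \<one>\<^bsub>G\<^esub>" if "a \<in> carrier G" "(word_map \<circ> \<sigma>_star) a = \<one>\<^bsub>free_sigma_product D\<^esub>" for a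
      using word[OF that(1)] that(2) by simp
  qed
  have e0: "earring_embed None = (0, 0)" by (simp add: earring_embed_def)
  have None_in: "None \<in> topspace (mtopology_of Q)" by (simp add: mspace_Q)
  have r0: "earring_retract (0, 0) = None"
    using earring_retract_embed[of None] e0 None_in by simp
  let ?e = "induced_map earring_embed (top_of_set hawaiian_earring) (0, 0)"
  have homP: "group_hom ?Q P ?e"
    unfolding P_def by (rule group_hom_induced_map[OF continuous_map_earring_embed e0 None_in])
  interpret e: group_hom ?Q P ?e by (rule homP)
  show "\<exists>K. subgroup K P \<and> G \<cong> P\<lparr>carrier := K\<rparr>"
  proof (rule hom_image_subgroup_iso(2)[OF G e.H.monoid_axioms])
    show "?e \<circ> \<sigma>_star \<in> hom G P"
      by (rule hom_compose[OF \<sigma>.homh e.homh])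
    show "(?e \<circ> \<sigma>_star) \<one>\<^bsub>G\<^esub> = \<one>\<^bsub>P\<^esub>" by simp
    show "a = \<one>\<^bsub>G\<^esub>" if a: "a \<in> carrier G" "(?e \<circ> \<sigma>_star) a = \<one>\<^bsub>P\<^esub>" for a
    proof (rule trivial[OF a(1)])
      obtain f where f: "f \<in> loops (mtopology_of E) (x, p)" "a = loop_class (mtopology_of E) (x, p) f"
        "\<sigma> \<circ> f \<in> loops (mtopology_of Q) None" "\<sigma>_star a = loop_class (mtopology_of Q) None (\<sigma> \<circ> f)"
        using rep[OF a(1)] by blast
      let ?g = "\<sigma> \<circ> f"
      have eg: "earring_embed \<circ> ?g \<in> loops (top_of_set hawaiian_earring) (0, 0)"
        using continuous_image_loops[OF continuous_map_earring_embed f(3)] e0 by simp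
      have "?e (\<sigma>_star a) = loop_class (top_of_set hawaiian_earring) (0, 0) (earring_embed \<circ> ?g)"
        unfolding f(4) by (rule induced_map_loop_class[OF continuous_map_earring_embed e0 f(3)])
      then have "loop_homotopic (top_of_set hawaiian_earring) (0, 0) (earring_embed \<circ> ?g) (\<lambda>_. (0, 0))"
        using a(2) loop_class_eq_one_iff[OF eg] by (simp add: P_def)
      from loop_homotopic_image[OF continuous_map_earring_retract this]
      have h: "loop_homotopic (mtopology_of Q) None (earring_retract \<circ> (earring_embed \<circ> ?g)) (\<lambda>_. None)"
        by (simp add: r0 o_def)
      have "loop_homotopic (mtopology_of Q) None ?g (earring_retract \<circ> (earring_embed \<circ> ?g))"
      proof (rule loop_homotopic_eq[OF f(3)])
        show "?g t = (earring_retract \<circ> (earring_embed \<circ> ?g)) t" if t: "t \<in> {0..1}" for t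
        proof -
          have "?g t \<in> mspace Q" using path_in_Q[OF _ t, of ?g] f(3) by (simp add: loops_def)
          then show ?thesis using earring_retract_embed by simp
        qed
      qed
      from loop_homotopic_trans[OF this h] show "\<sigma>_star a = \<one>\<^bsub>?Q\<^esub>"
        unfolding f(4) using loop_class_eq_one_iff[OF f(3)] by blast
    qed
  qed
qed

end

theorem theorem3p2:
  fixes X :: "'a metric" and D :: "'a set" and \<nu> :: "'a \<Rightarrow> nat" and x :: 'a
    and C :: "complex metric" and p :: complex
  assumes "simply_conn_space (mtopology_of X)"
    and "locally_simply_conn_space (mtopology_of X)"
    and "x \<in> mspace X"
    and "D \<subseteq> mspace X" and "countable D" and "mtopology_of X closure_of D = mspace X"
    and "index_of_enumeration D \<nu>"
    and "circle_metric C" and "p \<in> mspace C"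
  shows "let E = earring_space X D \<nu> C p;
             Q = quotient_space D \<nu> C p;
             G = fundamental_group E (x, p);
             \<sigma>_star = induced_map (quotient_map_sigma p) Q None;
             S = free_sigma_product D;
             P = fundamental_group (top_of_set hawaiian_earring) (0, 0)
         in group_hom G (fundamental_group Q None) \<sigma>_star \<and>
            inj_on \<sigma>_star (carrier G) \<and>
            (\<exists>H. subgroup H S \<and> G \<cong> S\<lparr>carrier := H\<rparr>) \<and>
            (\<exists>K. subgroup K P \<and> G \<cong> P\<lparr>carrier := K\<rparr>)"
proof -
  interpret earring X D \<nu> C p
    by unfold_locales (use assms in auto)
  show ?thesis
    using fundamental_group_earring[OF assms(1-3)]
    unfolding Let_def earring_space_def quotient_space_def by blast
qed

end
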